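(* The functors $\mathrm{indpro}:\{\mathcal{Q}\text{-admissible groups}\}\to\mathcal{IP}^{\mathrm{ad}}$ and $\mathrm{ad}:\mathcal{IP}^{\mathrm{ad}}\to\{\mathcal{Q}\text{-admissible groups}\}$ are mutually inverse equivalences of categories. The functors $\mathrm{proind}:\{\mathcal{Q}\text{-admissible groups}\}\to\mathcal{PI}^{\mathrm{ad}}$ and $\mathrm{ad}:\mathcal{PI}^{\mathrm{ad}}\to\{\mathcal{Q}\text{-admissible groups}\}$ are mutually inverse equivalences of categories. The diagram formed by $\mathrm{indpro}$, $\mathrm{proind}$, the two functors $\mathrm{ad}$ and the two functors $\mathrm{can}:\mathcal{IP}^{\mathrm{ad}}\leftrightarrows\mathcal{PI}^{\mathrm{ad}}$ is commutative. In the definition of morphisms of $\mathcal{Q}$-admissible groups, the axioms (Hom-$\mathcal{Q}$-ad-1) and (Hom-$\mathcal{Q}$-ad-2) are equivalent.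
   Context: Conventions. $k$ is an algebraically closed field of characteristic $p>0$; groups are commutative; all inductive and projective systems (including those indexed by the sets $S$ below) are indexed by small filtered preordered sets which are essentially countable. $\mathcal{Q}$. A quasi-algebraic group is an abstract group $G$ with a class of pairs $(\mathcal{G},\iota)$, $\mathcal{G}$ a $k$-group scheme of finite type, $\iota:\mathcal{G}(k)\cong G$, two pairs being identified when the perfections are isomorphic compatibly with the $\iota$'s on $k$-points; the common perfection is $G^{\mathrm{pf}}$. Morphisms are homomorphisms induced by morphisms $G_1^{\mathrm{pf}}\to G_2^{\mathrm{pf}}$. They form an abelian category $\mathcal{Q}$. $\mathcal{P}$. A proalgebraic group is a group $G$ with a nonempty family $S$ of subgroups ("subgroups of definition") and a quasi-algebraic structure on each $G/H$, $H\in S$, such that: (P-1) for $H,H'\in S$ some $H''\in S$ lies in $H\cap H'$; (P-2) for $H\in S$ the subgroups $H'\supset H$ in $S$ are the inverse images of closed subgroups of $G/H$; (P-3) for $H\subset H'$ in $S$, $G/H\to G/H'$ is quasi-algebraic; (P-4) $G\cong\varprojlim_{H\in S}G/H$. A morphism $f:(G_1,S_1)\to(G_2,S_2)$ is a homomorphism with $f^{-1}(H_2)\in S_1$ and $G_1/f^{-1}(H_2)\to G_2/H_2$ quasi-algebraic for all $H_2\in S_2$. This is an abelian category $\mathcal{P}$; closed subgroups are the subobjects. $\mathcal{I}$. An indalgebraic group is a group $G$ with a nonempty family $S$ of subgroups, each with a quasi-algebraic structure, such that: (I-1) any two $H,H'\in S$ have $H+H'$ contained in some $H''\in S$; (I-2)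 for $H\in S$ the subgroups of $H$ in $S$ are the closed subgroups of $H$; (I-3) $\varinjlim_{H\in S}H\cong G$. Morphisms: homomorphisms with $f(H_1)\in S_2$ and $H_1\to f(H_1)$ quasi-algebraic for all $H_1\in S_1$. A strict indalgebraic subgroup of $(G,S)$ is a subgroup $G'$ such that each $G'\cap H$ ($H\in S$) is closed in $H$, with structure $\{G'\cap H\}$; a strict epimorphism is a surjective morphism $f$ with target structure $\{f(H):H\in S\}$. $\mathcal{IP}$. An indproalgebraic group is defined as an indalgebraic group with "quasi-algebraic" replaced by "proalgebraic" everywhere: axioms (IP-1), (IP-2), (IP-3). $\mathcal{IP}^{\mathrm{ad}}\subset\mathcal{IP}$ is the full subcategory of $(G,S)$ having a set of definition $S'$ such that $H_2'/H_1'$ is quasi-algebraic for all $H_1'\subset H_2'$ in $S'$. An origin of $(G,S)$ is $H_0\in S$ such that $H/H_0$ is quasi-algebraic for all $H\in S$ containing $H_0$. $\mathcal{PI}$. A proindalgebraic group is a group $G$ with a nonempty family $S$ of subgroups and an indalgebraic structure on each $G/H$, $H\in S$, such that: (PI-1) as (P-1); (PI-2) for $H\in S$ the subgroups $H'\supset H$ in $S$ are the inverse images of strict indalgebraic subgroups of $G/H$; (PI-3) for $H\subset H'$ in $S$, $G/H\to G/H'$ is a strict epimorphism of indalgebraic groups; (PI-4) $G\cong\varprojlim_{H\in S}G/H$. Morphisms: homomorphisms with $f^{-1}(H_2)\in S_1$ and $G_1/f^{-1}(H_2)\to G_2/H_2$ indalgebraic for all $H_2\in S_2$. $\mathcal{PI}^{\mathrm{ad}}\subset\mathcal{PI}$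 is the full subcategory of $(G,S)$ with a set of definition $S'$ such that the indalgebraic group $H_2'/H_1'$ is quasi-algebraic for all $H_1'\subset H_2'$ in $S'$. An origin is $H_0\in S$ such that $H_0/H$ is quasi-algebraic for all $H\in S$ with $H\subset H_0$. Generated structures. A set of definition is a family $S'$ generating the structure: $\langle S'\rangle$ denotes the smallest complete structure containing $S'$. In the $\mathcal{IP}$ (or $\mathcal{I}$) case $S'$ satisfies axioms 1, 3 and "inclusions between members are closed immersions", and $\langle S'\rangle$ is the set of closed subgroups of members of $S'$; in the $\mathcal{PI}$ case $S'$ satisfies (PI-1), (PI-3), (PI-4), and $\langle S'\rangle$ is the set of $H$ containing some $H'\in S'$ with $H/H'$ a strict indalgebraic subgroup of $G/H'$. $\mathcal{Q}$-admissible groups. A $\mathcal{Q}$-admissible group is a group $G$ with a nonempty family $S$ of subgroups and, for all $H\subset H'$ in $S$, a quasi-algebraic structure on $H'/H$ such that: ($\mathcal{Q}$-ad-1) for $H,H'\in S$ there are $H^+,H_-\in S$ with $H+H'\subset H^+$, $H_-\subset H\cap H'$; ($\mathcal{Q}$-ad-2) for $H\subset H'$ in $S$ the inverse images of closed subgroups of $H'/H$ are in $S$; ($\mathcal{Q}$-ad-3) for $H_-\subset H\subset H^+$ in $S$ the maps $H/H_-\to H^+/H_-$ and $H^+/H_-\to H^+/H$ are quasi-algebraic; ($\mathcal{Q}$-ad-4) for $H\in S$, $\varinjlim_{H\subset H^+\in S}H^+/H\to G/H$ and $H\to\varprojlim_{S\ni H_-\subset H}H/H_-$ are isomorphisms.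 A morphism $f:(G_1,S_1)\to(G_2,S_2)$ is a homomorphism satisfying: (Hom-$\mathcal{Q}$-ad-1) for every $H_1\in S_1$ there is $H_2\in S_2$ containing $f(H_1)$ such that for all $H_{2-}\in S_2$ in $H_2$, $f^{-1}(H_{2-})\cap H_1\in S_1$ and $H_1/(f^{-1}(H_{2-})\cap H_1)\to H_2/H_{2-}$ is quasi-algebraic; (Hom-$\mathcal{Q}$-ad-2) for every $H_2\in S_2$ there is $H_1\in S_1$ in $f^{-1}(H_2)$ such that for all $H_{1+}\in S_1$ containing $H_1$, $f(H_{1+})+H_2\in S_2$ and $H_{1+}/H_1\to(f(H_{1+})+H_2)/H_2$ is quasi-algebraic. Functors (all identity on underlying groups and homomorphisms). $\mathrm{indpro}(G,S)=(G,\langle S\rangle)\in\mathcal{IP}^{\mathrm{ad}}$, each $H\in S$ having proalgebraic structure $\{H_-\in S:H_-\subset H\}$. $\mathrm{proind}(G,S)=(G,\langle S\rangle)\in\mathcal{PI}^{\mathrm{ad}}$, each $G/H$ ($H\in S$) having indalgebraic structure $\{H^+/H:H\subset H^+\in S\}$. $\mathrm{ad}(G,S)=(G,S_0)$ with $S_0$ the set of origins, with the quasi-algebraic structures on $H_0'/H_0$. $\mathrm{can}:\mathcal{IP}^{\mathrm{ad}}\to\mathcal{PI}^{\mathrm{ad}}$: choose an origin $H_0$ with proalgebraic structure $S_{H_0}$; for $H\in S_{H_0}$ give $G/H$ the indalgebraic structure $\{H'/H:H\subset H'\in S\}$; $\mathrm{can}(G,S)=(G,\langle S_{H_0}\rangle)$,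 independent of $H_0$. $\mathrm{can}:\mathcal{PI}^{\mathrm{ad}}\to\mathcal{IP}^{\mathrm{ad}}$: choose an origin $H_0$; let $\tilde S$ be the set of $H\in S$ containing $H_0$ with $H/H_0$ in the indalgebraic structure of $G/H_0$, each $H\in\tilde S$ having proalgebraic structure $\{H'\in S:H'\subset H\}$; $\mathrm{can}(G,S)=(G,\langle\tilde S\rangle)$, independent of $H_0$. *)

theory Defs
  imports
    "HOL-Analysis.Analysis"
    "HOL-Algebra.Coset"
    "HOL-Computational_Algebra.Polynomial"
begin

section \<open>Varieties over an algebraically closed field\<close>

text \<open>
  Varieties are taken in the sense of Serre's FAC: topological spaces with a sheaf of
  \<open>'k\<close>-valued functions, locally isomorphic to affine algebraic sets. For \<open>'k\<close> algebraically
  closed these are the reduced \<open>'k\<close>-schemes of finite type, seen on their \<open>'k\<close>-points. The perfection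
  of a scheme only depends on the reduced scheme, so nilpotents play no role below.

  \<open>kreg X U\<close> is the set of regular functions on the open set \<open>U\<close>; functions are
  extensional. The values at non-open \<open>U\<close> are never used.
\<close>

record ('x, 'k) kspace =
  ktop :: "'x topology"
  kreg :: "'x set \<Rightarrow> ('x \<Rightarrow> 'k) set"

definition kmorphism :: "('x, 'k) kspace \<Rightarrow> ('y, 'k) kspace \<Rightarrow> ('x \<Rightarrow> 'y) \<Rightarrow> bool" where
  "kmorphism X Y f \<longleftrightarrow> continuous_map (ktop X) (ktop Y) f \<and>
     (\<forall>V g. openin (ktop Y) V \<longrightarrow> g \<in> kreg Y V \<longrightarrow>
        restrict (g \<circ> f) {x \<in> topspace (ktop X). f x \<in> V}
          \<in> kreg X {x \<in> topspace (ktop X). f x \<in> V})"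

definition kisomorphic :: "('x, 'k) kspace \<Rightarrow> ('y, 'k) kspace \<Rightarrow> bool" where
  "kisomorphic X Y \<longleftrightarrow> (\<exists>f g. kmorphism X Y f \<and> kmorphism Y X g \<and>
     (\<forall>x \<in> topspace (ktop X). g (f x) = x) \<and> (\<forall>y \<in> topspace (ktop Y). f (g y) = y))"

definition open_subspace :: "('x, 'k) kspace \<Rightarrow> 'x set \<Rightarrow> ('x, 'k) kspace" where
  "open_subspace X U = \<lparr>ktop = subtopology (ktop X) U, kreg = kreg X\<rparr>"

text \<open>Polynomial functions on affine \<open>n\<close>-space, whose points are \<open>{..<n} \<rightarrow>\<^sub>E UNIV\<close>.\<close>

inductive_set polyfun :: "nat \<Rightarrow> ((nat \<Rightarrow> 'k::field) \<Rightarrow> 'k) set" for n :: nat where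
  const: "(\<lambda>_. c) \<in> polyfun n"
| coord: "i < n \<Longrightarrow> (\<lambda>x. x i) \<in> polyfun n"
| add: "f \<in> polyfun n \<Longrightarrow> g \<in> polyfun n \<Longrightarrow> (\<lambda>x. f x + g x) \<in> polyfun n"
| mult: "f \<in> polyfun n \<Longrightarrow> g \<in> polyfun n \<Longrightarrow> (\<lambda>x. f x * g x) \<in> polyfun n"

definition zero_locus :: "nat \<Rightarrow> ((nat \<Rightarrow> 'k::field) \<Rightarrow> 'k) set \<Rightarrow> (nat \<Rightarrow> 'k) set" where
  "zero_locus n F = {x \<in> {..<n} \<rightarrow>\<^sub>E UNIV. \<forall>f \<in> F. f x = 0}"

definition zariski :: "nat \<Rightarrow> (nat \<Rightarrow> 'k::field) set \<Rightarrow> (nat \<Rightarrow> 'k) topology" where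
  "zariski n Z = topology_generated_by {{x \<in> Z. f x \<noteq> 0} | f. f \<in> polyfun n}"

definition affine_kspace ::
    "nat \<Rightarrow> ((nat \<Rightarrow> 'k::field) \<Rightarrow> 'k) set \<Rightarrow> (nat \<Rightarrow> 'k, 'k) kspace" where
  "affine_kspace n F =
     \<lparr>ktop = zariski n (zero_locus n F),
      kreg = (\<lambda>U. {r \<in> extensional U. \<forall>x \<in> U. \<exists>V. openin (zariski n (zero_locus n F)) V \<and>
                 x \<in> V \<and> V \<subseteq> U \<and>
                 (\<exists>g \<in> polyfun n. \<exists>h \<in> polyfun n. \<forall>y \<in> V. h y \<noteq> 0 \<and> r y = g y / h y)})\<rparr>"

definition function_sheaf :: "('x, 'k) kspace \<Rightarrow> bool" where
  "function_sheaf X \<longleftrightarrow>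
     (\<forall>U. openin (ktop X) U \<longrightarrow> kreg X U \<subseteq> extensional U) \<and>
     (\<forall>U V f. openin (ktop X) U \<longrightarrow> openin (ktop X) V \<longrightarrow> V \<subseteq> U \<longrightarrow> f \<in> kreg X U \<longrightarrow>
        restrict f V \<in> kreg X V) \<and>
     (\<forall>U f. openin (ktop X) U \<longrightarrow> f \<in> extensional U \<longrightarrow>
        (\<forall>x \<in> U. \<exists>V. openin (ktop X) V \<and> x \<in> V \<and> V \<subseteq> U \<and> restrict f V \<in> kreg X V) \<longrightarrow>
        f \<in> kreg X U)"

text \<open>Separatedness is not required here: it is automatic for group objects.\<close>

definition variety :: "('x, 'k::field) kspace \<Rightarrow> bool" where
  "variety X \<longleftrightarrow> function_sheaf X \<and>
     (\<exists>\<U>. finite \<U> \<and> \<Union>\<U> = topspace (ktop X) \<and>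
        (\<forall>U \<in> \<U>. openin (ktop X) U \<and>
           (\<exists>n F. F \<subseteq> polyfun n \<and> kisomorphic (open_subspace X U) (affine_kspace n F))))"

text \<open>The product of varieties: \<open>tensor_functions X Y A B\<close> is the image of
  \<open>\<O>(A) \<otimes> \<O>(B)\<close> in the functions on \<open>A \<times> B\<close>; its non-vanishing loci form
  a basis of the topology, and regular functions are locally quotients of its elements.\<close>

definition tensor_functions ::
    "('x, 'k::field) kspace \<Rightarrow> ('y, 'k) kspace \<Rightarrow> 'x set \<Rightarrow> 'y set \<Rightarrow> ('x \<times> 'y \<Rightarrow> 'k) set" where
  "tensor_functions X Y A B =
     {(\<lambda>(a, b). \<Sum>i<m. f i a * g i b) | (m::nat) f g. \<forall>i<m. f i \<in> kreg X A \<and> g i \<in> kreg Y B}"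

definition kprod_top ::
    "('x, 'k::field) kspace \<Rightarrow> ('y, 'k) kspace \<Rightarrow> ('x \<times> 'y) topology" where
  "kprod_top X Y = topology_generated_by
     {{z \<in> A \<times> B. t z \<noteq> 0} | A B t.
        openin (ktop X) A \<and> openin (ktop Y) B \<and> t \<in> tensor_functions X Y A B}"

definition kprod :: "('x, 'k::field) kspace \<Rightarrow> ('y, 'k) kspace \<Rightarrow> ('x \<times> 'y, 'k) kspace" where
  "kprod X Y =
     \<lparr>ktop = kprod_top X Y,
      kreg = (\<lambda>W. {r \<in> extensional W. \<forall>z \<in> W. \<exists>A B s t.
                 openin (ktop X) A \<and> openin (ktop Y) B \<and>
                 s \<in> tensor_functions X Y A B \<and> t \<in> tensor_functions X Y A B \<and>
                 z \<in> A \<times> B \<and> t z \<noteq> 0 \<and>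
                 (\<forall>w \<in> A \<times> B. t w \<noteq> 0 \<longrightarrow> w \<in> W \<and> r w = s w / t w)})\<rparr>"

section \<open>The category \<open>\<Q>\<close> of quasi-algebraic groups\<close>

definition algebraic_group :: "'a monoid \<Rightarrow> ('a, 'k::field) kspace \<Rightarrow> bool" where
  "algebraic_group G X \<longleftrightarrow> comm_group G \<and> variety X \<and> topspace (ktop X) = carrier G \<and>
     kmorphism (kprod X X) X (\<lambda>(x, y). x \<otimes>\<^bsub>G\<^esub> y) \<and> kmorphism X X (\<lambda>x. inv\<^bsub>G\<^esub> x)"

text \<open>The structure sheaf of the perfection is the colimit of \<open>\<O>\<close> along Frobenius;
  in terms of functions its sections are the \<open>p\<^sup>n\<close>-th roots of regular functions.\<close>

definition perfection :: "('x, 'k::field) kspace \<Rightarrow> ('x, 'k) kspace" where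
  "perfection X =
     \<lparr>ktop = ktop X,
      kreg = (\<lambda>U. {f \<in> extensional U.
                 \<exists>n. restrict (\<lambda>x. f x ^ (CHAR('k) ^ n)) U \<in> kreg X U})\<rparr>"

text \<open>A quasi-algebraic structure is the class of all algebraic group structures with a
  given perfection; it is represented by this common perfection.\<close>

definition quasialg :: "'a monoid \<Rightarrow> ('a, 'k::field) kspace \<Rightarrow> bool" where
  "quasialg G X \<longleftrightarrow> (\<exists>Y. algebraic_group G Y \<and> X = perfection Y)"

definition quasialg_hom ::
    "'a monoid \<Rightarrow> ('a, 'k) kspace \<Rightarrow> 'b monoid \<Rightarrow> ('b, 'k) kspace \<Rightarrow> ('a \<Rightarrow> 'b) \<Rightarrow> bool" where
  "quasialg_hom G1 X1 G2 X2 f \<longleftrightarrow> f \<in> hom G1 G2 \<and> kmorphism X1 X2 f"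

definition quasialg_closed :: "'a monoid \<Rightarrow> ('a, 'k) kspace \<Rightarrow> 'a set \<Rightarrow> bool" where
  "quasialg_closed G X K \<longleftrightarrow> subgroup K G \<and> closedin (ktop X) K"

section \<open>Pro- and ind-structures\<close>

text \<open>A family of subgroups, with a structure of type \<open>'q\<close> attached to each member.
  The values of \<open>str\<close> outside \<open>mem\<close> are irrelevant.\<close>

record ('a, 'q) family =
  mem :: "'a set set"
  str :: "'a set \<Rightarrow> 'q"

abbreviation restr_grp :: "'a monoid \<Rightarrow> 'a set \<Rightarrow> 'a monoid" (infixl "\<restriction>" 66) where
  "G \<restriction> H \<equiv> G\<lparr>carrier := H\<rparr>"

text \<open>The quotient \<open>H'/H\<close>, as a set of cosets. For \<open>H \<subseteq> H' \<subseteq> H''\<close> it is literally a subset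
  of \<open>H''/H\<close>, and \<open>\<Union>(H'/H) = H'\<close>.\<close>

definition quot_set :: "'a monoid \<Rightarrow> 'a set \<Rightarrow> 'a set \<Rightarrow> 'a set set" where
  "quot_set G H' H = carrier (G \<restriction> H' Mod H)"

text \<open>The map \<open>G1/H1 \<rightarrow> G2/H2\<close> induced by \<open>f\<close>, where \<open>f(H1) \<subseteq> H2\<close>; the coset \<open>c\<close> goes to
  \<open>H2 + f(c)\<close>.\<close>

definition quot_map :: "'b monoid \<Rightarrow> 'b set \<Rightarrow> ('a \<Rightarrow> 'b) \<Rightarrow> 'a set \<Rightarrow> 'b set" where
  "quot_map G2 H2 f c = H2 <#>\<^bsub>G2\<^esub> f ` c"

definition coset_preimage :: "'a monoid \<Rightarrow> 'a set \<Rightarrow> 'a set set \<Rightarrow> 'a set" where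
  "coset_preimage G H C = {x \<in> carrier G. H #>\<^bsub>G\<^esub> x \<in> C}"

definition quot_limit :: "'a monoid \<Rightarrow> 'a set set \<Rightarrow> ('a set \<Rightarrow> 'a set) set" where
  "quot_limit G M = {c \<in> (\<Pi>\<^sub>E H \<in> M. carrier (G Mod H)).
     \<forall>H \<in> M. \<forall>H' \<in> M. H \<subseteq> H' \<longrightarrow> c H' = quot_map G H' (\<lambda>x. x) (c H)}"

definition is_quot_limit :: "'a monoid \<Rightarrow> 'a set set \<Rightarrow> bool" where
  "is_quot_limit G M \<longleftrightarrow>
     bij_betw (\<lambda>x. \<lambda>H \<in> M. H #>\<^bsub>G\<^esub> x) (carrier G) (quot_limit G M)"

definition countably_cofinal :: "'a set set \<Rightarrow> bool" where
  "countably_cofinal M \<longleftrightarrow> (\<exists>C \<subseteq> M. countable C \<and> (\<forall>H \<in> M. \<exists>K \<in> C. H \<subseteq> K))"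

definition countably_coinitial :: "'a set set \<Rightarrow> bool" where
  "countably_coinitial M \<longleftrightarrow> (\<exists>C \<subseteq> M. countable C \<and> (\<forall>H \<in> M. \<exists>K \<in> C. K \<subseteq> H))"

text \<open>Axioms 1 and 4 of a pro-structure, resp. 1 and 3 of an ind-structure (where the
  directed colimit of subgroups is their union).\<close>

definition pro_system :: "'a monoid \<Rightarrow> 'a set set \<Rightarrow> bool" where
  "pro_system G M \<longleftrightarrow> M \<noteq> {} \<and> (\<forall>H \<in> M. subgroup H G) \<and> countably_coinitial M \<and>
     (\<forall>H \<in> M. \<forall>H' \<in> M. \<exists>H'' \<in> M. H'' \<subseteq> H \<inter> H') \<and> is_quot_limit G M"

definition ind_system :: "'a monoid \<Rightarrow> 'a set set \<Rightarrow> bool" where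
  "ind_system G M \<longleftrightarrow> M \<noteq> {} \<and> (\<forall>H \<in> M. subgroup H G) \<and> countably_cofinal M \<and>
     (\<forall>H \<in> M. \<forall>H' \<in> M. \<exists>H'' \<in> M. H <#>\<^bsub>G\<^esub> H' \<subseteq> H'') \<and> \<Union>M = carrier G"

text \<open>Pro- and ind-structures relative to a notion \<open>obj\<close> of structured group, with
  homomorphisms \<open>mor\<close>, allowed transition maps \<open>trn\<close> and closed subgroups \<open>clo\<close>.\<close>

definition pro_structure ::
    "('a set monoid \<Rightarrow> 'q \<Rightarrow> bool) \<Rightarrow>
     ('a set monoid \<Rightarrow> 'q \<Rightarrow> 'a set monoid \<Rightarrow> 'q \<Rightarrow> ('a set \<Rightarrow> 'a set) \<Rightarrow> bool) \<Rightarrow>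
     ('a set monoid \<Rightarrow> 'q \<Rightarrow> 'a set set \<Rightarrow> bool) \<Rightarrow> 'a monoid \<Rightarrow> ('a, 'q) family \<Rightarrow> bool" where
  "pro_structure obj trn clo G S \<longleftrightarrow> comm_group G \<and> pro_system G (mem S) \<and>
     (\<forall>H \<in> mem S. obj (G Mod H) (str S H)) \<and>
     (\<forall>H \<in> mem S. {H' \<in> mem S. H \<subseteq> H'} =
        {coset_preimage G H C | C. clo (G Mod H) (str S H) C}) \<and>
     (\<forall>H \<in> mem S. \<forall>H' \<in> mem S. H \<subseteq> H' \<longrightarrow>
        trn (G Mod H) (str S H) (G Mod H') (str S H') (quot_map G H' (\<lambda>x. x)))"

definition pro_hom ::
    "('a set monoid \<Rightarrow> 'q \<Rightarrow> 'a set monoid \<Rightarrow> 'q \<Rightarrow> ('a set \<Rightarrow> 'a set) \<Rightarrow> bool) \<Rightarrow>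
     'a monoid \<Rightarrow> ('a, 'q) family \<Rightarrow> 'a monoid \<Rightarrow> ('a, 'q) family \<Rightarrow> ('a \<Rightarrow> 'a) \<Rightarrow> bool" where
  "pro_hom mor G1 S1 G2 S2 f \<longleftrightarrow> f \<in> hom G1 G2 \<and>
     (\<forall>H2 \<in> mem S2. let K = {x \<in> carrier G1. f x \<in> H2} in K \<in> mem S1 \<and>
        mor (G1 Mod K) (str S1 K) (G2 Mod H2) (str S2 H2) (quot_map G2 H2 f))"

text \<open>Axiom 2 of an ind-structure includes that a closed subgroup \<open>H'\<close> of \<open>H\<close> carries
  the structure induced by \<open>H\<close>, which is the one for which the inclusion is a morphism.\<close>

definition ind_structure ::
    "('a monoid \<Rightarrow> 'q \<Rightarrow> bool) \<Rightarrow>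
     ('a monoid \<Rightarrow> 'q \<Rightarrow> 'a monoid \<Rightarrow> 'q \<Rightarrow> ('a \<Rightarrow> 'a) \<Rightarrow> bool) \<Rightarrow>
     ('a monoid \<Rightarrow> 'q \<Rightarrow> 'a set \<Rightarrow> bool) \<Rightarrow> 'a monoid \<Rightarrow> ('a, 'q) family \<Rightarrow> bool" where
  "ind_structure obj mor clo G S \<longleftrightarrow> comm_group G \<and> ind_system G (mem S) \<and>
     (\<forall>H \<in> mem S. obj (G \<restriction> H) (str S H)) \<and>
     (\<forall>H \<in> mem S. {H' \<in> mem S. H' \<subseteq> H} = {K. clo (G \<restriction> H) (str S H) K}) \<and>
     (\<forall>H \<in> mem S. \<forall>H' \<in> mem S. H' \<subseteq> H \<longrightarrow>
        mor (G \<restriction> H') (str S H') (G \<restriction> H) (str S H) (\<lambda>x. x))"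

definition ind_hom ::
    "('a monoid \<Rightarrow> 'q \<Rightarrow> 'a monoid \<Rightarrow> 'q \<Rightarrow> ('a \<Rightarrow> 'a) \<Rightarrow> bool) \<Rightarrow>
     'a monoid \<Rightarrow> ('a, 'q) family \<Rightarrow> 'a monoid \<Rightarrow> ('a, 'q) family \<Rightarrow> ('a \<Rightarrow> 'a) \<Rightarrow> bool" where
  "ind_hom mor G1 S1 G2 S2 f \<longleftrightarrow> f \<in> hom G1 G2 \<and>
     (\<forall>H1 \<in> mem S1. f ` H1 \<in> mem S2 \<and>
        mor (G1 \<restriction> H1) (str S1 H1) (G2 \<restriction> (f ` H1)) (str S2 (f ` H1)) f)"

section \<open>The categories \<open>\<P>\<close> and \<open>\<I>\<close>\<close>

type_synonym ('a, 'k) pro_fam = "('a, ('a set, 'k) kspace) family"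
type_synonym ('a, 'k) ind_fam = "('a, ('a, 'k) kspace) family"

definition proalg :: "'a monoid \<Rightarrow> ('a, 'k::field) pro_fam \<Rightarrow> bool" where
  "proalg = pro_structure quasialg quasialg_hom quasialg_closed"

definition proalg_hom ::
    "'a monoid \<Rightarrow> ('a, 'k) pro_fam \<Rightarrow> 'a monoid \<Rightarrow> ('a, 'k) pro_fam \<Rightarrow> ('a \<Rightarrow> 'a) \<Rightarrow> bool" where
  "proalg_hom = pro_hom quasialg_hom"

text \<open>Closed subgroups are the subobjects in \<open>\<P>\<close>; the monomorphisms of \<open>\<P>\<close> are the
  injective morphisms.\<close>

definition proalg_closed :: "'a monoid \<Rightarrow> ('a, 'k::field) pro_fam \<Rightarrow> 'a set \<Rightarrow> bool" where
  "proalg_closed G S K \<longleftrightarrow> subgroup K G \<and>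
     (\<exists>T. proalg (G \<restriction> K) T \<and> proalg_hom (G \<restriction> K) T G S (\<lambda>x. x))"

text \<open>The quotient \<open>G/N\<close> in \<open>\<P>\<close> has the images of the members of \<open>S\<close> as subgroups of
  definition; a proalgebraic group is quasi-algebraic if its trivial subgroup is a subgroup
  of definition.\<close>

definition proalg_quot_quasialg :: "'a monoid \<Rightarrow> ('a, 'k) pro_fam \<Rightarrow> 'a set \<Rightarrow> bool" where
  "proalg_quot_quasialg G S N \<longleftrightarrow>
     {\<one>\<^bsub>G Mod N\<^esub>} \<in> (\<lambda>K. (\<lambda>x. N #>\<^bsub>G\<^esub> x) ` K) ` mem S"

definition indalg :: "'a monoid \<Rightarrow> ('a, 'k::field) ind_fam \<Rightarrow> bool" where
  "indalg = ind_structure quasialg quasialg_hom quasialg_closed"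

definition indalg_hom ::
    "'a monoid \<Rightarrow> ('a, 'k) ind_fam \<Rightarrow> 'a monoid \<Rightarrow> ('a, 'k) ind_fam \<Rightarrow> ('a \<Rightarrow> 'a) \<Rightarrow> bool" where
  "indalg_hom = ind_hom quasialg_hom"

definition strict_subgroup :: "'a monoid \<Rightarrow> ('a, 'k) ind_fam \<Rightarrow> 'a set \<Rightarrow> bool" where
  "strict_subgroup G S K \<longleftrightarrow> subgroup K G \<and>
     (\<forall>H \<in> mem S. quasialg_closed (G \<restriction> H) (str S H) (K \<inter> H))"

definition strict_epi ::
    "'a monoid \<Rightarrow> ('a, 'k) ind_fam \<Rightarrow> 'a monoid \<Rightarrow> ('a, 'k) ind_fam \<Rightarrow> ('a \<Rightarrow> 'a) \<Rightarrow> bool" where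
  "strict_epi G1 S1 G2 S2 f \<longleftrightarrow> indalg_hom G1 S1 G2 S2 f \<and> f ` carrier G1 = carrier G2 \<and>
     mem S2 = {f ` H | H. H \<in> mem S1}"

text \<open>The strict subgroup \<open>K\<close> has the subgroups \<open>K \<inter> H\<close> as its structure; an indalgebraic
  group is quasi-algebraic if the whole group belongs to its structure.\<close>

definition strict_subgroup_quasialg :: "('a, 'k) ind_fam \<Rightarrow> 'a set \<Rightarrow> bool" where
  "strict_subgroup_quasialg S K \<longleftrightarrow> K \<in> (\<lambda>H. K \<inter> H) ` mem S"

section \<open>The categories \<open>\<I>\<P>\<close> and \<open>\<P>\<I>\<close>\<close>

type_synonym ('a, 'k) indpro_fam = "('a, ('a, 'k) pro_fam) family"
type_synonym ('a, 'k) proind_fam = "('a, ('a set, 'k) ind_fam) family"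

definition indproalg :: "'a monoid \<Rightarrow> ('a, 'k::field) indpro_fam \<Rightarrow> bool" where
  "indproalg = ind_structure proalg proalg_hom proalg_closed"

definition indproalg_hom ::
    "'a monoid \<Rightarrow> ('a, 'k) indpro_fam \<Rightarrow> 'a monoid \<Rightarrow> ('a, 'k) indpro_fam \<Rightarrow>
     ('a \<Rightarrow> 'a) \<Rightarrow> bool" where
  "indproalg_hom = ind_hom proalg_hom"

definition proindalg :: "'a monoid \<Rightarrow> ('a, 'k::field) proind_fam \<Rightarrow> bool" where
  "proindalg = pro_structure indalg strict_epi strict_subgroup"

definition proindalg_hom ::
    "'a monoid \<Rightarrow> ('a, 'k) proind_fam \<Rightarrow> 'a monoid \<Rightarrow> ('a, 'k) proind_fam \<Rightarrow>
     ('a \<Rightarrow> 'a) \<Rightarrow> bool" where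
  "proindalg_hom = pro_hom indalg_hom"

text \<open>The complete structure \<open>\<langle>S\<rangle>\<close> generated by a set of definition \<open>S\<close>. Its new members
  (resp. new quotients) carry the unique structure which makes their inclusion in a member
  of \<open>S\<close> a closed immersion (resp. the projection from a quotient in \<open>S\<close> a strict
  epimorphism).\<close>

definition indpro_members :: "'a monoid \<Rightarrow> ('a, 'k::field) indpro_fam \<Rightarrow> 'a set set" where
  "indpro_members G S = {K. \<exists>H \<in> mem S. proalg_closed (G \<restriction> H) (str S H) K}"

definition indpro_generated ::
    "'a monoid \<Rightarrow> ('a, 'k::field) indpro_fam \<Rightarrow> ('a, 'k) indpro_fam" where
  "indpro_generated G S =
     \<lparr>mem = indpro_members G S,
      str = (\<lambda>K. SOME T. proalg (G \<restriction> K) T \<and>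
               (\<exists>H \<in> mem S. K \<subseteq> H \<and> proalg_hom (G \<restriction> K) T (G \<restriction> H) (str S H) (\<lambda>x. x)))\<rparr>"

definition proind_members :: "'a monoid \<Rightarrow> ('a, 'k) proind_fam \<Rightarrow> 'a set set" where
  "proind_members G S = {H. subgroup H G \<and>
     (\<exists>H' \<in> mem S. H' \<subseteq> H \<and> strict_subgroup (G Mod H') (str S H') (quot_set G H H'))}"

definition proind_generated ::
    "'a monoid \<Rightarrow> ('a, 'k::field) proind_fam \<Rightarrow> ('a, 'k) proind_fam" where
  "proind_generated G S =
     \<lparr>mem = proind_members G S,
      str = (\<lambda>H. SOME T. indalg (G Mod H) T \<and>
               (\<exists>H' \<in> mem S. H' \<subseteq> H \<and>
                  strict_epi (G Mod H') (str S H') (G Mod H) T (quot_map G H (\<lambda>x. x))))\<rparr>"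

definition indproalg_ad :: "'a monoid \<Rightarrow> ('a, 'k::field) indpro_fam \<Rightarrow> bool" where
  "indproalg_ad G S \<longleftrightarrow> indproalg G S \<and>
     (\<exists>M \<subseteq> mem S. ind_system G M \<and> indpro_members G (S\<lparr>mem := M\<rparr>) = mem S \<and>
        (\<forall>H1 \<in> M. \<forall>H2 \<in> M. H1 \<subseteq> H2 \<longrightarrow> proalg_quot_quasialg (G \<restriction> H2) (str S H2) H1))"

definition proindalg_ad :: "'a monoid \<Rightarrow> ('a, 'k::field) proind_fam \<Rightarrow> bool" where
  "proindalg_ad G S \<longleftrightarrow> proindalg G S \<and>
     (\<exists>M \<subseteq> mem S. pro_system G M \<and> proind_members G (S\<lparr>mem := M\<rparr>) = mem S \<and>
        (\<forall>H1 \<in> M. \<forall>H2 \<in> M. H1 \<subseteq> H2 \<longrightarrow>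
           strict_subgroup_quasialg (str S H1) (quot_set G H2 H1)))"

definition indpro_origins :: "'a monoid \<Rightarrow> ('a, 'k) indpro_fam \<Rightarrow> 'a set set" where
  "indpro_origins G S =
     {H0 \<in> mem S. \<forall>H \<in> mem S. H0 \<subseteq> H \<longrightarrow> proalg_quot_quasialg (G \<restriction> H) (str S H) H0}"

definition proind_origins :: "'a monoid \<Rightarrow> ('a, 'k) proind_fam \<Rightarrow> 'a set set" where
  "proind_origins G S =
     {H0 \<in> mem S. \<forall>H \<in> mem S. H \<subseteq> H0 \<longrightarrow> strict_subgroup_quasialg (str S H) (quot_set G H0 H)}"

section \<open>\<open>\<Q>\<close>-admissible groups\<close>

text \<open>For \<open>H \<subseteq> H'\<close> in \<open>mem S\<close>, \<open>str S H' H\<close> is the structure on \<open>H'/H\<close> (note the order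
  of the arguments).\<close>

type_synonym ('a, 'k) qad_fam = "('a, 'a set \<Rightarrow> ('a set, 'k) kspace) family"

definition qadmissible :: "'a monoid \<Rightarrow> ('a, 'k::field) qad_fam \<Rightarrow> bool" where
  "qadmissible G S \<longleftrightarrow> comm_group G \<and> mem S \<noteq> {} \<and> (\<forall>H \<in> mem S. subgroup H G) \<and>
     countably_cofinal (mem S) \<and> countably_coinitial (mem S) \<and>
     (\<forall>H \<in> mem S. \<forall>H' \<in> mem S. H \<subseteq> H' \<longrightarrow> quasialg (G \<restriction> H' Mod H) (str S H' H)) \<and>
     (\<forall>H \<in> mem S. \<forall>H' \<in> mem S.
        (\<exists>Hp \<in> mem S. H <#>\<^bsub>G\<^esub> H' \<subseteq> Hp) \<and> (\<exists>Hm \<in> mem S. Hm \<subseteq> H \<inter> H')) \<and>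
     (\<forall>H \<in> mem S. \<forall>H' \<in> mem S. H \<subseteq> H' \<longrightarrow>
        (\<forall>C. quasialg_closed (G \<restriction> H' Mod H) (str S H' H) C \<longrightarrow>
           coset_preimage (G \<restriction> H') H C \<in> mem S)) \<and>
     (\<forall>Hm \<in> mem S. \<forall>H \<in> mem S. \<forall>Hp \<in> mem S. Hm \<subseteq> H \<longrightarrow> H \<subseteq> Hp \<longrightarrow>
        quasialg_hom (G \<restriction> H Mod Hm) (str S H Hm) (G \<restriction> Hp Mod Hm) (str S Hp Hm) (\<lambda>c. c) \<and>
        quasialg_hom (G \<restriction> Hp Mod Hm) (str S Hp Hm) (G \<restriction> Hp Mod H) (str S Hp H)
          (quot_map G H (\<lambda>x. x))) \<and>
     (\<forall>H \<in> mem S. (\<Union>Hp \<in> {Hp \<in> mem S. H \<subseteq> Hp}. quot_set G Hp H) = carrier (G Mod H) \<and>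
        is_quot_limit (G \<restriction> H) {Hm \<in> mem S. Hm \<subseteq> H})"

definition hom_qad_1 ::
    "'a monoid \<Rightarrow> ('a, 'k) qad_fam \<Rightarrow> 'a monoid \<Rightarrow> ('a, 'k) qad_fam \<Rightarrow> ('a \<Rightarrow> 'a) \<Rightarrow> bool" where
  "hom_qad_1 G1 S1 G2 S2 f \<longleftrightarrow>
     (\<forall>H1 \<in> mem S1. \<exists>H2 \<in> mem S2. f ` H1 \<subseteq> H2 \<and>
        (\<forall>H2m \<in> mem S2. H2m \<subseteq> H2 \<longrightarrow>
           (let K = {x \<in> H1. f x \<in> H2m} in K \<in> mem S1 \<and>
              quasialg_hom (G1 \<restriction> H1 Mod K) (str S1 H1 K) (G2 \<restriction> H2 Mod H2m) (str S2 H2 H2m)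
                (quot_map G2 H2m f))))"

definition hom_qad_2 ::
    "'a monoid \<Rightarrow> ('a, 'k) qad_fam \<Rightarrow> 'a monoid \<Rightarrow> ('a, 'k) qad_fam \<Rightarrow> ('a \<Rightarrow> 'a) \<Rightarrow> bool" where
  "hom_qad_2 G1 S1 G2 S2 f \<longleftrightarrow>
     (\<forall>H2 \<in> mem S2. \<exists>H1 \<in> mem S1. f ` H1 \<subseteq> H2 \<and>
        (\<forall>H1p \<in> mem S1. H1 \<subseteq> H1p \<longrightarrow>
           (let L = (f ` H1p) <#>\<^bsub>G2\<^esub> H2 in L \<in> mem S2 \<and>
              quasialg_hom (G1 \<restriction> H1p Mod H1) (str S1 H1p H1) (G2 \<restriction> L Mod H2) (str S2 L H2)
                (quot_map G2 H2 f))))"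

definition qad_hom ::
    "'a monoid \<Rightarrow> ('a, 'k) qad_fam \<Rightarrow> 'a monoid \<Rightarrow> ('a, 'k) qad_fam \<Rightarrow> ('a \<Rightarrow> 'a) \<Rightarrow> bool" where
  "qad_hom G1 S1 G2 S2 f \<longleftrightarrow>
     f \<in> hom G1 G2 \<and> hom_qad_1 G1 S1 G2 S2 f \<and> hom_qad_2 G1 S1 G2 S2 f"

section \<open>Categories and functors\<close>

record ('o, 'm) category =
  Ob :: "'o set"
  Hom :: "'o \<Rightarrow> 'o \<Rightarrow> 'm set"
  Idn :: "'o \<Rightarrow> 'm"
  Comp :: "'o \<Rightarrow> 'o \<Rightarrow> 'o \<Rightarrow> 'm \<Rightarrow> 'm \<Rightarrow> 'm"

text \<open>\<open>Comp C X Y Z g f\<close> is the composite of \<open>f : X \<rightarrow> Y\<close> and \<open>g : Y \<rightarrow> Z\<close>.\<close>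

definition is_category :: "('o, 'm) category \<Rightarrow> bool" where
  "is_category C \<longleftrightarrow>
     (\<forall>X \<in> Ob C. Idn C X \<in> Hom C X X) \<and>
     (\<forall>X \<in> Ob C. \<forall>Y \<in> Ob C. \<forall>f \<in> Hom C X Y.
        Comp C X X Y f (Idn C X) = f \<and> Comp C X Y Y (Idn C Y) f = f) \<and>
     (\<forall>X \<in> Ob C. \<forall>Y \<in> Ob C. \<forall>Z \<in> Ob C. \<forall>f \<in> Hom C X Y. \<forall>g \<in> Hom C Y Z.
        Comp C X Y Z g f \<in> Hom C X Z) \<and>
     (\<forall>W \<in> Ob C. \<forall>X \<in> Ob C. \<forall>Y \<in> Ob C. \<forall>Z \<in> Ob C.
        \<forall>f \<in> Hom C W X. \<forall>g \<in> Hom C X Y. \<forall>h \<in> Hom C Y Z.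
        Comp C W Y Z h (Comp C W X Y g f) = Comp C W X Z (Comp C X Y Z h g) f)"

record ('o, 'm, 'p, 'n) funct =
  fob :: "'o \<Rightarrow> 'p"
  fmap :: "'o \<Rightarrow> 'o \<Rightarrow> 'm \<Rightarrow> 'n"

definition is_functor ::
    "('o, 'm) category \<Rightarrow> ('p, 'n) category \<Rightarrow> ('o, 'm, 'p, 'n) funct \<Rightarrow> bool" where
  "is_functor C D F \<longleftrightarrow> is_category C \<and> is_category D \<and>
     (\<forall>X \<in> Ob C. fob F X \<in> Ob D \<and> fmap F X X (Idn C X) = Idn D (fob F X)) \<and>
     (\<forall>X \<in> Ob C. \<forall>Y \<in> Ob C. \<forall>f \<in> Hom C X Y. fmap F X Y f \<in> Hom D (fob F X) (fob F Y)) \<and>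
     (\<forall>X \<in> Ob C. \<forall>Y \<in> Ob C. \<forall>Z \<in> Ob C. \<forall>f \<in> Hom C X Y. \<forall>g \<in> Hom C Y Z.
        fmap F X Z (Comp C X Y Z g f) =
        Comp D (fob F X) (fob F Y) (fob F Z) (fmap F Y Z g) (fmap F X Y f))"

definition id_funct :: "('o, 'm, 'o, 'm) funct" where
  "id_funct = \<lparr>fob = (\<lambda>X. X), fmap = (\<lambda>X Y f. f)\<rparr>"

definition comp_funct ::
    "('p, 'n, 'q, 'l) funct \<Rightarrow> ('o, 'm, 'p, 'n) funct \<Rightarrow> ('o, 'm, 'q, 'l) funct"
    (infixl "\<circ>\<^sub>F" 55) where
  "F' \<circ>\<^sub>F F = \<lparr>fob = (\<lambda>X. fob F' (fob F X)),
              fmap = (\<lambda>X Y f. fmap F' (fob F X) (fob F Y) (fmap F X Y f))\<rparr>"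

definition is_iso :: "('o, 'm) category \<Rightarrow> 'o \<Rightarrow> 'o \<Rightarrow> 'm \<Rightarrow> bool" where
  "is_iso C X Y f \<longleftrightarrow> f \<in> Hom C X Y \<and>
     (\<exists>g \<in> Hom C Y X. Comp C X Y X g f = Idn C X \<and> Comp C Y X Y f g = Idn C Y)"

definition natural_iso ::
    "('o, 'm) category \<Rightarrow> ('p, 'n) category \<Rightarrow> ('o, 'm, 'p, 'n) funct \<Rightarrow>
     ('o, 'm, 'p, 'n) funct \<Rightarrow> ('o \<Rightarrow> 'n) \<Rightarrow> bool" where
  "natural_iso C D F F' \<eta> \<longleftrightarrow> is_functor C D F \<and> is_functor C D F' \<and>
     (\<forall>X \<in> Ob C. is_iso D (fob F X) (fob F' X) (\<eta> X)) \<and>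
     (\<forall>X \<in> Ob C. \<forall>Y \<in> Ob C. \<forall>f \<in> Hom C X Y.
        Comp D (fob F X) (fob F Y) (fob F' Y) (\<eta> Y) (fmap F X Y f) =
        Comp D (fob F X) (fob F' X) (fob F' Y) (fmap F' X Y f) (\<eta> X))"

definition mutually_inverse_equivalences ::
    "('o, 'm) category \<Rightarrow> ('p, 'n) category \<Rightarrow> ('o, 'm, 'p, 'n) funct \<Rightarrow>
     ('p, 'n, 'o, 'm) funct \<Rightarrow> bool" where
  "mutually_inverse_equivalences C D F F' \<longleftrightarrow> is_functor C D F \<and> is_functor D C F' \<and>
     (\<exists>\<eta>. natural_iso C C (F' \<circ>\<^sub>F F) id_funct \<eta>) \<and>
     (\<exists>\<epsilon>. natural_iso D D (F \<circ>\<^sub>F F') id_funct \<epsilon>)"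

text \<open>Categories of structured groups; homomorphisms are extensional functions on the carrier.\<close>

definition concrete_category ::
    "('a monoid \<Rightarrow> 's \<Rightarrow> bool) \<Rightarrow>
     ('a monoid \<Rightarrow> 's \<Rightarrow> 'a monoid \<Rightarrow> 's \<Rightarrow> ('a \<Rightarrow> 'a) \<Rightarrow> bool) \<Rightarrow>
     ('a monoid \<times> 's, 'a \<Rightarrow> 'a) category" where
  "concrete_category obj mor =
     \<lparr>Ob = {(G, S). obj G S},
      Hom = (\<lambda>(G1, S1) (G2, S2). {f \<in> extensional (carrier G1). mor G1 S1 G2 S2 f}),
      Idn = (\<lambda>(G, S). \<lambda>x \<in> carrier G. x),
      Comp = (\<lambda>X Y Z g f. compose (carrier (fst X)) g f)\<rparr>"

text \<open>A functor which is the identity on underlying groups and homomorphisms.\<close>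

definition concrete_funct ::
    "('a monoid \<Rightarrow> 's \<Rightarrow> 't) \<Rightarrow>
     ('a monoid \<times> 's, 'a \<Rightarrow> 'a, 'a monoid \<times> 't, 'a \<Rightarrow> 'a) funct" where
  "concrete_funct \<Phi> = \<lparr>fob = (\<lambda>(G, S). (G, \<Phi> G S)), fmap = (\<lambda>X Y f. f)\<rparr>"

text \<open>Two functors agree if the identity maps of the underlying groups form a
  natural isomorphism between them. This is equality of functors up to the irrelevant
  values of \<open>str\<close> and \<open>kreg\<close>.\<close>

definition functors_agree ::
    "('a monoid \<times> 's, 'a \<Rightarrow> 'a) category \<Rightarrow> ('a monoid \<times> 't, 'a \<Rightarrow> 'a) category \<Rightarrow>
     ('a monoid \<times> 's, 'a \<Rightarrow> 'a, 'a monoid \<times> 't, 'a \<Rightarrow> 'a) funct \<Rightarrow>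
     ('a monoid \<times> 's, 'a \<Rightarrow> 'a, 'a monoid \<times> 't, 'a \<Rightarrow> 'a) funct \<Rightarrow> bool" where
  "functors_agree C D F F' \<longleftrightarrow> natural_iso C D F F' (\<lambda>X. \<lambda>x \<in> carrier (fst X). x)"

type_synonym ('a, 'k) qad_cat = "('a monoid \<times> ('a, 'k) qad_fam, 'a \<Rightarrow> 'a) category"
type_synonym ('a, 'k) indpro_cat = "('a monoid \<times> ('a, 'k) indpro_fam, 'a \<Rightarrow> 'a) category"
type_synonym ('a, 'k) proind_cat = "('a monoid \<times> ('a, 'k) proind_fam, 'a \<Rightarrow> 'a) category"

definition QAd :: "('a, 'k::field) qad_cat" where
  "QAd = concrete_category qadmissible qad_hom"

definition IPad :: "('a, 'k::field) indpro_cat" where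
  "IPad = concrete_category indproalg_ad indproalg_hom"

definition PIad :: "('a, 'k::field) proind_cat" where
  "PIad = concrete_category proindalg_ad proindalg_hom"

section \<open>The functors\<close>

definition indpro_structure :: "'a monoid \<Rightarrow> ('a, 'k::field) qad_fam \<Rightarrow> ('a, 'k) indpro_fam" where
  "indpro_structure G S = indpro_generated G
     \<lparr>mem = mem S,
      str = (\<lambda>H. \<lparr>mem = {Hm \<in> mem S. Hm \<subseteq> H}, str = (\<lambda>Hm. str S H Hm)\<rparr>)\<rparr>"

definition proind_structure :: "'a monoid \<Rightarrow> ('a, 'k::field) qad_fam \<Rightarrow> ('a, 'k) proind_fam" where
  "proind_structure G S = proind_generated G
     \<lparr>mem = mem S,
      str = (\<lambda>H. \<lparr>mem = {quot_set G Hp H | Hp. Hp \<in> mem S \<and> H \<subseteq> Hp},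
                   str = (\<lambda>L. str S (\<Union>L) H)\<rparr>)\<rparr>"

definition ad_IP_structure :: "'a monoid \<Rightarrow> ('a, 'k) indpro_fam \<Rightarrow> ('a, 'k) qad_fam" where
  "ad_IP_structure G S =
     \<lparr>mem = indpro_origins G S, str = (\<lambda>H' H. str (str S H') H)\<rparr>"

definition ad_PI_structure :: "'a monoid \<Rightarrow> ('a, 'k) proind_fam \<Rightarrow> ('a, 'k) qad_fam" where
  "ad_PI_structure G S =
     \<lparr>mem = proind_origins G S, str = (\<lambda>H' H. str (str S H) (quot_set G H' H))\<rparr>"

definition can_IP_PI_structure ::
    "'a monoid \<Rightarrow> ('a, 'k::field) indpro_fam \<Rightarrow> ('a, 'k) proind_fam" where
  "can_IP_PI_structure G S =
     (let H0 = (SOME H0. H0 \<in> indpro_origins G S) in proind_generated G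
       \<lparr>mem = mem (str S H0),
        str = (\<lambda>H. \<lparr>mem = {quot_set G H' H | H'. H' \<in> mem S \<and> H \<subseteq> H'},
                     str = (\<lambda>L. str (str S (\<Union>L)) H)\<rparr>)\<rparr>)"

definition can_PI_IP_structure ::
    "'a monoid \<Rightarrow> ('a, 'k::field) proind_fam \<Rightarrow> ('a, 'k) indpro_fam" where
  "can_PI_IP_structure G S =
     (let H0 = (SOME H0. H0 \<in> proind_origins G S) in indpro_generated G
       \<lparr>mem = {H \<in> mem S. H0 \<subseteq> H \<and> quot_set G H H0 \<in> mem (str S H0)},
        str = (\<lambda>H. \<lparr>mem = {H' \<in> mem S. H' \<subseteq> H},
                     str = (\<lambda>H'. str (str S H') (quot_set G H H'))\<rparr>)\<rparr>)"

abbreviation "indpro \<equiv> concrete_funct indpro_structure"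
abbreviation "proind \<equiv> concrete_funct proind_structure"
abbreviation "ad_IP \<equiv> concrete_funct ad_IP_structure"
abbreviation "ad_PI \<equiv> concrete_funct ad_PI_structure"
abbreviation "can_IP_PI \<equiv> concrete_funct can_IP_PI_structure"
abbreviation "can_PI_IP \<equiv> concrete_funct can_PI_IP_structure"

end

theory Submission
 imports Defs
begin

text \<open>
 Quantifier elimination makes the graph of a morphism of quasi-algebraic groups constructible, and
 conversely a homomorphism with constructible graph is generically a \<open>p\<^sup>n\<close>-th root of a rational map,
 hence, by translation, a morphism. So morphisms can be checked after an injective or before a
 surjective morphism, and images of closed subgroups are closed. With the descending chain condition
 proalgebraic groups are linearly compact, so their images are closed as well.

 For a \<open>\<Q>\<close>-admissible group \<open>(G, S)\<close> the members of the generated \<open>\<I>\<P>\<close>-structure are the closed subgroups of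
 the \<open>H \<in> S\<close>, those of the generated \<open>\<P>\<I>\<close>-structure are the subgroups \<open>J\<close> with \<open>K \<inter> J \<in> S\<close> for all
 \<open>K \<in> S\<close>, and the origins of either structure are precisely the members of \<open>S\<close>. The structures on
 subgroups and quotients being unique, all composites are the identity up to irrelevant values.
\<close>

text \<open>Perfection is what makes the first half work. Frobenius is a bijective morphism of
  algebraic groups whose inverse is no morphism, so neither an injective nor a surjective morphism
  can be cancelled before perfecting; afterwards p-power roots of regular functions are regular, and
  a purely inseparable equation is solved by a regular function. Spaces may be reducible, so generic
  statements are proved by shrinking nonempty open sets and minimising degrees over all of them,
  which takes the place of a function field. The second half must cope with structures fixed only up
  to isomorphism: generated structures use Hilbert choice, and the canonical functors choose an
  origin. The relations \<open>ip_of\<close> and \<open>pi_of\<close> therefore say when a structure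
  belongs to a given Q-admissible group, whatever the choices; two structures belonging to the same
  group are isomorphic by the identity, and each triangle of the diagram reduces to this.
  Countability of the systems enters through the sequences of the linear compactness
  argument.\<close>

notation restr_grp (infixl "||" 66) and iff (infixr "<->" 25)
abbreviation pts where "pts X == topspace (ktop X)"
abbreviation opn where "opn X == openin (ktop X)"
abbreviation mult_in ("_ *[_] _" [70,0,71] 70) where "x *[G] y == x \<otimes>\<^bsub>G\<^esub> y"
abbreviation m_inv_in ("inv[_] _" [0,81] 80) where "inv[G] x == inv\<^bsub>G\<^esub> x"
abbreviation rcos_in ("_ #>[_] _" [60,0,61] 60) where "H #>[G] x == H #>\<^bsub>G\<^esub> x"
abbreviation setmult_in ("_ <#>[_] _" [60,0,61] 60) where "H <#>[G] K == H <#>\<^bsub>G\<^esub> K"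

section \<open>Elimination theory and noetherianity for polynomial functions\<close>

section \<open>Algebras of functions and constructible predicates\<close>

definition funalg :: "('t => 'r::comm_ring_1) set => bool" where
 "funalg A <-> (ALL c. (%_. c):A) &
   (ALL f:A. ALL g:A. (%t. f t + g t):A & (%t. f t * g t):A)"

lemma funalg_const: "funalg A ==> (%_. c):A"
 and funalg_add: "funalg A ==> f:A ==> g:A ==> (%t. f t + g t):A"
 and funalg_mult: "funalg A ==> f:A ==> g:A ==> (%t. f t * g t):A"
 unfolding funalg_def by blast+

lemma funalg_uminus: "funalg A ==> f:A ==> (%t. - f t):A"
 using funalg_mult[OF _ funalg_const[of A "- 1"], of f] by simp

lemma funalg_diff: "funalg A ==> f:A ==> g:A ==> (%t. f t - g t):A"
 using funalg_add[OF _ _ funalg_uminus, of A f g] by simp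

lemma funalg_power: "funalg A ==> f:A ==> (%t. f t ^ n):A"
 by (induction n) (auto intro: funalg_const funalg_mult)

lemma funalg_sum:
 "funalg A ==> (!!i. i:I ==> f i:A) ==> (%t. \<Sum>i\<in>I. f i t):A"
 by (induction I rule: infinite_finite_induct) (auto intro: funalg_const funalg_add)

lemma funalg_prod:
 "funalg A ==> (!!i. i:I ==> f i:A) ==> (%t. \<Prod>i\<in>I. f i t):A"
 by (induction I rule: infinite_finite_induct) (auto intro: funalg_const funalg_mult)

text \<open>This is the polynomial ring over the function algebra \<open>A\<close>. Coefficients in
  \<open>A\<close> alone would not bound the degree, so a uniform bound is built in; the inductions
  on formal degrees start from it.\<close>

definition polys :: "('t => 'r::comm_ring_1) set => ('t => 'r poly) set" where
 "polys A = {P. (EX d. ALL t. degree (P t) <= d) & (ALL i. (%t. coeff (P t) i):A)}"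

lemma polys_coeff: "P:polys A ==> (%t. coeff (P t) i):A"
 by (simp add: polys_def)

lemma polys_bound: "P:polys A ==> EX d. ALL t. ALL i>=d. coeff (P t) i = 0"
proof -
 assume "P:polys A"
 then obtain d where "!!t. degree (P t) <= d" by (auto simp: polys_def)
 thus ?thesis by (intro exI[of _ "Suc d"]) (auto intro!: coeff_eq_0 simp: Suc_le_eq intro: le_less_trans)
qed

lemma polysI:
 "(!!t i. i >= d ==> coeff (P t) i = 0) ==> (!!i. (%t. coeff (P t) i):A) ==> P:polys A"
 unfolding polys_def by (auto intro!: exI[of _ d] degree_le)

lemma polys_monom: "funalg A ==> a:A ==> (%t. monom (a t) i):polys A"
 by (rule polysI[where d="Suc i"], simp, rename_tac j, case_tac "i = j") (auto intro: funalg_const)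

lemma funalg_polys:
 assumes A: "funalg A"
 shows "funalg (polys A)"
 unfolding funalg_def
proof (intro conjI allI ballI)
 fix c :: "'b poly"
 show "(%_. c):polys A"
  by (rule polysI[where d="Suc (degree c)"]) (auto intro: funalg_const[OF A] coeff_eq_0)
next
 fix f g assume fg: "f:polys A" "g:polys A"
 obtain d e where d: "!!t i. i >= d ==> coeff (f t) i = 0" and e: "!!t i. i >= e ==> coeff (g t) i = 0"
  using polys_bound[OF fg(1)] polys_bound[OF fg(2)] by auto
 show "(%t. f t + g t):polys A"
  by (rule polysI[where d="max d e"])
    (auto simp: d e intro!: funalg_add[OF A] polys_coeff fg)
 show "(%t. f t * g t):polys A"
 proof (rule polysI[where d="d + e"])
  fix t i assume "d + e <= i"
  hence "coeff (f t) j * coeff (g t) (i - j) = 0" for j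
   using d[of j t] e[of "i - j" t] by (cases "j >= d") auto
  thus "coeff (f t * g t) i = 0" by (simp add: coeff_mult)
 next
  show "(%t. coeff (f t * g t) i):A" for i
   unfolding coeff_mult by (intro funalg_sum funalg_mult A polys_coeff fg)
 qed
qed

lemma polys_smult:
 assumes "funalg A" "a:A" "P:polys A"
 shows "(%t. smult (a t) (P t)):polys A"
 using funalg_mult[OF funalg_polys polys_monom[of A a 0] assms(3)] assms
 by (simp add: monom_0)

text \<open>Multiplying by the formal leading coefficient instead of dividing by it makes one
  division valid for all \<open>t\<close> with \<open>degree (D t) <= d\<close> at once, including
  points where that coefficient vanishes. Each round cancels the coefficient at
  \<open>d + e\<close>, so the induction is on the excess \<open>e\<close> of the degree bound over
  \<open>d\<close>.\<close>

lemma pseudo_division_bounded: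
 assumes A: "funalg A" and D: "D:polys A"
 shows "P:polys A ==>
  (!!t i. degree (D t) <= d ==> i >= d + e ==> coeff (P t) i = 0) ==>
  EX k. EX S:polys A. EX R:polys A. ALL t. degree (D t) <= d -->
   smult (coeff (D t) d ^ k) (P t) = D t * S t + R t & (ALL i>=d. coeff (R t) i = 0)"
proof (induction e arbitrary: P)
 case 0
 thus ?case
  by (intro exI[of _ 0] bexI[of _ "%_. 0"] bexI[of _ P])
    (auto intro: funalg_const funalg_polys A)
next
 case (Suc e)
 define c where "c = (%t. coeff (D t) d)"
 define l where "l = (%t. coeff (P t) (d + e))"
 have cl: "c:A" "l:A" using D Suc.prems by (auto simp: c_def l_def polys_coeff)
 define P' where "P' = (%t. smult (c t) (P t) - monom (l t) e * D t)"
 have P': "P':polys A" unfolding P'_def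
  by (intro funalg_diff funalg_mult funalg_polys A polys_smult polys_monom cl D Suc.prems)
 have "coeff (P' t) i = 0" if "degree (D t) <= d" "i >= d + e" for t i
 proof (cases "i = d + e")
  case True
  thus ?thesis by (simp add: P'_def coeff_monom_mult c_def l_def)
 next
  case False
  hence "coeff (P t) i = 0" "coeff (D t) (i - e) = 0"
   using that Suc.prems(2)[of t i] by (auto intro: coeff_eq_0)
  thus ?thesis by (simp add: P'_def coeff_monom_mult)
 qed
 from Suc.IH[OF P' this] obtain k S R where kSR: "S:polys A" "R:polys A"
  "!!t. degree (D t) <= d ==> smult (c t ^ k) (P' t) = D t * S t + R t"
  "!!t i. degree (D t) <= d ==> i>=d ==> coeff (R t) i = 0"
  unfolding c_def by metis
 define S' where "S' = (%t. S t + smult (c t ^ k) (monom (l t) e))"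
 have S': "S':polys A" unfolding S'_def
  by (intro funalg_add funalg_polys A polys_smult polys_monom cl kSR funalg_power)
 have "smult (c t ^ Suc k) (P t) = D t * S' t + R t" if "degree (D t) <= d" for t
 proof -
  have "smult (c t ^ Suc k) (P t) = smult (c t ^ k) (smult (c t) (P t))"
   by (simp add: mult.commute)
  also have "smult (c t) (P t) = P' t + monom (l t) e * D t"
   by (simp add: P'_def)
  finally show ?thesis using kSR(3)[OF that]
   by (simp add: S'_def smult_add_right algebra_simps)
 qed
 thus ?case using kSR S' unfolding c_def
  by (intro exI[of _ "Suc k"] bexI[of _ S'] bexI[of _ R]) auto
qed

lemma pseudo_division:
 assumes "funalg A" "D:polys A" "P:polys A"
 obtains k S R where "S:polys A" "R:polys A"
  "!!t. degree (D t) <= d ==> smult (coeff (D t) d ^ k) (P t) = D t * S t + R t"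
  "!!t i. degree (D t) <= d ==> i >= d ==> coeff (R t) i = 0"
proof -
 obtain e where "!!t i. i >= e ==> coeff (P t) i = 0" using polys_bound[OF assms(3)] by auto
 with pseudo_division_bounded[OF assms(1,2,3), of d e] that show ?thesis by (metis add_leE)
qed

text \<open>Disjunctive normal forms of \<open>\<forall>f \<in> F. f = 0\<close> and \<open>q \<noteq> 0\<close>.\<close>

definition dnf :: "(('t => 'k::field) list \<times> ('t => 'k)) list => 't => bool" where
 "dnf L t <-> (EX p:set L. (ALL f:set (fst p). f t = 0) & snd p t ~= 0)"

definition constr :: "('t => 'k::field) set => ('t => bool) set" where
 "constr A = dnf ` {L. ALL p:set L. set (fst p) <= A & snd p:A}"

lemma constrI: "ALL p:set L. set (fst p) <= A & snd p:A ==> P = dnf L ==> P:constr A"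
 unfolding constr_def by blast

lemma constrE:
 assumes "P:constr A"
 obtains L where "ALL p:set L. set (fst p) <= A & snd p:A" "P = dnf L"
 using assms unfolding constr_def by blast

lemma constr_zero: "funalg A ==> a:A ==> (%t. a t = 0):constr A"
 by (rule constrI[of "[([a], %_. 1)]"]) (auto intro: funalg_const simp: dnf_def)

lemma constr_nonzero: "funalg A ==> a:A ==> (%t. a t ~= 0):constr A"
 by (rule constrI[of "[([], a)]"]) (auto intro: funalg_const simp: dnf_def)

lemma constr_const: "funalg A ==> (%_. b):constr A"
 using constr_zero[of A "%_. 0"] constr_zero[of A "%_. 1"] funalg_const[of A] by (cases b) auto

lemma constr_disj:
 assumes "P:constr A" "Q:constr A"
 shows "(%t. P t | Q t):constr A"
proof -
 obtain L where L: "ALL p:set L. set (fst p) <= A & snd p:A" "P = dnf L"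
  using assms(1) by (rule constrE)
 obtain M where M: "ALL p:set M. set (fst p) <= A & snd p:A" "Q = dnf M"
  using assms(2) by (rule constrE)
 show ?thesis
  by (rule constrI[of "L @ M"]) (use L M in \<open>auto simp: dnf_def fun_eq_iff bex_Un\<close>)
qed

lemma constr_conj:
 assumes A: "funalg A" and "P:constr A" "Q:constr A"
 shows "(%t. P t & Q t):constr A"
proof -
 obtain L where L: "ALL p:set L. set (fst p) <= A & snd p:A" "P = dnf L"
  using assms(2) by (rule constrE)
 obtain M where M: "ALL p:set M. set (fst p) <= A & snd p:A" "Q = dnf M"
  using assms(3) by (rule constrE)
 define N where "N = [(fst a @ fst b, %t. snd a t * snd b t). a \<leftarrow> L, b \<leftarrow> M]"
 have N: "set N = (%(a, b). (fst a @ fst b, %t. snd a t * snd b t)) ` (set L \<times> set M)"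
  by (auto simp: N_def)
 show ?thesis
 proof (rule constrI[of N])
  show "ALL p:set N. set (fst p) <= A & snd p:A"
   unfolding N using L(1) M(1) by (auto intro!: funalg_mult[OF A])
  show "(%t. P t & Q t) = dnf N"
   unfolding L M dnf_def N fun_eq_iff by (simp add: ball_Un) blast
 qed
qed

lemma constr_bex:
 assumes A: "funalg A" and I: "finite I" and P: "!!i. i:I ==> P i:constr A"
 shows "(%t. EX i:I. P i t):constr A"
 using I P
proof (induction I rule: finite_induct)
 case empty
 thus ?case using constr_const[OF A, of False] by simp
next
 case (insert i I)
 thus ?case using constr_disj[of "P i" A "%t. EX i:I. P i t"] by simp
qed

lemma constr_ball:
 assumes A: "funalg A" and I: "finite I" and P: "!!i. i:I ==> P i:constr A"
 shows "(%t. ALL i:I. P i t):constr A"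
 using I P
proof (induction I rule: finite_induct)
 case empty
 thus ?case using constr_const[OF A, of True] by simp
next
 case (insert i I)
 thus ?case using constr_conj[OF A, of "P i" "%t. ALL i:I. P i t"] by simp
qed

lemma constr_not:
 assumes A: "funalg A" and "P:constr A"
 shows "(%t. ~P t):constr A"
proof -
 obtain L where L: "ALL p:set L. set (fst p) <= A & snd p:A" "P = dnf L"
  using assms(2) by (rule constrE)
 have "(%t. ALL a:set L. (EX f:set (fst a). f t ~= 0) | snd a t = 0):constr A"
  by (intro constr_ball constr_disj constr_bex constr_nonzero constr_zero A)
    (use L(1) in auto)
 also have "(%t. ALL a:set L. (EX f:set (fst a). f t ~= 0) | snd a t = 0) = (%t. ~P t)"
  unfolding L dnf_def by (intro ext) blast
 finally show ?thesis .
qed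

lemma constr_subst:
 assumes "!!a. a:A ==> (%s. a (\<sigma> s)):B" "P:constr A"
 shows "(%s. P (\<sigma> s)):constr B"
proof -
 obtain L where L: "ALL p:set L. set (fst p) <= A & snd p:A" "P = dnf L"
  using assms(2) by (rule constrE)
 show ?thesis
  by (rule constrI[of "map (%p. (map (%f s. f (\<sigma> s)) (fst p), %s. snd p (\<sigma> s))) L"])
    (use L assms(1) in \<open>force simp: dnf_def fun_eq_iff\<close>)+
qed

subsection \<open>Elimination of an existential quantifier\<close>

text \<open>Every root of \<open>P\<close>, repeated with multiplicity, contributes a linear factor
  dividing \<open>Q\<close>, and there are \<open>degree P\<close> of them. This one-variable
  Nullstellensatz turns a statement about roots into a divisibility that pseudo-division can
  decide.\<close>

lemma root_inclusion_imp_dvd_power: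
 fixes P Q :: "'k::alg_closed_field poly"
 assumes "P ~= 0" "!!y. poly P y = 0 ==> poly Q y = 0"
 shows "P dvd Q ^ degree P"
proof -
 obtain M where M: "size M = degree P" "P = smult (lead_coeff P) (\<Prod>x\<in>#M. [:-x, 1:])"
  using alg_closed_imp_factorization[OF assms(1)] by blast
 have "poly P x = 0" if "x:# M" for x
 proof -
  have "[:-x, 1:] dvd (\<Prod>x\<in>#M. [:-x, 1:])" using that by (intro dvd_prod_mset) auto
  hence "[:-x, 1:] dvd P" by (metis M(2) dvd_smult)
  thus ?thesis by (simp add: poly_eq_0_iff_dvd)
 qed
 hence dvd: "[:-x, 1:] dvd Q" if "x:# M" for x
  using assms(2) that by (simp flip: poly_eq_0_iff_dvd)
 have "(\<Prod>x\<in>#M. [:-x, 1:]) dvd Q ^ size M"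
  using dvd by (induction M) (simp_all add: mult_dvd_mono del: mult_pCons_left)
 thus ?thesis using M assms(1) by (metis leading_coeff_0_iff smult_dvd)
qed

lemma constr_if:
 assumes "funalg A" "c:A" "P:constr A" "Q:constr A"
 shows "(%t. if c t = 0 then P t else Q t):constr A"
proof -
 have "(%t. (c t = 0 & P t) | (c t ~= 0 & Q t)):constr A"
  using assms by (intro constr_disj constr_conj constr_zero constr_nonzero)
 also have "(%t. (c t = 0 & P t) | (c t ~= 0 & Q t)) = (%t. if c t = 0 then P t else Q t)"
  by auto
 finally show ?thesis .
qed

lemma poly_nonzero_point: "(EX y. poly Q y ~= 0) <-> Q ~= 0" for Q :: "'k::alg_closed_field poly"
proof -
 have "infinite (UNIV :: 'k set)"
 proof
  assume fin: "finite (UNIV :: 'k set)"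
  \<comment> \<open>Over a finite field this polynomial has positive degree but takes the value 1
    everywhere.\<close>
  define P where "P = 1 + (\<Prod>x\<in>(UNIV::'k set). [:-x, 1:])"
  have "degree (\<Prod>x\<in>(UNIV::'k set). [:-x, 1:]) = card (UNIV :: 'k set)"
   by (subst degree_prod_eq_sum_degree) auto
  moreover have "card (UNIV :: 'k set) > 0" using fin by (simp add: card_gt_0_iff)
  ultimately have "degree P > 0" unfolding P_def by (subst degree_add_eq_right) auto
  then obtain x where "poly P x = 0" using alg_closed_imp_poly_has_root by blast
  moreover have "poly P x = 1"
   using fin by (auto simp: P_def poly_prod intro!: prod_zero bexI[of _ x])
  ultimately show False by simp
 qed
 thus ?thesis using poly_roots_finite[of Q] by (auto dest: finite_subset[rotated])
qed

lemma ex_root_iff_not_dvd_power: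
 fixes P Q :: "'k::alg_closed_field poly"
 assumes "degree P = d" "P ~= 0"
 shows "(EX y. poly P y = 0 & poly Q y ~= 0) <-> ~P dvd Q ^ d"
proof
 assume "EX y. poly P y = 0 & poly Q y ~= 0"
 then obtain y where "poly P y = 0" "poly Q y ~= 0" by blast
 hence "poly (P * R) y ~= poly (Q ^ d) y" for R by simp
 thus "~P dvd Q ^ d" unfolding dvd_def by metis
qed (use root_inclusion_imp_dvd_power[OF assms(2), of Q] assms(1) in blast)

lemma constr_ex_root_bounded:
 fixes A :: "('t => 'k::alg_closed_field) set"
 assumes A: "funalg A" and Q: "Q:polys A"
 shows "(ALL (P, d):set Ls. P:polys A & (ALL t. ALL i>=d. coeff (P t) i = 0)) ==>
  (%t. EX y. (ALL (P, d):set Ls. poly (P t) y = 0) & poly (Q t) y ~= 0):constr A"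
  (is "_ ==> ?E Ls:_")
\<comment> \<open>\<open>Suc d\<close> rather than \<open>d\<close>, so that discarding an equation
  of bound 0, which is the zero polynomial, also lowers the measure.\<close>
proof (induction "sum_list (map (%(P, d). Suc d) Ls)" arbitrary: Ls rule: less_induct)
 case less
 note pol = funalg_diff funalg_mult funalg_polys A polys_smult polys_monom polys_coeff
 consider "Ls = []" | P where "(P, 0):set Ls" | P d where "Ls = [(P, Suc d)]"
  | P1 d1 P2 d2 M where "set Ls = set ((P1, Suc d1) # (P2, Suc d2) # M)" "d1 <= d2"
    "sum_list (map (%(P, d). Suc d) Ls) = Suc (Suc d1) + Suc (Suc d2) + sum_list (map (%(P, d). Suc d) M)"
 proof (cases "EX P. (P, 0):set Ls")
  case False
  hence nz: "EX P d. p = (P, Suc d)" if "p:set Ls" for p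
   using that by (cases p; cases "snd p") auto
  show thesis
  proof (cases Ls)
   case L: (Cons p Ms)
   then obtain P1 d1 where p: "p = (P1, Suc d1)" using nz[of p] by auto
   show thesis
   proof (cases Ms)
    case Nil
    thus thesis using that(3) L p by simp
   next
    case (Cons q M)
    then obtain P2 d2 where q: "q = (P2, Suc d2)" using nz[of q] L by auto
    show thesis
    proof (cases "d1 <= d2")
     case True
     thus thesis by (intro that(4)[of P1 d1 P2 d2 M]) (simp_all add: L Cons p q)
    next
     case False
     thus thesis by (intro that(4)[of P2 d2 P1 d1 M]) (simp_all add: L Cons p q insert_commute)
    qed
   qed
  qed (use that(1) in auto)
 qed (use that(2) in blast)
 thus ?case
 proof cases
  case 1
  obtain e where e: "!!t i. i >= e ==> coeff (Q t) i = 0" using polys_bound[OF Q] by auto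
  have "(%t. EX i:{..<e}. coeff (Q t) i ~= 0):constr A"
   by (intro constr_bex constr_nonzero A polys_coeff Q) auto
  also have "(%t. EX i:{..<e}. coeff (Q t) i ~= 0) = (%t. Q t ~= 0)"
   using e unfolding fun_eq_iff poly_eq_iff by (metis coeff_0 lessThan_iff not_less)
  finally show ?thesis by (simp add: 1 poly_nonzero_point)
 next
  case (2 P)
  then obtain xs ys where L: "Ls = xs @ (P, 0) # ys" by (meson split_list)
  hence P: "P t = 0" for t using less.prems by (auto simp: poly_eq_iff)
  have "?E (xs @ ys):constr A" by (rule less.hyps) (use L less.prems in auto)
  also have "?E (xs @ ys) = ?E Ls" using P by (auto simp: L)
  finally show ?thesis .
 next
  case (3 P d)
  hence P: "P:polys A" "!!t i. i >= Suc d ==> coeff (P t) i = 0" using less.prems by auto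
  define c where "c = (%t. coeff (P t) d)"
  have c: "c:A" using P by (simp add: c_def polys_coeff)
  have deg: "degree (P t) <= d" for t using P(2) by (intro degree_le) auto
  \<comment> \<open>The exponent \<open>d\<close> is the degree of \<open>P t\<close> wherever
    \<open>c t ~= 0\<close>, as \<open>ex_root_iff_not_dvd_power\<close> demands.\<close>
  obtain k S R where R: "S:polys A" "R:polys A"
   "!!t. smult (c t ^ k) (Q t ^ d) = P t * S t + R t" "!!t i. i >= d ==> coeff (R t) i = 0"
   using pseudo_division[OF A P(1) funalg_power[OF funalg_polys[OF A] Q], of d d] deg
   unfolding c_def by metis
  define P' where "P' = (%t. P t - monom (c t) d)"
  have "?E [(P', d)]:constr A"
  proof (rule less.hyps)
   show "ALL (P, d):set [(P', d)]. P:polys A & (ALL t. ALL i>=d. coeff (P t) i = 0)"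
    using P by (auto simp: P'_def c c_def intro!: pol)
  qed (simp add: 3)
  moreover have "(%t. EX i:{..<d}. coeff (R t) i ~= 0):constr A"
   by (intro constr_bex constr_nonzero A polys_coeff R) auto
  ultimately have "(%t. if c t = 0 then ?E [(P', d)] t else EX i:{..<d}. coeff (R t) i ~= 0):constr A"
   by (rule constr_if[OF A c])
  also have "(%t. if c t = 0 then ?E [(P', d)] t else EX i:{..<d}. coeff (R t) i ~= 0) = ?E Ls"
  proof
   fix t
   show "(if c t = 0 then ?E [(P', d)] t else EX i:{..<d}. coeff (R t) i ~= 0) = ?E Ls t"
   proof (cases "c t = 0")
    case False
    have dP: "degree (P t) = d" using False deg[of t] le_degree[of "P t" d] by (simp add: c_def)
    moreover have "P t ~= 0" using False by (auto simp: c_def)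
    ultimately have "?E Ls t <-> ~P t dvd Q t ^ d"
     by (simp add: 3 ex_root_iff_not_dvd_power)
    also have "P t dvd Q t ^ d <-> P t dvd smult (c t ^ k) (Q t ^ d)"
     using False by (simp add: dvd_smult_iff)
    also have "... <-> P t dvd R t" by (simp add: R dvd_add_right_iff)
    also have "... <-> R t = 0"
    proof
     assume "P t dvd R t"
     thus "R t = 0"
      using R(4)[of "degree (R t)" t] False deg[of t] le_degree[of "P t" d] dvd_imp_degree_le leading_coeff_0_iff
      by (auto simp: c_def)
    qed simp
    also have "~... <-> (EX i:{..<d}. coeff (R t) i ~= 0)"
     using R(4) unfolding poly_eq_iff by (metis coeff_0 lessThan_iff not_less)
    finally show ?thesis using False by simp
   qed (simp add: 3 P'_def)
  qed
  finally show ?thesis .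
 next
  case (4 P1 d1 P2 d2 M)
  hence P: "P1:polys A" "!!t i. i >= Suc d1 ==> coeff (P1 t) i = 0"
   "P2:polys A" "!!t i. i >= Suc d2 ==> coeff (P2 t) i = 0"
   and M: "ALL (P, d):set M. P:polys A & (ALL t. ALL i>=d. coeff (P t) i = 0)"
   using less.prems by auto
  define c where "c = (%t. coeff (P1 t) d1)"
  have c: "c:A" using P by (simp add: c_def polys_coeff)
  define P1' where "P1' = (%t. P1 t - monom (c t) d1)"
  \<comment> \<open>At a root of \<open>P1\<close> the subtracted term vanishes, so there
    \<open>P2'\<close> and \<open>P2\<close> have the same roots as soon as \<open>c t ~= 0\<close>;
    the coefficient at \<open>d2\<close> cancels.\<close>
  define P2' where "P2' = (%t. smult (c t) (P2 t) - monom (coeff (P2 t) d2) (d2 - d1) * P1 t)"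
  have 1: "P1':polys A" "P2':polys A"
   unfolding P1'_def P2'_def by (intro pol c P)+
  have 2: "coeff (P1' t) i = 0" if "i >= d1" for t i
   using that P(2)[of i t] by (cases "i = d1") (auto simp: P1'_def c_def)
  have 3: "coeff (P2' t) i = 0" if "i >= d2" for t i
   using that P(4)[of i t] P(2)[of "i - (d2 - d1)" t] `d1 <= d2`
   by (cases "i = d2") (auto simp: P2'_def c_def coeff_monom_mult)
  have "?E ((P1', d1) # (P2, Suc d2) # M):constr A"
   by (rule less.hyps) (use 4 1 2 P M in auto)
  moreover have "?E ((P1, Suc d1) # (P2', d2) # M):constr A"
   by (rule less.hyps) (use 4 1 3 P M in auto)
  ultimately have "(%t. if c t = 0 then ?E ((P1', d1) # (P2, Suc d2) # M) t
    else ?E ((P1, Suc d1) # (P2', d2) # M) t):constr A"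
   by (rule constr_if[OF A c])
  also have "(%t. if c t = 0 then ?E ((P1', d1) # (P2, Suc d2) # M) t
    else ?E ((P1, Suc d1) # (P2', d2) # M) t) = ?E Ls"
  proof
   fix t
   have "P1' t = P1 t" if "c t = 0" using that by (simp add: P1'_def)
   moreover have "poly (P2' t) y = 0 <-> poly (P2 t) y = 0" if "c t ~= 0" "poly (P1 t) y = 0" for y
    using that by (simp add: P2'_def)
   ultimately show "(if c t = 0 then ?E ((P1', d1) # (P2, Suc d2) # M) t
    else ?E ((P1, Suc d1) # (P2', d2) # M) t) = ?E Ls t"
    unfolding 4(1) by (cases "c t = 0") auto
  qed
  finally show ?thesis .
 qed
qed

lemma constr_ex_root:
 fixes A :: "('t => 'k::alg_closed_field) set"
 assumes A: "funalg A" and Q: "Q:polys A" and F: "finite F" "F <= polys A"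
 shows "(%t. EX y. (ALL P:F. poly (P t) y = 0) & poly (Q t) y ~= 0):constr A"
proof -
 have "ALL P:F. EX d. ALL t. ALL i>=d. coeff (P t) i = 0" using F polys_bound by blast
 then obtain d where d: "ALL P:F. ALL t. ALL i>=d P. coeff (P t) i = 0" by metis
 obtain Fs where Fs: "set Fs = F" using finite_list[OF F(1)] by blast
 have "(%t. EX y. (ALL (P, d):set (map (%P. (P, d P)) Fs). poly (P t) y = 0) & poly (Q t) y ~= 0):constr A"
  by (rule constr_ex_root_bounded[OF A Q]) (use Fs F d in auto)
 thus ?thesis by (simp add: Fs)
qed

subsection \<open>Polynomial functions\<close>

lemma funalg_polyfun: "funalg (polyfun n)"
 unfolding funalg_def by (auto intro: polyfun.intros)

lemma polyfun_subst:
 "f:polyfun n ==> (!!i. i < n ==> (%x. s x i):polyfun N) ==> (%x. f (s x)):polyfun N"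
 by (induction rule: polyfun.induct) (auto intro: polyfun.intros)

lemma polyfun_mono: "f:polyfun n ==> n <= N ==> f:polyfun N"
 by (induction rule: polyfun.induct) (auto intro: polyfun.intros)

lemma polyfun_cong: "f:polyfun n ==> (!!i. i < n ==> x i = y i) ==> f x = f y"
 by (induction rule: polyfun.induct) auto

lemma constr_polyfun_subst:
 "P:constr (polyfun n) ==> (!!i. i < n ==> (%x. s x i):polyfun N) ==>
  (%x. P (s x)):constr (polyfun N)"
 by (rule constr_subst[of "polyfun n"]) (auto intro: polyfun_subst)

lemma constr_polyfun_cong:
 assumes "P:constr (polyfun n)" "!!i. i < n ==> x i = y i"
 shows "P x <-> P y"
proof -
 obtain L where L: "ALL p:set L. set (fst p) <= polyfun n & snd p:polyfun n" "P = dnf L"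
  using assms(1) by (rule constrE)
 have "f x = f y" if "f:polyfun n" for f using polyfun_cong[OF that] assms(2) by blast
 with L(1) have "ALL p:set L. (ALL f:set (fst p). f x = f y) & snd p x = snd p y"
  by blast
 thus ?thesis unfolding L(2) dnf_def by (intro bex_cong refl) metis
qed

text \<open>Separates the last variable: polynomials in \<open>Suc n\<close> variables are
  polynomials in the last one over those in the first \<open>n\<close>.
  \<open>polyfun_Suc_of_poly\<close> goes back.\<close>

lemma polyfun_Suc_as_poly:
 "f:polyfun (Suc n) ==> EX P:polys (polyfun n). ALL x y. f (x(n := y)) = poly (P x) y"
proof (induction rule: polyfun.induct)
 case (const c)
 show ?case
  by (rule bexI[of _ "%_. [:c:]"]) (auto intro: funalg_const funalg_polys funalg_polyfun)
next
 case (coord i)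
 show ?case
 proof (cases "i = n")
  case True
  thus ?thesis
   by (intro bexI[of _ "%x. monom 1 1"]) (auto simp: poly_monom intro!: polys_monom funalg_polyfun polyfun.intros)
 next
  case False
  thus ?thesis using coord
   by (intro bexI[of _ "%x. monom (x i) 0"]) (auto simp: poly_monom intro!: polys_monom funalg_polyfun polyfun.intros)
 qed
next
 case (add f g)
 then obtain P Q where "P:polys (polyfun n)" "ALL x y. f (x(n := y)) = poly (P x) y"
  "Q:polys (polyfun n)" "ALL x y. g (x(n := y)) = poly (Q x) y" by blast
 thus ?case
  by (intro bexI[of _ "%x. P x + Q x"]) (auto intro: funalg_add funalg_polys funalg_polyfun simp del: fun_upd_apply)
next
 case (mult f g)
 then obtain P Q where "P:polys (polyfun n)" "ALL x y. f (x(n := y)) = poly (P x) y"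
  "Q:polys (polyfun n)" "ALL x y. g (x(n := y)) = poly (Q x) y" by blast
 thus ?case
  by (intro bexI[of _ "%x. P x * Q x"]) (auto intro: funalg_mult funalg_polys funalg_polyfun simp del: fun_upd_apply)
qed

lemma polyfun_Suc_of_poly:
 assumes "P:polys (polyfun n)"
 shows "(%x. poly (P x) (x n)):polyfun (Suc n)"
proof -
 obtain d where d: "!!t i. i >= d ==> coeff (P t) i = 0" using polys_bound[OF assms] by auto
 have "poly (P x) y = (\<Sum>i<d. coeff (P x) i * y ^ i)" for x y
  unfolding poly_altdef using d by (intro sum.mono_neutral_cong) (auto simp: coeff_eq_0 not_less)
 moreover have "(%x. \<Sum>i<d. coeff (P x) i * x n ^ i):polyfun (Suc n)"
  by (intro funalg_sum funalg_mult funalg_power funalg_polyfun polyfun_mono[OF polys_coeff[OF assms]]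
    polyfun.coord) auto
 ultimately show ?thesis by simp
qed

text \<open>Existence distributes over the disjunctive normal form, and each disjunct is one system
  of equations with one inequation in the last coordinate, as treated by
  \<open>constr_ex_root\<close>.\<close>

lemma constr_ex_coord:
 fixes P :: "(nat => 'k::alg_closed_field) => bool"
 assumes "P:constr (polyfun (Suc n))"
 shows "(%x. EX y. P (x(n := y))):constr (polyfun n)"
proof -
 obtain L where L: "ALL p:set L. set (fst p) <= polyfun (Suc n) & snd p:polyfun (Suc n)" "P = dnf L"
  using assms by (rule constrE)
 have "ALL f:polyfun (Suc n). EX P. P:polys (polyfun n) & (ALL x y. f (x(n := y)) = poly (P x) y)"
  using polyfun_Suc_as_poly by blast
 from bchoice[OF this] obtain \<phi> :: "((nat => 'k) => 'k) => (nat => 'k) => 'k poly"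
  where \<phi>: "!!f. f:polyfun (Suc n) ==> \<phi> f:polys (polyfun n)"
  "!!f x y. f:polyfun (Suc n) ==> f (x(n := y)) = poly (\<phi> f x) y"
  by blast
 have "(%x. EX p:set L. EX y. (ALL P:\<phi> ` set (fst p). poly (P x) y = 0) & poly (\<phi> (snd p) x) y ~= 0)
   :constr (polyfun n)"
  by (intro constr_bex constr_ex_root funalg_polyfun) (use L \<phi> in auto)
 also have "(%x. EX p:set L. EX y. (ALL P:\<phi> ` set (fst p). poly (P x) y = 0) & poly (\<phi> (snd p) x) y ~= 0)
   = (%x. EX y. P (x(n := y)))"
 proof (intro ext)
  fix x
  have "f (x(n := y)) = poly (\<phi> f x) y" if "p:set L" "f = snd p | f:set (fst p)" for p f y
   using L(1) that by (intro \<phi>(2)) auto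
  thus "(EX p:set L. EX y. (ALL P:\<phi> ` set (fst p). poly (P x) y = 0) & poly (\<phi> (snd p) x) y ~= 0)
   = (EX y. P (x(n := y)))"
   unfolding L(2) dnf_def by auto
 qed
 finally show ?thesis .
qed

definition join :: "nat => (nat => 'k) => (nat => 'k) => nat => 'k" where
 "join n x z = (%i. if i < n then x i else z (i - n))"

lemma constr_ex_join:
 fixes P :: "(nat => 'k::alg_closed_field) => bool"
 shows "P:constr (polyfun (n + m)) ==> (%x. EX z. P (join n x z)):constr (polyfun n)"
proof (induction m arbitrary: P)
 case 0
 have "P (join n x z) <-> P x" for x z
  using 0 by (intro constr_polyfun_cong[of P n]) (auto simp: join_def)
 thus ?case using 0 by simp
next
 case (Suc m)
 have "(%x. EX y. P (x(n + m := y))):constr (polyfun (n + m))"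
  using Suc.prems by (intro constr_ex_coord) simp
 from Suc.IH[OF this] have "(%x. EX z y. P ((join n x z)(n + m := y))):constr (polyfun n)" .
 moreover have "(join n x z)(n + m := y) = join n x (z(m := y))" for x z :: "nat => 'k" and y
  by (auto simp: join_def fun_eq_iff)
 moreover have "(EX z y. P (join n x (z(m := y)))) <-> (EX z. P (join n x z))" for x
  by (metis fun_upd_triv)
 ultimately show ?case by simp
qed

subsection \<open>Hilbert's basis theorem\<close>

inductive_set idl :: "('t => 'r::comm_ring_1) set => ('t => 'r) set => ('t => 'r) set" for A F where
 zero: "(%_. 0):idl A F"
| step: "h:idl A F ==> a:A ==> g:F ==> (%t. a t * g t + h t):idl A F"

text \<open>Phrased for arbitrary families instead of ideals: the finite generating set can then be
  chosen inside a prescribed set of equations, which is what the quasi-compactness argument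
  uses.\<close>

definition noeth :: "('t => 'r::comm_ring_1) set => bool" where
 "noeth A <-> (ALL F <= A. EX F0 <= F. finite F0 & F <= idl A F0)"

lemma idl_base: "funalg A ==> g:F ==> g:idl A F"
 using idl.step[OF idl.zero, of "%_. 1" A g F] by (simp add: funalg_const)

lemma idl_add: "f:idl A F ==> g:idl A F ==> (%t. f t + g t):idl A F"
 by (induction rule: idl.induct) (auto intro: idl.step simp: add.assoc)

lemma idl_mult: "funalg A ==> b:A ==> f:idl A F ==> (%t. b t * f t):idl A F"
proof (rotate_tac 2, induction rule: idl.induct)
 case (step h a g)
 thus ?case using idl.step[of "%t. b t * h t" A F "%t. b t * a t" g]
  by (simp add: funalg_mult algebra_simps)
qed (auto intro: idl.zero)

lemma idl_diff:
 assumes "funalg A" "f:idl A F" "g:idl A F"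
 shows "(%t. f t - g t):idl A F"
 using idl_add[OF assms(2) idl_mult[OF assms(1) funalg_const[OF assms(1), of "-1"] assms(3)]] by simp

lemma idl_trans:
 assumes "funalg A" "F <= idl A G" "f:idl A F"
 shows "f:idl A G"
 using assms(3) by induction (use assms(1,2) in \<open>auto intro!: idl.zero idl_add idl_mult\<close>)

lemma idl_mono: "f:idl A F ==> F <= G ==> f:idl A G"
 by (induction rule: idl.induct) (auto intro: idl.intros)

lemma idl_closed: "funalg A ==> F <= A ==> f:idl A F ==> f:A"
 by (rotate_tac 2, induction rule: idl.induct) (auto intro!: funalg_const funalg_add funalg_mult)

lemma idl_finite_support:
 assumes "f:idl A F"
 shows "EX F0 <= F. finite F0 & f:idl A F0"
 using assms
proof induction
 case (step h a g)
 then obtain F0 where "F0 <= F" "finite F0" "h:idl A F0" by blast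
 with step.hyps show ?case
  by (intro exI[of _ "insert g F0"]) (auto intro!: idl.step intro: idl_mono)
qed (auto intro: idl.zero)

lemma idl_vanish: "f:idl A F ==> ALL g:F. g t = 0 ==> f t = 0"
 by (induction rule: idl.induct) auto

text \<open>\<open>L d\<close> collects the \<open>d\<close>-th coefficients of the members of the
  ideal of degree at most \<open>d\<close>. Finitely many generators of the union of all
  \<open>L d\<close> serve the degrees above some \<open>D\<close> after multiplication by powers of
  the variable; finitely many more serve each degree up to \<open>D\<close>. Subtracting a lift of
  the leading coefficient then lowers the degree.\<close>

theorem Hilbert_basis:
 fixes A :: "('t => 'r::comm_ring_1) set"
 assumes A: "funalg A" and N: "noeth A"
 shows "noeth (polys A)"
 unfolding noeth_def
proof (intro allI impI)
 fix F assume F: "F <= polys A"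
 note pA = funalg_polys[OF A]
 define I where "I = idl (polys A) F"
 have IA: "I <= polys A" unfolding I_def using idl_closed[OF pA F] by blast
 define bnd where "bnd = (%(P :: 't => 'r poly) d. ALL t. ALL i>d. coeff (P t) i = 0)"
 define L where "L = (%d. {(%t. coeff (P t) d) | P. P:I & bnd P d})"
 have LA: "L d <= A" for d unfolding L_def using IA by (auto intro: polys_coeff)
 obtain F0 where F0: "F0 <= (\<Union>d. L d)" "finite F0" "(\<Union>d. L d) <= idl A F0"
  using N LA unfolding noeth_def by (metis UN_least)
 have "ALL l:F0. EX d P. P:I & bnd P d & l = (%t. coeff (P t) d)"
  using F0(1) unfolding L_def by blast
 then obtain dd q where q: "!!l. l:F0 ==> q l:I & bnd (q l) (dd l) & l = (%t. coeff (q l t) (dd l))"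
  by metis
 define D where "D = Max (insert 0 (dd ` F0))"
 have D: "dd l <= D" if "l:F0" for l using that F0(2) by (simp add: D_def)
 have "EX E. E <= L d & finite E & L d <= idl A E" for d
  using N LA unfolding noeth_def by blast
 then obtain E where E: "!!d. E d <= L d" "!!d. finite (E d)" "!!d. L d <= idl A (E d)" by metis
 have "ALL d. ALL l:E d. EX P. P:I & bnd P d & l = (%t. coeff (P t) d)"
  using E(1) unfolding L_def by blast
 then obtain p where p: "!!d l. l:E d ==> p d l:I & bnd (p d l) d & l = (%t. coeff (p d l t) d)"
  by metis
 define G where "G = q ` F0 Un (UN d:{..D}. p d ` E d)"
 have G: "finite G" "G <= I" unfolding G_def using F0(2) E(2) p q by auto
 have lift: "EX H:idl (polys A) G. bnd H d & (%t. coeff (H t) d) = l"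
  if F': "ALL l:F'. EX H:idl (polys A) G. bnd H d & (%t. coeff (H t) d) = l"
   and l: "l:idl A F'" for d l F'
  using l
 proof induction
  case zero
  thus ?case by (intro bexI[of _ "%_. 0"]) (auto simp: bnd_def intro: idl.zero)
 next
  case (step h a g)
  obtain H1 where H1: "H1:idl (polys A) G" "bnd H1 d" "(%t. coeff (H1 t) d) = h"
   using step.IH by (elim bexE conjE)
  obtain H2 where H2: "H2:idl (polys A) G" "bnd H2 d" "(%t. coeff (H2 t) d) = g"
   using bspec[OF F' step.hyps(3)] by (elim bexE conjE)
  have "(%t. monom (a t) 0 * H2 t + H1 t):idl (polys A) G"
   by (intro idl_add idl_mult pA polys_monom A H1 H2 step.hyps)
  moreover have "bnd (%t. monom (a t) 0 * H2 t + H1 t) d"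
   using H1(2) H2(2) by (simp add: bnd_def coeff_monom_mult)
  moreover have "coeff (monom (a t) 0 * H2 t + H1 t) d = a t * g t + h t" for t
   using fun_cong[OF H1(3), of t] fun_cong[OF H2(3), of t] by (simp add: coeff_monom_mult)
  ultimately show ?case by blast
 qed
 have L_lift: "EX H:idl (polys A) G. bnd H d & (%t. coeff (H t) d) = l" if "l:L d" for d l
 proof (cases "d <= D")
  case True
  have "ALL l:E d. EX H:idl (polys A) G. bnd H d & (%t. coeff (H t) d) = l"
  proof
   fix l assume l: "l:E d"
   hence "p d l:idl (polys A) G" using True by (intro idl_base pA) (auto simp: G_def)
   thus "EX H:idl (polys A) G. bnd H d & (%t. coeff (H t) d) = l"
    using p[OF l] by (intro bexI[of _ "p d l"]) auto
  qed
  thus ?thesis by (rule lift) (use E(3) that in auto)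
 next
  case False
  have "ALL l:F0. EX H:idl (polys A) G. bnd H d & (%t. coeff (H t) d) = l"
  proof
   fix l assume l: "l:F0"
   have le: "dd l <= d" using D[OF l] False by simp
   have "q l:idl (polys A) G" using l by (intro idl_base pA) (auto simp: G_def)
   hence "(%t. monom 1 (d - dd l) * q l t):idl (polys A) G"
    by (intro idl_mult pA funalg_const)
   moreover have "bnd (%t. monom 1 (d - dd l) * q l t) d"
    using q[OF l] le by (simp add: bnd_def coeff_monom_mult)
   moreover have "coeff (monom 1 (d - dd l) * q l t) d = l t" for t
    using q[OF l] le fun_cong[of l "%t. coeff (q l t) (dd l)" t] by (simp add: coeff_monom_mult)
   ultimately show "EX H:idl (polys A) G. bnd H d & (%t. coeff (H t) d) = l"
    by blast
  qed
  thus ?thesis by (rule lift) (use F0(3) that in auto)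
 qed
 have main: "P:idl (polys A) G" if "P:I" "ALL t. ALL i>=d. coeff (P t) i = 0" for P d
  using that
 proof (induction d arbitrary: P)
  case 0
  hence "P = (%_. 0)" by (auto simp: fun_eq_iff poly_eq_iff)
  thus ?case by (simp add: idl.zero)
 next
  case (Suc d)
  hence "(%t. coeff (P t) d):L d" unfolding L_def bnd_def by (auto simp: Suc_le_eq)
  then obtain H where H: "H:idl (polys A) G" "bnd H d" "(%t. coeff (H t) d) = (%t. coeff (P t) d)"
   using L_lift by blast
  have "H:I" using H(1) G(2) unfolding I_def by (rule_tac idl_trans[OF pA])
  hence "(%t. P t - H t):I" using Suc.prems(1) unfolding I_def by (rule_tac idl_diff[OF pA])
  hence "(%t. P t - H t):idl (polys A) G"
  proof (rule Suc.IH, intro allI impI)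
   fix t i assume "d <= i"
   thus "coeff (P t - H t) i = 0"
    using Suc.prems(2) H(2) fun_cong[OF H(3), of t] by (cases "i = d") (auto simp: bnd_def)
  qed
  from idl_add[OF this H(1)] show ?case by simp
 qed
 \<comment> \<open>\<open>G\<close> lies in the ideal of \<open>F\<close> but perhaps not in
   \<open>F\<close>; the finitely many members of \<open>F\<close> that express the elements of
   \<open>G\<close> generate as well.\<close>
 have "ALL g:G. EX E. E <= F & finite E & g:idl (polys A) E"
  using G(2) idl_finite_support unfolding I_def by blast
 from bchoice[OF this] obtain E' where E': "!!g. g:G ==> E' g <= F & finite (E' g) & g:idl (polys A) (E' g)"
  by blast
 have "G <= idl (polys A) (\<Union>(E' ` G))" using E' by (blast intro: idl_mono)
 moreover have "F <= idl (polys A) G" using polys_bound F main I_def idl_base pA by blast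
 ultimately show "EX F0 <= F. finite F0 & F <= idl (polys A) F0"
  using E' G(1) idl_trans[OF pA] by (intro exI[of _ "\<Union>(E' ` G)"]) blast
qed

text \<open>Evaluation at the last coordinate maps \<open>polys (polyfun n)\<close> onto
  \<open>polyfun (Suc n)\<close> and carries ideal combinations to ideal combinations; without
  variables only constants over a field remain.\<close>

lemma noeth_polyfun: "noeth (polyfun n :: ((nat => 'k::field) => 'k) set)"
proof (induction n)
 case 0
 have c: "EX c. f = (%_. c)" if "f:polyfun 0" for f :: "(nat => 'k) => 'k"
  using that by (induction rule: polyfun.induct) auto
 show ?case unfolding noeth_def
 proof (intro allI impI)
  fix F :: "((nat => 'k) => 'k) set" assume F: "F <= polyfun 0"
  show "EX F0 <= F. finite F0 & F <= idl (polyfun 0) F0"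
  proof (cases "F <= {%_. 0}")
   case True
   thus ?thesis by (intro exI[of _ "{}"]) (auto intro: idl.zero)
  next
   case False
   then obtain g where g: "g:F" "g ~= (%_. 0)" by blast
   moreover obtain c where "g = (%_. c)" using c[of g] F g(1) by blast
   ultimately have c0: "c ~= 0" "(%_. c):F" by auto
   have "F <= idl (polyfun 0) {%_. c}"
   proof
    fix f assume "f:F"
    then obtain d where "f = (%_. d)" using c F by blast
    thus "f:idl (polyfun 0) {%_. c}"
     using idl.step[OF idl.zero polyfun.const[of "d / c"], of "%_. c" "{%_. c}"] c0 by simp
   qed
   thus ?thesis using c0 by (intro exI[of _ "{%_. c}"]) auto
  qed
 qed
next
 case (Suc n)
 let ?ev = "%P :: (nat => 'k) => 'k poly. %x. poly (P x) (x n)"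
 have ev: "?ev P:idl (polyfun (Suc n)) (?ev ` E)" if "P:idl (polys (polyfun n)) E" for P E
  using that
 proof induction
  case (step h a g)
  thus ?case
   using idl.step[of "?ev h" "polyfun (Suc n)" "?ev ` E" "?ev a" "?ev g"]
   by (simp add: polyfun_Suc_of_poly)
 qed (simp add: idl.zero)
 show ?case unfolding noeth_def
 proof (intro allI impI)
  fix F :: "((nat => 'k) => 'k) set" assume F: "F <= polyfun (Suc n)"
  have "ALL f:F. EX P. P:polys (polyfun n) & ?ev P = f"
  proof
   fix f assume "f:F"
   then obtain P where "P:polys (polyfun n)" "ALL x y. f (x(n := y)) = poly (P x) y"
    using polyfun_Suc_as_poly F by blast
   hence "f x = poly (P x) (x n)" for x by (metis fun_upd_triv)
   thus "EX P. P:polys (polyfun n) & ?ev P = f"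
    using `P:_` by (intro exI[of _ P]) (simp add: fun_eq_iff)
  qed
  from bchoice[OF this] obtain \<phi> where \<phi>: "!!f. f:F ==> \<phi> f:polys (polyfun n)" "!!f. f:F ==> ?ev (\<phi> f) = f"
   by blast
  have "\<phi> ` F <= polys (polyfun n)" using \<phi>(1) by blast
  from Hilbert_basis[OF funalg_polyfun Suc, unfolded noeth_def, rule_format, OF this]
  obtain E where E: "E <= \<phi> ` F" "finite E" "\<phi> ` F <= idl (polys (polyfun n)) E"
   by (elim exE conjE)
  then obtain F0 where F0: "F0 <= F" "finite F0" "\<phi> ` F <= idl (polys (polyfun n)) (\<phi> ` F0)"
   using finite_subset_image[OF E(2,1)] by blast
  have "f:idl (polyfun (Suc n)) F0" if "f:F" for f
  proof -
   have "?ev ` \<phi> ` F0 = (%f. f) ` F0"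
    unfolding image_image by (rule image_cong[OF refl]) (use \<phi>(2) F0(1) in blast)
   moreover have "?ev (\<phi> f):idl (polyfun (Suc n)) (?ev ` \<phi> ` F0)"
    by (rule ev) (use F0(3) that in blast)
   ultimately show ?thesis unfolding \<phi>(2)[OF that] by simp
  qed
  thus "EX F0 <= F. finite F0 & F <= idl (polyfun (Suc n)) F0" using F0 by blast
 qed
qed

lemma finite_zero_locus:
 fixes F :: "((nat => 'k::field) => 'k) set"
 assumes "F <= polyfun n"
 obtains F0 where "F0 <= F" "finite F0" "!!x. (ALL f:F0. f x = 0) ==> (ALL f:F. f x = 0)"
proof -
 obtain F0 where F0: "F0 <= F" "finite F0" "F <= idl (polyfun n) F0"
  using noeth_polyfun[of n, unfolded noeth_def, rule_format, OF assms] by (elim exE conjE)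
 hence "ALL f:F. f x = 0" if "ALL f:F0. f x = 0" for x
  using idl_vanish[OF _ that] F0(3) by blast
 with F0(1,2) show thesis by (rule that)
qed

section \<open>Coordinates and regular functions on varieties and their perfections\<close>

section \<open>Charts\<close>

lemma topspace_zariski [simp]: "topspace (zariski n Z) = Z"
proof -
 have "Z = {x:Z. (1::'a::field) ~= 0}" by simp
 hence "Z:{{x:Z. f x ~= 0} | f. f:polyfun n}"
  by (intro CollectI exI[of _ "%_. 1"]) (auto intro: polyfun.const)
 thus ?thesis unfolding zariski_def topology_generated_by_topspace by auto
qed

lemma openin_zariski_basic: "a:polyfun n ==> openin (zariski n Z) {x:Z. a x ~= 0}"
 unfolding zariski_def by (rule topology_generated_by_Basis) blast

lemma openin_zariski_iff:
 "openin (zariski n Z) W <->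
   W <= Z & (ALL z:W. EX a:polyfun n. a z ~= 0 & {y:Z. a y ~= 0} <= W)" (is "_ <-> ?R W")
proof
 assume "openin (zariski n Z) W"
 hence "generate_topology_on {{x:Z. f x ~= 0} | f. f:polyfun n} W"
  by (simp add: zariski_def openin_topology_generated_by_iff)
 thus "?R W"
 proof (induction rule: generate_topology_on.induct)
  case (Int a b)
  have "EX c:polyfun n. c z ~= 0 & {y:Z. c y ~= 0} <= a Int b" if z: "z:a Int b" for z
  proof -
   from z Int.IH obtain c d where "c:polyfun n" "c z ~= 0" "{y:Z. c y ~= 0} <= a"
    "d:polyfun n" "d z ~= 0" "{y:Z. d y ~= 0} <= b" by (meson IntE)
   thus ?thesis
    by (intro bexI[of _ "%x. c x * d x"]) (auto intro: polyfun.mult)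
  qed
  thus ?case using Int.IH by blast
 next
  case (UN K)
  thus ?case by (meson Union_iff Sup_upper Sup_least order_trans)
 qed auto
next
 assume R: "?R W"
 show "openin (zariski n Z) W"
 proof (subst openin_subopen, intro ballI)
  fix z assume "z:W"
  with R obtain a where "a:polyfun n" "a z ~= 0" "{y:Z. a y ~= 0} <= W" by blast
  thus "EX T. openin (zariski n Z) T & z:T & T <= W"
   using openin_zariski_basic `z:W` R by (intro exI[of _ "{y:Z. a y ~= 0}"]) auto
 qed
qed

text \<open>Coordinates \<open>u\<close> on the open set \<open>U\<close> in which regular functions \<open>g\<close> are locally given by
 \<open>g ^ p\<^sup>e = a / b\<close>, where \<open>e \<in> E\<close>: the case \<open>E = {0}\<close> is that of varieties,
 the case \<open>E = UNIV\<close> that of their perfections.\<close>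

definition chart ::
  "nat set => ('x, 'k::field) kspace => 'x set => nat => ('x => nat => 'k) => bool" where
 "chart E X U n u <-> opn X U & inj_on u U & (EX F <= polyfun n. u ` U = zero_locus n F) &
   (ALL V. opn X V --> V <= U -->
    (ALL x:V. EX a:polyfun n. a (u x) ~= 0 & {y:U. a (u y) ~= 0} <= V)) &
   (ALL a:polyfun n. opn X {y:U. a (u y) ~= 0}) &
   (ALL a:polyfun n. ALL b:polyfun n. restrict (%y. a (u y) / b (u y)) {y:U. b (u y) ~= 0}
    :kreg X {y:U. b (u y) ~= 0}) &
   (ALL V g. opn X V --> V <= U --> g:kreg X V -->
    (ALL x:V. EX a:polyfun n. EX b:polyfun n. EX e:E. b (u x) ~= 0 &
     (ALL y:U. b (u y) ~= 0 --> y:V & g y ^ (CHAR('k) ^ e) = a (u y) / b (u y))))"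

lemma chartD:
 fixes X :: "('x, 'k::field) kspace"
 assumes "chart E X U n u"
 shows chart_open: "opn X U"
  and chart_inj: "inj_on u U"
  and chart_image: "EX F <= polyfun n. u ` U = zero_locus n F"
  and chart_basis: "opn X V ==> V <= U ==> x:V ==>
    EX a:polyfun n. a (u x) ~= 0 & {y:U. a (u y) ~= 0} <= V"
  and chart_nonvanishing: "a:polyfun n ==> opn X {y:U. a (u y) ~= 0}"
  and chart_fraction: "a:polyfun n ==> b:polyfun n ==>
    restrict (%y. a (u y) / b (u y)) {y:U. b (u y) ~= 0}:kreg X {y:U. b (u y) ~= 0}"
  and chart_form: "opn X V ==> V <= U ==> g:kreg X V ==> x:V ==>
    EX a:polyfun n. EX b:polyfun n. EX e:E. b (u x) ~= 0 &
     (ALL y:U. b (u y) ~= 0 --> y:V & g y ^ (CHAR('k) ^ e) = a (u y) / b (u y))"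
 by (atomize (full), use assms in \<open>simp add: chart_def\<close>)

definition atlas :: "nat set => ('x, 'k::field) kspace => bool" where
 "atlas E X <-> (EX C. finite C & (ALL (U, n, u):C. chart E X U n u) & pts X = \<Union>(fst ` C))"

lemma topspace_affine [simp]: "pts (affine_kspace n F) = zero_locus n F"
 by (simp add: affine_kspace_def)

lemma chart_of_isomorphism:
 fixes X :: "('x, 'k::field) kspace"
 assumes U: "opn X U" and F: "F <= polyfun n"
  and iso: "kmorphism (open_subspace X U) (affine_kspace n F) f"
   "kmorphism (affine_kspace n F) (open_subspace X U) g"
   "!!x. x:U ==> g (f x) = x" "!!y. y:zero_locus n F ==> f (g y) = y"
 shows "chart {0} X U n f"
proof -
 define Z where "Z = zero_locus n F"
 have topU: "pts (open_subspace X U) = U"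
  using openin_subset[OF U] by (auto simp: open_subspace_def)
 have openU: "opn (open_subspace X U) V <-> opn X V & V <= U" for V
  by (simp add: open_subspace_def openin_open_subtopology[OF U])
 have aff: "ktop (affine_kspace n F) = zariski n Z"
  "kreg (affine_kspace n F) W = {r:extensional W. ALL x:W. EX V. openin (zariski n Z) V &
         x:V & V <= W &
         (EX g:polyfun n. EX h:polyfun n. ALL y:V. h y ~= 0 & r y = g y / h y)}" for W
  by (simp_all add: affine_kspace_def Z_def)
 have fU: "f x:Z" if "x:U" for x
  using iso(1) that by (auto simp: kmorphism_def continuous_map_def topU aff)
 have gZ: "g z:U" if "z:Z" for z
  using iso(2) that by (auto simp: kmorphism_def continuous_map_def topU aff)
 have preimage_f: "opn X {x:U. f x:W}" if "openin (zariski n Z) W" for W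
  using iso(1) that by (auto simp: kmorphism_def continuous_map_def topU aff openU)
 have preimage_g: "openin (zariski n Z) {z:Z. g z:V}" if "opn X V" "V <= U" for V
  using iso(2) that by (auto simp: kmorphism_def continuous_map_def aff openU)
 have "{x:U. f x:{z:Z. a z ~= 0}} = {y:U. a (f y) ~= 0}" for a :: "(nat => 'k) => 'k"
  using fU by auto
 hence "a:polyfun n ==> opn X {y:U. a (f y) ~= 0}" for a
  using preimage_f[OF openin_zariski_basic[of a n Z]] by simp
 moreover have "inj_on f U" by (rule inj_on_inverseI[of U g f]) (rule iso(3))
 moreover have "f ` U = zero_locus n F" using fU gZ iso(4) by (force simp: Z_def)
 moreover have "EX a:polyfun n. a (f x) ~= 0 & {y:U. a (f y) ~= 0} <= V"
  if V: "opn X V" "V <= U" "x:V" for V x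
 proof -
  have "f x:{z:Z. g z:V}" using V fU iso(3) by auto
  then obtain a where "a:polyfun n" "a (f x) ~= 0" "{y:Z. a y ~= 0} <= {z:Z. g z:V}"
   using preimage_g[OF V(1,2)] unfolding openin_zariski_iff by blast
  thus ?thesis using fU iso(3) by (intro bexI[of _ a]) (auto, force)
 qed
 moreover have "restrict (%y. a (f y) / b (f y)) {y:U. b (f y) ~= 0}:kreg X {y:U. b (f y) ~= 0}"
  if ab: "a:polyfun n" "b:polyfun n" for a b
 proof -
  let ?W = "{z:Z. b z ~= 0}"
  have op: "openin (zariski n Z) ?W" by (rule openin_zariski_basic[OF ab(2)])
  have "restrict (%z. a z / b z) ?W:kreg (affine_kspace n F) ?W"
   unfolding aff mem_Collect_eq
  proof (intro conjI ballI)
   fix x assume "x:?W"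
   thus "EX V. openin (zariski n Z) V & x:V & V <= ?W & (EX g:polyfun n. EX h:polyfun n.
     ALL y:V. h y ~= 0 & restrict (%z. a z / b z) ?W y = g y / h y)"
    by (intro exI[of _ ?W] conjI op subset_refl bexI[OF _ ab(1)] bexI[OF _ ab(2)]) simp_all
  qed simp
  hence "restrict (restrict (%z. a z / b z) ?W o f) {x:U. f x:?W}:kreg X {x:U. f x:?W}"
   using iso(1) op unfolding kmorphism_def topU aff(1) by (auto simp: open_subspace_def)
  moreover have "{x:U. f x:?W} = {y:U. b (f y) ~= 0}" using fU by auto
  moreover have "restrict (restrict (%z. a z / b z) ?W o f) {y:U. b (f y) ~= 0} =
   restrict (%y. a (f y) / b (f y)) {y:U. b (f y) ~= 0}" using fU by (auto simp: restrict_def fun_eq_iff)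
  ultimately show ?thesis by simp
 qed
 moreover have "EX a:polyfun n. EX b:polyfun n. EX e:{0}. b (f x) ~= 0 &
     (ALL y:U. b (f y) ~= 0 --> y:V & r y ^ (CHAR('k) ^ e) = a (f y) / b (f y))"
  if V: "opn X V" "V <= U" "r:kreg X V" "x:V" for V r x
 proof -
  let ?W = "{z:Z. g z:V}"
  have "restrict (r o g) ?W:kreg (affine_kspace n F) ?W"
   using iso(2) V openU unfolding kmorphism_def topspace_affine Z_def[symmetric]
   by (auto simp: open_subspace_def)
  moreover have fx: "f x:?W" using V fU iso(3) by auto
  ultimately obtain V' a b where V': "openin (zariski n Z) V'" "f x:V'" "V' <= ?W" and
   ab: "a:polyfun n" "b:polyfun n" "ALL y:V'. b y ~= 0 & restrict (r o g) ?W y = a y / b y"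
   unfolding aff by blast
  obtain c where c: "c:polyfun n" "c (f x) ~= 0" "{y:Z. c y ~= 0} <= V'"
   using V'(1,2) unfolding openin_zariski_iff by blast
  have "y:V & r y = a (f y) * c (f y) / (b (f y) * c (f y))" if y: "y:U" "b (f y) * c (f y) ~= 0" for y
  proof -
   have "f y:V'" using y c(3) fU by auto
   moreover from this have "f y:?W" using V'(3) by auto
   ultimately show ?thesis using ab(3) iso(3)[OF y(1)] y(2) by auto
  qed
  thus ?thesis using ab c V'(2)
   by (intro bexI[of _ "%z. a z * c z"] bexI[of _ "%z. b z * c z"]) (auto intro: polyfun.mult)
 qed
 ultimately show ?thesis unfolding chart_def using U F by (intro conjI allI impI ballI exI[of _ F]) simp_all
qed

lemma variety_atlas:
 assumes "variety X"
 shows "atlas {0} X"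
proof -
 obtain \<U> where \<U>: "finite \<U>" "\<Union>\<U> = pts X" "ALL U:\<U>. opn X U &
      (EX n F. F <= polyfun n & kisomorphic (open_subspace X U) (affine_kspace n F))"
  using assms unfolding variety_def by (elim conjE exE)
 have "EX n f. chart {0} X U n f" if "U:\<U>" for U
 proof -
  from bspec[OF \<U>(3) that] obtain n F where U: "opn X U" "F <= polyfun n"
   "kisomorphic (open_subspace X U) (affine_kspace n F)" by blast
  have "pts (open_subspace X U) = U"
   using openin_subset[OF U(1)] by (auto simp: open_subspace_def)
  with U show ?thesis unfolding kisomorphic_def
   using chart_of_isomorphism[OF U(1,2)] by (metis topspace_affine)
 qed
 then obtain n f where "!!U. U:\<U> ==> chart {0} X U (n U) (f U)" by metis
 with \<U> show ?thesis unfolding atlas_def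
  by (intro exI[of _ "(%U. (U, n U, f U)) ` \<U>"]) (auto simp: image_image)
qed

text \<open>The polynomials whose non-vanishing locus lies in some member of the family have the
  same common zeros as finitely many of them; the members chosen for these cover the same
  set.\<close>

lemma chart_quasi_compact:
 assumes c: "chart E X U n u" and \<V>: "!!V. V:\<V> ==> opn X V & V <= U"
 shows "EX \<W> <= \<V>. finite \<W> & \<Union>\<W> = \<Union>\<V>"
proof -
 define F where "F = {a:polyfun n. EX V:\<V>. {y:U. a (u y) ~= 0} <= V}"
 have "F <= polyfun n" by (auto simp: F_def)
 from finite_zero_locus[OF this] obtain F0 where F0: "F0 <= F" "finite F0"
  "!!x. (ALL f:F0. f x = 0) ==> (ALL f:F. f x = 0)" by metis
 have "ALL a:F0. EX V. V:\<V> & {y:U. a (u y) ~= 0} <= V" using F0(1) by (auto simp: F_def)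
 from bchoice[OF this] obtain h where h: "!!a. a:F0 ==> h a:\<V> & {y:U. a (u y) ~= 0} <= h a" by blast
 have "x:\<Union>(h ` F0)" if x: "x:V" "V:\<V>" for x V
 proof -
  obtain a where "a:polyfun n" "a (u x) ~= 0" "{y:U. a (u y) ~= 0} <= V"
   using chart_basis[OF c, of V x] \<V>[OF x(2)] x by blast
  then obtain b where "b:F0" "b (u x) ~= 0" using x F0(3)[of "u x"] by (auto simp: F_def)
  thus ?thesis using h[of b] x \<V>[OF x(2)] by auto
 qed
 hence "\<Union>\<V> <= \<Union>(h ` F0)" by blast
 moreover have "h ` F0 <= \<V>" using h by blast
 ultimately show ?thesis using F0(2) by (intro exI[of _ "h ` F0"]) auto
qed

lemma atlas_quasi_compact:
 assumes "atlas E X" and \<V>: "!!V. V:\<V> ==> opn X V"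
 obtains \<W> where "\<W> <= \<V>" "finite \<W>" "\<Union>\<W> = \<Union>\<V>"
proof -
 obtain C where C: "finite C" "ALL (U, n, u):C. chart E X U n u" "pts X = \<Union>(fst ` C)"
  using assms(1) unfolding atlas_def by (elim exE conjE)
 have "EX \<W> <= \<V>. finite \<W> & (\<Union>\<W>) Int fst c = (\<Union>\<V>) Int fst c" if "c:C" for c
 proof -
  obtain U n u where c: "c = (U, n, u)" by (cases c)
  have ch: "chart E X U n u" using bspec[OF C(2) that] c by simp
  have "EX \<W> <= (%V. V Int U) ` \<V>. finite \<W> & \<Union>\<W> = \<Union>((%V. V Int U) ` \<V>)"
   by (rule chart_quasi_compact[OF ch]) (use \<V> chart_open[OF ch] in auto)
  then obtain \<W> where W: "\<W> <= (%V. V Int U) ` \<V>" "finite \<W>" "\<Union>\<W> = \<Union>((%V. V Int U) ` \<V>)"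
   by (elim exE conjE)
  obtain \<W>' where W': "\<W>' <= \<V>" "finite \<W>'" "\<W> = (%V. V Int U) ` \<W>'"
   using finite_subset_image[OF W(2,1)] by blast
  thus ?thesis using W(3) c by (intro exI[of _ \<W>']) auto
 qed
 then obtain h where h: "!!c. c:C ==> h c <= \<V> & finite (h c) & (\<Union>(h c)) Int fst c = (\<Union>\<V>) Int fst c"
  by metis
 have "\<Union>(\<Union>(h ` C)) = \<Union>\<V>"
 proof
  show "\<Union>\<V> <= \<Union>(\<Union>(h ` C))"
  proof
   fix x assume x: "x:\<Union>\<V>"
   hence "x:pts X" using \<V> openin_subset by blast
   then obtain c where c: "c:C" "x:fst c" using C(3) by auto
   hence "x:\<Union>(h c)" using h[of c] x by blast
   thus "x:\<Union>(\<Union>(h ` C))" using c by blast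
  qed
 qed (use h in blast)
 moreover have "\<Union>(h ` C) <= \<V>" using h by blast
 moreover have "finite (\<Union>(h ` C))" using h C(1) by blast
 ultimately show thesis by (intro that)
qed

lemma atlas_chart_at:
 assumes "atlas E X" "x:pts X"
 obtains U n u where "chart E X U n u" "x:U"
 using assms unfolding atlas_def by (auto simp: image_iff) (metis (mono_tags, lifting) case_prodD)

lemma chart_perfection:
 fixes X :: "('x, 'k::field) kspace"
 assumes "chart {0} X U n u"
 shows "chart UNIV (perfection X) U n u"
proof -
 note c = chartD[OF assms]
 have [simp]: "ktop (perfection X) = ktop X" by (simp add: perfection_def)
 have "restrict (%y. a (u y) / b (u y)) {y:U. b (u y) ~= 0}:kreg (perfection X) {y:U. b (u y) ~= 0}"
  if "a:polyfun n" "b:polyfun n" for a b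
 proof -
  let ?W = "{y:U. b (u y) ~= 0}" and ?h = "%y. a (u y) / b (u y)"
  have "restrict (%x. restrict ?h ?W x ^ (CHAR('k) ^ 0)) ?W = restrict ?h ?W" by (rule restrict_ext) simp
  with c(6)[OF that] have "restrict (%x. restrict ?h ?W x ^ (CHAR('k) ^ 0)) ?W:kreg X ?W" by (simp only:)
  thus ?thesis unfolding perfection_def kspace.simps mem_Collect_eq
   by (intro conjI exI[of _ 0]) (rule restrict_extensional)
 qed
 moreover have "EX a:polyfun n. EX b:polyfun n. EX e. b (u x) ~= 0 &
     (ALL y:U. b (u y) ~= 0 --> y:V & g y ^ (CHAR('k) ^ e) = a (u y) / b (u y))"
  if V: "opn X V" "V <= U" "g:kreg (perfection X) V" "x:V" for V g x
 proof -
  obtain e where e: "restrict (%x. g x ^ (CHAR('k) ^ e)) V:kreg X V"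
   using V(3) by (auto simp: perfection_def)
  from c(7)[OF V(1,2) e V(4)] obtain a b where ab: "a:polyfun n" "b:polyfun n" "b (u x) ~= 0"
   "ALL y:U. b (u y) ~= 0 --> y:V & restrict (%x. g x ^ (CHAR('k) ^ e)) V y ^ (CHAR('k) ^ 0) = a (u y) / b (u y)"
   by blast
  show ?thesis
   by (rule bexI[OF _ ab(1)], rule bexI[OF _ ab(2)], rule exI[of _ e]) (use ab(3,4) in auto)
 qed
 ultimately show ?thesis unfolding chart_def using c(1-5) by simp
qed

lemma atlas_perfection: "atlas {0} X ==> atlas UNIV (perfection X)"
proof -
 assume "atlas {0} X"
 then obtain C where C: "finite C" "ALL (U, n, u):C. chart {0} X U n u" "pts X = \<Union>(fst ` C)"
  unfolding atlas_def by (elim exE conjE)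
 have "ALL (U, n, u):C. chart UNIV (perfection X) U n u" using bspec C(2) chart_perfection by fastforce
 moreover have "pts (perfection X) = \<Union>(fst ` C)" using C(3) by (simp add: perfection_def)
 ultimately show ?thesis unfolding atlas_def using C(1) by (intro exI[of _ C]) simp
qed

section \<open>Regular functions on perfect spaces\<close>

definition reg :: "('x, 'k) kspace => 'x set => ('x => 'k) => bool" where
 "reg X V f <-> opn X V & restrict f V:kreg X V"

lemma reg_open: "reg X V f ==> opn X V"
 by (simp add: reg_def)

lemma reg_cong: "(!!x. x:V ==> f x = g x) ==> reg X V f <-> reg X V g"
 unfolding reg_def by (metis restrict_ext)

lemma reg_kreg: "function_sheaf X ==> opn X V ==> f:kreg X V ==> reg X V f"
 unfolding reg_def function_sheaf_def by (metis extensional_restrict subsetD)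

lemma reg_mono:
 assumes "function_sheaf X" "reg X V f" "opn X W" "W <= V"
 shows "reg X W f"
proof -
 have "restrict (restrict f V) W:kreg X W"
  using assms unfolding function_sheaf_def reg_def by blast
 moreover have "restrict (restrict f V) W = restrict f W" using assms(4) by (auto simp: restrict_def fun_eq_iff)
 ultimately show ?thesis using assms(3) by (simp add: reg_def)
qed

lemma reg_glue:
 assumes X: "function_sheaf X" and "!!x. x:V ==> EX W. x:W & W <= V & reg X W f"
 shows "reg X V f"
proof -
 have V: "opn X V"
  using assms(2) by (subst openin_subopen) (meson reg_open)
 have "EX W. opn X W & x:W & W <= V & restrict (restrict f V) W:kreg X W" if x: "x:V" for x
 proof -
  obtain W where W: "x:W" "W <= V" "reg X W f" using assms(2)[OF x] by (elim exE conjE)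
  moreover have "restrict (restrict f V) W = restrict f W" using W(2) by (auto simp: restrict_def fun_eq_iff)
  ultimately show ?thesis by (auto simp: reg_def)
 qed
 moreover have "!!U f. opn X U ==> f:extensional U ==>
   ALL x:U. EX V. opn X V & x:V & V <= U & restrict f V:kreg X V ==> f:kreg X U"
  using X unfolding function_sheaf_def by simp
 ultimately show ?thesis using V by (simp add: reg_def)
qed

text \<open>Abstracts what is used of a perfection, so that no underlying variety has to be carried
  along. The last condition is perfectness.\<close>

definition pspace :: "('x, 'k::field) kspace => bool" where
 "pspace X <-> function_sheaf X & atlas UNIV X &
   (ALL V f e. reg X V (%x. f x ^ (CHAR('k) ^ e)) --> reg X V f)"

lemma pspaceD:
 fixes X :: "('x, 'k::field) kspace"
 assumes "pspace X"
 shows pspace_sheaf: "function_sheaf X" and pspace_atlas: "atlas UNIV X"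
  and pspace_root: "reg X V (%x. f x ^ (CHAR('k) ^ e)) ==> reg X V f"
 using assms unfolding pspace_def by blast+

lemma chart_reg_form:
 fixes X :: "('x, 'k::field) kspace"
 assumes "function_sheaf X" "chart E X U n u" "reg X V f" "x:V" "x:U"
 obtains a b e where "a:polyfun n" "b:polyfun n" "e:E" "b (u x) ~= 0"
  "!!y. y:U ==> b (u y) ~= 0 ==> y:V & f y ^ (CHAR('k) ^ e) = a (u y) / b (u y)"
proof -
 have op: "opn X (V Int U)" using assms(2,3) chart_open reg_open by blast
 hence "reg X (V Int U) f" by (rule reg_mono[OF assms(1,3)]) blast
 hence 1: "restrict f (V Int U):kreg X (V Int U)" by (simp add: reg_def)
 have 2: "V Int U <= U" "x:V Int U" using assms(4,5) by auto
 from chart_form[OF assms(2) op 2(1) 1 2(2)] obtain a b e where *: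
   "a:polyfun n" "b:polyfun n" "e:E" "b (u x) ~= 0"
   "ALL y:U. b (u y) ~= 0 --> y:V Int U & restrict f (V Int U) y ^ (CHAR('k) ^ e) = a (u y) / b (u y)"
  by (elim bexE conjE)
 show thesis by (rule that[OF *(1-4)]) (use *(5) in auto)
qed

lemma reg_power_variety:
 fixes X :: "('x, 'k::field) kspace"
 assumes sh: "function_sheaf X" and at: "atlas {0} X" and f: "reg X V f"
 shows "reg X V (%x. f x ^ m)"
proof (rule reg_glue[OF sh])
 fix x assume x: "x:V"
 then obtain U n u where U: "chart {0} X U n u" "x:U" using reg_open[OF f] openin_subset atlas_chart_at[OF at] by blast
 obtain a b e where ab: "a:polyfun n" "b:polyfun n" "e:{0::nat}" "b (u x) ~= 0"
  "!!y. y:U ==> b (u y) ~= 0 ==> y:V & f y ^ (CHAR('k) ^ e) = a (u y) / b (u y)"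
  by (rule chart_reg_form[OF sh U(1) f x U(2)]) blast
 show "EX W. x:W & W <= V & reg X W (%x. f x ^ m)"
 \<comment> \<open>For \<open>m = 0\<close> the denominator \<open>b ^ m\<close> no longer cuts out
   the neighbourhood, so the constant 1 is written as a fraction with denominator
   \<open>b\<close>.\<close>
 proof (cases "m = 0")
  case True
  have "reg X {y:U. b (u y) ~= 0} (%y. b (u y) / b (u y))"
   unfolding reg_def using chart_fraction[OF U(1) ab(2,2)] chart_nonvanishing[OF U(1) ab(2)] by blast
  also have "reg X {y:U. b (u y) ~= 0} (%y. b (u y) / b (u y)) =
   reg X {y:U. b (u y) ~= 0} (%y. f y ^ m)" by (rule reg_cong) (use True in auto)
  finally show ?thesis using ab U(2) by (intro exI[of _ "{y:U. b (u y) ~= 0}"]) auto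
 next
  case False
  let ?b = "%z. b z ^ m" and ?a = "%z. a z ^ m"
  have p: "?a:polyfun n" "?b:polyfun n" using ab by (auto intro: funalg_power funalg_polyfun)
  have eq: "{y:U. b (u y) ^ m ~= 0} = {y:U. b (u y) ~= 0}" using False by auto
  have "reg X {y:U. b (u y) ~= 0} (%y. a (u y) ^ m / b (u y) ^ m)"
   unfolding reg_def using chart_fraction[OF U(1) p] chart_nonvanishing[OF U(1) p(2)] eq by simp
  also have "reg X {y:U. b (u y) ~= 0} (%y. a (u y) ^ m / b (u y) ^ m) =
   reg X {y:U. b (u y) ~= 0} (%y. f y ^ m)"
   by (rule reg_cong) (use ab(3,5) in \<open>auto simp: power_divide\<close>)
  finally show ?thesis using ab U(2) by (intro exI[of _ "{y:U. b (u y) ~= 0}"]) auto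
 qed
qed

lemma reg_perfection_iff:
 fixes X :: "('x, 'k::field) kspace"
 shows "reg (perfection X) V f <-> (EX e. reg X V (%x. f x ^ (CHAR('k) ^ e)))"
proof -
 have "restrict (%x. restrict f V x ^ m) V = restrict (%x. f x ^ m) V" for m by (auto simp: restrict_def)
 thus ?thesis by (simp add: reg_def perfection_def)
qed

text \<open>The exponent of a section of \<open>perfection X\<close> is uniform on its open set, so
  gluing needs a finite subcover and the maximum of its exponents; powers of regular functions being
  regular, every local exponent can be raised to this maximum.\<close>

lemma pspace_perfection:
 fixes X :: "('x, 'k::field) kspace"
 assumes sh: "function_sheaf X" and at: "atlas {0} X"
 shows "pspace (perfection X)"
proof -
 have kt [simp]: "ktop (perfection X) = ktop X" by (simp add: perfection_def)
 have atp: "atlas UNIV (perfection X)" by (rule atlas_perfection[OF at])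
 have ext: "kreg (perfection X) V <= extensional V" for V by (auto simp: perfection_def)
 have mono: "reg (perfection X) W f" if "reg (perfection X) V f" "opn X W" "W <= V" for V W f
  using that reg_mono[OF sh] unfolding reg_perfection_iff by blast
 have glue: "reg (perfection X) V f"
  if "opn X V" and loc: "!!x. x:V ==> EX W. x:W & W <= V & reg (perfection X) W f" for V f
 proof -
  let ?W = "{W. W <= V & reg (perfection X) W f}"
  obtain \<W> where W: "\<W> <= ?W" "finite \<W>" "\<Union>\<W> = \<Union>?W"
   by (rule atlas_quasi_compact[OF at, of ?W]) (simp add: reg_def)
  have "ALL W:\<W>. EX e. reg X W (%x. f x ^ (CHAR('k) ^ e))" using W(1) by (auto simp: reg_perfection_iff)
  from bchoice[OF this] obtain e where e: "!!W. W:\<W> ==> reg X W (%x. f x ^ (CHAR('k) ^ e W))" by blast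
  define N where "N = Max (insert 0 (e ` \<W>))"
  have "reg X V (%x. f x ^ (CHAR('k) ^ N))"
  proof (rule reg_glue[OF sh])
   fix x assume "x:V"
   then obtain W' where W': "W':\<W>" "x:W'" using loc W(3) by blast
   have "e W' <= N" using W(2) W'(1) by (simp add: N_def)
   hence "(f x ^ (CHAR('k) ^ e W')) ^ (CHAR('k) ^ (N - e W')) = f x ^ (CHAR('k) ^ N)" for x
    by (simp flip: power_mult power_add)
   hence "reg X W' (%x. f x ^ (CHAR('k) ^ N))"
    using reg_power_variety[OF sh at e[OF W'(1)], of "CHAR('k) ^ (N - e W')"] by simp
   thus "EX W. x:W & W <= V & reg X W (%x. f x ^ (CHAR('k) ^ N))" using W' W(1) by blast
  qed
  thus ?thesis unfolding reg_perfection_iff by blast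
 qed
 have "function_sheaf (perfection X)"
  unfolding function_sheaf_def
 proof (intro conjI allI impI)
  fix U V f assume "opn (perfection X) U" "opn (perfection X) V" "V <= U" "f:kreg (perfection X) U"
  moreover from this have "restrict f U = f" using ext by (meson extensional_restrict subsetD)
  ultimately show "restrict f V:kreg (perfection X) V" using mono[of U f V] by (simp add: reg_def)
 next
  fix U f assume U: "opn (perfection X) U" "f:extensional U"
   "ALL x:U. EX V. opn (perfection X) V & x:V & V <= U & restrict f V:kreg (perfection X) V"
  hence "reg (perfection X) U f" by (intro glue) (auto simp: reg_def)
  thus "f:kreg (perfection X) U" using U(2) by (simp add: reg_def extensional_restrict)
 qed (use ext in auto)
 moreover have "reg (perfection X) V f" if "reg (perfection X) V (%x. f x ^ (CHAR('k) ^ e))" for V f e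
 proof -
  from that obtain d where "reg X V (%x. (f x ^ (CHAR('k) ^ e)) ^ (CHAR('k) ^ d))"
   unfolding reg_perfection_iff by blast
  hence "reg X V (%x. f x ^ (CHAR('k) ^ (e + d)))" by (simp add: power_add power_mult)
  thus ?thesis unfolding reg_perfection_iff by blast
 qed
 ultimately show ?thesis using atp by (simp add: pspace_def)
qed

lemma variety_pspace: "variety X ==> pspace (perfection X)"
 by (simp add: pspace_perfection variety_atlas variety_def)

locale pos_char =
 fixes k_type :: "'k::alg_closed_field itself"
 assumes char_pos: "CHAR('k) > 0"
begin

lemma prime_char: "prime CHAR('k)"
 using char_pos by (rule prime_CHAR_semidom)

lemma frob_add: "(a + b :: 'k) ^ (CHAR('k) ^ e) = a ^ (CHAR('k) ^ e) + b ^ (CHAR('k) ^ e)"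
 by (rule freshmans_dream') (simp_all add: prime_char)

lemma frob_inj:
 assumes "(a :: 'k) ^ (CHAR('k) ^ e) = b ^ (CHAR('k) ^ e)"
 shows "a = b"
proof -
 have "a ^ (CHAR('k) ^ e) = (a - b) ^ (CHAR('k) ^ e) + b ^ (CHAR('k) ^ e)"
  by (simp flip: frob_add)
 with assms show ?thesis by simp
qed

lemma reg_of_form:
 fixes X :: "('x, 'k) kspace"
 assumes X: "pspace X" and c: "chart E X U n u" and ab: "a:polyfun n" "b:polyfun n"
  and f: "!!y. y:U ==> b (u y) ~= 0 ==> f y ^ (CHAR('k) ^ e) = a (u y) / b (u y)"
 shows "reg X {y:U. b (u y) ~= 0} f"
proof (rule pspace_root[OF X, where e=e])
 have "reg X {y:U. b (u y) ~= 0} (%y. a (u y) / b (u y))"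
  using chart_fraction[OF c ab] chart_nonvanishing[OF c ab(2)] by (simp add: reg_def)
 also have "reg X {y:U. b (u y) ~= 0} (%y. a (u y) / b (u y)) =
   reg X {y:U. b (u y) ~= 0} (%y. f y ^ (CHAR('k) ^ e))"
  by (rule reg_cong) (use f in auto)
 finally show "reg X {y:U. b (u y) ~= 0} (%y. f y ^ (CHAR('k) ^ e))" .
qed

text \<open>Raising the two local expressions to the powers \<open>q1\<close> and \<open>q2\<close>
  gives them the same exponent \<open>e1 + e2\<close>; a common denominator follows by
  cross-multiplication.\<close>

lemma reg_common_form:
 fixes X :: "('x, 'k) kspace"
 assumes X: "pspace X" and f: "reg X V f" and g: "reg X V g" and x: "x:V"
 obtains U n u a c b e where "chart UNIV X U n u" "a:polyfun n" "c:polyfun n" "b:polyfun n"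
  "x:U" "b (u x) ~= 0"
  "!!y. y:U ==> b (u y) ~= 0 ==>
    y:V & f y ^ (CHAR('k) ^ e) = a (u y) / b (u y) & g y ^ (CHAR('k) ^ e) = c (u y) / b (u y)"
proof -
 obtain U n u where U: "chart UNIV X U n u" "x:U" using x reg_open[OF f] openin_subset atlas_chart_at[OF pspace_atlas[OF X]] by blast
 obtain a1 b1 e1 where 1: "a1:polyfun n" "b1:polyfun n" "b1 (u x) ~= 0"
  "!!y. y:U ==> b1 (u y) ~= 0 ==> y:V & f y ^ (CHAR('k) ^ e1) = a1 (u y) / b1 (u y)"
  by (rule chart_reg_form[OF pspace_sheaf[OF X] U(1) f x U(2)]) blast
 obtain a2 b2 e2 where 2: "a2:polyfun n" "b2:polyfun n" "b2 (u x) ~= 0"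
  "!!y. y:U ==> b2 (u y) ~= 0 ==> y:V & g y ^ (CHAR('k) ^ e2) = a2 (u y) / b2 (u y)"
  by (rule chart_reg_form[OF pspace_sheaf[OF X] U(1) g x U(2)]) blast
 define q1 q2 where "q1 = CHAR('k) ^ e2" and "q2 = CHAR('k) ^ e1"
 have q: "q1 > 0" "q2 > 0" using char_pos by (auto simp: q1_def q2_def)
 define b where "b = (%z. b1 z ^ q1 * b2 z ^ q2)"
 define a where "a = (%z. a1 z ^ q1 * b2 z ^ q2)"
 define c where "c = (%z. a2 z ^ q2 * b1 z ^ q1)"
 show thesis
 proof (rule that[OF U(1) _ _ _ U(2)])
  show "a:polyfun n" "c:polyfun n" "b:polyfun n" unfolding a_def b_def c_def
   by (intro funalg_mult funalg_power funalg_polyfun 1 2)+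
  show "b (u x) ~= 0" using 1 2 by (simp add: b_def)
  fix y assume y: "y:U" "b (u y) ~= 0"
  hence nz: "b1 (u y) ~= 0" "b2 (u y) ~= 0" using q by (auto simp: b_def)
  have "f y ^ (CHAR('k) ^ (e1 + e2)) = (a1 (u y) / b1 (u y)) ^ q1"
   using 1(4)[OF y(1) nz(1)] by (simp add: q1_def power_add power_mult)
  moreover have "g y ^ (CHAR('k) ^ (e1 + e2)) = (a2 (u y) / b2 (u y)) ^ q2"
   using 2(4)[OF y(1) nz(2)] by (simp add: q2_def add.commute[of e1] power_add power_mult)
  ultimately show "y:V & f y ^ (CHAR('k) ^ (e1 + e2)) = a (u y) / b (u y) &
    g y ^ (CHAR('k) ^ (e1 + e2)) = c (u y) / b (u y)"
   using nz 1(4)[OF y(1) nz(1)] by (simp add: a_def b_def c_def power_divide field_simps)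
 qed
qed

lemma reg_const:
 fixes X :: "('x, 'k) kspace"
 assumes X: "pspace X" and V: "opn X V"
 shows "reg X V (%_. c)"
proof (rule reg_glue[OF pspace_sheaf[OF X]])
 fix x assume x: "x:V"
 then obtain U n u where U: "chart UNIV X U n u" "x:U" using V openin_subset atlas_chart_at[OF pspace_atlas[OF X]] by blast
 have "opn X (V Int U)" using V chart_open[OF U(1)] by blast
 then obtain b where b: "b:polyfun n" "b (u x) ~= 0" "{y:U. b (u y) ~= 0} <= V Int U"
  using chart_basis[OF U(1), of "V Int U" x] x U(2) by blast
 have "reg X {y:U. b (u y) ~= 0} (%_. c)"
  by (rule reg_of_form[OF X U(1) _ b(1), where a="%z. c * b z" and e=0])
    (auto intro: b polyfun.intros)
 thus "EX W. x:W & W <= V & reg X W (%_. c)"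
  using b U(2) by (intro exI[of _ "{y:U. b (u y) ~= 0}"]) auto
qed

lemma reg_add:
 fixes X :: "('x, 'k) kspace"
 assumes X: "pspace X" and f: "reg X V f" and g: "reg X V g"
 shows "reg X V (%x. f x + g x)"
proof (rule reg_glue[OF pspace_sheaf[OF X]])
 fix x assume x: "x:V"
 from reg_common_form[OF X f g x] obtain U n u a c b e where
  *: "chart UNIV X U n u" "a:polyfun n" "c:polyfun n" "b:polyfun n" "x:U" "b (u x) ~= 0"
  "!!y. y:U ==> b (u y) ~= 0 ==>
    y:V & f y ^ (CHAR('k) ^ e) = a (u y) / b (u y) & g y ^ (CHAR('k) ^ e) = c (u y) / b (u y)"
  by metis
 have "reg X {y:U. b (u y) ~= 0} (%x. f x + g x)"
  by (rule reg_of_form[OF X *(1) _ *(4), where a="%z. a z + c z" and e=e])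
    (auto intro: * polyfun.intros simp: frob_add *(7) add_divide_distrib)
 thus "EX W. x:W & W <= V & reg X W (%x. f x + g x)"
  using *(5-7) by (intro exI[of _ "{y:U. b (u y) ~= 0}"]) auto
qed

lemma reg_mult:
 fixes X :: "('x, 'k) kspace"
 assumes X: "pspace X" and f: "reg X V f" and g: "reg X V g"
 shows "reg X V (%x. f x * g x)"
proof (rule reg_glue[OF pspace_sheaf[OF X]])
 fix x assume x: "x:V"
 from reg_common_form[OF X f g x] obtain U n u a c b e where
  *: "chart UNIV X U n u" "a:polyfun n" "c:polyfun n" "b:polyfun n" "x:U" "b (u x) ~= 0"
  "!!y. y:U ==> b (u y) ~= 0 ==>
    y:V & f y ^ (CHAR('k) ^ e) = a (u y) / b (u y) & g y ^ (CHAR('k) ^ e) = c (u y) / b (u y)"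
  by metis
 have "reg X {y:U. b (u y) * b (u y) ~= 0} (%x. f x * g x)"
  by (rule reg_of_form[OF X *(1), where a="%z. a z * c z" and b="%z. b z * b z" and e=e])
    (auto intro!: polyfun.mult * simp: power_mult_distrib *(7))
 moreover have "{y:U. b (u y) * b (u y) ~= 0} <= V" using *(7) by auto
 ultimately show "EX W. x:W & W <= V & reg X W (%x. f x * g x)"
  using *(5,6) by (intro exI[of _ "{y:U. b (u y) * b (u y) ~= 0}"]) auto
qed

lemma reg_nonvanishing:
 fixes X :: "('x, 'k) kspace"
 assumes X: "pspace X" and f: "reg X V f"
 shows "reg X {x:V. f x ~= 0} (%x. inverse (f x))"
proof (rule reg_glue[OF pspace_sheaf[OF X]])
 fix x assume x: "x:{x:V. f x ~= 0}"
 hence xV: "x:V" by simp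
 from reg_common_form[OF X f f xV] obtain U n u a b e where
  *: "chart UNIV X U n u" "a:polyfun n" "b:polyfun n" "x:U" "b (u x) ~= 0"
  "!!y. y:U ==> b (u y) ~= 0 ==> y:V & f y ^ (CHAR('k) ^ e) = a (u y) / b (u y)"
  by metis
 have "reg X {y:U. a (u y) * b (u y) ~= 0} (%x. inverse (f x))"
  by (rule reg_of_form[OF X *(1), where a="%z. b z * b z" and b="%z. a z * b z" and e=e])
    (auto intro!: polyfun.mult * simp: power_inverse *(6))
 moreover have "{y:U. a (u y) * b (u y) ~= 0} <= {x:V. f x ~= 0}"
  using *(6) char_pos by (fastforce simp: zero_power)
 moreover have "a (u x) ~= 0" using *(6)[OF *(4,5)] x by auto
 ultimately show "EX W. x:W & W <= {x:V. f x ~= 0} & reg X W (%x. inverse (f x))"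
  using *(4,5) by (intro exI[of _ "{y:U. a (u y) * b (u y) ~= 0}"]) auto
qed

lemma reg_divide:
 fixes X :: "('x, 'k) kspace"
 assumes X: "pspace X" and f: "reg X V f" and g: "reg X V g"
 shows "reg X {x:V. g x ~= 0} (%x. f x / g x)"
proof -
 note inv = reg_nonvanishing[OF X g]
 have "reg X {x:V. g x ~= 0} f" by (rule reg_mono[OF pspace_sheaf[OF X] f reg_open[OF inv]]) auto
 from reg_mult[OF X this inv] show ?thesis by (simp add: divide_inverse)
qed

lemma reg_sum:
 fixes X :: "('x, 'k) kspace"
 assumes X: "pspace X" and V: "opn X V" and f: "!!i. i:I ==> reg X V (f i)"
 shows "reg X V (%x. \<Sum>i\<in>I. f i x)"
 using f by (induction I rule: infinite_finite_induct) (auto intro: reg_const[OF X V] reg_add[OF X])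

lemma reg_polyfun:
 fixes X :: "('x, 'k) kspace"
 assumes X: "pspace X" and V: "opn X V" and w: "!!i. i < n ==> reg X V (%x. w x i)"
 shows "a:polyfun n ==> reg X V (%x. a (w x))"
 by (induction rule: polyfun.induct) (auto intro: reg_const[OF X V] reg_add[OF X] reg_mult[OF X] w)

lemma chart_coord:
 fixes X :: "('x, 'k) kspace"
 assumes X: "pspace X" and c: "chart E X U n u" and i: "i < n"
 shows "reg X U (%x. u x i)"
 using reg_of_form[OF X c polyfun.coord[OF i] polyfun.const[of 1], where e=0] by simp

lemma kmorphism_reg:
 assumes f: "kmorphism X Y f" and g: "reg Y V g"
 shows "reg X {x:pts X. f x:V} (%x. g (f x))"
proof -
 let ?P = "{x:pts X. f x:V}"
 have "opn X ?P" "restrict (restrict g V o f) ?P:kreg X ?P"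
  using f g by (auto simp: kmorphism_def continuous_map_def reg_def)
 moreover have "restrict (restrict g V o f) ?P = restrict (%x. g (f x)) ?P"
  by (rule restrict_ext) auto
 ultimately show ?thesis by (simp add: reg_def)
qed

lemma kmorphismI_local:
 fixes X :: "('x, 'k) kspace" and Y :: "('y, 'k) kspace"
 assumes X: "pspace X" and Y: "pspace Y"
  and top: "!!x. x:pts X ==> f x:pts Y"
  and loc: "!!x V g. x:pts X ==> reg Y V g ==> f x:V ==>
   EX W. x:W & (ALL y:W. f y:V) & reg X W (%y. g (f y))"
 shows "kmorphism X Y f"
proof -
 have main: "reg X {x:pts X. f x:V} (%x. g (f x))" if V: "reg Y V g" for V g
 proof (rule reg_glue[OF pspace_sheaf[OF X]])
  fix x assume x: "x:{x:pts X. f x:V}"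
  with loc[OF _ V, of x] obtain W where W: "x:W" "ALL y:W. f y:V" "reg X W (%y. g (f y))" by auto
  thus "EX W. x:W & W <= {x:pts X. f x:V} & reg X W (%x. g (f x))"
   using openin_subset[OF reg_open[OF W(3)]] by (intro exI[of _ W]) auto
 qed
 show ?thesis unfolding kmorphism_def
 proof (intro conjI allI impI)
  \<comment> \<open>Openness is part of \<open>reg\<close>, so continuity is the case of a constant
    function.\<close>
  show "continuous_map (ktop X) (ktop Y) f" unfolding continuous_map_def
   using top reg_open[OF main[OF reg_const[OF Y]]] by auto
  fix V g assume V: "opn Y V" "g:kreg Y V"
  show "restrict (g o f) {x:pts X. f x:V}:kreg X {x:pts X. f x:V}"
   using main[OF reg_kreg[OF pspace_sheaf[OF Y] V]] by (simp add: reg_def comp_def)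
 qed
qed

end

lemma kmorphism_id: "function_sheaf X ==> kmorphism X X (%x. x)"
proof -
 assume "function_sheaf X"
 hence "!!V g. opn X V ==> g:kreg X V ==> g:extensional V"
  unfolding function_sheaf_def by blast
 moreover have "{x:pts X. x:V} = V" if "opn X V" for V
  using openin_subset[OF that] by auto
 ultimately show ?thesis by (auto simp: kmorphism_def comp_def extensional_restrict)
qed

lemma kmorphism_cong:
 assumes "!!x. x:pts X ==> f x = g x"
 shows "kmorphism X Y f <-> kmorphism X Y g"
proof -
 have "kmorphism X Y g" if "kmorphism X Y f" "!!x. x:pts X ==> f x = g x" for f g
 proof -
  have 1: "{x:pts X. f x:V} = {x:pts X. g x:V}" for V using that(2) by auto
  have 2: "restrict (h o f) {x:pts X. g x:V} = restrict (h o g) {x:pts X. g x:V}" for h V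
   by (rule restrict_ext) (auto simp: that(2))
  show ?thesis using that(1) unfolding kmorphism_def 1 2
   using continuous_map_eq[of "ktop X" "ktop Y" f g] that(2) by blast
 qed
 from this[of f g] this[of g f] assms show ?thesis by auto
qed

lemma kmorphism_comp:
 assumes "kmorphism X Y f" "kmorphism Y Z g"
 shows "kmorphism X Z (%x. g (f x))"
proof -
 have fX: "f x:pts Y" if "x:pts X" for x
  using assms(1) that by (auto simp: kmorphism_def continuous_map_def)
 show ?thesis unfolding kmorphism_def
 proof (intro conjI allI impI)
  show "continuous_map (ktop X) (ktop Z) (%x. g (f x))"
   using assms continuous_map_compose[of "ktop X" "ktop Y" f "ktop Z" g] by (auto simp: kmorphism_def comp_def)
  fix V h assume V: "opn Z V" "h:kreg Z V"
  let ?Q = "{y:pts Y. g y:V}"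
  have "restrict (h o g) ?Q:kreg Y ?Q" "opn Y ?Q"
   using assms(2) V by (auto simp: kmorphism_def continuous_map_def)
  hence "restrict (restrict (h o g) ?Q o f) {x:pts X. f x:?Q}:       kreg X {x:pts X. f x:?Q}" using assms(1) unfolding kmorphism_def by blast
  moreover have "{x:pts X. f x:?Q} = {x:pts X. g (f x):V}" using fX by auto
  moreover have "restrict (restrict (h o g) ?Q o f) {x:pts X. g (f x):V} =
   restrict (h o (%x. g (f x))) {x:pts X. g (f x):V}"
   by (rule restrict_ext) (use fX in auto)
  ultimately show "restrict (h o (%x. g (f x))) {x:pts X. g (f x):V}:       kreg X {x:pts X. g (f x):V}" by simp
 qed
qed

lemma kmorphism_perfection:
 fixes X :: "('x, 'k::field) kspace" and Y :: "('y, 'k) kspace"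
 assumes f: "kmorphism X Y f"
 shows "kmorphism (perfection X) (perfection Y) f"
 unfolding kmorphism_def
proof (intro conjI allI impI)
 show "continuous_map (ktop (perfection X)) (ktop (perfection Y)) f"
  using f by (simp add: kmorphism_def perfection_def)
 fix V g assume V: "opn (perfection Y) V" "g:kreg (perfection Y) V"
 let ?P = "{x:pts (perfection X). f x:V}"
 obtain e where e: "restrict (%x. g x ^ (CHAR('k) ^ e)) V:kreg Y V" using V by (auto simp: perfection_def)
 have "restrict (restrict (%x. g x ^ (CHAR('k) ^ e)) V o f) ?P:kreg X ?P"
  using f V(1) e unfolding kmorphism_def by (simp add: perfection_def)
 moreover have "restrict (restrict (%x. g x ^ (CHAR('k) ^ e)) V o f) ?P =
   restrict (%x. restrict (g o f) ?P x ^ (CHAR('k) ^ e)) ?P" by (rule restrict_ext) auto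
 ultimately have "restrict (%x. restrict (g o f) ?P x ^ (CHAR('k) ^ e)) ?P:kreg X ?P" by (simp only:)
 thus "restrict (g o f) ?P:kreg (perfection X) ?P"
  unfolding perfection_def kspace.simps mem_Collect_eq by (intro conjI exI[of _ e]) simp_all
qed

section \<open>Perfect groups\<close>

text \<open>Translations and inversion stand in for the multiplication, so that the generic
  arguments below can be carried out without product spaces.\<close>

definition pgroup :: "'a monoid => ('a, 'k::field) kspace => bool" where
 "pgroup G X <-> comm_group G & pspace X & pts X = carrier G &
   (ALL a:carrier G. kmorphism X X (%x. a *[G] x)) & kmorphism X X (%x. inv[G] x)"

lemma reg_one_variety:
 assumes c: "chart {0} X U n u"
 shows "reg X U (%_. 1)"
 using chart_fraction[OF c polyfun.const[of 1] polyfun.const[of 1]] chart_open[OF c] by (simp add: reg_def)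

text \<open>Generating open sets are non-vanishing loci of tensors, so each point needs a tensor
  that does not vanish at it: the product of the constants 1 on two charts.\<close>

lemma topspace_kprod:
 fixes Y :: "('a, 'k::field) kspace"
 assumes var: "variety Y"
 shows "topspace (kprod_top Y Y) = pts Y \<times> pts Y"
proof
 show "topspace (kprod_top Y Y) <= pts Y \<times> pts Y"
  unfolding kprod_top_def topology_generated_by_topspace using openin_subset by fast
 show "pts Y \<times> pts Y <= topspace (kprod_top Y Y)"
 proof (rule subrelI)
  fix a x assume ax: "(a, x):pts Y \<times> pts Y"
  obtain U n u where U: "chart {0} Y U n u" "a:U"
   using atlas_chart_at[OF variety_atlas[OF var], of a] ax by blast
  obtain U' n' u' where U': "chart {0} Y U' n' u'" "x:U'"
   using atlas_chart_at[OF variety_atlas[OF var], of x] ax by blast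
  define one where "one = (%(y, z). \<Sum>i<Suc 0. restrict (%_. 1 :: 'k) U y * restrict (%_. 1 :: 'k) U' z)"
  have "one:tensor_functions Y Y U U'"
   unfolding tensor_functions_def one_def mem_Collect_eq
   using reg_one_variety[OF U(1)] reg_one_variety[OF U'(1)] unfolding reg_def
   by (intro exI[of _ "Suc 0"] exI[of _ "%_. restrict (%_. 1) U"] exI[of _ "%_. restrict (%_. 1) U'"]) simp
  hence "openin (kprod_top Y Y) {z:U \<times> U'. one z ~= 0}" unfolding kprod_top_def
   using chart_open[OF U(1)] chart_open[OF U'(1)] by (intro topology_generated_by_Basis) blast
  moreover have "(a, x):{z:U \<times> U'. one z ~= 0}" using U U' by (simp add: one_def)
  ultimately show "(a, x):topspace (kprod_top Y Y)" using openin_subset by blast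
 qed
qed

context pos_char
begin

text \<open>Versions over the field of the locale, which make the types of structures inferable.\<close>

abbreviation quasialg :: "'a monoid => ('a, 'k) kspace => bool" where "quasialg == Defs.quasialg"
abbreviation quasialg_hom :: "'a monoid => ('a, 'k) kspace => 'b monoid => ('b, 'k) kspace => ('a => 'b) => bool"
 where "quasialg_hom == Defs.quasialg_hom"
abbreviation proalg :: "'a monoid => ('a, 'k) pro_fam => bool" where "proalg == Defs.proalg"
abbreviation proalg_hom :: "'a monoid => ('a, 'k) pro_fam => 'a monoid => ('a, 'k) pro_fam => ('a => 'a) => bool" where "proalg_hom == Defs.proalg_hom"
abbreviation indalg :: "'a monoid => ('a, 'k) ind_fam => bool" where "indalg == Defs.indalg"
abbreviation indalg_hom :: "'a monoid => ('a, 'k) ind_fam => 'a monoid => ('a, 'k) ind_fam => ('a => 'a) => bool" where "indalg_hom == Defs.indalg_hom"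
abbreviation strict_epi :: "'a monoid => ('a, 'k) ind_fam => 'a monoid => ('a, 'k) ind_fam => ('a => 'a) => bool" where "strict_epi == Defs.strict_epi"
abbreviation indproalg :: "'a monoid => ('a, 'k) indpro_fam => bool" where "indproalg == Defs.indproalg"
abbreviation proindalg :: "'a monoid => ('a, 'k) proind_fam => bool" where "proindalg == Defs.proindalg"
abbreviation qadmissible :: "'a monoid => ('a, 'k) qad_fam => bool" where "qadmissible == Defs.qadmissible"
abbreviation indproalg_ad :: "'a monoid => ('a, 'k) indpro_fam => bool" where "indproalg_ad == Defs.indproalg_ad"
abbreviation proindalg_ad :: "'a monoid => ('a, 'k) proind_fam => bool" where "proindalg_ad == Defs.proindalg_ad"

text \<open>On the slice \<open>{a} \<times> B\<close> a tensor function becomes a combination of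
  regular functions with constant coefficients, so the local fractions describing the multiplication
  restrict to regular fractions.\<close>

lemma quasialg_translation:
 fixes Y :: "('a, 'k) kspace"
 assumes G: "algebraic_group G Y" and a: "a:carrier G"
 shows "kmorphism (perfection Y) (perfection Y) (%x. a *[G] x)"
proof -
 interpret comm_group G using G by (simp add: algebraic_group_def)
 have var: "variety Y" and top: "pts Y = carrier G"
  and mult: "kmorphism (kprod Y Y) Y (%(x, y). x *[G] y)" using G by (auto simp: algebraic_group_def)
 note X = variety_pspace[OF var]
 have kt: "ktop (perfection Y) = ktop Y" by (simp add: perfection_def)
 have regp: "reg (perfection Y) V f" if "reg Y V f" for V f
  using that by (auto simp: reg_perfection_iff intro!: exI[of _ 0])
 show ?thesis
 proof (rule kmorphismI_local[OF X X])
  fix x V g assume x: "x:pts (perfection Y)" and g: "reg (perfection Y) V g" and ax: "a *[G] x:V"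
  have xG: "x:carrier G" using x by (simp add: kt top)
  obtain e where e: "reg Y V (%x. g x ^ (CHAR('k) ^ e))" using g by (auto simp: reg_perfection_iff)
  define h where "h = restrict (%x. g x ^ (CHAR('k) ^ e)) V"
  have V: "opn Y V" "h:kreg Y V" using e by (auto simp: reg_def h_def)
  define P where "P = {z:topspace (kprod_top Y Y). (%(x, y). x *[G] y) z:V}"
  have axP: "(a, x):P" using a xG ax by (simp add: topspace_kprod[OF var] top P_def)
  have "restrict (h o (%(x, y). x *[G] y)) P:kreg (kprod Y Y) P"
   using mult V unfolding kmorphism_def P_def by (simp add: kprod_def)
  hence "ALL z:P. EX A B s t.
         opn Y A & opn Y B &
         s:tensor_functions Y Y A B & t:tensor_functions Y Y A B &
         z:A \<times> B & t z ~= 0 &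
         (ALL w:A \<times> B. t w ~= 0 --> w:P & restrict (h o (%(x, y). x *[G] y)) P w = s w / t w)"
   by (simp add: kprod_def)
  from bspec[OF this axP] obtain A B s t where AB: "opn Y A" "opn Y B"
         "s:tensor_functions Y Y A B" "t:tensor_functions Y Y A B"
         "(a, x):A \<times> B" "t (a, x) ~= 0"
         "ALL w:A \<times> B. t w ~= 0 --> w:P & restrict (h o (%(x, y). x *[G] y)) P w = s w / t w"
   by (elim exE conjE)
  have tens: "reg (perfection Y) B (%y. r (a, y))" if r: "r:tensor_functions Y Y A B" for r
  proof -
   obtain m f g where *: "r = (%(a, b). \<Sum>i<(m::nat). f i a * g i b)" "ALL i<m. f i:kreg Y A & g i:kreg Y B"
    using r unfolding tensor_functions_def by blast
   have "reg (perfection Y) B (g i)" if "i < m" for i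
    using * that AB(2) var by (intro regp reg_kreg) (auto simp: variety_def)
   thus ?thesis unfolding *(1) using AB(2)
    by (auto simp: kt intro!: reg_sum[OF X] reg_mult[OF X] reg_const[OF X])
  qed
  let ?W = "{y:B. t (a, y) ~= 0}"
  have W: "y:?W ==> a *[G] y:V & g (a *[G] y) ^ (CHAR('k) ^ e) = s (a, y) / t (a, y)" for y
   using bspec[OF AB(7), of "(a, y)"] AB(5) by (auto simp: P_def h_def)
  have "reg (perfection Y) ?W (%y. s (a, y) / t (a, y))"
   by (rule reg_divide[OF X tens[OF AB(3)] tens[OF AB(4)]])
  also have "reg (perfection Y) ?W (%y. s (a, y) / t (a, y)) =
    reg (perfection Y) ?W (%y. g (a *[G] y) ^ (CHAR('k) ^ e))"
   by (rule reg_cong) (use W in auto)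
  finally have "reg (perfection Y) ?W (%y. g (a *[G] y))" by (rule pspace_root[OF X])
  thus "EX W. x:W & (ALL y:W. a *[G] y:V) & reg (perfection Y) W (%y. g (a *[G] y))"
   using AB(5,6) W by (intro exI[of _ ?W]) auto
 qed (simp add: kt top a)
qed

lemma quasialg_pgroup:
 assumes "quasialg G X"
 shows "pgroup G X"
proof -
 obtain Y where Y: "algebraic_group G Y" "X = perfection Y" using assms unfolding quasialg_def by blast
 hence "kmorphism X X (%x. inv[G] x)" by (simp add: algebraic_group_def kmorphism_perfection)
 moreover have "pts X = carrier G" using Y by (simp add: algebraic_group_def perfection_def)
 ultimately show ?thesis using Y quasialg_translation[OF Y(1)] variety_pspace[of Y]
  unfolding pgroup_def by (auto simp: algebraic_group_def)
qed

end

section \<open>Definability and its consequences for homomorphisms and subgroups\<close>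

section \<open>Definable sets and relations\<close>

text \<open>Constructibility is demanded in every chart, not only in those of one atlas, so that
  sections, composites and images can be tested in whichever charts come up.\<close>

definition dset :: "('x, 'k::field) kspace => ('x => bool) => bool" where
 "dset X D <-> (ALL U n u. chart UNIV X U n u -->
   (EX P:constr (polyfun n). ALL x:U. D x <-> P (u x)))"

definition drel :: "('x, 'k::field) kspace => ('y, 'k) kspace => ('x => 'y => bool) => bool" where
 "drel X Y R <-> (ALL U n u V m v. chart UNIV X U n u --> chart UNIV Y V m v -->
   (EX P:constr (polyfun (n + m)). ALL x:U. ALL y:V. R x y <-> P (join n (u x) (v y))))"

lemma join_right: "join n x z (n + i) = z i"
 by (simp add: join_def)

lemma polyfun_if:
 "(b ==> f:polyfun n) ==> (~b ==> g:polyfun n) ==>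
  (%x. if b then f x else g x):polyfun n"
 by (cases b) auto

lemma dsetE:
 assumes "dset X D" "chart UNIV X U n u"
 obtains P where "P:constr (polyfun n)" "!!x. x:U ==> D x <-> P (u x)"
 using assms unfolding dset_def by blast

lemma drelE:
 assumes "drel X Y R" "chart UNIV X U n u" "chart UNIV Y V m v"
 obtains P where "P:constr (polyfun (n + m))"
  "!!x y. x:U ==> y:V ==> R x y <-> P (join n (u x) (v y))"
 using assms unfolding drel_def by blast

lemma drel_converse:
 fixes X :: "('x, 'k::field) kspace"
 assumes "drel X Y R"
 shows "drel Y X (%y x. R x y)"
 unfolding drel_def
proof (intro allI impI)
 fix V m v U n u assume c: "chart UNIV Y V m v" "chart UNIV X U n u"
 obtain P where P: "P:constr (polyfun (n + m))"
  "!!x y. x:U ==> y:V ==> R x y <-> P (join n (u x) (v y))"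
  by (rule drelE[OF assms c(2,1)]) blast
 define s :: "(nat => 'k) => nat => 'k" where "s = (%w i. if i < n then w (m + i) else w (i - n))"
 have "(%w. P (s w)):constr (polyfun (m + n))"
  by (rule constr_polyfun_subst[OF P(1)]) (auto simp: s_def intro!: polyfun_if polyfun.coord)
 moreover have "s (join m b a) i = join n a b i" if "i < n + m" for a b i
  using that by (auto simp: s_def join_def)
 hence "P (s (join m b a)) = P (join n a b)" for a b
  using constr_polyfun_cong[OF P(1)] by blast
 ultimately show "EX P:constr (polyfun (m + n)). ALL y:V. ALL x:U. R x y = P (join m (v y) (u x))"
  using P(2) by (intro bexI[of _ "%w. P (s w)"]) auto
qed

lemma drel_conj:
 assumes R: "drel X Y R" and S: "drel X Y S"
 shows "drel X Y (%x y. R x y & S x y)"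
 unfolding drel_def
proof (intro allI impI)
 fix V m v U n u assume c: "chart UNIV X U n u" "chart UNIV Y V m v"
 obtain P where P: "P:constr (polyfun (n + m))"
  "!!x y. x:U ==> y:V ==> R x y <-> P (join n (u x) (v y))"
  by (rule drelE[OF R c]) blast
 obtain Q where Q: "Q:constr (polyfun (n + m))"
  "!!x y. x:U ==> y:V ==> S x y <-> Q (join n (u x) (v y))"
  by (rule drelE[OF S c]) blast
 show "EX P:constr (polyfun (n + m)). ALL x:U. ALL y:V. (R x y & S x y) = P (join n (u x) (v y))"
  using P Q by (intro bexI[of _ "%w. P w & Q w"] constr_conj funalg_polyfun) auto
qed

lemma drel_of_dset:
 assumes "dset Y D"
 shows "drel X Y (%_. D)"
 unfolding drel_def
proof (intro allI impI)
 fix V m v U n u assume c: "chart UNIV X U n u" "chart UNIV Y V m v"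
 obtain P where P: "P:constr (polyfun m)" "!!y. y:V ==> D y <-> P (v y)"
  by (rule dsetE[OF assms c(2)]) blast
 have "(%w. P (%i. w (n + i))):constr (polyfun (n + m))"
  by (rule constr_polyfun_subst[OF P(1)]) (auto intro!: polyfun.coord)
 thus "EX P:constr (polyfun (n + m)). ALL x:U. ALL y:V. D y = P (join n (u x) (v y))"
  using P(2) by (intro bexI[of _ "%w. P (%i. w (n + i))"]) (auto simp: join_def)
qed

lemma dset_section:
 assumes at: "atlas UNIV X" and x: "x:pts X" and R: "drel X Y R"
 shows "dset Y (R x)"
 unfolding dset_def
proof (intro allI impI)
 fix V m v assume c: "chart UNIV Y V m v"
 obtain U n u where U: "chart UNIV X U n u" "x:U" by (rule atlas_chart_at[OF at x])
 obtain P where P: "P:constr (polyfun (n + m))"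
  "!!x y. x:U ==> y:V ==> R x y <-> P (join n (u x) (v y))"
  by (rule drelE[OF R U(1) c]) blast
 have "(%w. P (join n (u x) w)):constr (polyfun m)"
  by (rule constr_polyfun_subst[OF P(1)]) (auto simp: join_def intro!: polyfun_if polyfun.const polyfun.coord)
 thus "EX P:constr (polyfun m). ALL y:V. R x y = P (v y)"
  using P(2)[OF U(2)] by (intro bexI[of _ "%w. P (join n (u x) w)"]) auto
qed

lemma dset_not: "dset X D ==> dset X (%x. ~D x)"
 unfolding dset_def
proof (intro allI impI)
 fix U n u assume D: "ALL U n u. chart UNIV X U n u --> (EX P:constr (polyfun n). ALL x:U. D x = P (u x))"
  and "chart UNIV X U n u"
 then obtain P where "P:constr (polyfun n)" "ALL x:U. D x = P (u x)" by blast
 thus "EX P:constr (polyfun n). ALL x:U. (~D x) = P (u x)"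
  by (intro bexI[of _ "%t. ~P t"] constr_not funalg_polyfun) auto
qed

text \<open>Noetherianity replaces the equations of the chart by finitely many. Points are compared
  in their first \<open>n\<close> coordinates only, since constructible predicates over
  \<open>polyfun n\<close> do not see the others.\<close>

lemma chart_locus:
 assumes "chart E X U n u"
 obtains L where "L:constr (polyfun n)" "!!t. L t <-> (EX x:U. ALL i<n. u x i = t i)"
proof -
 obtain F where F: "F <= polyfun n" "u ` U = zero_locus n F" using chart_image[OF assms] by blast
 obtain F0 where F0: "F0 <= F" "finite F0" "!!x. (ALL f:F0. f x = 0) ==> (ALL f:F. f x = 0)"
  by (rule finite_zero_locus[OF F(1)]) blast
 define L where "L = (%t. ALL f:F0. f t = 0)"
 have "L:constr (polyfun n)" unfolding L_def
  using F0 F by (intro constr_ball constr_zero funalg_polyfun) auto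
 moreover have "L t <-> (EX x:U. ALL i<n. u x i = t i)" for t
 proof
  assume "L t"
  hence "ALL f:F. f t = 0" using F0(3) by (simp add: L_def)
  moreover have "f (restrict t {..<n}) = f t" if "f:F" for f
   using F(1) that by (intro polyfun_cong[of f n]) auto
  ultimately have "ALL f:F. f (restrict t {..<n}) = 0" by metis
  hence "restrict t {..<n}:zero_locus n F" by (auto simp: zero_locus_def)
  then obtain x where "x:U" "u x = restrict t {..<n}" using F(2) by (metis imageE)
  thus "EX x:U. ALL i<n. u x i = t i" by (intro bexI[of _ x]) auto
 next
  assume "EX x:U. ALL i<n. u x i = t i"
  then obtain x where x: "x:U" "ALL i<n. u x i = t i" by blast
  hence "u x:zero_locus n F" using F(2) by blast
  moreover have "f t = f (u x)" if "f:F" for f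
   using F(1) that x(2) by (intro polyfun_cong[of f n]) auto
  ultimately have "ALL f:F. f t = 0" unfolding zero_locus_def by (metis (mono_tags, lifting) mem_Collect_eq)
  thus "L t" using F0(1) by (auto simp: L_def)
 qed
 ultimately show thesis by (rule that)
qed

text \<open>The intermediate point ranges over finitely many charts of \<open>Y\<close>; in each it
  is a tuple of coordinates satisfying the equations of the chart, and this tuple is removed by
  quantifier elimination.\<close>

lemma drel_comp:
 fixes X :: "('x, 'k::alg_closed_field) kspace" and Y :: "('y, 'k) kspace" and Z :: "('z, 'k) kspace"
 assumes at: "atlas UNIV Y" and R: "drel X Y R" and S: "drel Y Z S"
 shows "drel X Z (%x z. EX y:pts Y. R x y & S y z)"
 unfolding drel_def
proof (intro allI impI)
 fix U n u V m v assume c: "chart UNIV X U n u" "chart UNIV Z V m v"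
 obtain C where C: "finite C" "ALL (U, n, u):C. chart UNIV Y U n u" "pts Y = \<Union>(fst ` C)"
  using at unfolding atlas_def by (elim exE conjE)
 have "EX P. P:constr (polyfun (n + m)) &
   (ALL x:U. ALL z:V. (EX y:fst d. R x y & S y z) = P (join n (u x) (v z)))" if d: "d:C" for d
 proof -
  obtain W l w where dW: "d = (W, l, w)" by (cases d)
  have W: "chart UNIV Y W l w" using bspec[OF C(2) d] by (simp add: dW)
  obtain P where P: "P:constr (polyfun (n + l))"
   "!!x y. x:U ==> y:W ==> R x y <-> P (join n (u x) (w y))"
   by (rule drelE[OF R c(1) W]) blast
  obtain Q where Q: "Q:constr (polyfun (l + m))"
   "!!x y. x:W ==> y:V ==> S x y <-> Q (join l (w x) (v y))"
   by (rule drelE[OF S W c(2)]) blast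
  obtain L where L: "L:constr (polyfun l)" "!!t. L t <-> (EX x:W. ALL i<l. w x i = t i)"
   by (rule chart_locus[OF W]) blast
  \<comment> \<open>The eliminated coordinates must come last, so the blocks are those of
    \<open>x\<close>, then \<open>z\<close>, then \<open>y\<close>; \<open>s1\<close>,
    \<open>s2\<close> and \<open>s3\<close> pick out the pair of \<open>x\<close> and
    \<open>y\<close>, the pair of \<open>y\<close> and \<open>z\<close>, and \<open>y\<close>
    alone.\<close>
  define s1 :: "(nat => 'k) => nat => 'k" where "s1 = (%T i. if i < n then T i else T (m + i))"
  define s2 :: "(nat => 'k) => nat => 'k" where "s2 = (%T i. if i < l then T (n + m + i) else T (n + (i - l)))"
  define s3 :: "(nat => 'k) => nat => 'k" where "s3 = (%T i. T (n + m + i))"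
  have "(%T. L (s3 T) & P (s1 T) & Q (s2 T)):constr (polyfun (n + m + l))"
   by (intro constr_conj funalg_polyfun constr_polyfun_subst[OF P(1)] constr_polyfun_subst[OF Q(1)]
     constr_polyfun_subst[OF L(1)]) (auto simp: s1_def s2_def s3_def intro!: polyfun_if polyfun.coord)
  from constr_ex_join[OF this] have ex: "(%T. EX t. L (s3 (join (n + m) T t)) & P (s1 (join (n + m) T t)) &
   Q (s2 (join (n + m) T t))):constr (polyfun (n + m))" .
  have PQ: "P (s1 (join (n + m) (join n a b) t)) = P (join n a t)"
    "Q (s2 (join (n + m) (join n a b) t)) = Q (join l t b)" "s3 (join (n + m) (join n a b) t) = t" for a b t
   by (rule constr_polyfun_cong[OF P(1)], force simp: s1_def join_def)
     (rule constr_polyfun_cong[OF Q(1)], force simp: s2_def join_def, force simp: s3_def join_def)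
  have "(EX y:W. R x y & S y z) <-> (EX t. L t & P (join n (u x) t) & Q (join l t (v z)))"
   if x: "x:U" and z: "z:V" for x z
  proof
   assume "EX y:W. R x y & S y z"
   thus "EX t. L t & P (join n (u x) t) & Q (join l t (v z))" using P(2)[OF x] Q(2)[OF _ z] L(2) by blast
  next
   assume "EX t. L t & P (join n (u x) t) & Q (join l t (v z))"
   then obtain t where t: "L t" "P (join n (u x) t)" "Q (join l t (v z))" by blast
   then obtain y where y: "y:W" "ALL i<l. w y i = t i" using L(2) by blast
   have "P (join n (u x) t) = P (join n (u x) (w y))"
    by (rule constr_polyfun_cong[OF P(1)]) (use y(2) in \<open>auto simp: join_def\<close>)
   moreover have "Q (join l t (v z)) = Q (join l (w y) (v z))"
    by (rule constr_polyfun_cong[OF Q(1)]) (use y(2) in \<open>auto simp: join_def\<close>)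
   ultimately show "EX y:W. R x y & S y z" using P(2)[OF x y(1)] Q(2)[OF y(1) z] t y(1) by blast
  qed
  thus ?thesis using ex
   by (intro exI[of _ "%T. EX t. L (s3 (join (n + m) T t)) & P (s1 (join (n + m) T t)) & Q (s2 (join (n + m) T t))"])
     (simp add: PQ dW)
 qed
 hence "ALL d:C. EX P. P:constr (polyfun (n + m)) &
   (ALL x:U. ALL z:V. (EX y:fst d. R x y & S y z) = P (join n (u x) (v z)))" by blast
 from bchoice[OF this] obtain P where P: "ALL d:C. P d:constr (polyfun (n + m)) &
   (ALL x:U. ALL z:V. (EX y:fst d. R x y & S y z) = P d (join n (u x) (v z)))" ..
 have "(%T. EX d:C. P d T):constr (polyfun (n + m))"
  using P by (intro constr_bex funalg_polyfun C(1)) auto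
 moreover have "(EX y:pts Y. R x y & S y z) = (EX d:C. P d (join n (u x) (v z)))"
  if "x:U" "z:V" for x z
  using P that unfolding C(3) by auto
 ultimately show "EX P:constr (polyfun (n + m)). ALL x:U. ALL z:V.
   (EX y:pts Y. R x y & S y z) = P (join n (u x) (v z))"
  by (intro bexI[of _ "%T. EX d:C. P d T"]) auto
qed

lemma dset_const: "dset X (%_. b)"
 unfolding dset_def by (intro allI impI bexI[OF _ constr_const[OF funalg_polyfun, of b]]) simp

lemma dset_image:
 fixes X :: "('x, 'k::alg_closed_field) kspace" and Y :: "('y, 'k) kspace"
 assumes X: "atlas UNIV X" and Y: "atlas UNIV Y" "pts Y ~= {}" and R: "drel X Y R"
 shows "dset Y (%y. EX x:pts X. R x y)"
proof -
 obtain y0 where y0: "y0:pts Y" using Y(2) by blast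
 \<comment> \<open>An image is the section, at any base point, of the composite of the full relation
   with \<open>R\<close>.\<close>
 have "drel Y Y (%y' y. EX x:pts X. True & R x y)"
  by (rule drel_comp[OF X drel_of_dset[OF dset_const] R])
 from dset_section[OF Y(1) y0 this] show ?thesis by simp
qed

text \<open>Inside a chart an open set is a union of basic open sets, and by quasi-compactness
  finitely many suffice.\<close>

lemma dset_open:
 assumes V: "opn X V"
 shows "dset X (%x. x:V)"
 unfolding dset_def
proof (intro allI impI)
 fix U n u assume c: "chart UNIV X U n u"
 define A where "A = {a:polyfun n. {y:U. a (u y) ~= 0} <= V}"
 have "EX \<W> <= (%a. {y:U. a (u y) ~= 0}) ` A. finite \<W> & \<Union>\<W> = \<Union>((%a. {y:U. a (u y) ~= 0}) ` A)"
  by (rule chart_quasi_compact[OF c]) (auto simp: A_def chart_nonvanishing[OF c])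
 then obtain \<W> where W: "\<W> <= (%a. {y:U. a (u y) ~= 0}) ` A" "finite \<W>"
   "\<Union>\<W> = \<Union>((%a. {y:U. a (u y) ~= 0}) ` A)" by (elim exE conjE)
 obtain B where B: "B <= A" "finite B" "\<W> = (%a. {y:U. a (u y) ~= 0}) ` B"
  using finite_subset_image[OF W(2,1)] by blast
 have VU: "opn X (V Int U)" using V chart_open[OF c] by blast
 have "x:V <-> (EX a:B. a (u x) ~= 0)" if x: "x:U" for x
 proof
  assume "x:V"
  then obtain a where "a:polyfun n" "a (u x) ~= 0" "{y:U. a (u y) ~= 0} <= V Int U"
   using chart_basis[OF c VU, of x] x by blast
  hence "x:\<Union>((%a. {y:U. a (u y) ~= 0}) ` A)" using x by (auto simp: A_def)
  thus "EX a:B. a (u x) ~= 0" using W(3) B(3) by auto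
 qed (use B(1) x in \<open>auto simp: A_def\<close>)
 moreover have "(%t. EX a:B. a t ~= 0):constr (polyfun n)"
  using B by (intro constr_bex constr_nonzero funalg_polyfun) (auto simp: A_def)
 ultimately show "EX P:constr (polyfun n). ALL x:U. (x:V) = P (u x)"
  by (intro bexI[of _ "%t. EX a:B. a t ~= 0"]) auto
qed

lemma dset_closed:
 assumes "closedin (ktop X) K"
 shows "dset X (%x. x:K)"
proof -
 have "dset X (%x. ~x:pts X - K)"
  using assms by (intro dset_not dset_open) (auto simp: closedin_def)
 hence d: "dset X (%x. ~x:pts X - K)" .
 show ?thesis unfolding dset_def
 proof (intro allI impI)
  fix U n u assume c: "chart UNIV X U n u"
  obtain P where P: "P:constr (polyfun n)" "!!x. x:U ==> (~x:pts X - K) <-> P (u x)"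
   by (rule dsetE[OF d c]) blast
  have "x:U ==> x:pts X" for x using chart_open[OF c] openin_subset by blast
  thus "EX P:constr (polyfun n). ALL x:U. (x:K) <-> P (u x)"
   using P by (intro bexI[of _ P]) auto
 qed
qed

context pos_char
begin

text \<open>On a finite cover some p-power of each target coordinate is a fraction in the source
  coordinates, which gives polynomial equations for the graph; they determine the target coordinates
  themselves because Frobenius is injective.\<close>

lemma drel_kmorphism:
 fixes X :: "('x, 'k) kspace" and Y :: "('y, 'k) kspace"
 assumes X: "pspace X" and Y: "pspace Y" and f: "kmorphism X Y f"
 shows "drel X Y (%x y. f x = y)"
 unfolding drel_def
proof (intro allI impI)
 fix U n u V m v assume c: "chart UNIV X U n u" "chart UNIV Y V m v"
 define q where "q = (%e. CHAR('k) ^ e)"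
 define W where "W = {x:pts X. f x:V}"
 have W: "opn X W" using f chart_open[OF c(2)] by (auto simp: W_def kmorphism_def continuous_map_def)
 hence WU: "opn X (W Int U)" using chart_open[OF c(1)] by blast
 have "EX a b e. a:polyfun n & b:polyfun n & b (u x) ~= 0 &
   (ALL y:U. b (u y) ~= 0 --> v (f y) i ^ q e = a (u y) / b (u y))" if x: "x:W Int U" and i: "i < m" for x i
 proof -
  have "reg X W (%x. v (f x) i)" unfolding W_def by (rule kmorphism_reg[OF f chart_coord[OF Y c(2) i]])
  with x obtain a b e where "a:polyfun n" "b:polyfun n" "b (u x) ~= 0"
   "!!y. y:U ==> b (u y) ~= 0 ==> y:W & v (f y) i ^ (CHAR('k) ^ e) = a (u y) / b (u y)"
   using chart_reg_form[OF pspace_sheaf[OF X] c(1), of W "%x. v (f x) i" x thesis] by blast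
  thus ?thesis unfolding q_def by (intro exI[of _ a] exI[of _ b] exI[of _ e]) auto
 qed
 then obtain a b e where abe: "!!x i. x:W Int U ==> i < m ==> a x i:polyfun n & b x i:polyfun n & b x i (u x) ~= 0 &
   (ALL y:U. b x i (u y) ~= 0 --> v (f y) i ^ q (e x i) = a x i (u y) / b x i (u y))"
  by metis
 have "ALL x:W Int U. EX c. c:polyfun n & c (u x) ~= 0 & {y:U. c (u y) ~= 0} <= W Int U"
  using chart_basis[OF c(1) WU] by blast
 from bchoice[OF this] obtain d where d: "!!x. x:W Int U ==> d x:polyfun n & d x (u x) ~= 0 &
   {y:U. d x (u y) ~= 0} <= W Int U" by blast
 \<comment> \<open>The factor \<open>d x\<close> keeps the neighbourhood inside
   \<open>W Int U\<close>; the others are the denominators of all \<open>m\<close>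
   coordinates.\<close>
 define B where "B = (%x t. d x t * (\<Prod>i<m. b x i t))"
 have B: "B x:polyfun n" "B x (u x) ~= 0" "{y:U. B x (u y) ~= 0} <= W Int U" if "x:W Int U" for x
 proof -
  show "{y:U. B x (u y) ~= 0} <= W Int U" using d[OF that] unfolding B_def by auto
 qed (use that abe d in \<open>auto simp: B_def intro!: funalg_mult funalg_prod funalg_polyfun\<close>)
 have "EX \<W> <= (%x. {y:U. B x (u y) ~= 0}) ` (W Int U). finite \<W> & \<Union>\<W> = \<Union>((%x. {y:U. B x (u y) ~= 0}) ` (W Int U))"
  by (rule chart_quasi_compact[OF c(1)]) (use B(1) chart_nonvanishing[OF c(1)] in auto)
 then obtain \<W> where \<W>: "\<W> <= (%x. {y:U. B x (u y) ~= 0}) ` (W Int U)" "finite \<W>"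
   "\<Union>\<W> = \<Union>((%x. {y:U. B x (u y) ~= 0}) ` (W Int U))" by (elim exE conjE)
 obtain X0 where X0: "X0 <= W Int U" "finite X0" "\<W> = (%x. {y:U. B x (u y) ~= 0}) ` X0"
  using finite_subset_image[OF \<W>(2,1)] by blast
 have cover: "EX x0:X0. B x0 (u x) ~= 0" if "x:W Int U" for x
 proof -
  have "x:\<Union>((%x. {y:U. B x (u y) ~= 0}) ` (W Int U))" using that B(2) by auto
  thus ?thesis using \<W>(3) X0(3) by auto
 qed
 define P where "P = (%T. EX x:X0. B x T ~= 0 & (ALL i:{..<m}. b x i T * T (n + i) ^ q (e x i) - a x i T = 0))"
 have lift: "g:polyfun n ==> g:polyfun (n + m)" for g :: "(nat => 'k) => 'k" by (rule polyfun_mono) auto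
 have mem: "B x:polyfun (n + m)" "i < m ==> a x i:polyfun (n + m)" "i < m ==> b x i:polyfun (n + m)"
  if "x:X0" for x i
  using that X0(1) B(1)[of x] abe[of x i] by (auto intro!: lift)
 have "(%T. b x i T * T (n + i) ^ q (e x i) - a x i T):polyfun (n + m)" if "x:X0" "i < m" for x i
  by (intro funalg_diff[OF funalg_polyfun] funalg_mult[OF funalg_polyfun] funalg_power[OF funalg_polyfun] mem that)
    (use that in \<open>auto intro: polyfun.coord\<close>)
 hence "P:constr (polyfun (n + m))" unfolding P_def
  using X0(2) mem(1) by (intro constr_bex constr_conj constr_ball constr_nonzero constr_zero funalg_polyfun) auto
 moreover have "f x = y <-> P (join n (u x) (v y))" if x: "x:U" and y: "y:V" for x y
 proof -
  have ev: "g (join n (u x) (v y)) = g (u x)" if "g:polyfun n" for g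
   using that by (rule polyfun_cong) (simp add: join_def)
  have ev2: "B x0 (join n (u x) (v y)) = B x0 (u x)" "i < m ==> a x0 i (join n (u x) (v y)) = a x0 i (u x)"
    "i < m ==> b x0 i (join n (u x) (v y)) = b x0 i (u x)" if "x0:X0" for x0 i
  proof -
   have "x0:W Int U" using that X0(1) by blast
   thus "B x0 (join n (u x) (v y)) = B x0 (u x)" "i < m ==> a x0 i (join n (u x) (v y)) = a x0 i (u x)"
    "i < m ==> b x0 i (join n (u x) (v y)) = b x0 i (u x)"
    using B(1)[of x0] abe[of x0 i] by (auto intro!: ev)
  qed
  have P: "P (join n (u x) (v y)) <-> (EX x0:X0. B x0 (u x) ~= 0 & (ALL i<m. b x0 i (u x) * v y i ^ q (e x0 i) = a x0 i (u x)))"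
   unfolding P_def by (intro bex_cong refl) (auto simp: ev2 join_right)
  have bnz: "b x0 i (u x) ~= 0" if "B x0 (u x) ~= 0" "i < m" for x0 i
   using that by (auto simp: B_def)
  have eq: "v (f x) i ^ q (e x0 i) = a x0 i (u x) / b x0 i (u x)" if "x0:X0" "B x0 (u x) ~= 0" "i < m" for x0 i
   using abe[of x0 i] X0(1) bnz that x by blast
  show ?thesis
  proof
   assume fx: "f x = y"
   hence "x:W Int U" using x y chart_open[OF c(1)] openin_subset by (auto simp: W_def)
   from cover[OF this] obtain x0 where "x0:X0" "B x0 (u x) ~= 0" by blast
   thus "P (join n (u x) (v y))" unfolding P using eq bnz fx by (intro bexI[of _ x0]) auto
  next
   assume "P (join n (u x) (v y))"
   then obtain x0 where x0: "x0:X0" "B x0 (u x) ~= 0" "ALL i<m. b x0 i (u x) * v y i ^ q (e x0 i) = a x0 i (u x)"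
    unfolding P by blast
   hence fxV: "f x:V" using B(3)[of x0] X0(1) x by (auto simp: W_def)
   have "v y i = v (f x) i" if "i < m" for i
   proof (rule frob_inj[where e="e x0 i"])
    have "v y i ^ q (e x0 i) = a x0 i (u x) / b x0 i (u x)"
     using x0(3) that bnz[OF x0(2) that] by (auto simp: field_simps)
    thus "v y i ^ (CHAR('k) ^ e x0 i) = v (f x) i ^ (CHAR('k) ^ e x0 i)"
     using eq[OF x0(1,2) that] by (simp add: q_def)
   qed
   moreover obtain F where "v ` V = zero_locus m F" using chart_image[OF c(2)] by blast
   hence "v y:extensional {..<m}" "v (f x):extensional {..<m}"
    using fxV y by (auto simp: zero_locus_def PiE_def)
   ultimately have "v y = v (f x)" by (intro extensionalityI[of _ "{..<m}"]) auto
   thus "f x = y" using inj_onD[OF chart_inj[OF c(2)], of "f x" y] fxV y by simp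
  qed
 qed
 ultimately show "EX P:constr (polyfun (n + m)). ALL x:U. ALL y:V. (f x = y) = P (join n (u x) (v y))"
  by (intro bexI[of _ P]) auto
qed

end

section \<open>Generic behaviour of constructible predicates\<close>

text \<open>For each of the finitely many polynomials occurring in \<open>P\<close>, either it
  vanishes on the part of the open set in \<open>K\<close>, or its non-vanishing locus is a smaller
  open set still meeting \<open>K\<close>. Below, \<open>K\<close> is \<open>UNIV\<close> or the
  closure of a subgroup.\<close>

lemma shrink_constr:
 assumes c: "chart E X U n u" and P: "P:constr (polyfun n)"
  and V: "opn X V" "V <= U" "V Int K ~= {}"
 obtains V' where "opn X V'" "V' <= V" "V' Int K ~= {}"
  "(ALL x:V' Int K. P (u x)) | (ALL x:V' Int K. ~P (u x))"
proof -
 have step: "EX V'. opn X V' & V' <= V & V' Int K ~= {} &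
   (ALL a:A. (ALL x:V' Int K. a (u x) = 0) | (ALL x:V' Int K. a (u x) ~= 0))"
  if "finite A" "A <= polyfun n" for A
  using that
 proof (induction A rule: finite_induct)
  case empty
  thus ?case using V by blast
 next
  case (insert a A)
  then obtain V' where V': "opn X V'" "V' <= V" "V' Int K ~= {}"
   "ALL a:A. (ALL x:V' Int K. a (u x) = 0) | (ALL x:V' Int K. a (u x) ~= 0)" by auto
  show ?case
  proof (cases "ALL x:V' Int K. a (u x) = 0")
   case True
   thus ?thesis using V' by (intro exI[of _ V']) auto
  next
   case False
   have "opn X (V' Int {y:U. a (u y) ~= 0})"
    using V'(1) chart_nonvanishing[OF c, of a] insert.prems by auto
   moreover have "V' Int {y:U. a (u y) ~= 0} Int K ~= {}" using False V'(2) V(2) by auto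
   ultimately show ?thesis using V' by (intro exI[of _ "V' Int {y:U. a (u y) ~= 0}"]) auto
  qed
 qed
 obtain L where L: "ALL p:set L. set (fst p) <= polyfun n & snd p:polyfun n" "P = dnf L"
  using P by (rule constrE)
 define A where "A = (UN p:set L. insert (snd p) (set (fst p)))"
 have "finite A" "A <= polyfun n" using L(1) by (auto simp: A_def)
 from step[OF this] obtain V' where V': "opn X V'" "V' <= V" "V' Int K ~= {}"
   "ALL a:A. (ALL x:V' Int K. a (u x) = 0) | (ALL x:V' Int K. a (u x) ~= 0)" by blast
 have eq: "(a (u x) = 0) = (a (u y) = 0)" if "a:A" "x:V' Int K" "y:V' Int K" for a x y
  using V'(4) that by blast
 have "P (u x) = P (u y)" if "x:V' Int K" "y:V' Int K" for x y
  unfolding L(2) dnf_def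
 proof (intro bex_cong refl)
  fix p assume "p:set L"
  thus "((ALL f:set (fst p). f (u x) = 0) & snd p (u x) ~= 0) = ((ALL f:set (fst p). f (u y) = 0) & snd p (u y) ~= 0)"
   using eq that by (auto simp: A_def)
 qed
 thus thesis using that[OF V'(1-3)] by blast
qed

text \<open>By \<open>shrink_constr\<close> a piece either holds on a nonempty open set or can be
  struck from the cover after shrinking.\<close>

lemma shrink_cover:
 assumes c: "chart E X U n u" and I: "finite I" and P: "!!i. i:I ==> P i:constr (polyfun n)"
  and V: "opn X V" "V <= U" "V ~= {}" and cover: "!!x. x:V ==> EX i:I. P i (u x)"
 obtains V' i where "opn X V'" "V' <= V" "V' ~= {}" "i:I" "!!x. x:V' ==> P i (u x)"
proof -
 have "EX V' i. opn X V' & V' <= V & V' ~= {} & i:I & (ALL x:V'. P i (u x))"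
  using I P V cover
 proof (induction I arbitrary: V rule: finite_induct)
  case (insert i I)
  obtain V' where V': "opn X V'" "V' <= V" "V' Int UNIV ~= {}"
   "(ALL x:V' Int UNIV. P i (u x)) | (ALL x:V' Int UNIV. ~P i (u x))"
   by (rule shrink_constr[OF c, of "P i" V UNIV]) (use insert.prems in auto)
  show ?case
  proof (cases "ALL x:V'. P i (u x)")
   case True
   thus ?thesis using V' by (intro exI[of _ V'] exI[of _ i]) auto
  next
   case False
   hence "EX j:I. P j (u x)" if "x:V'" for x using V'(4) insert.prems(5)[of x] that V'(2) by auto
   hence "EX V'' j. opn X V'' & V'' <= V' & V'' ~= {} & j:I & (ALL x:V''. P j (u x))"
    using V' insert.prems(1,3) by (intro insert.IH) auto
   thus ?thesis using V'(2) by blast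
  qed
 qed auto
 thus thesis using that by blast
qed

section \<open>Functions with definable graph are generically regular\<close>

context pos_char
begin

text \<open>Compare coefficients at degree \<open>q\<close> in
  \<open>(1 + y) ^ (q * m) = (1 + y ^ q) ^ m\<close>, where \<open>q = CHAR('k) ^ e\<close>: the
  right side gives \<open>m\<close>, which is nonzero in the field.\<close>

lemma binomial_prime_power_nonzero:
 assumes "~CHAR('k) dvd m"
 shows "of_nat ((CHAR('k) ^ e * m) choose (CHAR('k) ^ e)) ~= (0 :: 'k)"
proof -
 define q where "q = CHAR('k) ^ e"
 have q: "q > 0" using char_pos by (simp add: q_def)
 have "([:1, 1:] :: 'k poly) = monom 1 1 + 1" by (simp add: monom_altdef one_pCons)
 also have "... ^ q = monom 1 1 ^ q + 1 ^ q"
  unfolding q_def by (rule freshmans_dream') (simp_all add: prime_char)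
 finally have lin: "([:1, 1:] :: 'k poly) ^ q = 1 + monom 1 q" by (simp add: monom_power add.commute)
 have "coeff ((1 + monom 1 q) ^ m :: 'k poly) 0 = 1 & coeff ((1 + monom 1 q) ^ m :: 'k poly) q = of_nat m" for m
  using q by (induction m) (auto simp: distrib_right coeff_monom_mult coeff_1)
 hence "coeff (([:1, 1:] :: 'k poly) ^ (q * m)) q = of_nat m" by (simp add: power_mult lin)
 moreover have "q <= q * m" using assms by (cases m) auto
 ultimately have "of_nat ((q * m) choose q) = (of_nat m :: 'k)"
  using coeff_linear_poly_power[of q "q * m" "1 :: 'k" 1] by simp
 thus ?thesis using assms by (simp add: q_def of_nat_eq_0_iff_char_dvd)
qed

text \<open>Take the largest index whose coefficient is not identically zero on \<open>V\<close>;
  wherever that coefficient is nonzero, the index is the degree.\<close>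

lemma generic_degree:
 assumes c: "chart E X U n u" and R: "R:polys (polyfun n)" and V: "opn X V" "V <= U"
  and x: "x:V" "R (u x) ~= 0"
 obtains V' i where "opn X V'" "V' <= V" "V' ~= {}"
  "!!x. x:V' ==> R (u x) ~= 0 & degree (R (u x)) = i"
proof -
 obtain d where d: "!!t i. i >= d ==> coeff (R t) i = 0" using polys_bound[OF R] by auto
 define I where "I = {i. EX x:V. coeff (R (u x)) i ~= 0}"
 have "I <= {..<d}" using d by (force simp: I_def not_less[symmetric])
 hence fin: "finite I" by (rule finite_subset) auto
 have "degree (R (u x)):I" using x by (auto simp: I_def intro!: bexI[of _ x])
 hence ne: "I ~= {}" by blast
 define i where "i = Max I"
 have i: "i:I" "!!j. j:I ==> j <= i" using Max_in[OF fin ne] fin by (auto simp: i_def)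
 define V' where "V' = V Int {y:U. coeff (R (u y)) i ~= 0}"
 show thesis
 proof (rule that)
  show "opn X V'" unfolding V'_def
   using V(1) chart_nonvanishing[OF c polys_coeff[OF R]] by blast
  show "V' ~= {}" using i(1) V(2) by (auto simp: V'_def I_def)
  fix x assume x: "x:V'"
  have "coeff (R (u x)) j = 0" if "j > i" for j
   using i(2)[of j] that x by (auto simp: I_def V'_def)
  hence "degree (R (u x)) <= i" by (intro degree_le) auto
  moreover have "coeff (R (u x)) i ~= 0" using x by (auto simp: V'_def)
  ultimately show "R (u x) ~= 0 & degree (R (u x)) = i" by (auto simp: le_degree intro: antisym)
 qed (auto simp: V'_def)
qed

lemma single_root_poly:
 fixes P :: "'k poly"
 assumes "P ~= 0" "!!y. poly P y = 0 ==> y = a"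
 shows "P = smult (lead_coeff P) ([:-a, 1:] ^ degree P)"
proof -
 obtain M where M: "size M = degree P" "P = smult (lead_coeff P) (\<Prod>x\<in>#M. [:-x, 1:])"
  using alg_closed_imp_factorization[OF assms(1)] by blast
 have "x = a" if "x:# M" for x
 proof -
  have "[:-x, 1:] dvd (\<Prod>x\<in>#M. [:-x, 1:])" using that by (intro dvd_prod_mset) auto
  hence "[:-x, 1:] dvd P" by (metis M(2) dvd_smult)
  thus ?thesis by (intro assms(2)) (simp add: poly_eq_0_iff_dvd)
 qed
 hence "M = replicate_mset (degree P) a" by (metis M(1) set_mset_subset_singletonD singleton_iff subsetI)
 thus ?thesis using M(2) by simp
qed

text \<open>Having a single root, \<open>D (u x)\<close> is its leading coefficient times the
  \<open>d\<close>-th power of a linear factor. With \<open>q\<close> the largest power of the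
  characteristic dividing \<open>d\<close>, its coefficient at \<open>d - q\<close> is
  \<open>\<phi> x ^ q\<close> times the leading coefficient and the nonzero constant
  \<open>\<kappa>\<close>. So a p-power of \<open>\<phi>\<close> is regular, and perfectness
  extracts the root.\<close>

lemma purely_inseparable_generic:
 fixes X :: "('x, 'k) kspace"
 assumes X: "pspace X" and c: "chart E X U n u" and V: "opn X V" "V <= U"
  and D: "D:polys (polyfun n)" "!!x. x:V ==> D (u x) ~= 0 & degree (D (u x)) = d"
  and d: "d > 0" and root: "!!x y. x:V ==> poly (D (u x)) y = 0 ==> y = \<phi> x"
 shows "reg X V \<phi>"
proof -
 define e where "e = multiplicity (CHAR('k)) d"
 have "~is_unit (CHAR('k))" using prime_char by auto
 moreover have "d ~= 0" using d by simp
 ultimately obtain m where m: "d = CHAR('k) ^ e * m" "~CHAR('k) dvd m"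
  unfolding e_def by (rule_tac multiplicity_decompose'[of d "CHAR('k)"]) auto
 define q where "q = CHAR('k) ^ e"
 have q: "q <= d" using m d by (cases m) (auto simp: q_def)
 define \<kappa> where "\<kappa> = (of_nat (d choose (d - q)) * (-1) ^ q :: 'k)"
 have \<kappa>: "\<kappa> ~= 0"
  using binomial_prime_power_nonzero[OF m(2), of e] binomial_symmetric[OF q] m(1) by (simp add: \<kappa>_def q_def)
 have eq: "coeff (D (u x)) d * \<kappa> ~= 0 &
  coeff (D (u x)) (d - q) / (coeff (D (u x)) d * \<kappa>) = \<phi> x ^ (CHAR('k) ^ e)" if x: "x:V" for x
 proof -
  have D': "D (u x) = smult (coeff (D (u x)) d) ([:-\<phi> x, 1:] ^ d)"
   using single_root_poly[of "D (u x)" "\<phi> x"] D(2)[OF x] root[OF x] by simp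
  have nz: "coeff (D (u x)) d ~= 0" using D(2)[OF x] by auto
  have "coeff (D (u x)) (d - q) = coeff (D (u x)) d * coeff ([:-\<phi> x, 1:] ^ d) (d - q)"
   by (subst D') simp
  also have "coeff ([:-\<phi> x, 1:] ^ d) (d - q) = of_nat (d choose (d - q)) * (- \<phi> x) ^ q"
   using q by (subst coeff_linear_poly_power) auto
  also have "(- \<phi> x) ^ q = (-1) ^ q * \<phi> x ^ q" by (metis mult_minus1 power_mult_distrib)
  finally show ?thesis using nz \<kappa> by (simp add: \<kappa>_def q_def)
 qed
 have coeff: "reg X V (%x. coeff (D (u x)) i)" for i
  by (rule reg_polyfun[OF X V(1) _ polys_coeff[OF D(1)]])
    (rule reg_mono[OF pspace_sheaf[OF X] chart_coord[OF X c] V])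
 have "reg X {x:V. coeff (D (u x)) d * \<kappa> ~= 0} (%x. coeff (D (u x)) (d - q) / (coeff (D (u x)) d * \<kappa>))"
  by (intro reg_divide[OF X] reg_mult[OF X] reg_const[OF X V(1)] coeff)
 also have "{x:V. coeff (D (u x)) d * \<kappa> ~= 0} = V" using eq by auto
 also have "reg X V (%x. coeff (D (u x)) (d - q) / (coeff (D (u x)) d * \<kappa>)) =
   reg X V (%x. \<phi> x ^ (CHAR('k) ^ e))" by (rule reg_cong) (use eq in auto)
 finally show ?thesis by (rule pspace_root[OF X])
qed

text \<open>Euclid's algorithm without a function field. \<open>D\<close> has the least generic
  degree among polynomials with root \<open>\<phi> x\<close>, hence divides every \<open>P\<close>
  over a nonempty open set. \<open>E\<close> is a generic greatest common divisor of
  \<open>D\<close> and \<open>Q\<close>; it does not vanish at \<open>\<phi> x\<close>, so if its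
  degree were positive, the cofactor \<open>F\<close> of \<open>E\<close> in \<open>D\<close> would
  contradict minimality. Thus \<open>D\<close> and \<open>Q\<close> are coprime, and every root of
  \<open>D\<close> solves the system, that is, equals \<open>\<phi> x\<close>.\<close>

lemma unique_root_generic:
 fixes X :: "('x, 'k) kspace"
 assumes X: "pspace X" and c: "chart E X U n u" and V: "opn X V1" "V1 <= U" "V1 ~= {}"
  and Ps: "Ps <= polys (polyfun n)" and Q: "Q:polys (polyfun n)"
  and \<phi>: "!!x y. x:V1 ==> (ALL P:Ps. poly (P (u x)) y = 0) & poly (Q (u x)) y ~= 0 <-> y = \<phi> x"
 obtains V where "opn X V" "V <= V1" "V ~= {}" "reg X V \<phi>"
proof -
 let ?A = "polys (polyfun n)"
 note A = funalg_polyfun[of n]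
 define good where "good = (%d V D. opn X V & V <= V1 & V ~= {} & D:?A &
   (ALL x:V. D (u x) ~= 0 & degree (D (u x)) = d & poly (D (u x)) (\<phi> x) = 0))"
 have "EX d V D. good d V D"
 proof -
  obtain x where x: "x:V1" using V(3) by blast
  \<comment> \<open>Otherwise \<open>Q\<close> alone would be nonzero at a single point only, which
    is impossible for a polynomial over an infinite field.\<close>
  have "EX P:Ps. P (u x) ~= 0"
  proof (rule ccontr)
   assume "~(EX P:Ps. P (u x) ~= 0)"
   hence "poly (Q (u x) * [:- \<phi> x, 1:]) y = 0" for y using \<phi>[OF x, of y] by auto
   hence "Q (u x) = 0" using poly_nonzero_point mult_eq_0_iff pCons_eq_0_iff zero_neq_one by metis
   thus False using \<phi>[OF x, of "\<phi> x"] by simp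
  qed
  then obtain P where P: "P:Ps" "P (u x) ~= 0" by blast
  obtain V' i where V': "opn X V'" "V' <= V1" "V' ~= {}"
   "!!x. x:V' ==> P (u x) ~= 0 & degree (P (u x)) = i"
   by (rule generic_degree[OF c subsetD[OF Ps P(1)] V(1,2) x P(2)]) blast
  have "poly (P (u y)) (\<phi> y) = 0" if "y:V'" for y
   using \<phi>[OF subsetD[OF V'(2) that], of "\<phi> y"] P(1) by blast
  hence "good i V' P" using P(1) Ps V' by (auto simp: good_def)
  thus ?thesis by blast
 qed
 then obtain d where d: "EX V D. good d V D" "!!d'. d' < d ==> ~(EX V D. good d' V D)"
  using exists_least_iff[of "%d. EX V D. good d V D"] by blast
 then obtain V2 D where D: "opn X V2" "V2 <= V1" "V2 ~= {}" "D:?A"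
   "!!x. x:V2 ==> D (u x) ~= 0 & degree (D (u x)) = d & poly (D (u x)) (\<phi> x) = 0"
  unfolding good_def by blast
 have V2U: "V2 <= U" using D(2) V(2) by blast
 have D_dvd: "D (u x) dvd P (u x)" if P: "P:Ps" and x: "x:V2" for P x
 proof -
  obtain k S R where R: "S:?A" "R:?A"
   "!!t. degree (D t) <= d ==> smult (coeff (D t) d ^ k) (P t) = D t * S t + R t"
   "!!t i. degree (D t) <= d ==> i >= d ==> coeff (R t) i = 0"
   by (rule pseudo_division[OF A D(4) subsetD[OF Ps P], of d]) blast
  have "R (u x) = 0"
  proof (rule ccontr)
   assume "R (u x) ~= 0"
   then obtain V' i where V': "opn X V'" "V' <= V2" "V' ~= {}"
     "!!x. x:V' ==> R (u x) ~= 0 & degree (R (u x)) = i"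
    using generic_degree[OF c R(2) D(1) V2U x] by blast
   have "poly (R (u y)) (\<phi> y) = 0" if y: "y:V'" for y
   proof -
    have y2: "y:V2" "y:V1" using y V'(2) D(2) by auto
    hence "poly (smult (coeff (D (u y)) d ^ k) (P (u y))) (\<phi> y) = 0" using \<phi>[of y "\<phi> y"] P by simp
    thus ?thesis using R(3)[of "u y"] D(5)[OF y2(1)] by simp
   qed
   hence "good i V' R" using V' R(2) D(2) by (auto simp: good_def)
   moreover obtain y where y: "y:V'" using V'(3) by blast
   hence "i < d" using V'(2,4) R(4)[of "u y" i] D(5)[of y]
    by (metis leading_coeff_0_iff not_less order_refl subsetD)
   ultimately show False using d(2) by blast
  qed
  hence "D (u x) dvd smult (coeff (D (u x)) d ^ k) (P (u x))" using R(3)[of "u x"] D(5)[OF x] by simp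
  moreover have "coeff (D (u x)) d ~= 0" using D(5)[OF x] by auto
  ultimately show ?thesis by (simp add: dvd_smult_iff)
 qed
 \<comment> \<open>Minimises the generic degree of combinations of \<open>D\<close> and
   \<open>Q\<close>, as in the proof of Bezout's identity.\<close>
 define good2 where "good2 = (%e V E. opn X V & V <= V2 & V ~= {} & E:?A &
   (ALL x:V. E (u x) ~= 0 & degree (E (u x)) = e & (EX s t. E (u x) = s * D (u x) + t * Q (u x))))"
 have "EX s t. D (u x) = s * D (u x) + t * Q (u x)" for x by (intro exI[of _ 1] exI[of _ 0]) simp
 hence "good2 d V2 D" unfolding good2_def using D by (intro conjI ballI) simp_all
 then obtain e where e: "EX V E. good2 e V E" "!!e'. e' < e ==> ~(EX V E. good2 e' V E)"
  using exists_least_iff[of "%e. EX V E. good2 e V E"] by blast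
 then obtain V3 E where E: "opn X V3" "V3 <= V2" "V3 ~= {}" "E:?A"
   "!!x. x:V3 ==> E (u x) ~= 0 & degree (E (u x)) = e & (EX s t. E (u x) = s * D (u x) + t * Q (u x))"
  unfolding good2_def by (elim exE conjE) metis
 have V3U: "V3 <= U" using E(2) V2U by blast
 have E_div: "EX k. EX F:?A. ALL x:V3. smult (coeff (E (u x)) e ^ k) (P (u x)) = E (u x) * F (u x)"
  if P: "P:?A" "!!x. x:V3 ==> EX s t. P (u x) = s * D (u x) + t * Q (u x)" for P
 proof -
  obtain k S R where R: "S:?A" "R:?A"
   "!!t. degree (E t) <= e ==> smult (coeff (E t) e ^ k) (P t) = E t * S t + R t"
   "!!t i. degree (E t) <= e ==> i >= e ==> coeff (R t) i = 0"
   by (rule pseudo_division[OF A E(4) P(1), of e]) blast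
  have "R (u x) = 0" if x: "x:V3" for x
  proof (rule ccontr)
   assume "R (u x) ~= 0"
   then obtain V' i where V': "opn X V'" "V' <= V3" "V' ~= {}"
     "!!x. x:V' ==> R (u x) ~= 0 & degree (R (u x)) = i"
    using generic_degree[OF c R(2) E(1) V3U x] by blast
   have "EX s t. R (u y) = s * D (u y) + t * Q (u y)" if y: "y:V'" for y
   proof -
    have y3: "y:V3" using y V'(2) by auto
    obtain s t where st: "P (u y) = s * D (u y) + t * Q (u y)" using P(2)[OF y3] by blast
    obtain s' t' where st': "E (u y) = s' * D (u y) + t' * Q (u y)" using E(5)[OF y3] by blast
    define w where "w = [:coeff (E (u y)) e ^ k:]"
    have "w * P (u y) = E (u y) * S (u y) + R (u y)"
     using R(3)[of "u y"] E(5)[OF y3] by (simp add: w_def)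
    hence "R (u y) = (w * s - s' * S (u y)) * D (u y) + (w * t - t' * S (u y)) * Q (u y)"
     unfolding st by (subst (asm) st') (simp add: algebra_simps)
    thus ?thesis by blast
   qed
   hence "good2 i V' R" using V' R(2) E(2) by (auto simp: good2_def)
   moreover obtain y where y: "y:V'" using V'(3) by blast
   hence "i < e" using V'(2,4) R(4)[of "u y" i] E(5)[of y]
    by (metis leading_coeff_0_iff not_less order_refl subsetD)
   ultimately show False using e(2) by blast
  qed
  thus ?thesis using R(1,3) E(5) by (intro exI[of _ k] bexI[of _ S]) auto
 qed
 have Enz: "coeff (E (u x)) e ~= 0" if "x:V3" for x using E(5)[OF that] by (metis leading_coeff_0_iff)
 have "EX s t. Q (u x) = s * D (u x) + t * Q (u x)" for x by (intro exI[of _ 0] exI[of _ 1]) simp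
 from E_div[OF Q this] obtain k F where "ALL x:V3. smult (coeff (E (u x)) e ^ k) (Q (u x)) = E (u x) * F (u x)"
  by blast
 hence E\<phi>: "poly (E (u x)) (\<phi> x) ~= 0" if x: "x:V3" for x
 proof -
  assume "ALL x:V3. smult (coeff (E (u x)) e ^ k) (Q (u x)) = E (u x) * F (u x)"
  hence "poly (smult (coeff (E (u x)) e ^ k) (Q (u x))) (\<phi> x) = poly (E (u x) * F (u x)) (\<phi> x)"
   using x by simp
  moreover have "poly (Q (u x)) (\<phi> x) ~= 0" using \<phi>[of x "\<phi> x"] x E(2) D(2) by blast
  ultimately show ?thesis using Enz[OF x] by auto
 qed
 have "EX s t. D (u x) = s * D (u x) + t * Q (u x)" for x by (intro exI[of _ 1] exI[of _ 0]) simp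
 from E_div[OF D(4) this] obtain k' F where F: "F:?A"
  "!!x. x:V3 ==> smult (coeff (E (u x)) e ^ k') (D (u x)) = E (u x) * F (u x)" by blast
 have "e = 0"
 proof (rule ccontr)
  assume "e ~= 0"
  have "F (u x) ~= 0 & degree (F (u x)) = d - e & poly (F (u x)) (\<phi> x) = 0" and "e <= d" if x: "x:V3" for x
  proof -
   have x2: "x:V2" using x E(2) by blast
   have nz: "F (u x) ~= 0" using F(2)[OF x] D(5)[OF x2] Enz[OF x] by auto
   have "degree (smult (coeff (E (u x)) e ^ k') (D (u x))) = d" using D(5)[OF x2] Enz[OF x] by simp
   hence "d = e + degree (F (u x))"
    unfolding F(2)[OF x] using nz E(5)[OF x] by (simp add: degree_mult_eq)
   moreover have "poly (smult (coeff (E (u x)) e ^ k') (D (u x))) (\<phi> x) = 0" using D(5)[OF x2] by simp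
   hence "poly (F (u x)) (\<phi> x) = 0" unfolding F(2)[OF x] using E\<phi>[OF x] by simp
   ultimately show "F (u x) ~= 0 & degree (F (u x)) = d - e & poly (F (u x)) (\<phi> x) = 0" "e <= d"
    using nz by auto
  qed
  hence "good (d - e) V3 F" "e <= d" using E(1-3) D(2) F(1) by (auto simp: good_def)
  thus False using d(2)[of "d - e"] `e ~= 0` by (cases "d = 0") auto
 qed
 have root: "y = \<phi> x" if x: "x:V3" and y: "poly (D (u x)) y = 0" for x y
 proof -
  have x1: "x:V1" "x:V2" using x E(2) D(2) by auto
  obtain s t where st: "E (u x) = s * D (u x) + t * Q (u x)" using E(5)[OF x] by blast
  have "poly (E (u x)) y ~= 0" using E(5)[OF x] `e = 0` by (auto elim!: degree_eq_zeroE)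
  hence "poly (Q (u x)) y ~= 0" using y unfolding st by auto
  moreover have "poly (P (u x)) y = 0" if "P:Ps" for P
   using D_dvd[OF that x1(2)] y by (auto simp: dvd_def)
  ultimately show ?thesis using \<phi>[OF x1(1)] by blast
 qed
 have "d > 0"
 proof (rule ccontr)
  assume "~d > 0"
  moreover obtain x where "x:V2" using D(3) by blast
  ultimately show False using D(5)[of x] by (auto elim!: degree_eq_zeroE)
 qed
 have "reg X V3 \<phi>"
 proof (rule purely_inseparable_generic[OF X c E(1) V3U D(4) _ `d > 0` root])
  show "D (u x) ~= 0 & degree (D (u x)) = d" if "x:V3" for x using that D(5) E(2) by blast
 qed
 thus thesis using that E(1-3) D(2) by blast
qed

text \<open>Of the finitely many disjuncts one has a solution over a whole nonempty open set; as
  every solution equals \<open>\<phi> x\<close>, this disjunct alone is a system with unique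
  solution \<open>\<phi> x\<close>.\<close>

lemma definable_function_generic:
 fixes X :: "('x, 'k) kspace"
 assumes X: "pspace X" and c: "chart E X U n u" and V: "opn X V0" "V0 <= U" "V0 ~= {}"
  and \<Gamma>: "\<Gamma>:constr (polyfun (Suc n))"
  and \<phi>: "!!x y. x:V0 ==> \<Gamma> ((u x)(n := y)) <-> y = \<phi> x"
 obtains V where "opn X V" "V <= V0" "V ~= {}" "reg X V \<phi>"
proof -
 obtain L where L: "ALL p:set L. set (fst p) <= polyfun (Suc n) & snd p:polyfun (Suc n)" "\<Gamma> = dnf L"
  using \<Gamma> by (rule constrE)
 have "ALL f:polyfun (Suc n). EX P. P:polys (polyfun n) & (ALL x y. f (x(n := y)) = poly (P x) y)"
  using polyfun_Suc_as_poly by blast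
 from bchoice[OF this] obtain \<psi> :: "((nat => 'k) => 'k) => (nat => 'k) => 'k poly"
  where \<psi>: "!!f. f:polyfun (Suc n) ==> \<psi> f:polys (polyfun n)"
  "!!f x y. f:polyfun (Suc n) ==> f (x(n := y)) = poly (\<psi> f x) y"
  by blast
 define T where "T = (%p t y. (ALL P:\<psi> ` set (fst p). poly (P t) y = 0) & poly (\<psi> (snd p) t) y ~= 0)"
 have T: "\<Gamma> (t(n := y)) <-> (EX p:set L. T p t y)" for t y
 proof -
  have "f (t(n := y)) = poly (\<psi> f t) y" if "p:set L" "f = snd p | f:set (fst p)" for p f
   using L(1) that by (intro \<psi>(2)) auto
  thus ?thesis unfolding L(2) dnf_def T_def by auto
 qed
 obtain V1 p where V1: "opn X V1" "V1 <= V0" "V1 ~= {}" "p:set L" "!!x. x:V1 ==> EX y. T p (u x) y"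
 proof (rule shrink_cover[OF c, of "set L" "%p t. EX y. T p t y" V0])
  show "(%t. EX y. T p t y):constr (polyfun n)" if "p:set L" for p
   unfolding T_def using L(1) \<psi>(1) that by (intro constr_ex_root funalg_polyfun) auto
  show "EX p:set L. EX y. T p (u x) y" if "x:V0" for x
   using T[of "u x" "\<phi> x"] \<phi>[OF that] by blast
 qed (use V in auto)
 have "T p (u x) y <-> y = \<phi> x" if x: "x:V1" for x y
 proof -
  have "T p (u x) y ==> y = \<phi> x" for y using T[of "u x" y] \<phi>[of x y] V1(2,4) x by blast
  thus ?thesis using V1(5)[OF x] by blast
 qed
 note key = this[unfolded T_def]
 have V1U: "V1 <= U" using V(2) V1(2) by blast
 have "set (fst p) <= polyfun (Suc n)" "snd p:polyfun (Suc n)" using L(1) V1(4) by auto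
 hence Ps: "\<psi> ` set (fst p) <= polys (polyfun n)" "\<psi> (snd p):polys (polyfun n)" using \<psi>(1) by auto
 obtain V' where V': "opn X V'" "V' <= V1" "V' ~= {}" "reg X V' \<phi>"
  by (rule unique_root_generic[OF X c V1(1) V1U V1(3) Ps key]) auto
 have "V' <= V0" using V'(2) V1(2) by blast
 from that[OF V'(1) this V'(3,4)] show thesis .
qed

section \<open>Definable homomorphisms and subgroups\<close>

text \<open>Over some nonempty open set all images lie in one chart of \<open>Y\<close>. Their
  coordinates are functions with constructible graphs, so they become regular one after another on
  smaller and smaller open sets.\<close>

lemma definable_map_generic:
 fixes X :: "('x, 'k) kspace" and Y :: "('y, 'k) kspace"
 assumes X: "pspace X" and Y: "pspace Y" and ne: "pts X ~= {}"
  and f: "!!x. x:pts X ==> f x:pts Y" and gr: "drel X Y (%x y. f x = y)"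
 obtains x0 where "x0:pts X"
  "!!V g. reg Y V g ==> f x0:V ==> EX W. x0:W & (ALL y:W. f y:V) & reg X W (%y. g (f y))"
proof -
 obtain x where x: "x:pts X" using ne by blast
 obtain U n u where U: "chart UNIV X U n u" "x:U" by (rule atlas_chart_at[OF pspace_atlas[OF X] x])
 obtain C where C: "finite C" "ALL (W, m, w):C. chart UNIV Y W m w" "pts Y = \<Union>(fst ` C)"
  using pspace_atlas[OF Y] unfolding atlas_def by (elim exE conjE)
 have "EX \<Phi>. \<Phi>:constr (polyfun (n + fst (snd d))) & (ALL x:U. ALL t. \<Phi> (join n (u x) t) <->
   f x:fst d & (ALL i<fst (snd d). snd (snd d) (f x) i = t i))" if d: "d:C" for d
 proof -
  obtain W m w where dW: "d = (W, m, w)" by (cases d)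
  have W: "chart UNIV Y W m w" using bspec[OF C(2) d] by (simp add: dW)
  obtain P where P: "P:constr (polyfun (n + m))"
   "!!x y. x:U ==> y:W ==> f x = y <-> P (join n (u x) (w y))"
   by (rule drelE[OF gr U(1) W]) blast
  obtain L where L: "L:constr (polyfun m)" "!!t. L t <-> (EX y:W. ALL i<m. w y i = t i)"
   by (rule chart_locus[OF W]) blast
  have "(%T. L (%i. T (n + i)) & P T):constr (polyfun (n + m))"
   by (intro constr_conj funalg_polyfun P(1) constr_polyfun_subst[OF L(1)]) (auto intro: polyfun.coord)
  moreover have "L (%i. join n (u x) t (n + i)) & P (join n (u x) t) <-> f x:W & (ALL i<m. w (f x) i = t i)"
   if x: "x:U" for x t
  proof -
   have P': "P (join n (u x) t) <-> f x = y" if "y:W" "ALL i<m. w y i = t i" for y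
   proof -
    have "P (join n (u x) t) = P (join n (u x) (w y))"
     by (rule constr_polyfun_cong[OF P(1)]) (use that in \<open>auto simp: join_def\<close>)
    thus ?thesis using P(2)[OF x that(1)] by simp
   qed
   show ?thesis unfolding join_right L(2) using P' by blast
  qed
  ultimately show ?thesis unfolding dW fst_conv snd_conv by blast
 qed
 hence "ALL d:C. EX \<Phi>. \<Phi>:constr (polyfun (n + fst (snd d))) & (ALL x:U. ALL t. \<Phi> (join n (u x) t) <->
   f x:fst d & (ALL i<fst (snd d). snd (snd d) (f x) i = t i))" by (intro ballI)
 from bchoice[OF this] obtain \<Phi> where \<Phi>: "ALL d:C. \<Phi> d:constr (polyfun (n + fst (snd d))) &
   (ALL x:U. ALL t. \<Phi> d (join n (u x) t) <-> f x:fst d & (ALL i<fst (snd d). snd (snd d) (f x) i = t i))" ..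
 obtain V1 d where V1: "opn X V1" "V1 <= U" "V1 ~= {}" "d:C"
   "!!x. x:V1 ==> EX t. \<Phi> d (join n (u x) t)"
 proof (rule shrink_cover[OF U(1) C(1), of "%d s. EX t. \<Phi> d (join n s t)" U])
  show "(%s. EX t. \<Phi> d (join n s t)):constr (polyfun n)" if "d:C" for d
   using \<Phi> that by (intro constr_ex_join[of _ n "fst (snd d)"]) auto
  show "EX d:C. EX t. \<Phi> d (join n (u x) t)" if x: "x:U" for x
  proof -
   have "f x:pts Y" using f x chart_open[OF U(1)] openin_subset by blast
   then obtain d where "d:C" "f x:fst d" unfolding C(3) by auto
   hence "\<Phi> d (join n (u x) (snd (snd d) (f x)))" using \<Phi> x by auto
   thus ?thesis using `d:C` by blast
  qed
 qed (use U chart_open[OF U(1)] in auto)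
 obtain W m w where dW: "d = (W, m, w)" by (cases d)
 have W: "chart UNIV Y W m w" using bspec[OF C(2) V1(4)] by (simp add: dW)
 have \<Phi>d: "\<Phi> d:constr (polyfun (n + m))"
  "!!x t. x:U ==> \<Phi> d (join n (u x) t) <-> f x:W & (ALL i<m. w (f x) i = t i)"
  using \<Phi> V1(4) dW by auto
 have fW: "f x:W" if "x:V1" for x using V1(2) V1(5)[OF that] \<Phi>d(2)[of x] that by auto
 have "EX V. opn X V & V <= V1 & V ~= {} & (ALL i<j. reg X V (%x. w (f x) i))" if "j <= m" for j
  using that
 proof (induction j)
  case 0
  thus ?case using V1 by auto
 next
  case (Suc j)
  then obtain V where V: "opn X V" "V <= V1" "V ~= {}" "ALL i<j. reg X V (%x. w (f x) i)" by auto
  \<comment> \<open>Slot \<open>n\<close> is inserted for the value of coordinate \<open>j\<close>;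
    the full image tuple follows it and is eliminated.\<close>
  define s :: "(nat => 'k) => nat => 'k" where "s = (%S i. if i < n then S i else S (Suc i))"
  have "(%S. \<Phi> d (s S) & S (Suc n + j) - S n = 0):constr (polyfun (Suc n + m))"
   using Suc.prems by (intro constr_conj constr_zero funalg_polyfun constr_polyfun_subst[OF \<Phi>d(1)] funalg_diff polyfun.coord)
     (auto simp: s_def intro!: polyfun_if polyfun.coord)
  from constr_ex_join[OF this]
  have con: "(%T. EX t. \<Phi> d (s (join (Suc n) T t)) & join (Suc n) T t (Suc n + j) - join (Suc n) T t n = 0)
    :constr (polyfun (Suc n))" .
  have gr: "(EX t. \<Phi> d (s (join (Suc n) ((u x)(n := y)) t)) &
    join (Suc n) ((u x)(n := y)) t (Suc n + j) - join (Suc n) ((u x)(n := y)) t n = 0) <-> y = w (f x) j"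
   if "x:V" for x y
  proof -
   have "s (join (Suc n) ((u x)(n := y)) t) = join n (u x) t" for t
    by (auto simp: s_def join_def fun_eq_iff)
   moreover have "join (Suc n) ((u x)(n := y)) t n = y" for t by (simp add: join_def)
   moreover have "\<Phi> d (join n (u x) t) <-> (ALL i<m. w (f x) i = t i)" for t
    using \<Phi>d(2)[of x t] fW[of x] that V(2) V1(2) by blast
   moreover have "join (Suc n) ((u x)(n := y)) t (Suc n + j) = t j" for t by (rule join_right)
   ultimately have "(EX t. \<Phi> d (s (join (Suc n) ((u x)(n := y)) t)) &
    join (Suc n) ((u x)(n := y)) t (Suc n + j) - join (Suc n) ((u x)(n := y)) t n = 0) <->
    (EX t. (ALL i<m. w (f x) i = t i) & t j = y)" by (simp only: right_minus_eq)
   also have "... <-> y = w (f x) j" using Suc.prems by (metis Suc_le_eq)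
   finally show ?thesis .
  qed
  have VU: "V <= U" using V(2) V1(2) by blast
  obtain V' where V': "opn X V'" "V' <= V" "V' ~= {}" "reg X V' (%x. w (f x) j)"
   by (rule definable_function_generic[OF X U(1) V(1) VU V(3) con gr])
  have "reg X V' (%x. w (f x) i)" if "i < Suc j" for i
   using that V'(4) V(4) reg_mono[OF pspace_sheaf[OF X] _ V'(1,2)] by (auto simp: less_Suc_eq)
  thus ?case using V' V(2) by blast
 qed
 from this[OF order_refl] obtain V where V: "opn X V" "V <= V1" "V ~= {}" "ALL i<m. reg X V (%x. w (f x) i)"
  by blast
 obtain x0 where x0: "x0:V" using V(3) by blast
 show thesis
 proof (rule that)
  show "x0:pts X" using x0 V(1) openin_subset by blast
  fix V' g assume g: "reg Y V' g" and fx: "f x0:V'"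
  have fxW: "f x0:W" using fW x0 V(2) by blast
  obtain a b e where ab: "a:polyfun m" "b:polyfun m" "b (w (f x0)) ~= 0"
   "!!y. y:W ==> b (w y) ~= 0 ==> y:V' & g y ^ (CHAR('k) ^ e) = a (w y) / b (w y)"
   by (rule chart_reg_form[OF pspace_sheaf[OF Y] W g fx fxW]) blast
  let ?N = "{y:V. b (w (f y)) ~= 0}"
  have N: "f y:V' & g (f y) ^ (CHAR('k) ^ e) = a (w (f y)) / b (w (f y))" if "y:?N" for y
   using ab(4)[of "f y"] fW[of y] that V(2) by auto
  have rw: "i < m ==> reg X V (%x. w (f x) i)" for i using V(4) by blast
  have "reg X ?N (%y. a (w (f y)) / b (w (f y)))"
   using reg_divide[OF X reg_polyfun[OF X V(1), of m "%x. w (f x)", OF rw ab(1)]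
     reg_polyfun[OF X V(1), of m "%x. w (f x)", OF rw ab(2)]] by simp
  also have "reg X ?N (%y. a (w (f y)) / b (w (f y))) = reg X ?N (%y. g (f y) ^ (CHAR('k) ^ e))"
   by (rule reg_cong) (use N in auto)
  finally have "reg X ?N (%y. g (f y))" by (rule pspace_root[OF X])
  thus "EX W. x0:W & (ALL y:W. f y:V') & reg X W (%y. g (f y))"
   using x0 ab(3) N by (intro exI[of _ ?N]) auto
 qed
qed

text \<open>Translation by \<open>a\<close> in the source and by \<open>b\<close> in the target
  carries the good point \<open>x0\<close> to an arbitrary \<open>x\<close>, because
  \<open>f y = b *[H] f (a *[G] y)\<close>.\<close>

lemma definable_hom_kmorphism:
 fixes X :: "('a, 'k) kspace" and Y :: "('b, 'k) kspace"
 assumes G: "pgroup G X" and H: "pgroup H Y" and f: "f:hom G H" and gr: "drel X Y (%x y. f x = y)"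
 shows "kmorphism X Y f"
proof -
 have X: "pspace X" "pts X = carrier G" "!!a. a:carrier G ==> kmorphism X X (%x. a *[G] x)"
  using G by (auto simp: pgroup_def)
 have Y: "pspace Y" "pts Y = carrier H" "!!a. a:carrier H ==> kmorphism Y Y (%x. a *[H] x)"
  using H by (auto simp: pgroup_def)
 interpret G: comm_group G using G by (simp add: pgroup_def)
 interpret H: comm_group H using H by (simp add: pgroup_def)
 interpret f: group_hom G H f using f by unfold_locales
 have "pts X ~= {}" using X(2) G.one_closed by auto
 then obtain x0 where x0: "x0:carrier G"
  "!!V g. reg Y V g ==> f x0:V ==> EX W. x0:W & (ALL y:W. f y:V) & reg X W (%y. g (f y))"
  using definable_map_generic[OF X(1) Y(1) _ _ gr] X(2) Y(2) by auto
 show ?thesis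
 proof (rule kmorphismI_local[OF X(1) Y(1)])
  fix x V g assume x: "x:pts X" and g: "reg Y V g" and fx: "f x:V"
  have xG: "x:carrier G" using x X(2) by simp
  define a where "a = x0 *[G] inv[G] x"
  have a: "a:carrier G" "a *[G] x = x0" using x0(1) xG by (simp_all add: a_def G.m_assoc)
  define b where "b = inv[H] (f a)"
  have b: "b:carrier H" "!!y. y:carrier G ==> b *[H] f (a *[G] y) = f y"
   using a(1) by (auto simp: b_def H.m_assoc[symmetric])
  define V' where "V' = {z:pts Y. b *[H] z:V}"
  have g': "reg Y V' (%z. g (b *[H] z))" unfolding V'_def by (rule kmorphism_reg[OF Y(3)[OF b(1)] g])
  have "f x0:V'" using b(2)[OF xG] fx x0(1) by (simp add: V'_def Y(2) a(2))
  from x0(2)[OF g' this] obtain N where N: "x0:N" "ALL y:N. f y:V'" "reg X N (%y. g (b *[H] f y))" by blast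
  let ?W = "{y:pts X. a *[G] y:N}"
  have "reg X ?W (%y. g (b *[H] f (a *[G] y)))" by (rule kmorphism_reg[OF X(3)[OF a(1)] N(3)])
  also have "reg X ?W (%y. g (b *[H] f (a *[G] y))) = reg X ?W (%y. g (f y))"
   by (rule reg_cong) (use b(2) X(2) in auto)
  finally show "EX W. x:W & (ALL y:W. f y:V) & reg X W (%y. g (f y))"
   using x N(1,2) a(2) b(2) X(2) by (intro exI[of _ ?W]) (force simp: V'_def)
 qed (use X(2) Y(2) in auto)
qed

text \<open>The closure \<open>C\<close> is a subgroup since translations and inversion are
  continuous. Constructibility makes \<open>D\<close> contain a nonempty relatively open part of
  \<open>C\<close>, and translating this part reaches every point of \<open>C\<close>.\<close>

lemma definable_subgroup_closed:
 assumes G: "pgroup G X" and D: "subgroup D G" and def: "dset X (%x. x:D)"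
 shows "closedin (ktop X) D"
proof -
 have X: "pspace X" "pts X = carrier G"
  "!!a. a:carrier G ==> continuous_map (ktop X) (ktop X) (%x. a *[G] x)"
  "continuous_map (ktop X) (ktop X) (%x. inv[G] x)"
  using G by (auto simp: pgroup_def kmorphism_def)
 interpret G: comm_group G using G by (simp add: pgroup_def)
 interpret D: subgroup D G by (rule D)
 define C where "C = ktop X closure_of D"
 have C: "closedin (ktop X) C" "D <= C" "C <= carrier G"
  using closure_of_subset[of D "ktop X"] closure_of_subset_topspace[of "ktop X" D] X(2) D.subset by (auto simp: C_def)
 have closed_under: "\<tau> ` C <= C" if "continuous_map (ktop X) (ktop X) \<tau>" "\<tau> ` D <= C" for \<tau>
 proof -
  have "\<tau> ` C <= ktop X closure_of (\<tau> ` D)"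
   unfolding C_def using that(1) by (rule continuous_map_image_closure_subset)
  also have "... <= C" using that(2) C(1) by (rule closure_of_minimal)
  finally show ?thesis .
 qed
 have DC: "a *[G] c:C" if "a:D" "c:C" for a c
 proof -
  have "(%x. a *[G] x) ` C <= C"
   by (rule closed_under[OF X(3)]) (use that(1) C(2) in auto)
  thus ?thesis using that(2) by blast
 qed
 have CC: "a *[G] c:C" if a: "a:C" and c: "c:C" for a c
 proof -
  have "a *[G] x:C" if "x:D" for x using DC[OF that a] that a C(3) by (metis D.mem_carrier G.m_comm subsetD)
  hence "(%x. a *[G] x) ` C <= C"
   using a C(3) by (intro closed_under X(3)) auto
  thus ?thesis using c by blast
 qed
 have "(%x. inv[G] x) ` C <= C" by (rule closed_under[OF X(4)]) (use C(2) in auto)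
 hence Cinv: "inv[G] c:C" if "c:C" for c using that by blast
 obtain U n u where U: "chart UNIV X U n u" "(one G):U" using X(2) atlas_chart_at[OF pspace_atlas[OF X(1)]] by blast
 obtain P where P: "P:constr (polyfun n)" "!!x. x:U ==> x:D <-> P (u x)"
  by (rule dsetE[OF def U(1)]) blast
 have "U Int C ~= {}" using U(2) C(2) D.one_closed by blast
 then obtain O' where O: "opn X O'" "O' <= U" "O' Int C ~= {}"
  "(ALL x:O' Int C. P (u x)) | (ALL x:O' Int C. ~P (u x))"
  by (rule shrink_constr[OF U(1) P(1) chart_open[OF U(1)] order_refl]) blast
 have meets: "EX y:D. y:V" if "opn X V" "z:V" "z:C" for V z
  using that by (auto simp: C_def in_closure_of)
 obtain o' where o: "o':O'" "o':C" using O(3) by blast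
 have OD: "x:D" if "x:O' Int C" for x
 proof -
  obtain y where "y:D" "y:O'" using meets[OF O(1) o] by blast
  hence "P (u y)" "y:O' Int C" using P(2) O(2) C(2) by auto
  thus ?thesis using O(2,4) P(2) that by blast
 qed
 have "x:D" if x: "x:C" for x
 proof -
  have oG: "o':carrier G" "x:carrier G" using o x C(3) by auto
  define a where "a = o' *[G] inv[G] x"
  have a: "a:carrier G" "a:C" using oG o(2) CC Cinv x by (auto simp: a_def)
  \<comment> \<open>Density provides a point \<open>y\<close> of \<open>D\<close> near
    \<open>x\<close> for which \<open>a *[G] y\<close> falls into the part of \<open>C\<close> known
    to lie in \<open>D\<close>.\<close>
  let ?V = "{y:pts X. a *[G] y:O'}"
  have "opn X ?V" using X(3)[OF a(1)] O(1) by (auto simp: continuous_map_def)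
  moreover have "x:?V" using oG o(1) X(2) by (simp add: a_def G.m_assoc)
  ultimately obtain y where y: "y:D" "a *[G] y:O'" using meets x by blast
  have "a *[G] y:D" using OD y CC[OF a(2)] C(2) by blast
  moreover have "o':D" using OD o by blast
  moreover have "x = y *[G] inv[G] (a *[G] y) *[G] o'"
  proof -
   have "y:carrier G" using y(1) by simp
   hence "y *[G] inv[G] (a *[G] y) = inv[G] a"
    using a(1) by (simp add: G.inv_mult_group G.m_assoc[symmetric])
   moreover have "inv[G] a = x *[G] inv[G] o'" using oG by (simp add: a_def G.inv_mult_group)
   ultimately show ?thesis using oG by (simp add: G.m_assoc)
  qed
  ultimately show ?thesis using y(1) by simp
 qed
 hence "C = D" using C(2) by blast
 thus ?thesis using C(1) by simp
qed

end

section \<open>The category of quasi-algebraic groups\<close>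

lemma drel_cong:
 assumes "!!x y. x:pts X ==> y:pts Y ==> R x y <-> S x y"
 shows "drel X Y R <-> drel X Y S"
proof -
 have "drel X Y S" if R: "drel X Y R"
   and RS: "!!x y. x:pts X ==> y:pts Y ==> R x y <-> S x y" for R S
  unfolding drel_def
 proof (intro allI impI)
  fix U n u V m v assume c: "chart UNIV X U n u" "chart UNIV Y V m v"
  obtain P where P: "P:constr (polyfun (n + m))"
   "!!x y. x:U ==> y:V ==> R x y <-> P (join n (u x) (v y))"
   by (rule drelE[OF R c]) blast
  have UV: "U <= pts X" "V <= pts Y"
   using openin_subset chart_open[OF c(1)] chart_open[OF c(2)] by auto
  have "S x y <-> P (join n (u x) (v y))" if "x:U" "y:V" for x y
   using P(2)[OF that] RS[of x y] that UV by auto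
  thus "EX P:constr (polyfun (n + m)). ALL x:U. ALL y:V. S x y = P (join n (u x) (v y))"
   using P(1) by (intro bexI[of _ P]) auto
 qed
 from this[of R S] this[of S R] assms show ?thesis by blast
qed

lemma quasialg_hom_id:
 assumes "function_sheaf X" "group G"
 shows "quasialg_hom G X G X (%x. x)"
 using assms by (simp add: quasialg_hom_def kmorphism_id hom_def)

lemma quasialg_hom_comp:
 assumes "quasialg_hom G X H Y f" "quasialg_hom H Y K Z g"
 shows "quasialg_hom G X K Z (%x. g (f x))"
 using assms kmorphism_comp[of X Y f Z g] hom_compose[of f G H g K]
 by (simp add: quasialg_hom_def comp_def)

lemma quasialg_hom_cong:
 assumes "pts X = carrier G" "group G" "!!x. x:carrier G ==> f x = g x"
 shows "quasialg_hom G X H Y f <-> quasialg_hom G X H Y g"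
proof -
 interpret group G by fact
 have "f:hom G H <-> g:hom G H"
  using assms(3) by (auto simp: hom_def Pi_iff)
 moreover have "kmorphism X Y f <-> kmorphism X Y g" using assms by (intro kmorphism_cong) auto
 ultimately show ?thesis by (simp add: quasialg_hom_def)
qed

context pos_char
begin

lemma quasialgD:
 assumes "quasialg G X"
 shows quasialg_comm_group: "comm_group G" and quasialg_group: "group G"
  and quasialg_topspace: "pts X = carrier G"
  and quasialg_pspace: "pspace X" and quasialg_sheaf: "function_sheaf X" and quasialg_atlas: "atlas UNIV X"
 using quasialg_pgroup[OF assms] by (auto simp: pgroup_def pspace_def comm_group_def)

lemma quasialg_hom_graph:
 assumes "quasialg G X" "quasialg H Y" "quasialg_hom G X H Y f"
 shows "drel X Y (%x y. f x = y)"
 using assms by (intro drel_kmorphism) (auto simp: quasialg_pspace quasialg_hom_def)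

lemma definable_quasialg_hom:
 assumes "quasialg G X" "quasialg H Y" "f:hom G H" "drel X Y (%x y. f x = y)"
 shows "quasialg_hom G X H Y f"
 using assms definable_hom_kmorphism[of G X H Y f] by (simp add: quasialg_hom_def quasialg_pgroup)

text \<open>The graph of \<open>f\<close> is the composite of the graph of
  \<open>%x. i (f x)\<close> with the converse of the graph of \<open>i\<close>, hence definable.
  Before perfection this fails already when \<open>i\<close> is Frobenius.\<close>

lemma quasialg_hom_lift:
 assumes G: "quasialg G X" and H: "quasialg H Y" and K: "quasialg K Z"
  and i: "quasialg_hom H Y K Z i" "inj_on i (carrier H)"
  and f: "f:hom G H" and if': "quasialg_hom G X K Z (%x. i (f x))"
 shows "quasialg_hom G X H Y f"
proof (rule definable_quasialg_hom[OF G H f])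
 have "drel X Y (%x y. EX z:pts Z. i (f x) = z & i y = z)"
  by (intro drel_comp quasialg_atlas[OF K] quasialg_hom_graph[OF G K if']
    drel_converse[OF quasialg_hom_graph[OF H K i(1)]])
 thus "drel X Y (%x y. f x = y)"
 proof (subst (asm) drel_cong)
  fix x y assume "x:pts X" "y:pts Y"
  hence "x:carrier G" "y:carrier H" using quasialg_topspace G H by blast+
  moreover from this have "f x:carrier H" using f by (auto simp: hom_def)
  moreover have "i (f x):pts Z"
   using i(1) `f x:carrier H` quasialg_topspace[OF K] by (auto simp: quasialg_hom_def hom_def)
  ultimately show "(EX z:pts Z. i (f x) = z & i y = z) <-> f x = y"
   using inj_onD[OF i(2)] by auto
 qed
qed

lemma quasialg_hom_descend:
 assumes G: "quasialg G X" and H: "quasialg H Y" and K: "quasialg K Z"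
  and q: "quasialg_hom G X H Y q" "q ` carrier G = carrier H"
  and f: "f:hom H K" and fq: "quasialg_hom G X K Z (%x. f (q x))"
 shows "quasialg_hom H Y K Z f"
proof (rule definable_quasialg_hom[OF H K f])
 have "drel Y Z (%y z. EX x:pts X. q x = y & f (q x) = z)"
  by (intro drel_comp quasialg_atlas[OF G] quasialg_hom_graph[OF G K fq]
    drel_converse[OF quasialg_hom_graph[OF G H q(1)]])
 thus "drel Y Z (%y z. f y = z)"
 proof (subst (asm) drel_cong)
  fix y z assume "y:pts Y"
  hence "y:q ` pts X" using quasialg_topspace[OF G] quasialg_topspace[OF H] q(2) by simp
  thus "(EX x:pts X. q x = y & f (q x) = z) <-> f y = z" by blast
 qed
qed

text \<open>The image is definable by quantifier elimination, and definable subgroups are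
  closed.\<close>

lemma quasialg_closed_image:
 assumes G: "quasialg G X" and H: "quasialg H Y" and f: "quasialg_hom G X H Y f"
  and K: "quasialg_closed G X K"
 shows "quasialg_closed H Y (f ` K)"
proof -
 interpret f: group_hom G H f
  using f quasialg_group[OF G] quasialg_group[OF H] by (simp add: group_hom_def group_hom_axioms_def quasialg_hom_def)
 have KG: "subgroup K G" "closedin (ktop X) K" using K by (auto simp: quasialg_closed_def)
 have sub: "subgroup (f ` K) H" using KG(1) by (rule f.subgroup_img_is_subgroup)
 have "drel X Y (%x y. f x = y & x:K)"
  by (intro drel_conj quasialg_hom_graph[OF G H f] drel_converse[of Y X "%_ x. x:K"] drel_of_dset dset_closed KG)
 hence "dset Y (%y. EX x:pts X. f x = y & x:K)"
  using quasialg_topspace[OF H] subgroup.one_closed[OF sub] subgroup.subset[OF sub]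
  by (intro dset_image quasialg_atlas[OF G] quasialg_atlas[OF H]) auto
 moreover have "(%y. EX x:pts X. f x = y & x:K) = (%y. y:f ` K)"
  using closedin_subset[OF KG(2)] by (intro ext) blast
 ultimately have "dset Y (%y. y:f ` K)" by simp
 hence "closedin (ktop Y) (f ` K)" by (rule definable_subgroup_closed[OF quasialg_pgroup[OF H] sub])
 with sub show ?thesis by (simp add: quasialg_closed_def)
qed

lemma quasialg_closed_carrier: "quasialg G (X :: ('a, 'k) kspace) ==> quasialg_closed G X (carrier G)"
 using quasialg_topspace[of G X] closedin_topspace[of "ktop X"] group.subgroup_self[OF quasialg_group, of G X]
 by (simp add: quasialg_closed_def)

lemma quasialg_closed_one:
 assumes G: "quasialg G X"
 shows "quasialg_closed G X {(one G)}"
proof -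
 interpret group G by (rule quasialg_group[OF G])
 have "drel X X (%x y. x = y)"
  by (intro drel_kmorphism[where f="%x. x"] kmorphism_id quasialg_pspace[OF G] quasialg_sheaf[OF G])
 hence "dset X (%y. (one G) = y)"
  using quasialg_topspace[OF G] by (intro dset_section[OF quasialg_atlas[OF G]]) auto
 hence "dset X (%y. y:{(one G)})" by (simp add: eq_commute[of _ "(one G)"])
 hence "closedin (ktop X) {(one G)}"
  by (intro definable_subgroup_closed[OF quasialg_pgroup[OF G]] triv_subgroup)
 thus ?thesis by (simp add: quasialg_closed_def triv_subgroup)
qed

lemma quasialg_closed_preimage:
 assumes G: "quasialg G X" and H: "quasialg H Y" and f: "quasialg_hom G X H Y f"
  and K: "quasialg_closed H Y K"
 shows "quasialg_closed G X {x:carrier G. f x:K}"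
proof -
 interpret f: group_hom G H f
  using f quasialg_group[OF G] quasialg_group[OF H] by (simp add: group_hom_def group_hom_axioms_def quasialg_hom_def)
 interpret K: subgroup K H using K by (simp add: quasialg_closed_def)
 have "subgroup {x:carrier G. f x:K} G" by unfold_locales auto
 moreover have "closedin (ktop X) {x:pts X. f x:K}"
  using f K by (intro closedin_continuous_map_preimage[of _ "ktop Y"]) (auto simp: quasialg_hom_def kmorphism_def quasialg_closed_def)
 ultimately show ?thesis by (simp add: quasialg_closed_def quasialg_topspace[OF G])
qed

lemma quasialg_closed_inter:
 assumes "group G" "quasialg_closed G X K" "quasialg_closed G X L"
 shows "quasialg_closed G X (K Int L)"
 using assms by (auto simp: quasialg_closed_def intro: group.subgroups_Inter_pair)

text \<open>The union of the increasing complements is already the union of finitely many of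
  them.\<close>

lemma quasialg_closed_dcc:
 assumes G: "quasialg G X" and K: "!!n. quasialg_closed G X (K n)" and dec: "!!n. K (Suc n) <= K n"
 obtains m where "!!n. n >= m ==> K n = K m"
proof -
 let ?V = "%n. pts X - K n"
 obtain \<W> where W: "\<W> <= range ?V" "finite \<W>" "\<Union>\<W> = \<Union>(range ?V)"
  by (rule atlas_quasi_compact[OF quasialg_atlas[OF G], of "range ?V"])
    (use K in \<open>auto simp: quasialg_closed_def\<close>)
 obtain N where N: "finite N" "\<W> = ?V ` N" using finite_subset_image[OF W(2,1)] by blast
 define m where "m = Max (insert 0 N)"
 have anti: "i <= j ==> K j <= K i" for i j using dec by (rule lift_Suc_antimono_le)
 have KX: "K n <= pts X" for n using K[of n] by (auto simp: quasialg_closed_def dest: closedin_subset)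
 have "K m <= K n" for n
 proof
  fix x assume x: "x:K m"
  show "x:K n"
  proof (rule ccontr)
   assume "x ~: K n"
   then obtain i where i: "i:N" "x ~: K i" using x KX W(3) N(2) by blast
   have "i <= m" using i(1) N(1) by (simp add: m_def)
   thus False using anti x i(2) by blast
  qed
 qed
 thus thesis using that[of m] anti by blast
qed

end

section \<open>Pullback of algebraic group structures\<close>

text \<open>The structure induced on a closed subset, with a map \<open>j\<close> in place of the
  inclusion: besides closed subgroups it serves groups that are merely isomorphic to one, such as
  the quotient of \<open>K\<close> by \<open>K \<inter> L\<close> inside the quotient of
  \<open>G\<close> by \<open>L\<close>.\<close>

definition kpull :: "'b set => ('b => 'a) => ('a, 'k) kspace => ('b, 'k) kspace" where
 "kpull B j Y = \<lparr>ktop = pullback_topology B j (ktop Y),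
   kreg = (%V. {r:extensional V. ALL b:V. EX O' g. opn Y O' & j b:O' & g:kreg Y O' &
    (ALL b':B. j b':O' --> b':V & r b' = g (j b'))})\<rparr>"

lemma openin_kpull: "opn (kpull B j Y) V <-> (EX O'. opn Y O' & V = {b:B. j b:O'})"
 by (auto simp: kpull_def openin_pullback_topology)

lemma topspace_kpull: "j ` B <= pts Y ==> pts (kpull B j Y) = B"
 by (auto simp: kpull_def topspace_pullback_topology)

lemma kreg_kpullI:
 assumes "r:extensional V"
  "!!b. b:V ==> EX O' g. opn Y O' & j b:O' & g:kreg Y O' &
    (ALL b':B. j b':O' --> b':V & r b' = g (j b'))"
 shows "r:kreg (kpull B j Y) V"
 using assms by (simp add: kpull_def)

lemma kreg_kpullE:
 assumes "r:kreg (kpull B j Y) V" "b:V"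
 obtains O' g where "opn Y O'" "j b:O'" "g:kreg Y O'"
  "!!b'. b':B ==> j b':O' ==> b':V & r b' = g (j b')"
proof -
 from assms show thesis using that by (auto simp: kpull_def)
qed

lemma kpull_sheaf:
 assumes Y: "function_sheaf Y"
 shows "function_sheaf (kpull B j Y)"
 unfolding function_sheaf_def
proof (intro conjI allI impI)
 fix U V r assume UV: "opn (kpull B j Y) V" "V <= U" "r:kreg (kpull B j Y) U"
 obtain W where W: "opn Y W" "V = {b:B. j b:W}" using UV(1) unfolding openin_kpull by blast
 show "restrict r V:kreg (kpull B j Y) V"
 proof (rule kreg_kpullI)
  fix b assume b: "b:V"
  obtain O' g where O: "opn Y O'" "j b:O'" "g:kreg Y O'"
   "!!b'. b':B ==> j b':O' ==> b':U & r b' = g (j b')"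
   by (rule kreg_kpullE[OF UV(3) subsetD[OF UV(2) b]]) blast
  have OW: "opn Y (O' Int W)" using O(1) W(1) by blast
  have "restrict g (O' Int W):kreg Y (O' Int W)"
   using Y O(1,3) OW unfolding function_sheaf_def by blast
  thus "EX O' g. opn Y O' & j b:O' & g:kreg Y O' &
    (ALL b':B. j b':O' --> b':V & restrict r V b' = g (j b'))"
   using OW O b W(2) by (intro exI[of _ "O' Int W"] exI[of _ "restrict g (O' Int W)"]) auto
 qed simp
next
 fix U r assume U: "opn (kpull B j Y) U" "r:extensional U"
  "ALL x:U. EX V. opn (kpull B j Y) V & x:V & V <= U & restrict r V:kreg (kpull B j Y) V"
 show "r:kreg (kpull B j Y) U"
 proof (rule kreg_kpullI[OF U(2)])
  fix b assume "b:U"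
  with U(3) obtain V where V: "b:V" "V <= U" "restrict r V:kreg (kpull B j Y) V" by blast
  obtain O' g where O: "opn Y O'" "j b:O'" "g:kreg Y O'"
   "!!b'. b':B ==> j b':O' ==> b':V & restrict r V b' = g (j b')"
   by (rule kreg_kpullE[OF V(3,1)]) blast
  have "ALL b':B. j b':O' --> b':U & r b' = g (j b')"
  proof (intro ballI impI)
   fix b' assume "b':B" "j b':O'"
   from O(4)[OF this] show "b':U & r b' = g (j b')" using V(2) by auto
  qed
  thus "EX O' g. opn Y O' & j b:O' & g:kreg Y O' &
    (ALL b':B. j b':O' --> b':U & r b' = g (j b'))" using O(1-3) by blast
 qed
qed (auto simp: kpull_def)

lemma kpull_comp:
 assumes "opn Y A" "g:kreg Y A"
 shows "restrict (%b. g (j b)) {b:B. j b:A}:kreg (kpull B j Y) {b:B. j b:A}"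
proof (rule kreg_kpullI)
 fix b assume "b:{b:B. j b:A}"
 thus "EX O' h. opn Y O' & j b:O' & h:kreg Y O' & (ALL b':B. j b':O' -->
   b':{b:B. j b:A} & restrict (%b. g (j b)) {b:B. j b:A} b' = h (j b'))"
  using assms by (intro exI[of _ A] exI[of _ g]) auto
qed simp

lemma kmorphism_kpull:
 assumes jB: "j ` B <= pts Y"
 shows "kmorphism (kpull B j Y) Y j"
 unfolding kmorphism_def topspace_kpull[OF jB]
proof (intro conjI allI impI)
 show "continuous_map (ktop (kpull B j Y)) (ktop Y) j"
  unfolding continuous_map_def topspace_kpull[OF jB] openin_kpull using jB by auto
 fix V g assume "opn Y V" "g:kreg Y V"
 from kpull_comp[OF this, of j B] show "restrict (g o j) {x:B. j x:V}:kreg (kpull B j Y) {x:B. j x:V}"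
  by (simp add: comp_def)
qed

text \<open>The universal property of the pullback. The assumption on \<open>W\<close> is the gluing
  axiom, in a form that can be checked directly when \<open>W\<close> is a product
  \<open>kprod\<close>.\<close>

lemma kmorphism_into_kpull:
 assumes W: "!!V r. opn W V ==> r:extensional V ==>
   (!!x. x:V ==> EX V'. opn W V' & x:V' & V' <= V & restrict r V':kreg W V') ==> r:kreg W V"
  and h: "!!w. w:pts W ==> h w:B" and jh: "kmorphism W Y (%w. j (h w))"
  and jB: "j ` B <= pts Y"
 shows "kmorphism W (kpull B j Y) h"
proof -
 have pre: "opn W {w:pts W. j (h w):O'}" if "opn Y O'" for O'
  using jh that by (simp add: kmorphism_def continuous_map_def)
 have op: "opn W {w:pts W. h w:V}" if V: "opn (kpull B j Y) V" for V
 proof -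
  obtain O' where O: "opn Y O'" "V = {b:B. j b:O'}" using V unfolding openin_kpull by blast
  have "{w:pts W. h w:V} = {w:pts W. j (h w):O'}" using h O(2) by auto
  thus ?thesis using pre[OF O(1)] by simp
 qed
 show ?thesis unfolding kmorphism_def
 proof (intro conjI allI impI)
  show "continuous_map (ktop W) (ktop (kpull B j Y)) h"
   unfolding continuous_map_def topspace_kpull[OF jB] using h op by auto
  fix V r assume V: "opn (kpull B j Y) V" "r:kreg (kpull B j Y) V"
  let ?P = "{w:pts W. h w:V}"
  show "restrict (r o h) ?P:kreg W ?P"
  proof (rule W[OF op[OF V(1)]])
   fix w assume w: "w:?P"
   hence hw: "h w:V" by simp
   obtain O' g where O: "opn Y O'" "j (h w):O'" "g:kreg Y O'"
    "!!b'. b':B ==> j b':O' ==> b':V & r b' = g (j b')"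
    by (rule kreg_kpullE[OF V(2) hw]) blast
   let ?Q = "{w:pts W. j (h w):O'}"
   have QP: "?Q <= ?P" using O(4) h by auto
   have "restrict (g o (%w. j (h w))) ?Q:kreg W ?Q" using jh O(1,3) by (simp add: kmorphism_def)
   moreover have "restrict (restrict (r o h) ?P) ?Q = restrict (g o (%w. j (h w))) ?Q"
    by (rule restrict_ext) (use O(4) h QP in auto)
   ultimately have "restrict (restrict (r o h) ?P) ?Q:kreg W ?Q" by simp
   thus "EX V'. opn W V' & w:V' & V' <= ?P & restrict (restrict (r o h) ?P) V':kreg W V'"
    using pre[OF O(1)] w O(2) QP by (intro exI[of _ ?Q]) auto
  qed simp
 qed
qed

text \<open>In a chart of \<open>Y\<close> the image of \<open>B\<close> is exactly the common zero
  locus of the polynomials vanishing on it: by closedness a point of the chart outside the image has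
  a basic neighbourhood \<open>a ~= 0\<close> that misses it. The chart coordinates composed with
  \<open>j\<close> are then affine coordinates on the preimage.\<close>

lemma kpull_variety:
 fixes Y :: "('a, 'k::field) kspace"
 assumes Y: "variety Y" and j: "inj_on j B" and K: "closedin (ktop Y) (j ` B)"
 shows "variety (kpull B j Y)"
proof -
 let ?Z = "kpull B j Y"
 have sh: "function_sheaf Y" using Y by (simp add: variety_def)
 have jB: "j ` B <= pts Y" using closedin_subset[OF K] .
 note topZ = topspace_kpull[OF jB]
 have chart_iso: "EX n F. F <= polyfun n & kisomorphic (open_subspace ?Z {b:B. j b:U}) (affine_kspace n F)"
  if c: "chart {0} Y U n u" for U n u
 proof -
  let ?U = "{b:B. j b:U}"
  have opU: "opn ?Z ?U" unfolding openin_kpull using chart_open[OF c] by blast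
  obtain F0 where F0: "F0 <= polyfun n" "u ` U = zero_locus n F0" using chart_image[OF c] by blast
  define F where "F = {a:polyfun n. ALL b:?U. a (u (j b)) = 0}"
  define w where "w = (%b. u (j b))"
  have inj: "inj_on w ?U" unfolding w_def
   using j inj_onD[OF chart_inj[OF c]] by (auto simp: inj_on_def)
  have img: "w ` ?U = zero_locus n F"
  proof
   show "w ` ?U <= zero_locus n F" using F0(2) by (auto simp: w_def zero_locus_def F_def)
   show "zero_locus n F <= w ` ?U"
   proof
    fix z assume z: "z:zero_locus n F"
    have "f (u (j b)) = 0" if "f:F0" "b:?U" for f b
     using F0(2) that by (auto simp: zero_locus_def set_eq_iff image_iff)
    hence "z:u ` U" using F0(1) z F0(2) by (auto simp: F_def zero_locus_def)
    then obtain y where y: "y:U" "z = u y" by blast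
    have "y:j ` B"
    proof (rule ccontr)
     assume "y ~: j ` B"
     moreover have "opn Y (U - j ` B)" using chart_open[OF c] K by blast
     ultimately obtain a where a: "a:polyfun n" "a (u y) ~= 0" "{y:U. a (u y) ~= 0} <= U - j ` B"
      using chart_basis[OF c, of "U - j ` B" y] y(1) by blast
     hence "a:F" by (auto simp: F_def)
     thus False using z y(2) a(2) by (auto simp: zero_locus_def)
    qed
    thus "z:w ` ?U" using y by (auto simp: w_def)
   qed
  qed
  define Z' where "Z' = zero_locus n F"
  define h where "h = inv_into ?U w"
  have hw: "b:?U ==> h (w b) = b" for b unfolding h_def using inj by (rule inv_into_f_f)
  have wh: "z:Z' ==> w (h z) = z" for z
   unfolding h_def Z'_def img[symmetric] by (rule f_inv_into_f)
  have hZ: "z:Z' ==> h z:?U" for z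
   unfolding h_def Z'_def img[symmetric] by (rule inv_into_into)
  have wZ: "b:?U ==> w b:Z'" for b using img by (auto simp: Z'_def)
  let ?S = "open_subspace ?Z ?U" and ?A = "affine_kspace n F"
  have topS: "pts ?S = ?U" using openin_subset[OF opU] by (auto simp: open_subspace_def)
  have opS: "opn ?S V <-> opn ?Z V & V <= ?U" for V
   by (simp add: open_subspace_def openin_open_subtopology[OF opU])
  have regS: "kreg ?S = kreg ?Z" by (simp add: open_subspace_def)
  have aff: "ktop ?A = zariski n Z'" "pts ?A = Z'"
   "kreg ?A W = {r:extensional W. ALL x:W. EX V. openin (zariski n Z') V &
         x:V & V <= W &
         (EX g:polyfun n. EX h:polyfun n. ALL y:V. h y ~= 0 & r y = g y / h y)}" for W
   by (simp_all add: affine_kspace_def Z'_def)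
  have pre: "opn ?Z {b:?U. a (w b) ~= 0}" if "a:polyfun n" for a
   unfolding openin_kpull using chart_nonvanishing[OF c that]
   by (intro exI[of _ "{y:U. a (u y) ~= 0}"]) (auto simp: w_def)
  have "kmorphism ?S ?A w"
   unfolding kmorphism_def topS
  proof (intro conjI allI impI)
   have opW: "opn ?Z {b:?U. w b:W}" if W: "openin (zariski n Z') W" for W
   proof (subst openin_subopen, intro ballI)
    fix b assume b: "b:{b:?U. w b:W}"
    then obtain a where a: "a:polyfun n" "a (w b) ~= 0" "{y:Z'. a y ~= 0} <= W"
     using W unfolding openin_zariski_iff by blast
    thus "EX T. opn ?Z T & b:T & T <= {b:?U. w b:W}"
     using pre[OF a(1)] wZ b by (intro exI[of _ "{b:?U. a (w b) ~= 0}"]) auto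
   qed
   show "continuous_map (ktop ?S) (ktop ?A) w"
    unfolding continuous_map_def topS aff opS using wZ opW by auto
   fix W r assume W: "opn ?A W" "r:kreg ?A W"
   let ?P = "{b:?U. w b:W}"
   show "restrict (r o w) ?P:kreg ?S ?P" unfolding regS
   proof (rule kreg_kpullI)
    fix b assume b: "b:?P"
    hence "w b:W" by simp
    then obtain V' g d where V': "openin (zariski n Z') V'" "w b:V'" "V' <= W" and
     gd: "g:polyfun n" "d:polyfun n" "ALL y:V'. d y ~= 0 & r y = g y / d y"
     using W(2) unfolding aff by blast
    obtain a where a: "a:polyfun n" "a (w b) ~= 0" "{y:Z'. a y ~= 0} <= V'"
     using V'(1,2) unfolding openin_zariski_iff by blast
    let ?O = "{y:U. d (u y) * a (u y) ~= 0}"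
    have p: "(%y. g y * a y):polyfun n" "(%y. d y * a y):polyfun n" using gd a by (auto intro: polyfun.mult)
    have "ALL b':B. j b':?O --> b':?P &
     restrict (r o w) ?P b' = restrict (%y. g (u y) * a (u y) / (d (u y) * a (u y))) ?O (j b')"
    proof (intro ballI impI)
     fix b' assume b': "b':B" "j b':?O"
     have "b':?U" using b' by auto
     moreover from this have "w b':V'" using a(3) wZ b'(2) by (auto simp: w_def)
     ultimately show "b':?P & restrict (r o w) ?P b' =
       restrict (%y. g (u y) * a (u y) / (d (u y) * a (u y))) ?O (j b')"
      using V'(3) gd(3) b' by (auto simp: w_def)
    qed
    moreover have "j b:?O" using b a(2) gd(3) V'(2) by (auto simp: w_def)
    ultimately show "EX O' g. opn Y O' & j b:O' & g:kreg Y O' &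
     (ALL b':B. j b':O' --> b':?P & restrict (r o w) ?P b' = g (j b'))"
     using chart_nonvanishing[OF c p(2)] chart_fraction[OF c p]
     by (intro exI[of _ ?O] exI[of _ "restrict (%y. g (u y) * a (u y) / (d (u y) * a (u y))) ?O"] conjI)
   qed simp
  qed
  moreover have "kmorphism ?A ?S h"
   unfolding kmorphism_def aff(2)
  proof (intro conjI allI impI)
   have loc: "EX O'. opn Y O' & O' <= U & V = {b:B. j b:O'}" if V: "opn ?S V" for V
   proof -
    obtain O' where "opn Y O'" "V = {b:B. j b:O'}" "V <= ?U"
     using V unfolding opS openin_kpull by blast
    thus ?thesis using chart_open[OF c] by (intro exI[of _ "O' Int U"]) auto
   qed
   have opP: "openin (zariski n Z') {z:Z'. h z:V}" if V: "opn ?S V" for V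
   proof -
    obtain O' where O: "opn Y O'" "O' <= U" "V = {b:B. j b:O'}" using loc[OF V] by blast
    have "EX a:polyfun n. a z ~= 0 & {y:Z'. a y ~= 0} <= {z:Z'. h z:V}" if z: "z:Z'" "h z:V" for z
    proof -
     have "j (h z):O'" using z(2) O(3) by simp
     from chart_basis[OF c O(1,2) this] obtain a where a: "a:polyfun n" "a (u (j (h z))) ~= 0"
       "{y:U. a (u y) ~= 0} <= O'" by blast
     have "h y:V" if y: "y:Z'" "a y ~= 0" for y
      using a(3) hZ[OF y(1)] wh[OF y(1)] y(2) O(3) by (auto simp: w_def)
     moreover have "a z ~= 0" using a(2) wh[OF z(1)] by (simp add: w_def)
     ultimately show ?thesis using a(1) by (intro bexI[of _ a]) auto
    qed
    thus ?thesis unfolding openin_zariski_iff by auto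
   qed
   show "continuous_map (ktop ?A) (ktop ?S) h"
    unfolding continuous_map_def aff topS using hZ opP by auto
   fix V r assume V: "opn ?S V" "r:kreg ?S V"
   let ?P = "{z:Z'. h z:V}"
   show "restrict (r o h) ?P:kreg ?A ?P" unfolding aff mem_Collect_eq
   proof (intro conjI ballI)
    fix z assume "z:?P"
    hence z: "z:Z'" "h z:V" by auto
    have rV: "r:kreg ?Z V" using V(2) regS by simp
    obtain O' g where O: "opn Y O'" "j (h z):O'" "g:kreg Y O'"
     "!!b'. b':B ==> j b':O' ==> b':V & r b' = g (j b')"
     by (rule kreg_kpullE[OF rV z(2)]) blast
    have OU: "opn Y (O' Int U)" using O(1) chart_open[OF c] by blast
    have gOU: "restrict g (O' Int U):kreg Y (O' Int U)"
     using sh O(1,3) OU unfolding function_sheaf_def by blast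
    have jh: "j (h z):O' Int U" using O(2) hZ[OF z(1)] by auto
    from chart_form[OF c OU Int_lower2 gOU jh] obtain a d e where ad: "a:polyfun n" "d:polyfun n" "e:{0::nat}"
     "d (u (j (h z))) ~= 0" "ALL y:U. d (u y) ~= 0 --> y:O' Int U &
       restrict g (O' Int U) y ^ (CHAR('k) ^ e) = a (u y) / d (u y)" by (elim bexE conjE)
    let ?D = "{y:Z'. d y ~= 0}"
    have D: "y:?P & (r o h) y = a y / d y" if y: "y:?D" for y
    proof -
     have hy: "h y:?U" "u (j (h y)) = y" using hZ[of y] wh[of y] y by (auto simp: w_def)
     have "j (h y):O' Int U & restrict g (O' Int U) (j (h y)) ^ (CHAR('k) ^ e) = a (u (j (h y))) / d (u (j (h y)))"
      using ad(5) hy y by auto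
     hence "j (h y):O'" "g (j (h y)) = a y / d y" using ad(3) hy(2) by auto
     thus ?thesis using O(4)[of "h y"] hy(1) y by auto
    qed
    show "EX V. openin (zariski n Z') V & z:V & V <= ?P &
      (EX g:polyfun n. EX k:polyfun n. ALL y:V. k y ~= 0 & restrict (r o h) ?P y = g y / k y)"
    proof (intro exI[of _ ?D] conjI)
     show "z:?D" using z(1) ad(4) wh[OF z(1)] by (simp add: w_def)
     show "EX g:polyfun n. EX k:polyfun n. ALL y:?D. k y ~= 0 & restrict (r o h) ?P y = g y / k y"
      by (rule bexI[OF _ ad(1)], rule bexI[OF _ ad(2)]) (use D in auto)
    qed (use D openin_zariski_basic[OF ad(2)] in auto)
   qed simp
  qed
  ultimately have "kisomorphic ?S ?A"
   unfolding kisomorphic_def topS aff(2) using hw wh by blast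
  thus ?thesis by (intro exI[of _ n] exI[of _ F]) (auto simp: F_def)
 qed
 obtain C where C: "finite C" "ALL (U, n, u):C. chart {0} Y U n u" "pts Y = \<Union>(fst ` C)"
  using variety_atlas[OF Y] unfolding atlas_def by (elim exE conjE)
 let ?\<U> = "(%d. {b:B. j b:fst d}) ` C"
 have "opn ?Z U' & (EX n F. F <= polyfun n & kisomorphic (open_subspace ?Z U') (affine_kspace n F))"
  if U': "U':?\<U>" for U'
 proof -
  obtain d where d: "d:C" "U' = {b:B. j b:fst d}" using U' by blast
  obtain U n u where Un: "d = (U, n, u)" by (cases d)
  have c: "chart {0} Y U n u" using bspec[OF C(2) d(1)] Un by simp
  show ?thesis using chart_iso[OF c] chart_open[OF c] unfolding d(2) Un fst_conv openin_kpull by blast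
 qed
 moreover have "\<Union>?\<U> = pts ?Z" unfolding topZ using C(3) jB by auto
 ultimately show ?thesis unfolding variety_def using kpull_sheaf[OF sh] C(1)
  by (intro conjI exI[of _ ?\<U>]) auto
qed

lemma kreg_kprodI:
 assumes "r:extensional W"
  "!!z. z:W ==> EX A B s t. opn X A & opn Y B &
    s:tensor_functions X Y A B & t:tensor_functions X Y A B & z:A \<times> B & t z ~= 0 &
    (ALL w:A \<times> B. t w ~= 0 --> w:W & r w = s w / t w)"
 shows "r:kreg (kprod X Y) W"
 using assms by (simp add: kprod_def)

lemma kpull_tensor:
 fixes j :: "'b => 'a" and B :: "'b set"
 assumes A: "opn Y A" "opn Y A'" and t: "t:tensor_functions Y Y A A'"
 defines "jA == {b:B. j b:A}" and "jA' == {b:B. j b:A'}"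
 obtains t' where "t':tensor_functions (kpull B j Y) (kpull B j Y) jA jA'"
  "!!b c. b:jA ==> c:jA' ==> t' (b, c) = t (j b, j c)"
proof -
 obtain m f g where t: "t = (%(a, b). \<Sum>i<(m::nat). f i a * g i b)" "ALL i<m. f i:kreg Y A & g i:kreg Y A'"
  using t unfolding tensor_functions_def by blast
 define f' where "f' = (%i. restrict (%b. f i (j b)) jA)"
 define g' where "g' = (%i. restrict (%b. g i (j b)) jA')"
 have "ALL i<m. f' i:kreg (kpull B j Y) jA & g' i:kreg (kpull B j Y) jA'"
  unfolding f'_def g'_def jA_def jA'_def
  by (intro allI impI conjI kpull_comp A(1,2)) (use t(2) in blast)+
 hence "(%(a, b). \<Sum>i<m. f' i a * g' i b):tensor_functions (kpull B j Y) (kpull B j Y) jA jA'"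
  unfolding tensor_functions_def by blast
 thus thesis by (rule that) (simp add: t(1) f'_def g'_def)
qed

lemma kmorphism_kpull_prod:
 fixes Y :: "('a, 'k::field) kspace" and B :: "'b set"
 assumes Y: "variety Y" and Z: "variety (kpull B j Y)" and jB: "j ` B <= pts Y"
 shows "kmorphism (kprod (kpull B j Y) (kpull B j Y)) (kprod Y Y) (%(b, c). (j b, j c))"
proof -
 let ?Z = "kpull B j Y" and ?jj = "%(b, c). (j b, j c)"
 have kt: "ktop (kprod X X') = kprod_top X X'" for X :: "('x, 'k) kspace" and X' :: "('y, 'k) kspace"
  by (simp add: kprod_def)
 have top: "topspace (kprod_top ?Z ?Z) = B \<times> B" by (simp add: topspace_kprod[OF Z] topspace_kpull[OF jB])
 have opj: "opn Y A ==> opn ?Z {b:B. j b:A}" for A unfolding openin_kpull by blast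
 show ?thesis unfolding kmorphism_def kt top
 proof (intro conjI allI impI)
  show "continuous_map (kprod_top ?Z ?Z) (kprod_top Y Y) ?jj"
   unfolding kprod_top_def[of Y Y]
  proof (rule continuous_on_generated_topo)
   fix W assume "W:{{z:A \<times> B. t z ~= 0} | A B t.
    opn Y A & opn Y B & t:tensor_functions Y Y A B}"
   then obtain A A' t where W: "W = {z:A \<times> A'. t z ~= 0}" "opn Y A" "opn Y A'"
    "t:tensor_functions Y Y A A'" by blast
   let ?A = "{b:B. j b:A}" and ?A' = "{b:B. j b:A'}"
   obtain t' where t': "t':tensor_functions ?Z ?Z ?A ?A'" "!!b c. b:?A ==> c:?A' ==> t' (b, c) = t (j b, j c)"
    by (rule kpull_tensor[OF W(2-4), of B j]) blast
   have "openin (kprod_top ?Z ?Z) {z:?A \<times> ?A'. t' z ~= 0}"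
    unfolding kprod_top_def using opj[OF W(2)] opj[OF W(3)] t'(1) by (intro topology_generated_by_Basis) blast
   moreover have "?jj -` W Int topspace (kprod_top ?Z ?Z) = {z:?A \<times> ?A'. t' z ~= 0}"
    unfolding top W(1) using t'(2) by auto
   ultimately show "openin (kprod_top ?Z ?Z) (?jj -` W Int topspace (kprod_top ?Z ?Z))" by simp
  next
   have "?jj ` topspace (kprod_top ?Z ?Z) <= topspace (kprod_top Y Y)"
    unfolding top topspace_kprod[OF Y] using jB by auto
   thus "?jj ` topspace (kprod_top ?Z ?Z) <= \<Union>{{z:A \<times> B. t z ~= 0} | A B t.
    opn Y A & opn Y B & t:tensor_functions Y Y A B}"
    by (simp only: kprod_top_def[of Y Y] topology_generated_by_topspace)
  qed
  fix W r assume "openin (kprod_top Y Y) W" and r: "r:kreg (kprod Y Y) W"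
  let ?P = "{z:B \<times> B. ?jj z:W}"
  show "restrict (r o ?jj) ?P:kreg (kprod ?Z ?Z) ?P"
  proof (rule kreg_kprodI)
   fix z assume z: "z:?P"
   obtain b c where bc: "z = (b, c)" "b:B" "c:B" "(j b, j c):W" using z by auto
   have "ALL z:W. EX A B s t. opn Y A & opn Y B &
         s:tensor_functions Y Y A B & t:tensor_functions Y Y A B &
         z:A \<times> B & t z ~= 0 & (ALL w:A \<times> B. t w ~= 0 --> w:W & r w = s w / t w)"
    using r by (simp add: kprod_def)
   from bspec[OF this bc(4)] obtain A A' s t where A: "opn Y A" "opn Y A'"
         "s:tensor_functions Y Y A A'" "t:tensor_functions Y Y A A'"
         "(j b, j c):A \<times> A'" "t (j b, j c) ~= 0"
         "ALL w:A \<times> A'. t w ~= 0 --> w:W & r w = s w / t w" by (elim exE conjE)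
   let ?A = "{b:B. j b:A}" and ?A' = "{b:B. j b:A'}"
   obtain t' where t': "t':tensor_functions ?Z ?Z ?A ?A'" "!!b c. b:?A ==> c:?A' ==> t' (b, c) = t (j b, j c)"
    by (rule kpull_tensor[OF A(1,2,4), of B j]) blast
   obtain s' where s': "s':tensor_functions ?Z ?Z ?A ?A'" "!!b c. b:?A ==> c:?A' ==> s' (b, c) = s (j b, j c)"
    by (rule kpull_tensor[OF A(1,2,3), of B j]) blast
   show "EX A B s t. opn ?Z A & opn ?Z B & s:tensor_functions ?Z ?Z A B &
     t:tensor_functions ?Z ?Z A B & z:A \<times> B & t z ~= 0 &
     (ALL w:A \<times> B. t w ~= 0 --> w:?P & restrict (r o ?jj) ?P w = s w / t w)"
   proof (rule exI[of _ ?A], rule exI[of _ ?A'], rule exI[of _ s'], rule exI[of _ t'], intro conjI ballI impI)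
    fix w assume w: "w:?A \<times> ?A'" "t' w ~= 0"
    have *: "w:?P & restrict (r o ?jj) ?P w = s' w / t' w"
     using w t'(2) s'(2) A(7) by auto
    thus "w:?P" by (rule conjunct1)
    from * show "restrict (r o ?jj) ?P w = s' w / t' w" by (rule conjunct2)
   qed (use A bc t' s' opj in auto)
  qed simp
 qed
qed

context pos_char
begin

text \<open>A variety \<open>Y\<close> whose perfection is \<open>X\<close> has the same topology,
  so \<open>kpull\<close> along \<open>j\<close> makes \<open>B\<close> an algebraic group, and its
  perfection is the structure sought.\<close>

theorem quasialg_pullback:
 fixes B :: "'b monoid"
 assumes G: "quasialg G X" and B: "comm_group B" and j: "j:hom B G" "inj_on j (carrier B)"
  and K: "closedin (ktop X) (j ` carrier B)"
 obtains X' where "quasialg B X'" "quasialg_hom B X' G X j"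
proof -
 obtain Y where Y: "algebraic_group G Y" "X = perfection Y" using G unfolding quasialg_def by blast
 have var: "variety Y" and top: "pts Y = carrier G"
  and mult: "kmorphism (kprod Y Y) Y (%(x, y). x *[G] y)" and inv: "kmorphism Y Y (%x. inv[G] x)"
  using Y(1) by (auto simp: algebraic_group_def)
 interpret B: comm_group B by (rule B)
 interpret G: group G by (rule quasialg_group[OF G])
 interpret j: group_hom B G j using j(1) by unfold_locales
 let ?Z = "kpull (carrier B) j Y"
 have KY: "closedin (ktop Y) (j ` carrier B)" using K Y(2) by (simp add: perfection_def)
 have jB: "j ` carrier B <= pts Y" using closedin_subset[OF KY] .
 note varZ = kpull_variety[OF var j(2) KY]
 note topZ = topspace_kpull[OF jB]
 have glueZ: "!!V r. opn ?Z V ==> r:extensional V ==>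
   (!!x. x:V ==> EX V'. opn ?Z V' & x:V' & V' <= V & restrict r V':kreg ?Z V') ==> r:kreg ?Z V"
  using varZ unfolding variety_def function_sheaf_def by simp
 have topZZ: "pts (kprod ?Z ?Z) = carrier B \<times> carrier B"
  using topspace_kprod[OF varZ] topZ by (simp add: kprod_def)
 have "kmorphism (kprod ?Z ?Z) ?Z (%(x, y). x *[B] y)"
 proof (rule kmorphism_into_kpull[OF _ _ _ jB])
  have "kmorphism (kprod ?Z ?Z) Y (%z. (%(x, y). x *[G] y) ((%(b, c). (j b, j c)) z))"
   by (rule kmorphism_comp[OF kmorphism_kpull_prod[OF var varZ jB] mult])
  thus "kmorphism (kprod ?Z ?Z) Y (%w. j ((%(x, y). x *[B] y) w))"
   by (rule kmorphism_cong[THEN iffD1, rotated]) (auto simp: topZZ)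
  fix V r assume V: "opn (kprod ?Z ?Z) V" "r:extensional V"
   and loc: "!!x. x:V ==> EX V'. opn (kprod ?Z ?Z) V' & x:V' & V' <= V & restrict r V':kreg (kprod ?Z ?Z) V'"
  show "r:kreg (kprod ?Z ?Z) V"
  proof (rule kreg_kprodI[OF V(2)])
   fix z assume "z:V"
   from loc[OF this] obtain V' where V': "z:V'" "V' <= V" "restrict r V':kreg (kprod ?Z ?Z) V'" by blast
   have "ALL z:V'. EX A B s t. opn ?Z A & opn ?Z B & s:tensor_functions ?Z ?Z A B &
     t:tensor_functions ?Z ?Z A B & z:A \<times> B & t z ~= 0 &
     (ALL w:A \<times> B. t w ~= 0 --> w:V' & restrict r V' w = s w / t w)"
    using V'(3) by (simp add: kprod_def)
   from bspec[OF this V'(1)] obtain A B s t where A: "opn ?Z A" "opn ?Z B"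
     "s:tensor_functions ?Z ?Z A B" "t:tensor_functions ?Z ?Z A B" "z:A \<times> B" "t z ~= 0"
     "ALL w:A \<times> B. t w ~= 0 --> w:V' & restrict r V' w = s w / t w" by (elim exE conjE)
   have "ALL w:A \<times> B. t w ~= 0 --> w:V & r w = s w / t w" using A(7) V'(2) by fastforce
   thus "EX A B s t. opn ?Z A & opn ?Z B & s:tensor_functions ?Z ?Z A B &
     t:tensor_functions ?Z ?Z A B & z:A \<times> B & t z ~= 0 &
     (ALL w:A \<times> B. t w ~= 0 --> w:V & r w = s w / t w)"
    using A(1-6) by (intro exI[of _ A] exI[of _ B] exI[of _ s] exI[of _ t] conjI)
  qed
 qed (use topZZ in auto)
 moreover have "kmorphism ?Z ?Z (%x. inv[B] x)"
 proof (rule kmorphism_into_kpull[OF glueZ _ _ jB])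
  have "kmorphism ?Z Y (%z. inv[G] (j z))" by (rule kmorphism_comp[OF kmorphism_kpull[OF jB] inv])
  thus "kmorphism ?Z Y (%w. j (inv[B] w))"
   by (rule kmorphism_cong[THEN iffD1, rotated]) (simp add: topZ)
 qed (use topZ in auto)
 ultimately have "algebraic_group B ?Z"
  unfolding algebraic_group_def using B varZ topZ by simp
 hence "quasialg B (perfection ?Z)" unfolding quasialg_def by blast
 moreover have "quasialg_hom B (perfection ?Z) G X j"
  unfolding quasialg_hom_def Y(2) using j(1) kmorphism_perfection[OF kmorphism_kpull[OF jB]] by blast
 ultimately show thesis by (rule that)
qed

end

section \<open>Subgroups and cosets in commutative groups\<close>

lemma restr_simps [simp]:
 "(G || H) || K = G || K"
 "r_coset (G || H) = r_coset G"
 "set_mult (G || H) = set_mult G"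
 "quot_map (G || H) = quot_map G"
 by (simp_all add: fun_eq_iff r_coset_def set_mult_def quot_map_def)

lemma quot_set_image: "quot_set G K H = (%x. H #>[G] x) ` K"
 by (simp add: quot_set_def carrier_FactGroup)

lemma quot_set_restr [simp]: "quot_set (G || H) K B = quot_set G K B"
 by (simp add: quot_set_def)

lemma carrier_Mod: "carrier (G Mod H) = quot_set G (carrier G) H"
 by (simp add: quot_set_image carrier_FactGroup)

lemma Mod_restr: "(G Mod H) || (quot_set G K H) = G || K Mod H"
 by (simp add: quot_set_def FactGroup_def)

locale cgroup = comm_group G for G :: "'a monoid" (structure)
begin

lemma restr_comm_group: "subgroup H G ==> comm_group (G || H)"
 by (rule group.group_comm_groupI[OF subgroup.subgroup_is_group])
   (auto intro: m_comm simp: subgroup.mem_carrier)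

lemma subgroup_restr: "subgroup H G ==> subgroup K (G || H) <-> subgroup K G & K <= H"
 using incl_subgroup[of H K] subgroup_incl[of K H] subgroup.subset[of K "G || H"] by auto

lemma inv_restr: "subgroup H G ==> x:H ==> inv[G || H] x = inv x"
 by (rule m_inv_consistent)

lemma mem_coset:
 assumes H: "subgroup H G" and x: "x:carrier G"
 shows "y:H #> x <-> y:carrier G & y \<otimes> inv x:H"
proof
 assume "y:H #> x"
 then obtain h where h: "h:H" "y = h \<otimes> x" by (auto simp: r_coset_def)
 thus "y:carrier G & y \<otimes> inv x:H" using subgroup.mem_carrier[OF H] h x by (simp add: m_assoc)
next
 assume y: "y:carrier G & y \<otimes> inv x:H"
 hence "y = (y \<otimes> inv x) \<otimes> x" using x by (simp add: m_assoc)
 thus "y:H #> x" using y by (auto simp: r_coset_def)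
qed

lemma coset_eq_iff:
 assumes H: "subgroup H G" and xy: "x:carrier G" "y:carrier G"
 shows "H #> x = H #> y <-> x \<otimes> inv y:H"
proof
 assume "H #> x = H #> y"
 thus "x \<otimes> inv y:H" using rcos_self[OF xy(1) H] mem_coset[OF H xy(2)] by blast
next
 assume "x \<otimes> inv y:H"
 thus "H #> x = H #> y" using mem_coset[OF H xy(2)] xy repr_independence[OF _ xy(2) H] by simp
qed

lemma coset_one_iff:
 assumes H: "subgroup H G" and x: "x:carrier G"
 shows "H #> x = H <-> x:H"
 using coset_eq_iff[OF H x one_closed] coset_mult_one[of H] subgroup.subset[OF H] x by simp

lemma diff_cancel:
 assumes "subgroup H G" "x:carrier G" "y:carrier G" "x \<otimes> inv y:H"
 shows "y \<otimes> inv x:H" "x:H <-> y:H"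
proof -
 show 1: "y \<otimes> inv x:H" using assms(2,3) subgroup.m_inv_closed[OF assms(1,4)] by (simp add: inv_mult_group)
 have "x = (x \<otimes> inv y) \<otimes> y" "y = (y \<otimes> inv x) \<otimes> x" using assms(2,3) by (simp_all add: m_assoc)
 thus "x:H <-> y:H" using 1 assms(1,4) subgroup.m_closed by metis
qed

lemma diff_trans:
 assumes "subgroup H G" "x:carrier G" "y:carrier G" "z:carrier G" "x \<otimes> inv y:H" "y \<otimes> inv z:H"
 shows "x \<otimes> inv z:H"
proof -
 show ?thesis using assms(2-4) subgroup.m_closed[OF assms(1,5,6)] inv_closed l_inv m_assoc m_closed r_one l_one by metis
qed

lemma set_mult_upper1: "subgroup K G ==> H <= carrier G ==> H <= H <#> K"
 unfolding set_mult_def using subgroup.one_closed[of K G] r_one by (fastforce intro: bexI[of _ "\<one>"])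

lemma set_mult_upper2: "subgroup H G ==> K <= carrier G ==> K <= H <#> K"
 unfolding set_mult_def using subgroup.one_closed[of H G] l_one by (fastforce intro: bexI[of _ "\<one>"])

lemma set_mult_least: "subgroup L G ==> H <= L ==> K <= L ==> H <#> K <= L"
 unfolding set_mult_def using subgroup.m_closed[of L G] by auto

lemma set_mult_comm: "H <= carrier G ==> K <= carrier G ==> H <#> K = K <#> H"
 unfolding set_mult_def using m_comm by (fastforce simp: subset_iff)

lemma set_mult_mono: "H <= H' ==> K <= K' ==> H <#> K <= H' <#> K'"
 unfolding set_mult_def by blast

lemma set_mult_absorb: "subgroup K G ==> subgroup H G ==> H <= K ==> K <#> H = K"
 using set_mult_least[of K K H] set_mult_upper1[of H K] subgroup.subset[of K] by auto

lemma mem_set_mult_iff: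
 assumes "subgroup H G" "K <= carrier G"
 shows "x:K <#> H <-> x:carrier G & (EX k:K. x \<otimes> inv k:H)"
proof
 assume "x:K <#> H"
 then obtain k h where kh: "k:K" "h:H" "x = k \<otimes> h" by (auto simp: set_mult_def)
 hence "k:carrier G" "h:carrier G" using assms subgroup.mem_carrier by auto
 moreover from this have "k \<otimes> h \<otimes> inv k = h" by (metis inv_closed m_assoc m_comm r_inv r_one)
 ultimately show "x:carrier G & (EX k:K. x \<otimes> inv k:H)"
  using kh by (auto intro!: bexI[of _ k])
next
 assume "x:carrier G & (EX k:K. x \<otimes> inv k:H)"
 then obtain k where k: "x:carrier G" "k:K" "x \<otimes> inv k:H" by blast
 moreover have kG: "k:carrier G" using k(2) assms(2) by blast
 ultimately have "(x \<otimes> inv k) \<otimes> k = x" by (simp add: m_assoc)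
 thus "x:K <#> H" using m_comm[of k "x \<otimes> inv k"] k(1) kG k unfolding set_mult_def by fastforce
qed

text \<open>Dedekind's law; it recovers a subgroup from its product with a member of a system, in
  place of a computation in a quotient.\<close>

lemma modular_law:
 assumes "subgroup A G" "subgroup B G" "subgroup C G" "B <= C"
 shows "(A <#> B) Int C = (A Int C) <#> B"
proof
 show "(A Int C) <#> B <= (A <#> B) Int C"
  using set_mult_mono[of "A Int C" A B B] set_mult_least[OF assms(3), of "A Int C" B] assms(4) by blast
 show "(A <#> B) Int C <= (A Int C) <#> B"
 proof
  fix x assume "x:(A <#> B) Int C"
  then obtain a b where ab: "a:A" "b:B" "x = a \<otimes> b" "x:C" by (auto simp: set_mult_def)
  have car: "a:carrier G" "b:carrier G" using ab assms subgroup.mem_carrier by auto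
  have "a = x \<otimes> inv b" using ab(3) car by (simp add: m_assoc)
  hence "a:C" using ab(2,4) assms(3,4) subgroup.m_closed subgroup.m_inv_closed by (metis subsetD)
  thus "x:(A Int C) <#> B" using ab unfolding set_mult_def by blast
 qed
qed

lemma coset_mult:
 assumes "subgroup H G" "x:carrier G" "y:carrier G"
 shows "(H #> x) <#> (H #> y) = H #> (x \<otimes> y)"
 using normal.rcos_sum[OF subgroup_imp_normal[OF assms(1)] assms(2,3)] .

lemma coset_hom: "subgroup H G ==> (%x. H #> x):hom G (G Mod H)"
 by (rule normal.r_coset_hom_Mod[OF subgroup_imp_normal])

lemma coset_group_hom: "subgroup H G ==> group_hom G (G Mod H) (%x. H #> x)"
 using coset_hom[of H] abelian_FactGroup[of H] is_group
 by (simp add: group_hom_def group_hom_axioms_def comm_group_def)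

lemma quot_set_subgroup:
 assumes "subgroup H G" "subgroup K G"
 shows "subgroup (quot_set G K H) (G Mod H)"
 unfolding quot_set_image
 using group_hom.subgroup_img_is_subgroup[OF coset_group_hom[OF assms(1)] assms(2)] .

lemma coset_preimage_subgroup:
 assumes "subgroup H G" "subgroup C (G Mod H)"
 shows "subgroup (coset_preimage G H C) G" "H <= coset_preimage G H C"
  "quot_set G (coset_preimage G H C) H = C"
proof -
 interpret h: group_hom G "G Mod H" "%x. H #> x" by (rule coset_group_hom[OF assms(1)])
 interpret C: subgroup C "G Mod H" by (rule assms(2))
 show "subgroup (coset_preimage G H C) G"
  unfolding coset_preimage_def
  by unfold_locales (use C.m_closed C.one_closed in \<open>auto simp: coset_mult[OF assms(1), symmetric] coset_join2[OF _ assms(1) subgroup.one_closed[OF assms(1)]]\<close>)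
 show "H <= coset_preimage G H C"
  unfolding coset_preimage_def using C.one_closed subgroup.mem_carrier[OF assms(1)]
  by (auto simp: coset_join3 coset_join2[OF _ assms(1)])
 show "quot_set G (coset_preimage G H C) H = C"
  unfolding quot_set_image coset_preimage_def using C.subset by (auto simp: carrier_FactGroup)
qed

lemma coset_preimage_quot_set:
 assumes "subgroup H G" "subgroup K G" "H <= K"
 shows "coset_preimage G H (quot_set G K H) = K"
proof -
 have "x:K" if x: "x:carrier G" "H #> x:quot_set G K H" for x
 proof -
  from x(2) obtain y where y: "y:K" "H #> x = H #> y" by (auto simp: quot_set_image)
  have yG: "y:carrier G" using y(1) subgroup.mem_carrier[OF assms(2)] by blast
  show ?thesis using coset_eq_iff[OF assms(1) x(1) yG] y(2) assms(3) diff_cancel(2)[OF assms(2) x(1) yG] y(1) by blast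
 qed
 thus ?thesis using subgroup.mem_carrier[OF assms(2)] by (auto simp: coset_preimage_def quot_set_image)
qed

lemma coset_mem_quot_set:
 assumes "subgroup H G" "subgroup K G" "H <= K" "x:carrier G"
 shows "H #> x:quot_set G K H <-> x:K"
 using coset_preimage_quot_set[OF assms(1-3)] assms(4) by (auto simp: coset_preimage_def)

lemma quot_set_mono_iff:
 assumes "subgroup H G" "subgroup K G" "subgroup L G" "H <= K" "H <= L"
 shows "quot_set G K H <= quot_set G L H <-> K <= L"
proof
 assume sub: "quot_set G K H <= quot_set G L H"
 show "K <= L"
 proof
  fix x assume x: "x:K"
  thus "x:L" using sub coset_mem_quot_set[OF assms(1,3,5)] subgroup.mem_carrier[OF assms(2) x] by (auto simp: quot_set_image)
 qed
qed (auto simp: quot_set_image)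

lemma Union_quot_set:
 assumes "subgroup H G" "subgroup K G" "H <= K"
 shows "\<Union>(quot_set G K H) = K"
proof
 show "\<Union>(quot_set G K H) <= K"
  using assms subgroup.m_closed[OF assms(2)] by (auto simp: quot_set_image r_coset_def)
 show "K <= \<Union>(quot_set G K H)"
  using rcos_self[OF _ assms(1)] subgroup.mem_carrier[OF assms(2)] by (auto simp: quot_set_image)
qed

lemma quot_set_inter:
 assumes "subgroup H G" "subgroup K G" "subgroup L G" "H <= K" "H <= L"
 shows "quot_set G K H Int quot_set G L H = quot_set G (K Int L) H"
proof
 show "quot_set G K H Int quot_set G L H <= quot_set G (K Int L) H"
 proof
  fix c assume c: "c:quot_set G K H Int quot_set G L H"
  then obtain x where x: "x:K" "c = H #> x" by (auto simp: quot_set_image)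
  hence "x:L" using coset_mem_quot_set[OF assms(1,3,5), of x] c subgroup.mem_carrier[OF assms(2)] by auto
  with x show "c:quot_set G (K Int L) H" by (auto simp: quot_set_image)
 qed
qed (auto simp: quot_set_image)

end

section \<open>Quasi-algebraic structures on quotients\<close>

definition maps :: "'a monoid => 'a set => 'b monoid => 'b set => ('a => 'b) => bool" where
 "maps G1 B1 G2 B2 f <-> comm_group G1 & comm_group G2 & f:hom G1 G2 &
   subgroup B1 G1 & subgroup B2 G2 & f ` B1 <= B2"

lemma maps_comp: "maps G1 B1 G2 B2 f ==> maps G2 B2 G3 B3 g ==> maps G1 B1 G3 B3 (%x. g (f x))"
 unfolding maps_def using hom_compose[of f G1 G2 g G3] by (auto simp: comp_def)

lemma maps_id: "comm_group G ==> subgroup B G ==> subgroup C G ==> B <= C ==> maps G B G C (%x. x)"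
 by (simp add: maps_def hom_def)

locale mapping = G1: cgroup G1 + G2: cgroup G2 + f: group_hom G1 G2 f
 for G1 :: "'a monoid" and B1 and G2 :: "'b monoid" and B2 f +
 assumes maps: "maps G1 B1 G2 B2 f"
begin

lemma base: "subgroup B1 G1" "subgroup B2 G2" "f ` B1 <= B2"
 using maps by (auto simp: maps_def)

lemma image_subgroup: "subgroup K G1 ==> subgroup (f ` K) G2"
 by (rule f.subgroup_img_is_subgroup)

lemma coset:
 assumes x: "x:carrier G1"
 shows "quot_map G2 B2 f (B1 #>[G1] x) = B2 #>[G2] f x"
proof -
 have fB: "subgroup (f ` B1) G2" by (rule image_subgroup[OF base(1)])
 have "f ` (B1 #>[G1] x) = f ` B1 #>[G2] f x"
  using x subgroup.mem_carrier[OF base(1)] by (force simp: r_coset_def)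
 thus ?thesis
  using G2.setmult_rcos_assoc[OF subgroup.subset[OF base(2)] subgroup.subset[OF fB], of "f x"] x
   G2.set_mult_absorb[OF base(2) fB base(3)] by (simp add: quot_map_def)
qed

lemma quot_hom: "quot_map G2 B2 f:hom (G1 Mod B1) (G2 Mod B2)"
proof (rule homI)
 fix c d assume "c:carrier (G1 Mod B1)" "d:carrier (G1 Mod B1)"
 then obtain x y where xy: "x:carrier G1" "c = B1 #>[G1] x" "y:carrier G1" "d = B1 #>[G1] y"
  by (auto simp: carrier_FactGroup)
 thus "quot_map G2 B2 f (c *[G1 Mod B1] d) = quot_map G2 B2 f c *[G2 Mod B2] quot_map G2 B2 f d"
  by (simp add: G1.coset_mult[OF base(1)] G2.coset_mult[OF base(2)] coset)
qed (auto simp: carrier_FactGroup coset)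

lemma image_mult_subgroup:
 assumes K: "subgroup K G1"
 shows "subgroup (f ` K <#>[G2] B2) G2" "B2 <= f ` K <#>[G2] B2" "f ` K <= f ` K <#>[G2] B2"
 using G2.mult_subgroups[OF image_subgroup[OF K] base(2)]
  G2.set_mult_upper1[OF base(2) subgroup.subset[OF image_subgroup[OF K]]]
  G2.set_mult_upper2[OF image_subgroup[OF K] subgroup.subset[OF base(2)]] by auto

lemma quot_map_image:
 assumes K: "subgroup K G1"
 shows "quot_map G2 B2 f ` quot_set G1 K B1 = quot_set G2 (f ` K <#>[G2] B2) B2"
proof -
 have e: "quot_map G2 B2 f ` quot_set G1 K B1 = (%x. B2 #>[G2] f x) ` K"
  unfolding quot_set_image image_image using coset subgroup.mem_carrier[OF K] by (intro image_cong) auto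
 have "B2 #>[G2] y:(%x. B2 #>[G2] f x) ` K" if y: "y:f ` K <#>[G2] B2" for y
 proof -
  obtain x where x: "x:K" "y *[G2] inv[G2] (f x):B2" "y:carrier G2"
   using y G2.mem_set_mult_iff[OF base(2) subgroup.subset[OF image_subgroup[OF K]]] by auto
  thus ?thesis using G2.coset_eq_iff[OF base(2) x(3), of "f x"] subgroup.mem_carrier[OF K] by auto
 qed
 thus ?thesis unfolding e using image_mult_subgroup(3)[OF K] unfolding quot_set_image by blast
qed

lemma image_mult_absorb:
 assumes A: "subgroup A G1"
 shows "f ` (A <#>[G1] B1) <#>[G2] B2 = f ` A <#>[G2] B2"
proof
 have "f ` (A <#>[G1] B1) <= f ` A <#>[G2] B2"
 proof clarify
  fix z assume "z:A <#>[G1] B1"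
  then obtain a b where ab: "a:A" "b:B1" "z = a *[G1] b" by (auto simp: set_mult_def)
  hence "a:carrier G1" "b:carrier G1" using subgroup.mem_carrier A base(1) by metis+
  thus "f z:f ` A <#>[G2] B2" using ab base(3) by (auto simp: set_mult_def)
 qed
 thus "f ` (A <#>[G1] B1) <#>[G2] B2 <= f ` A <#>[G2] B2"
  by (rule G2.set_mult_least[OF image_mult_subgroup(1)[OF A] _ image_mult_subgroup(2)[OF A]])
 have "f ` A <= f ` (A <#>[G1] B1)" using G1.set_mult_upper1[OF base(1) subgroup.subset[OF A]] by blast
 thus "f ` A <#>[G2] B2 <= f ` (A <#>[G1] B1) <#>[G2] B2" by (rule G2.set_mult_mono) simp
qed

lemma quot_map_inj:
 assumes "!!x. x:carrier G1 ==> f x:B2 ==> x:B1"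
 shows "inj_on (quot_map G2 B2 f) (carrier (G1 Mod B1))"
proof (rule inj_onI)
 fix c d assume cd: "c:carrier (G1 Mod B1)" "d:carrier (G1 Mod B1)" "quot_map G2 B2 f c = quot_map G2 B2 f d"
 then obtain x y where xy: "x:carrier G1" "c = B1 #>[G1] x" "y:carrier G1" "d = B1 #>[G1] y"
  by (auto simp: carrier_FactGroup)
 hence "B2 #>[G2] f x = B2 #>[G2] f y" using cd(3) coset by simp
 hence "x *[G1] inv[G1] y:B1" using G2.coset_eq_iff[OF base(2)] xy assms by simp
 thus "c = d" using G1.coset_eq_iff[OF base(1)] xy by simp
qed

lemma quot_map_onto:
 assumes "!!y. y:carrier G2 ==> EX x:carrier G1. y *[G2] inv[G2] (f x):B2"
 shows "quot_map G2 B2 f ` carrier (G1 Mod B1) = carrier (G2 Mod B2)"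
proof -
 have "f ` carrier G1 <#>[G2] B2 = carrier G2"
  using G2.mem_set_mult_iff[OF base(2) subgroup.subset[OF image_subgroup[OF G1.subgroup_self]]] assms by auto
 thus ?thesis using quot_map_image[OF G1.subgroup_self] by (simp add: carrier_Mod)
qed

end

lemma mapping: "maps G1 B1 G2 B2 f ==> mapping G1 B1 G2 B2 f"
 by (auto simp: maps_def mapping_def mapping_axioms_def cgroup_def group_hom_def group_hom_axioms_def comm_group_def)

lemmas maps_coset = mapping.coset[OF mapping]
 and maps_hom = mapping.quot_hom[OF mapping]
 and image_mult_subgroup = mapping.image_mult_subgroup[OF mapping]
 and quot_map_image = mapping.quot_map_image[OF mapping]
 and image_mult_absorb = mapping.image_mult_absorb[OF mapping]
 and quot_map_inj = mapping.quot_map_inj[OF mapping]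
 and quot_map_onto = mapping.quot_map_onto[OF mapping]

lemma quot_map_comp:
 assumes f: "maps G1 B1 G2 B2 f" and g: "maps G2 B2 G3 B3 g" and c: "c:carrier (G1 Mod B1)"
 shows "quot_map G3 B3 g (quot_map G2 B2 f c) = quot_map G3 B3 (%x. g (f x)) c"
proof -
 obtain x where x: "x:carrier G1" "c = B1 #>[G1] x" using c by (auto simp: carrier_FactGroup)
 have "f x:carrier G2" using f x(1) by (auto simp: maps_def hom_def)
 thus ?thesis using x(1) maps_coset[OF f] maps_coset[OF g] maps_coset[OF maps_comp[OF f g]] by (simp add: x(2))
qed

lemma quot_map_cong:
 fixes G :: "'a monoid"
 assumes "comm_group G" "subgroup B G" "!!x. x:carrier G ==> f x = g x" "c:carrier (G Mod B)"
 shows "quot_map G' B' f c = quot_map G' B' g c"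
proof -
 interpret cgroup G using assms(1) by (simp add: cgroup_def)
 have "c <= carrier G"
  using assms(4) subgroup.subset[OF assms(2)] r_coset_subset_G[of B] by (auto simp: carrier_FactGroup)
 hence "f ` c = g ` c" using assms(3) by (intro image_cong) auto
 thus ?thesis by (simp add: quot_map_def)
qed

lemma quot_map_id:
 assumes "comm_group G" "subgroup B G" "c:carrier (G Mod B)"
 shows "quot_map G B (%x. x) c = c"
 using maps_coset[OF maps_id[OF assms(1,2,2)]] assms(3) by (auto simp: carrier_FactGroup)

text \<open>Quotients are handled through pairs of subgroups of one group, and closed subgroups of
  \<open>G Mod B\<close> through subgroups of \<open>G\<close> containing \<open>B\<close>; iterated
  quotients and sets of cosets then disappear from the arguments.\<close>

definition qa :: "'a monoid => 'a set => ('a set, 'k::field) kspace => bool" where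
 "qa G B X <-> comm_group G & subgroup B G & quasialg (G Mod B) X"

definition qh :: "'a monoid => 'a set => ('a set, 'k) kspace => 'b monoid => 'b set => ('b set, 'k) kspace =>
  ('a => 'b) => bool" where
 "qh G1 B1 X1 G2 B2 X2 f <-> quasialg_hom (G1 Mod B1) X1 (G2 Mod B2) X2 (quot_map G2 B2 f)"

definition qcl :: "'a monoid => 'a set => ('a set, 'k) kspace => 'a set => bool" where
 "qcl G B X K <-> subgroup K G & B <= K & quasialg_closed (G Mod B) X (quot_set G K B)"

lemma qcl_coset_preimage_iff:
 assumes G: "comm_group G" and B: "subgroup B G"
 shows "(EX C. K = coset_preimage G B C & quasialg_closed (G Mod B) X C) <-> qcl G B X K"
proof -
 interpret cgroup G using G by (simp add: cgroup_def)
 have "qcl G B X K" if C: "K = coset_preimage G B C" "quasialg_closed (G Mod B) X C" for C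
  using coset_preimage_subgroup[OF B, of C] C by (simp add: qcl_def quasialg_closed_def)
 moreover have "EX C. K = coset_preimage G B C & quasialg_closed (G Mod B) X C" if "qcl G B X K"
  using coset_preimage_quot_set[OF B, of K] that by (intro exI[of _ "quot_set G K B"]) (auto simp: qcl_def)
 ultimately show ?thesis by blast
qed

lemma qclD: "qcl G B X K ==> subgroup K G" "qcl G B X K ==> B <= K"
 by (auto simp: qcl_def)

lemma qaD: "qa G B X ==> comm_group G" "qa G B X ==> subgroup B G" "qa G B X ==> quasialg (G Mod B) X"
 "qa G B X ==> cgroup G"
 by (auto simp: qa_def cgroup_def)

context pos_char
begin

abbreviation qa :: "'a monoid => 'a set => ('a set, 'k) kspace => bool" where "qa == Submission.qa"

lemma qa_top: "qa G B X ==> pts X = carrier (G Mod B)"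
 by (simp add: qa_def quasialg_topspace)

lemma qa_group: "qa G B X ==> group (G Mod B)"
 using quasialg_group qaD(3) by blast

lemma qh_comp_iff:
 assumes "qa G1 B1 X1" "maps G1 B1 G2 B2 f" "maps G2 B2 G3 B3 g"
 shows "quasialg_hom (G1 Mod B1) X1 (G3 Mod B3) X3 (%c. quot_map G3 B3 g (quot_map G2 B2 f c)) <->
  qh G1 B1 X1 G3 B3 X3 (%x. g (f x))"
 unfolding qh_def using quot_map_comp[OF assms(2,3)]
 by (rule quasialg_hom_cong[OF qa_top[OF assms(1)] qa_group[OF assms(1)]])

lemma qh_comp:
 assumes "qa G1 B1 X1" "maps G1 B1 G2 B2 f" "maps G2 B2 G3 B3 g"
  "qh G1 B1 X1 G2 B2 X2 f" "qh G2 B2 X2 G3 B3 X3 g"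
 shows "qh G1 B1 X1 G3 B3 X3 (%x. g (f x))"
 unfolding qh_comp_iff[OF assms(1-3), symmetric] using assms(4,5) unfolding qh_def by (rule quasialg_hom_comp)

lemma qh_id:
 assumes "qa G B X"
 shows "qh G B X G B X (%x. x)"
 using quasialg_hom_cong[OF qa_top[OF assms] qa_group[OF assms] quot_map_id[OF qaD(1,2)[OF assms]]]
  quasialg_hom_id[OF quasialg_sheaf[OF qaD(3)[OF assms]] qa_group[OF assms]] by (simp add: qh_def)

lemma qh_lift:
 assumes qa: "qa G1 B1 X1" "qa G2 B2 X2" "qa G3 B3 X3" and f: "maps G1 B1 G2 B2 f" and i: "maps G2 B2 G3 B3 i"
  and inj: "!!x. x:carrier G2 ==> i x:B3 ==> x:B2"
  and qh: "qh G2 B2 X2 G3 B3 X3 i" "qh G1 B1 X1 G3 B3 X3 (%x. i (f x))"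
 shows "qh G1 B1 X1 G2 B2 X2 f"
 unfolding qh_def
 by (rule quasialg_hom_lift[OF qaD(3)[OF qa(1)] qaD(3)[OF qa(2)] qaD(3)[OF qa(3)] qh(1)[unfolded qh_def]
   quot_map_inj[OF i inj] maps_hom[OF f] iffD2[OF qh_comp_iff[OF qa(1) f i] qh(2)]])

lemma qh_descend:
 assumes qa: "qa G1 B1 X1" "qa G2 B2 X2" "qa G3 B3 X3" and q: "maps G1 B1 G2 B2 q" and f: "maps G2 B2 G3 B3 f"
  and surj: "!!y. y:carrier G2 ==> EX x:carrier G1. y *[G2] inv[G2] (q x):B2"
  and qh: "qh G1 B1 X1 G2 B2 X2 q" "qh G1 B1 X1 G3 B3 X3 (%x. f (q x))"
 shows "qh G2 B2 X2 G3 B3 X3 f"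
 unfolding qh_def
 by (rule quasialg_hom_descend[OF qaD(3)[OF qa(1)] qaD(3)[OF qa(2)] qaD(3)[OF qa(3)] qh(1)[unfolded qh_def]
   quot_map_onto[OF q surj] maps_hom[OF f] iffD2[OF qh_comp_iff[OF qa(1) q f] qh(2)]])

lemma qcl_image:
 assumes qa: "qa G1 B1 X1" "qa G2 B2 X2" and f: "maps G1 B1 G2 B2 f" and qh: "qh G1 B1 X1 G2 B2 X2 f"
  and K: "qcl G1 B1 X1 K"
 shows "qcl G2 B2 X2 (f ` K <#>[G2] B2)"
 using quasialg_closed_image[OF qaD(3)[OF qa(1)] qaD(3)[OF qa(2)]] qh K
  image_mult_subgroup[OF f qclD(1)[OF K]] by (simp add: qh_def qcl_def quot_map_image[OF f qclD(1)[OF K], symmetric])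

lemma qcl_preimage:
 assumes qa: "qa G1 B1 X1" "qa G2 B2 X2" and f: "maps G1 B1 G2 B2 f" and qh: "qh G1 B1 X1 G2 B2 X2 f"
  and K: "qcl G2 B2 X2 K"
 shows "qcl G1 B1 X1 {x:carrier G1. f x:K}"
proof -
 interpret mapping G1 B1 G2 B2 f by (rule mapping[OF f])
 interpret K: subgroup K G2 by (rule qclD(1)[OF K])
 have sub: "subgroup {x:carrier G1. f x:K} G1" by unfold_locales auto
 have "quasialg_closed (G1 Mod B1) X1 {c:carrier (G1 Mod B1). quot_map G2 B2 f c:quot_set G2 K B2}"
  using quasialg_closed_preimage[OF qaD(3)[OF qa(1)] qaD(3)[OF qa(2)]] qh K by (simp add: qh_def qcl_def)
 also have "{c:carrier (G1 Mod B1). quot_map G2 B2 f c:quot_set G2 K B2} = quot_set G1 {x:carrier G1. f x:K} B1"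
  unfolding quot_set_image[of G1] carrier_FactGroup
  using coset G2.coset_mem_quot_set[OF base(2) qclD[OF K]] by auto
 finally show ?thesis unfolding qcl_def using sub subgroup.mem_carrier[OF base(1)] base(3) qclD(2)[OF K] by auto
qed

lemma qcl_base:
 assumes "qa G B X"
 shows "qcl G B X B"
proof -
 interpret cgroup G by (rule qaD(4)[OF assms])
 have B: "subgroup B G" by (rule qaD(2)[OF assms])
 have "quot_set G B B = {B}"
  using coset_one_iff[OF B] subgroup.mem_carrier[OF B] subgroup.one_closed[OF B] by (auto simp: quot_set_image intro!: rev_image_eqI)
 thus ?thesis using quasialg_closed_one[OF qaD(3)[OF assms]] B by (simp add: qcl_def)
qed

lemma qcl_carrier:
 assumes "qa G B X"
 shows "qcl G B X (carrier G)"
proof -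
 interpret cgroup G by (rule qaD(4)[OF assms])
 show ?thesis using quasialg_closed_carrier[OF qaD(3)[OF assms]] subgroup.subset[OF qaD(2)[OF assms]] subgroup_self
  by (simp add: qcl_def carrier_Mod)
qed

lemma qcl_inter:
 assumes "qa G B X" "qcl G B X K" "qcl G B X L"
 shows "qcl G B X (K Int L)"
proof -
 interpret cgroup G by (rule qaD(4)[OF assms(1)])
 have "quasialg_closed (G Mod B) X (quot_set G K B Int quot_set G L B)"
  using assms by (intro quasialg_closed_inter qa_group) (auto simp: qcl_def)
 thus ?thesis
  using assms quot_set_inter[OF qaD(2)[OF assms(1)], of K L] subgroups_Inter_pair[of K L] by (auto simp: qcl_def)
qed

lemma qcl_dcc:
 assumes qa: "qa G B X" and K: "!!n. qcl G B X (K n)" and dec: "!!n. K (Suc n) <= K n"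
 obtains m where "!!n. n >= m ==> K n = K m"
proof -
 interpret cgroup G by (rule qaD(4)[OF qa])
 have "quot_set G (K (Suc n)) B <= quot_set G (K n) B" for n using dec[of n] by (auto simp: quot_set_image)
 then obtain m where m: "!!n. n >= m ==> quot_set G (K n) B = quot_set G (K m) B"
  using quasialg_closed_dcc[OF qaD(3)[OF qa], of "%n. quot_set G (K n) B"] K by (auto simp: qcl_def)
 have "coset_preimage G B (quot_set G (K n) B) = K n" for n
  using coset_preimage_quot_set[OF qaD(2)[OF qa]] K by (simp add: qcl_def)
 thus thesis using m that by metis
qed

lemma qa_pullback:
 assumes qa: "qa G2 B2 X2" and j: "maps G1 B1 G2 B2 j"
  and inj: "!!x. x:carrier G1 ==> j x:B2 ==> x:B1" and cl: "qcl G2 B2 X2 (j ` carrier G1 <#>[G2] B2)"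
 obtains X1 where "qa G1 B1 X1" "qh G1 B1 X1 G2 B2 X2 j"
proof -
 interpret mapping G1 B1 G2 B2 j by (rule mapping[OF j])
 have "closedin (ktop X2) (quot_map G2 B2 j ` carrier (G1 Mod B1))"
  using cl quot_map_image[OF G1.subgroup_self] by (simp add: carrier_Mod qcl_def quasialg_closed_def)
 then obtain X1 where "quasialg (G1 Mod B1) X1" "quasialg_hom (G1 Mod B1) X1 (G2 Mod B2) X2 (quot_map G2 B2 j)"
  using quasialg_pullback[OF qaD(3)[OF qa] G1.abelian_FactGroup[OF base(1)] quot_hom quot_map_inj[OF inj]] by metis
 thus thesis using that base(1) G1.comm_group_axioms by (simp add: qa_def qh_def)
qed

end

section \<open>Formal properties of categories of structured groups\<close>

section \<open>Concrete categories\<close>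

text \<open>All functors are the identity on groups and homomorphisms, so they are determined
 by maps of structures, and two of them agree if the identity is an isomorphism of structures.\<close>

locale concrete =
 fixes obj :: "'a monoid => 's => bool"
  and mor :: "'a monoid => 's => 'a monoid => 's => ('a => 'a) => bool"
 assumes mor_hom: "mor G1 S1 G2 S2 f ==> f:hom G1 G2"
  and mor_id: "obj G S ==> mor G S G S (%x. x)"
  and mor_comp: "obj G1 S1 ==> obj G2 S2 ==> obj G3 S3 ==> mor G1 S1 G2 S2 f ==> mor G2 S2 G3 S3 g ==>
   mor G1 S1 G3 S3 (%x. g (f x))"
  and mor_cong: "obj G1 S1 ==> obj G2 S2 ==> (!!x. x:carrier G1 ==> f x = g x) ==> mor G1 S1 G2 S2 f ==> mor G1 S1 G2 S2 g"
begin

abbreviation "cat == concrete_category obj mor"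

lemma Ob_cat [simp]: "(G, S):Ob cat <-> obj G S"
 and Hom_cat [simp]: "f:Hom cat (G1, S1) (G2, S2) <-> f:extensional (carrier G1) & mor G1 S1 G2 S2 f"
 and Idn_cat [simp]: "Idn cat (G, S) = (\<lambda>x\<in>carrier G. x)"
 and Comp_cat [simp]: "Comp cat (G, S) Y Z g f = compose (carrier G) g f"
 by (simp_all add: concrete_category_def)

lemma mor_closed: "mor G1 S1 G2 S2 f ==> x:carrier G1 ==> f x:carrier G2"
 by (rule hom_in_carrier[OF mor_hom])

lemma mor_restrict:
 assumes "obj G1 S1" "obj G2 S2" "mor G1 S1 G2 S2 f"
 shows "mor G1 S1 G2 S2 (restrict f (carrier G1))"
 by (rule mor_cong[OF assms(1,2) _ assms(3)]) simp

lemma is_category_cat: "is_category cat"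
 unfolding is_category_def split_paired_Ball_Sigma Ball_def split_paired_All Ob_cat Hom_cat Idn_cat Comp_cat
proof (intro conjI allI impI)
 fix G1 S1 G2 S2 f assume "obj G1 S1" "obj G2 S2" and f: "f:extensional (carrier G1) & mor G1 S1 G2 S2 f"
 show "compose (carrier G1) f (\<lambda>x\<in>carrier G1. x) = f" "compose (carrier G1) (\<lambda>x\<in>carrier G2. x) f = f"
  using f mor_closed[of G1 S1 G2 S2 f] by (auto simp: compose_def restrict_def extensional_def fun_eq_iff)
next
 fix G0 S0 G1 S1 G2 S2 G3 S3 f g h assume "f:extensional (carrier G0) & mor G0 S0 G1 S1 f"
 thus "compose (carrier G0) h (compose (carrier G0) g f) = compose (carrier G0) (compose (carrier G1) h g) f"
  using mor_closed[of G0 S0 G1 S1 f] by (auto simp: compose_def restrict_def fun_eq_iff)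
qed (auto simp: compose_def intro: mor_restrict mor_id mor_comp)

end

lemma concrete_funct_simps [simp]:
 "fob (concrete_funct F) (G, S) = (G, F G S)" "fmap (concrete_funct F) X Y f = f"
 by (simp_all add: concrete_funct_def)

lemma concrete_funct_comp: "concrete_funct F' \<circ>\<^sub>F concrete_funct F = concrete_funct (%G S. F' G (F G S))"
 by (simp add: concrete_funct_def comp_funct_def fun_eq_iff)

lemma concrete_funct_id: "id_funct = concrete_funct (%G S. S)"
 by (simp add: concrete_funct_def id_funct_def fun_eq_iff)

locale concrete2 = C: concrete obj mor + D: concrete obj' mor'
 for obj :: "'a monoid => 's => bool" and mor
  and obj' :: "'a monoid => 't => bool" and mor'
begin

lemma is_functor_concrete:
 assumes "!!G S. obj G S ==> obj' G (F G S)"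
  and "!!G1 S1 G2 S2 f. obj G1 S1 ==> obj G2 S2 ==> mor G1 S1 G2 S2 f ==> mor' G1 (F G1 S1) G2 (F G2 S2) f"
 shows "is_functor C.cat D.cat (concrete_funct F)"
 unfolding is_functor_def Ball_def split_paired_All concrete_funct_simps C.Ob_cat C.Hom_cat D.Ob_cat D.Hom_cat C.Idn_cat D.Idn_cat C.Comp_cat D.Comp_cat
 using assms C.is_category_cat D.is_category_cat by blast

lemma functors_agree_concrete:
 assumes F: "!!G S. obj G S ==> obj' G (F G S)"
   "!!G1 S1 G2 S2 f. obj G1 S1 ==> obj G2 S2 ==> mor G1 S1 G2 S2 f ==> mor' G1 (F G1 S1) G2 (F G2 S2) f"
  and F': "!!G S. obj G S ==> obj' G (F' G S)"
   "!!G1 S1 G2 S2 f. obj G1 S1 ==> obj G2 S2 ==> mor G1 S1 G2 S2 f ==> mor' G1 (F' G1 S1) G2 (F' G2 S2) f"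
  and id: "!!G S. obj G S ==> mor' G (F G S) G (F' G S) (%x. x)" "!!G S. obj G S ==> mor' G (F' G S) G (F G S) (%x. x)"
 shows "functors_agree C.cat D.cat (concrete_funct F) (concrete_funct F')"
 unfolding functors_agree_def natural_iso_def Ball_def split_paired_All concrete_funct_simps C.Ob_cat C.Hom_cat D.Comp_cat fst_conv
proof (intro conjI allI impI)
 fix G S assume obj: "obj G S"
 note o' = F(1)[OF obj] F'(1)[OF obj]
 have "compose (carrier G) (\<lambda>x\<in>carrier G. x) (\<lambda>x\<in>carrier G. x) = (\<lambda>x\<in>carrier G. x)"
  by (auto simp: compose_def fun_eq_iff)
 thus "is_iso D.cat (G, F G S) (G, F' G S) (\<lambda>x\<in>carrier G. x)"
  unfolding is_iso_def D.Comp_cat D.Idn_cat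
  using D.mor_restrict[OF o' id(1)[OF obj]] D.mor_restrict[OF o'(2,1) id(2)[OF obj]]
  by (intro conjI bexI[of _ "\<lambda>x\<in>carrier G. x"]) simp_all
next
 fix G1 S1 G2 S2 f assume "obj G1 S1" "obj G2 S2" "f:extensional (carrier G1) & mor G1 S1 G2 S2 f"
 thus "compose (carrier G1) (\<lambda>x\<in>carrier G2. x) f = compose (carrier G1) f (\<lambda>x\<in>carrier G1. x)"
  using C.mor_closed[of G1 S1 G2 S2 f] by (auto simp: compose_def restrict_def fun_eq_iff)
qed (rule is_functor_concrete; rule F F'; assumption)+

end

lemma agree_imp_equivalences:
 assumes "is_functor C D F" "is_functor D C F'"
  and "functors_agree C C (F' \<circ>\<^sub>F F) id_funct" "functors_agree D D (F \<circ>\<^sub>F F') id_funct"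
 shows "mutually_inverse_equivalences C D F F'"
 using assms unfolding mutually_inverse_equivalences_def functors_agree_def by blast

lemma hom_cong:
 assumes "comm_group G1" "f:hom G1 G2" "!!x. x:carrier G1 ==> f x = g x"
 shows "g:hom G1 G2"
proof -
 interpret comm_group G1 by fact
 show ?thesis using assms(2,3) by (auto simp: hom_def Pi_iff)
qed

lemma concrete_mono:
 assumes "concrete obj mor" "!!G S. obj' G S ==> obj G S"
 shows "concrete obj' mor"
proof -
 interpret concrete obj mor by fact
 show ?thesis
  by (rule concrete.intro, erule mor_hom, rule mor_id[OF assms(2)], assumption,
   rule mor_comp[OF assms(2) assms(2) assms(2)], assumption+, rule mor_cong[OF assms(2) assms(2)], assumption+)
qed

text \<open>One proof over an arbitrary concrete base serves proalgebraic groups, built on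
  \<open>quasialg\<close>, and proindalgebraic groups, built on \<open>indalg\<close>.\<close>

lemma pro_hom_concrete:
 assumes "concrete obj mor"
 shows "concrete (pro_structure obj trn clo) (pro_hom mor)"
proof -
 interpret concrete obj mor by fact
 have D: "comm_group G" "H:mem S ==> subgroup H G" "H:mem S ==> obj (G Mod H) (str S H)"
  if "pro_structure obj trn clo G S" for G S H
  using that by (auto simp: pro_structure_def pro_system_def)
 have M: "{x:carrier G1. f x:H}:mem S1"
  "mor (G1 Mod {x:carrier G1. f x:H}) (str S1 {x:carrier G1. f x:H}) (G2 Mod H) (str S2 H) (quot_map G2 H f)"
  if "pro_hom mor G1 S1 G2 S2 f" "H:mem S2" for G1 S1 G2 S2 f H
  using that by (auto simp: pro_hom_def Let_def)
 show ?thesis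
 proof
  fix G1 G2 G3 S1 S2 S3 f g
  show "pro_hom mor G1 S1 G2 S2 f ==> f:hom G1 G2" by (simp add: pro_hom_def)
  show "pro_hom mor G1 S1 G1 S1 (%x. x)" if S: "pro_structure obj trn clo G1 S1"
   unfolding pro_hom_def Let_def
  proof (intro conjI ballI)
   fix H assume H: "H:mem S1"
   have eq: "{x:carrier G1. x:H} = H" using subgroup.subset[OF D(2)[OF S H]] by auto
   show "{x:carrier G1. x:H}:mem S1" unfolding eq by (rule H)
   show "mor (G1 Mod {x:carrier G1. x:H}) (str S1 {x:carrier G1. x:H}) (G1 Mod H) (str S1 H) (quot_map G1 H (%x. x))"
    unfolding eq by (rule mor_cong[OF D(3)[OF S H] D(3)[OF S H] quot_map_id[OF D(1)[OF S] D(2)[OF S H], symmetric] mor_id[OF D(3)[OF S H]]])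
  qed (simp add: hom_def)
  show "pro_hom mor G1 S1 G3 S3 (%x. g (f x))" if S: "pro_structure obj trn clo G1 S1"
   "pro_structure obj trn clo G2 S2" "pro_structure obj trn clo G3 S3"
   and f: "pro_hom mor G1 S1 G2 S2 f" and g: "pro_hom mor G2 S2 G3 S3 g"
   unfolding pro_hom_def Let_def
  proof (intro conjI ballI)
   have h: "f:hom G1 G2" "g:hom G2 G3" using f g by (auto simp: pro_hom_def)
   thus "(%x. g (f x)):hom G1 G3" using hom_compose[of f G1 G2 g G3] by (simp add: comp_def)
   fix H assume H: "H:mem S3"
   let ?K = "{x:carrier G2. g x:H}" and ?L = "{x:carrier G1. g (f x):H}"
   have eq: "?L = {x:carrier G1. f x:?K}" using h(1) by (auto simp: hom_def)
   note K = M[OF g H]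
   note L = M[OF f K(1), folded eq]
   show "?L:mem S1" by (rule L)
   have "maps G1 ?L G2 ?K f" "maps G2 ?K G3 H g"
    using D(1,2)[OF S(1)] D(1,2)[OF S(2)] D(1,2)[OF S(3)] h H K(1) L(1) by (auto simp: maps_def hom_def)
   from mor_cong[OF D(3)[OF S(1) L(1)] D(3)[OF S(3) H] quot_map_comp[OF this]
     mor_comp[OF D(3)[OF S(1) L(1)] D(3)[OF S(2) K(1)] D(3)[OF S(3) H] L(2) K(2)]]
   show "mor (G1 Mod ?L) (str S1 ?L) (G3 Mod H) (str S3 H) (quot_map G3 H (%x. g (f x)))" .
  qed
  show "pro_hom mor G1 S1 G2 S2 g" if S: "pro_structure obj trn clo G1 S1" "pro_structure obj trn clo G2 S2"
   and fg: "!!x. x:carrier G1 ==> f x = g x" and f: "pro_hom mor G1 S1 G2 S2 f"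
   unfolding pro_hom_def Let_def
  proof (intro conjI ballI)
   show "g:hom G1 G2" by (rule hom_cong[OF D(1)[OF S(1)] _ fg]) (use f in \<open>simp add: pro_hom_def\<close>)
   fix H assume H: "H:mem S2"
   have eq: "{x:carrier G1. g x:H} = {x:carrier G1. f x:H}" using fg by auto
   note L = M[OF f H]
   show "{x:carrier G1. g x:H}:mem S1" unfolding eq by (rule L)
   show "mor (G1 Mod {x:carrier G1. g x:H}) (str S1 {x:carrier G1. g x:H}) (G2 Mod H) (str S2 H) (quot_map G2 H g)"
    unfolding eq by (rule mor_cong[OF D(3)[OF S(1) L(1)] D(3)[OF S(2) H] quot_map_cong[OF D(1)[OF S(1)] D(2)[OF S(1) L(1)] fg] L(2)])
  qed
 qed
qed

lemma ind_hom_concrete: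
 assumes "concrete obj mor"
 shows "concrete (ind_structure obj mor clo) (ind_hom mor)"
proof -
 interpret concrete obj mor by fact
 have D: "comm_group G" "H:mem S ==> subgroup H G" "H:mem S ==> obj (G || H) (str S H)"
  if "ind_structure obj mor clo G S" for G S H
  using that by (auto simp: ind_structure_def ind_system_def)
 have M: "f ` H:mem S2" "mor (G1 || H) (str S1 H) (G2 || (f ` H)) (str S2 (f ` H)) f"
  if "ind_hom mor G1 S1 G2 S2 f" "H:mem S1" for G1 S1 G2 S2 f H
  using that by (auto simp: ind_hom_def)
 show ?thesis
 proof
  fix G1 G2 G3 S1 S2 S3 f g
  show "ind_hom mor G1 S1 G2 S2 f ==> f:hom G1 G2" by (simp add: ind_hom_def)
  show "ind_hom mor G1 S1 G1 S1 (%x. x)" if "ind_structure obj mor clo G1 S1"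
   using mor_id[OF D(3)[OF that]] by (simp add: ind_hom_def hom_def)
  show "ind_hom mor G1 S1 G3 S3 (%x. g (f x))" if S: "ind_structure obj mor clo G1 S1"
   "ind_structure obj mor clo G2 S2" "ind_structure obj mor clo G3 S3"
   and f: "ind_hom mor G1 S1 G2 S2 f" and g: "ind_hom mor G2 S2 G3 S3 g"
   using hom_compose[of f G1 G2 g G3] f g M[OF f] M[OF g M(1)[OF f]]
    mor_comp[OF D(3)[OF S(1)] D(3)[OF S(2) M(1)[OF f]] D(3)[OF S(3) M(1)[OF g M(1)[OF f]]] M(2)[OF f] M(2)[OF g M(1)[OF f]]]
   by (simp add: ind_hom_def comp_def image_image)
  show "ind_hom mor G1 S1 G2 S2 g" if S: "ind_structure obj mor clo G1 S1" "ind_structure obj mor clo G2 S2"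
   and fg: "!!x. x:carrier G1 ==> f x = g x" and f: "ind_hom mor G1 S1 G2 S2 f"
   unfolding ind_hom_def
  proof (intro conjI ballI)
   show "g:hom G1 G2" by (rule hom_cong[OF D(1)[OF S(1)] _ fg]) (use f in \<open>simp add: ind_hom_def\<close>)
   fix H assume H: "H:mem S1"
   have fgH: "f x = g x" if "x:carrier (G1 || H)" for x using subgroup.mem_carrier[OF D(2)[OF S(1) H]] that fg by simp
   hence eq: "g ` H = f ` H" by auto
   show "g ` H:mem S2" "mor (G1 || H) (str S1 H) (G2 || (g ` H)) (str S2 (g ` H)) g"
    unfolding eq using M(1)[OF f H] mor_cong[OF D(3)[OF S(1) H] D(3)[OF S(2) M(1)[OF f H]] fgH M(2)[OF f H]] by auto
  qed
 qed
qed

section \<open>Completeness, linear compactness and closed subgroups of proalgebraic groups\<close>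

section \<open>Completeness\<close>

text \<open>The projective limit condition in terms of representatives: an element of the limit is a
  family \<open>c\<close> compatible modulo the members of \<open>M\<close>. In this form it passes
  easily to coinitial systems and between a group and a member.\<close>

definition cplt :: "'a monoid => 'a set set => bool" where
 "cplt G M <-> (ALL x:carrier G. (ALL H:M. x:H) --> x = (one G)) &
   (ALL c. (ALL H:M. c H:carrier G) -->
    (ALL H:M. ALL H':M. H <= H' --> c H *[G] inv[G] (c H'):H') -->
    (EX x:carrier G. ALL H:M. x *[G] inv[G] (c H):H))"

lemma cplt_separated: "cplt G M ==> x:carrier G ==> (!!H. H:M ==> x:H) ==> x = (one G)"
 unfolding cplt_def by blast

lemma cplt_limit:
 assumes "cplt G M" "!!H. H:M ==> c H:carrier G"
  "!!H H'. H:M ==> H':M ==> H <= H' ==> c H *[G] inv[G] (c H'):H'"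
 obtains x where "x:carrier G" "!!H. H:M ==> x *[G] inv[G] (c H):H"
proof -
 show thesis using assms(1)[unfolded cplt_def, THEN conjunct2, rule_format, of c] assms(2,3) that by blast
qed

lemma is_quot_limit_iff:
 fixes G (structure)
 assumes G: "comm_group G" and M: "!!H. H:M ==> subgroup H G"
 shows "is_quot_limit G M <-> cplt G M"
proof -
 interpret cgroup G using G by (simp add: cgroup_def)
 have qm: "quot_map G H' (%x. x) (H #> x) = H' #> x" if "H:M" "H':M" "H <= H'" "x:carrier G" for H H' x
  using maps_coset[OF maps_id[OF G M[OF that(1)] M[OF that(2)] that(3)] that(4)] .
 let ?F = "%x. \<lambda>H\<in>M. H #> x"
 have sub: "?F ` carrier G <= quot_limit G M"
  using qm by (auto simp: quot_limit_def carrier_FactGroup)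
 show ?thesis
 proof
  assume lim: "is_quot_limit G M"
  hence inj: "inj_on ?F (carrier G)" and surj: "?F ` carrier G = quot_limit G M"
   by (auto simp: is_quot_limit_def bij_betw_def)
  show "cplt G M" unfolding cplt_def
  proof (intro conjI ballI allI impI)
   fix x assume x: "x:carrier G" "ALL H:M. x:H"
   have "?F x = ?F \<one>"
    by (rule restrict_ext) (use x M coset_eq_iff in auto)
   thus "x = \<one>" using inj x(1) by (auto dest: inj_onD)
  next
   fix c assume c: "ALL H:M. c H:carrier G" "ALL H:M. ALL H':M. H <= H' --> c H \<otimes> inv (c H'):H'"
   have "(\<lambda>H\<in>M. H #> c H):quot_limit G M"
    unfolding quot_limit_def using c qm coset_eq_iff[OF M] diff_cancel(1)[OF M] by (auto simp: carrier_FactGroup)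
   hence "(\<lambda>H\<in>M. H #> c H):?F ` carrier G" by (simp only: surj)
   then obtain x where x: "x:carrier G" "?F x = (\<lambda>H\<in>M. H #> c H)" by (auto elim!: imageE)
   have "x \<otimes> inv (c H):H" if "H:M" for H
    using fun_cong[OF x(2), of H] that coset_eq_iff[OF M[OF that] x(1)] c(1) by simp
   with x(1) show "EX x:carrier G. ALL H:M. x \<otimes> inv (c H):H" by blast
  qed
 next
  assume cp: "cplt G M"
  have "inj_on ?F (carrier G)"
  proof (rule inj_onI)
   fix x y assume xy: "x:carrier G" "y:carrier G" "?F x = ?F y"
   have "x \<otimes> inv y:H" if "H:M" for H
    using fun_cong[OF xy(3), of H] that coset_eq_iff[OF M[OF that] xy(1,2)] by simp
   hence "x \<otimes> inv y = \<one>" using cplt_separated[OF cp] xy by simp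
   thus "x = y" using xy by (metis inv_closed inv_equality inv_inv)
  qed
  moreover have "quot_limit G M <= ?F ` carrier G"
  proof
   fix d assume d: "d:quot_limit G M"
   hence "d H:(#>) H ` carrier G" if "H:M" for H
    using PiE_mem[OF conjunct1[OF d[unfolded quot_limit_def mem_Collect_eq]] that]
    by (simp add: carrier_FactGroup)
   hence "ALL H:M. EX x. x:carrier G & d H = H #> x" by blast
   from bchoice[OF this] obtain c where c: "!!H. H:M ==> c H:carrier G & d H = H #> c H" by blast
   have "c H \<otimes> inv (c H'):H'" if HH: "H:M" "H':M" "H <= H'" for H H'
   proof -
    have "d H' = quot_map G H' (%x. x) (d H)"
     by (rule conjunct2[OF d[unfolded quot_limit_def mem_Collect_eq], rule_format, OF HH])
    hence "H' #> c H = H' #> c H'" using c HH qm[OF HH] by metis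
    thus ?thesis using coset_eq_iff[OF M[OF HH(2)]] c HH by simp
   qed
   then obtain x where x: "x:carrier G" "!!H. H:M ==> x \<otimes> inv (c H):H"
    using cplt_limit[OF cp, of c] c by blast
   have "d = ?F x"
   proof
    fix H show "d H = ?F x H"
    proof (cases "H:M")
     case True
     have "H #> x = H #> c H" using c[OF True] x(2)[OF True] coset_eq_iff[OF M[OF True] x(1)] by blast
     thus ?thesis using c[OF True] True by simp
    next
     case False
     thus ?thesis
      using PiE_arb[OF conjunct1[OF d[unfolded quot_limit_def mem_Collect_eq]]] by simp
    qed
   qed
   thus "d:?F ` carrier G" using x(1) by blast
  qed
  ultimately show "is_quot_limit G M" using sub by (auto simp: is_quot_limit_def bij_betw_def)
 qed
qed

text \<open>Each \<open>H\<close> in \<open>M\<close> receives the value of the family at some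
  \<open>k H\<close> in \<open>N\<close> below it; directedness of \<open>N\<close> makes the new
  family compatible.\<close>

lemma cplt_coinitial:
 fixes G (structure)
 assumes G: "comm_group G" and M: "!!H. H:M ==> subgroup H G" and N: "!!H. H:N ==> subgroup H G"
  and dir: "!!K K'. K:N ==> K':N ==> EX K'':N. K'' <= K Int K'"
  and MN: "!!H. H:M ==> EX K:N. K <= H" and NM: "!!K. K:N ==> EX H:M. H <= K" and cp: "cplt G M"
 shows "cplt G N"
 unfolding cplt_def
proof (intro conjI ballI allI impI)
 fix x assume "x:carrier G" "ALL K:N. x:K"
 thus "x = (one G)" using cplt_separated[OF cp] MN by blast
next
 interpret cgroup G using G by (simp add: cgroup_def)
 fix c assume c: "ALL K:N. c K:carrier G" "ALL K:N. ALL K':N. K <= K' --> c K \<otimes> inv (c K'):K'"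
 obtain k where k: "!!H. H:M ==> k H:N & k H <= H" using MN by metis
 have "c (k H) \<otimes> inv (c (k H')):H'" if HH: "H:M" "H':M" "H <= H'" for H H'
 proof -
  obtain K where K: "K:N" "K <= k H Int k H'" using dir[of "k H" "k H'"] k[OF HH(1)] k[OF HH(2)] by blast
  have k': "k H:N" "k H <= H'" "k H':N" "k H' <= H'" "K <= k H" "K <= k H'"
   using k[OF HH(1)] k[OF HH(2)] HH(3) K(2) by auto
  have "c K \<otimes> inv (c (k H)):H'" "c K \<otimes> inv (c (k H')):H'" using c(2) K(1) k' k' by auto
  thus ?thesis using diff_trans[OF M[OF HH(2)], of "c (k H)" "c K"] diff_cancel(1)[OF M[OF HH(2)]] c(1) k HH K
   by metis
 qed
 moreover have "c (k H):carrier G" if "H:M" for H using c(1) k that by blast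
 ultimately obtain x where x: "x:carrier G" "!!H. H:M ==> x \<otimes> inv (c (k H)):H"
  using cplt_limit[OF cp, of "%H. c (k H)"] by blast
 have "x \<otimes> inv (c K):K" if K: "K:N" for K
 proof -
  obtain H where H: "H:M" "H <= K" using NM K by blast
  hence "k H:N" "k H <= K" using k by blast+
  hence "c (k H) \<otimes> inv (c K):K" "c (k H):carrier G" using c K by blast+
  moreover have "x \<otimes> inv (c (k H)):K" using x(2) H by blast
  ultimately show ?thesis using diff_trans[OF N[OF K] x(1)] c(1) K by blast
 qed
 with x(1) show "EX x:carrier G. ALL K:N. x \<otimes> inv (c K):K" by blast
qed

lemma cplt_restrict:
 fixes G (structure)
 assumes G: "comm_group G" and M: "!!H. H:M ==> subgroup H G"
  and dir: "!!K K'. K:M ==> K':M ==> EX K'':M. K'' <= K Int K'"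
  and H: "H:M" and cp: "cplt G M"
 shows "cplt (G || H) {K:M. K <= H}"
proof -
 interpret cgroup G using G by (simp add: cgroup_def)
 let ?N = "{K:M. K <= H}"
 have cpN: "cplt G ?N"
 proof (rule cplt_coinitial[OF G M _ _ _ _ cp])
  show "EX K'':?N. K'' <= K Int K'" if KK: "K:?N" "K':?N" for K K' using dir[of K K'] KK by auto
  show "EX K:?N. K <= H'" if H': "H':M" for H' using dir[OF H' H] by blast
 qed (use M in blast)+
 have HG: "x:H ==> x:carrier G" for x using subgroup.mem_carrier[OF M[OF H]] .
 show ?thesis unfolding cplt_def
 proof (intro conjI ballI allI impI)
  fix x assume "x:carrier (G || H)" "ALL K:?N. x:K"
  thus "x = (one (G || H))" using cplt_separated[OF cpN, of x] HG by auto
 next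
  fix c assume c: "ALL K:?N. c K:carrier (G || H)"
   "ALL K:?N. ALL K':?N. K <= K' --> c K *[G || H] inv[G || H] (c K'):K'"
  have cH: "c K:H" if "K:?N" for K using c(1) that by auto
  have inv: "inv[G || H] (c K) = inv (c K)" if "K:?N" for K using inv_restr[OF M[OF H] cH[OF that]] .
  have "c K \<otimes> inv (c K'):K'" if K: "K:?N" "K':?N" "K <= K'" for K K'
  proof -
   have "c K *[G || H] inv[G || H] (c K'):K'" using c(2) K by blast
   thus ?thesis using inv[OF K(2)] by simp
  qed
  then obtain x where x: "x:carrier G" "!!K. K:?N ==> x \<otimes> inv (c K):K"
   using cplt_limit[OF cpN, of c] cH HG by blast
  have HN: "H:?N" using H by blast
  thus "EX x:carrier (G || H). ALL K:?N. x *[G || H] inv[G || H] (c K):K"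
   using diff_cancel(2)[OF M[OF H] x(1), of "c H"] x(2)[OF HN] cH[OF HN] HG x(2) inv by auto
 qed
qed

text \<open>Division by the value at \<open>H\<close> moves the part of a compatible family below
  \<open>H\<close> into \<open>H\<close>. The limit found there is multiplied back by that value,
  and directedness extends the congruences to all of \<open>M\<close>.\<close>

lemma cplt_extend:
 fixes G (structure)
 assumes G: "comm_group G" and M: "!!H. H:M ==> subgroup H G"
  and dir: "!!K K'. K:M ==> K':M ==> EX K'':M. K'' <= K Int K'"
  and H: "H:M" and cp: "cplt (G || H) {K:M. K <= H}"
 shows "cplt G M"
proof -
 interpret cgroup G using G by (simp add: cgroup_def)
 have HG: "x:H ==> x:carrier G" for x using subgroup.mem_carrier[OF M[OF H]] .
 show ?thesis unfolding cplt_def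
 proof (intro conjI ballI allI impI)
  fix x assume "x:carrier G" "ALL K:M. x:K"
  thus "x = \<one>" using cplt_separated[OF cp, of x] H by auto
 next
  fix c assume c: "ALL K:M. c K:carrier G" "ALL K:M. ALL K':M. K <= K' --> c K \<otimes> inv (c K'):K'"
  define d where "d = (%K. c K \<otimes> inv (c H))"
  have cH: "c H:carrier G" using c(1) H by blast
  have dH: "d K:H" if "K:M" "K <= H" for K using c(2) that H by (simp add: d_def)
  have dd: "d K \<otimes> inv (d K') = c K \<otimes> inv (c K')" if "K:M" "K':M" for K K'
  proof -
   have "c K:carrier G" "c K':carrier G" using c(1) that by blast+
   thus ?thesis using cH unfolding d_def
    by (simp add: inv_mult_group m_assoc[symmetric]) (simp add: m_assoc)
  qed
  obtain x where x: "x:carrier (G || H)" "!!K. K:{K:M. K <= H} ==> x *[G || H] inv[G || H] (d K):K"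
  proof (rule cplt_limit[OF cp, of d])
   fix K K' assume K: "K:{K:M. K <= H}" "K':{K:M. K <= H}" "K <= K'"
   thus "d K *[G || H] inv[G || H] (d K'):K'"
    using c(2) dd[of K K'] inv_restr[OF M[OF H] dH[of K']] by simp
  qed (use dH in auto)
  have xH: "x:H" "x:carrier G" using x(1) HG by auto
  have 1: "(x \<otimes> c H) \<otimes> inv (c K):K" if K: "K:M" "K <= H" for K
  proof -
   have "x \<otimes> inv (d K):K" using x(2)[of K] K inv_restr[OF M[OF H] dH[OF K]] by simp
   moreover have "c K:carrier G" using c(1) K by blast
   moreover have "inv (d K) = c H \<otimes> inv (c K)"
    using cH `c K:carrier G` by (simp add: d_def inv_mult_group)
   ultimately show ?thesis using cH xH by (simp add: m_assoc)
  qed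
  have "(x \<otimes> c H) \<otimes> inv (c K):K" if K: "K:M" for K
  proof -
   obtain K' where K': "K':M" "K' <= K Int H" using dir[OF K H] by blast
   hence "(x \<otimes> c H) \<otimes> inv (c K'):K" using 1[of K'] by blast
   moreover have "c K' \<otimes> inv (c K):K" using c(2)[rule_format, OF K'(1) K] K'(2) by simp
   ultimately show ?thesis using diff_trans[OF M[OF K]] c(1) K K'(1) xH(2) cH by (meson m_closed)
  qed
  thus "EX x:carrier G. ALL K:M. x \<otimes> inv (c K):K" using xH(2) cH by (intro bexI[of _ "x \<otimes> c H"]) auto
 qed
qed

section \<open>Proalgebraic groups\<close>

lemma countably_coinitial_image:
 assumes "countably_coinitial M" "!!H K. H:M ==> K:M ==> H <= K ==> F H <= F K"
 shows "countably_coinitial (F ` M)"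
proof -
 obtain C where C: "C <= M" "countable C" "ALL H:M. EX K:C. K <= H"
  using assms(1) unfolding countably_coinitial_def by (elim exE conjE)
 have "EX K:F ` C. K <= F H" if H: "H:M" for H
 proof -
  obtain K where "K:C" "K <= H" using bspec[OF C(3) H] by (elim bexE)
  thus ?thesis using assms(2)[of K H] C(1) H by (intro bexI[of _ "F K"]) auto
 qed
 thus ?thesis unfolding countably_coinitial_def using C(1,2)
  by (intro exI[of _ "F ` C"]) (simp add: image_mono)
qed

lemma countably_cofinal_image:
 assumes "countably_cofinal M" "!!H K. H:M ==> K:M ==> H <= K ==> F H <= F K"
 shows "countably_cofinal (F ` M)"
proof -
 obtain C where C: "C <= M" "countable C" "ALL H:M. EX K:C. H <= K"
  using assms(1) unfolding countably_cofinal_def by (elim exE conjE)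
 have "EX K:F ` C. F H <= K" if H: "H:M" for H
 proof -
  obtain K where "K:C" "H <= K" using bspec[OF C(3) H] by (elim bexE)
  thus ?thesis using assms(2)[of H K] C(1) H by (intro bexI[of _ "F K"]) auto
 qed
 thus ?thesis unfolding countably_cofinal_def using C(1,2)
  by (intro exI[of _ "F ` C"]) (simp add: image_mono)
qed

text \<open>Running intersections of an enumeration. Essential countability enters here: the limit
  arguments for proalgebraic groups proceed by choices along such a sequence.\<close>

lemma countably_coinitial_chain:
 assumes "countably_coinitial M" "M ~= {}" and int: "!!H K. H:M ==> K:M ==> H Int K:M"
 obtains J :: "nat => 'a set" where "!!n. J n:M" "!!m n. m <= n ==> J n <= J m" "!!H. H:M ==> EX n. J n <= H"
proof -
 obtain C where C: "C <= M" "countable C" "ALL H:M. EX K:C. K <= H"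
  using assms(1) unfolding countably_coinitial_def by blast
 hence ne: "C ~= {}" using assms(2) by blast
 define e where "e = from_nat_into C"
 have e: "e n:M" for n using from_nat_into[OF ne] C(1) by (auto simp: e_def)
 define J where "J = rec_nat (e 0) (%n K. K Int e (Suc n))"
 have J: "J 0 = e 0" "J (Suc n) = J n Int e (Suc n)" for n by (simp_all add: J_def)
 have JM: "J n:M" for n by (induction n) (simp_all add: J e int)
 have Je: "J n <= e n" for n by (cases n) (auto simp: J)
 show thesis
 proof (rule that)
  show "J n <= J m" if mn: "m <= n" for m n by (rule lift_Suc_antimono_le[OF _ mn]) (simp add: J(2))
  fix H assume "H:M"
  then obtain K where "K:C" "K <= H" using C(3) by blast
  moreover from this obtain n where "e n = K" using from_nat_into_surj[OF C(2)] by (auto simp: e_def)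
  ultimately show "EX n. J n <= H" using Je by blast
 qed (rule JM)
qed

lemma (in cgroup) nested_coset:
 assumes "subgroup M G" "subgroup N G" "x:carrier G" "y:carrier G" "M #> x <= N #> y"
 shows "M <= N" "x \<otimes> inv y:N"
proof -
 show xy: "x \<otimes> inv y:N" using assms(5) rcos_self[OF assms(3,1)] mem_coset[OF assms(2,4)] by blast
 show "M <= N"
 proof
  fix a assume a: "a:M"
  have aG: "a:carrier G" using a subgroup.mem_carrier[OF assms(1)] by blast
  have "(a \<otimes> x) \<otimes> inv y:N" using a assms(5) mem_coset[OF assms(2,4)] by (auto simp: r_coset_def)
  thus "a:N"
   using aG assms(3,4) diff_cancel(2)[OF assms(2), of "a \<otimes> (x \<otimes> inv y)" "x \<otimes> inv y"] subgroup.m_closed[OF assms(2) _ subgroup.m_inv_closed[OF assms(2) xy]] aG assms(3,4) inv_closed m_assoc m_closed r_inv r_one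
   by metis
 qed
qed

context pos_char
begin

lemma proalg_iff:
 fixes G (structure)
 shows "proalg G S <-> comm_group G & mem S ~= {} & (ALL H:mem S. subgroup H G) & countably_coinitial (mem S) &
   (ALL H:mem S. ALL H':mem S. EX H'':mem S. H'' <= H Int H') & cplt G (mem S) &
   (ALL H:mem S. qa G H (str S H)) & (ALL H:mem S. ALL K. qcl G H (str S H) K <-> K:mem S & H <= K) &
   (ALL H:mem S. ALL H':mem S. H <= H' --> qh G H (str S H) G H' (str S H') (%x. x))"
proof (cases "comm_group G & (ALL H:mem S. subgroup H G)")
 case True
 hence sub: "!!H. H:mem S ==> subgroup H G" and G: "comm_group G" by auto
 have 1: "({H':mem S. H <= H'} = {coset_preimage G H C | C. quasialg_closed (G Mod H) (str S H) C}) <->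
   (ALL K. qcl G H (str S H) K <-> K:mem S & H <= K)" if "H:mem S" for H
  unfolding qcl_coset_preimage_iff[OF G sub[OF that], symmetric] set_eq_iff mem_Collect_eq by blast
 have 2: "quasialg (G Mod H) (str S H) <-> qa G H (str S H)" if "H:mem S" for H
  using G sub[OF that] by (simp add: qa_def)
 show ?thesis
  using 1 2 True is_quot_limit_iff[OF G sub] unfolding proalg_def pro_structure_def pro_system_def qh_def
  by (auto simp: simp_thms conj_ac)
next
 case False
 thus ?thesis by (auto simp: proalg_def pro_structure_def pro_system_def)
qed

lemma proalgD:
 fixes G (structure)
 assumes "proalg G S"
 shows pro_comm: "comm_group G" and pro_ne: "mem S ~= {}" and pro_sub: "H:mem S ==> subgroup H G"
  and pro_count: "countably_coinitial (mem S)"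
  and pro_dir: "H:mem S ==> H':mem S ==> EX H'':mem S. H'' <= H Int H'" and pro_cplt: "cplt G (mem S)"
  and pro_qa: "H:mem S ==> qa G H (str S H)"
  and pro_qcl: "H:mem S ==> qcl G H (str S H) K <-> K:mem S & H <= K"
  and pro_qh: "H:mem S ==> H':mem S ==> H <= H' ==> qh G H (str S H) G H' (str S H') (%x. x)"
 using assms unfolding proalg_iff by simp_all

lemma pro_maps:
 "proalg G S ==> H:mem S ==> H':mem S ==> H <= H' ==> maps G H G H' (%x. x)"
 by (intro maps_id pro_comm pro_sub)

lemma pro_int:
 assumes "proalg G S" "H:mem S" "K:mem S"
 shows "H Int K:mem S"
proof -
 obtain L where L: "L:mem S" "L <= H Int K" using pro_dir[OF assms] by blast
 hence "qcl G L (str S L) (H Int K)"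
  using assms by (intro qcl_inter pro_qa) (auto simp: pro_qcl[OF assms(1)])
 thus ?thesis using pro_qcl[OF assms(1) L(1)] by blast
qed

lemma pro_mult:
 assumes S: "proalg G S" and H: "H:mem S" and K: "K:mem S"
 shows "H <#>[G] K:mem S"
proof -
 obtain L where L: "L:mem S" "L <= H" "L <= K" using pro_dir[OF assms] by blast
 have "qcl G K (str S K) ((%x. x) ` H <#>[G] K)"
  using H L by (intro qcl_image[OF pro_qa[OF S L(1)] pro_qa[OF S K] pro_maps[OF S L(1) K L(3)] pro_qh[OF S L(1) K L(3)]])
   (simp add: pro_qcl[OF S])
 thus ?thesis using pro_qcl[OF S K] by simp
qed

text \<open>Members above a fixed \<open>J\<close> are closed subgroups of the quasi-algebraic
  quotient by \<open>J\<close>, where descending chains stop.\<close>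

lemma pro_dcc:
 assumes S: "proalg G S" and J: "J:mem S" and N: "!!n. N n:mem S" "!!n. J <= N n" "!!n. N (Suc n) <= N n"
 obtains m where "!!n. n >= m ==> N n = N m"
 using qcl_dcc[OF pro_qa[OF S J], of N] N pro_qcl[OF S J] by metis

lemma pro_chain:
 assumes S: "proalg G S"
 obtains J :: "nat => 'a set" where "!!n. J n:mem S" "!!m n. m <= n ==> J n <= J m" "!!H. H:mem S ==> EX n. J n <= H"
 using countably_coinitial_chain[OF pro_count[OF S] pro_ne[OF S] pro_int[OF S]] by metis

text \<open>By the descending chain condition, the images of the cosets in each quotient \<open>G/J\<close>
 stabilise, and a compatible system of points of these stable images has a limit.\<close>

theorem linear_compactness:
 fixes G (structure)
 assumes S: "proalg G S" and M: "!!n. M n:mem S" and x: "!!n. x n:carrier G"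
  and nested: "!!n. M (Suc n) #>[G] x (Suc n) <= M n #>[G] x n"
 obtains y where "y:carrier G" "!!n. y *[G] inv[G] (x n):M n"
proof -
 interpret cgroup G using pro_comm[OF S] by (simp add: cgroup_def)
 have sM: "subgroup (M n) G" for n by (rule pro_sub[OF S M])
 have nest: "M n #> x n <= M m #> x m" if mn: "m <= n" for m n
  by (rule lift_Suc_antimono_le[OF _ mn, of "%n. M n #> x n"]) (rule nested)
 have Mdec: "M n <= M m" and xdiff: "x n \<otimes> inv (x m):M m" if "m <= n" for m n
  using nested_coset[OF sM sM x x nest[OF that]] by auto
 obtain J :: "nat => 'a set" where J: "!!n. J n:mem S" "!!m n. m <= n ==> J n <= J m" "!!H. H:mem S ==> EX n. J n <= H"
  using pro_chain[OF S] by metis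
 have sJ: "subgroup (J n) G" for n by (rule pro_sub[OF S J(1)])
 have M_MJ: "M n <= M n <#> J i" for n i by (rule set_mult_upper1[OF sJ subgroup.subset[OF sM]])
 have "EX m. ALL n>=m. M n <#> J i = M m <#> J i" for i
 proof (rule pro_dcc[OF S J(1), of "%n. M n <#> J i" i])
  show "M (Suc n) <#> J i <= M n <#> J i" for n by (rule set_mult_mono[OF Mdec]) auto
 qed (use pro_mult[OF S M J(1)] set_mult_upper2[OF sM subgroup.subset[OF sJ]] in auto)
 then obtain m where m: "!!i n. n >= m i ==> M n <#> J i = M (m i) <#> J i" by metis
 \<comment> \<open>\<open>D i\<close> is the preimage of the intersection of the images of all
   cosets in the quotient by \<open>J i\<close>. By stabilisation it contains every coset of index
   at least \<open>m i\<close>.\<close>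
 define D where "D = (%i. {z:carrier G. ALL n. z \<otimes> inv (x n):M n <#> J i})"
 have DI: "z:D i" if z: "z:carrier G" "z \<otimes> inv (x k):M k" and k: "m i <= k" for z i k
 proof -
  have "z \<otimes> inv (x n):M n <#> J i" for n
  proof (cases "n <= k")
   case True
   show ?thesis using diff_trans[OF sM z(1) x x] Mdec[OF True] z(2) xdiff[OF True] M_MJ by blast
  next
   case False
   hence kn: "k <= n" by simp
   have "z \<otimes> inv (x n):M k"
    using diff_trans[OF sM z(1) x x z(2)] diff_cancel(1)[OF sM x x xdiff[OF kn]] by blast
   thus ?thesis using M_MJ m[of i k] m[of i n] k kn by auto
  qed
  thus ?thesis using z(1) by (simp add: D_def)
 qed
 have D0: "x (m 0):D 0"
  by (rule DI[OF x _ order_refl]) (use xdiff[of "m 0" "m 0"] in simp)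
 have step: "EX z'. z':D (Suc i) & z' \<otimes> inv z:J i" if z: "z:D i" for z i
 proof -
  \<comment> \<open>Beyond both stabilisation indices a point of \<open>D i\<close> can be corrected
    by an element of \<open>J i\<close> so as to lie in the coset of index \<open>k\<close> itself,
    hence in \<open>D (Suc i)\<close>.\<close>
  define k where "k = max (m i) (m (Suc i))"
  have zG: "z:carrier G" and "z \<otimes> inv (x k):M k <#> J i" using z by (auto simp: D_def)
  then obtain a b where ab: "a:M k" "b:J i" "z \<otimes> inv (x k) = a \<otimes> b" by (auto simp: set_mult_def)
  have car: "a:carrier G" "b:carrier G" using ab subgroup.mem_carrier[OF sM] subgroup.mem_carrier[OF sJ] by blast+
  define z' where "z' = a \<otimes> x k"
  have z'G: "z':carrier G" using car x by (simp add: z'_def)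
  have zz: "z = (a \<otimes> b) \<otimes> x k" using ab(3) zG x[of k] car by (metis inv_closed inv_solve_right' m_closed)
  hence "z = b \<otimes> z'" using car x[of k] by (simp add: z'_def m_ac)
  hence "z' \<otimes> inv z:J i" using car z'G subgroup.m_inv_closed[OF sJ ab(2)] by (simp add: inv_mult_group m_assoc[symmetric])
  moreover have "z' \<otimes> inv (x k):M k" using ab(1) car x[of k] by (simp add: z'_def m_assoc)
  hence "z':D (Suc i)" by (intro DI[OF z'G]) (auto simp: k_def)
  ultimately show ?thesis by blast
 qed
 obtain z where z: "!!i. z i:D i" "!!i. z (Suc i) \<otimes> inv (z i):J i"
  using dependent_nat_choice[of "%i z. z:D i" "%i z z'. z' \<otimes> inv z:J i"] D0 step by metis
 have zG: "z i:carrier G" for i using z(1)[of i] by (simp add: D_def)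
 have zz: "z j \<otimes> inv (z i):J i" if "i <= j" for i j
  using that
 proof (induction j rule: dec_induct)
  case base
  thus ?case using zG subgroup.one_closed[OF sJ] by simp
 next
  case (step j)
  thus ?case using diff_trans[OF sJ zG zG zG, of "Suc j" j i i] z(2)[of j] J(2)[of i j] by auto
 qed
 have zz': "z j \<otimes> inv (z i):H" if "J i <= H" "J j <= H" "H:mem S" for i j H
 proof (cases "i <= j")
  case False
  hence "z i \<otimes> inv (z j):H" using zz[of j i] that by auto
  thus ?thesis using diff_cancel(1)[OF pro_sub[OF S that(3)] zG zG] by blast
 qed (use zz that in blast)
 obtain k where k: "!!H. H:mem S ==> J (k H) <= H" using J(3) by metis
 obtain y where y: "y:carrier G" "!!H. H:mem S ==> y \<otimes> inv (z (k H)):H"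
 proof (rule cplt_limit[OF pro_cplt[OF S], of "%H. z (k H)"])
  fix H H' assume H: "H:mem S" "H':mem S" "H <= H'"
  thus "z (k H) \<otimes> inv (z (k H')):H'" using k[OF H(1)] k[OF H(2)] by (intro zz') auto
 qed (use zG in auto)
 have "y \<otimes> inv (x n):M n" for n
 proof -
  define i where "i = k (M n)"
  have Ji: "J i <= M n" using k[OF M] by (simp add: i_def)
  have "z i \<otimes> inv (x n):M n <#> J i" using z(1)[of i] by (simp add: D_def)
  hence "z i \<otimes> inv (x n):M n" using set_mult_absorb[OF sM sJ Ji] by simp
  moreover have "y \<otimes> inv (z i):M n" using y(2)[OF M] by (simp add: i_def)
  ultimately show ?thesis using diff_trans[OF sM y(1) zG x] by blast
 qed
 with y(1) show thesis by (rule that)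
qed

subsection \<open>Morphisms\<close>

lemma proalg_hom_iff:
 "proalg_hom G1 S1 G2 S2 f <-> f:hom G1 G2 & (ALL H:mem S2. {x:carrier G1. f x:H}:mem S1 &
   qh G1 {x:carrier G1. f x:H} (str S1 {x:carrier G1. f x:H}) G2 H (str S2 H) f)"
 by (simp add: proalg_hom_def pro_hom_def Let_def qh_def)

lemma proalg_hom_maps:
 assumes "proalg G1 S1" "proalg G2 S2" "proalg_hom G1 S1 G2 S2 f" "H:mem S2"
 shows "maps G1 {x:carrier G1. f x:H} G2 H f"
 using assms by (auto simp: maps_def proalg_hom_iff intro: pro_comm pro_sub)

lemma concrete_quasialg: "concrete quasialg quasialg_hom"
proof
 fix G1 G2 G3 :: "'a monoid" and S1 S2 S3 :: "('a, 'k) kspace" and f g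
 show "quasialg_hom G1 S1 G2 S2 f ==> f:hom G1 G2" by (simp add: quasialg_hom_def)
 show "quasialg G1 S1 ==> quasialg_hom G1 S1 G1 S1 (%x. x)"
  by (intro quasialg_hom_id quasialg_sheaf quasialg_group)
 show "quasialg_hom G1 S1 G2 S2 f ==> quasialg_hom G2 S2 G3 S3 g ==> quasialg_hom G1 S1 G3 S3 (%x. g (f x))"
  by (rule quasialg_hom_comp)
 show "quasialg_hom G1 S1 G2 S2 g" if "quasialg G1 S1" "!!x. x:carrier G1 ==> f x = g x" "quasialg_hom G1 S1 G2 S2 f"
  using that(3) quasialg_hom_cong[OF quasialg_topspace[OF that(1)] quasialg_group[OF that(1)], of f g] that(2) by simp
qed

lemma concrete_proalg: "concrete proalg proalg_hom"
 unfolding proalg_def proalg_hom_def by (rule pro_hom_concrete[OF concrete_quasialg])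

lemmas proalg_hom_id = concrete.mor_id[OF concrete_proalg]
 and proalg_hom_comp = concrete.mor_comp[OF concrete_proalg]
 and proalg_hom_cong = concrete.mor_cong[OF concrete_proalg]

text \<open>For the last part, the solutions of \<open>f y = x\<close> modulo \<open>J n\<close>
  form nested cosets of the members \<open>M n\<close> of \<open>S1\<close>; linear compactness
  gives a common point, and separatedness of \<open>G2\<close> makes it a solution.\<close>

lemma proalg_image:
 assumes S: "proalg G1 S1" "proalg G2 S2" and f: "proalg_hom G1 S1 G2 S2 f"
 shows "subgroup (f ` carrier G1) G2"
  and "L:mem S2 ==> f ` carrier G1 <#>[G2] L:mem S2"
  and "x:carrier G2 ==> (!!L. L:mem S2 ==> x:f ` carrier G1 <#>[G2] L) ==> x:f ` carrier G1"
proof -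
 interpret G1: cgroup G1 using pro_comm[OF S(1)] by (simp add: cgroup_def)
 interpret G2: cgroup G2 using pro_comm[OF S(2)] by (simp add: cgroup_def)
 interpret f: group_hom G1 G2 f using f by unfold_locales (simp add: proalg_hom_iff)
 show sub: "subgroup (f ` carrier G1) G2" by (rule f.subgroup_img_is_subgroup[OF G1.subgroup_self])
 show "f ` carrier G1 <#>[G2] L:mem S2" if L: "L:mem S2" for L
 proof -
  have K: "{x:carrier G1. f x:L}:mem S1" using f L by (simp add: proalg_hom_iff)
  have "qcl G2 L (str S2 L) (f ` carrier G1 <#>[G2] L)"
   using f L by (intro qcl_image[OF pro_qa[OF S(1) K] pro_qa[OF S(2) L] proalg_hom_maps[OF S f L]] qcl_carrier[OF pro_qa[OF S(1) K]])
    (simp add: proalg_hom_iff)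
  thus ?thesis using pro_qcl[OF S(2) L] by blast
 qed
 assume x: "x:carrier G2" "!!L. L:mem S2 ==> x:f ` carrier G1 <#>[G2] L"
 obtain J :: "nat => 'a set" where J: "!!n. J n:mem S2" "!!m n. m <= n ==> J n <= J m" "!!H. H:mem S2 ==> EX n. J n <= H"
  using pro_chain[OF S(2)] by metis
 have sJ: "subgroup (J n) G2" for n by (rule pro_sub[OF S(2) J(1)])
 have "EX a:carrier G1. x *[G2] inv[G2] (f a):J n" for n
  using x(2)[OF J(1)[of n]] G2.mem_set_mult_iff[OF sJ subgroup.subset[OF sub]] by blast
 then obtain a where a: "!!n. a n:carrier G1" "!!n. x *[G2] inv[G2] (f (a n)):J n" by metis
 define M where "M = (%n. {y:carrier G1. f y:J n})"
 have M: "M n:mem S1" for n using f J(1) by (simp add: M_def proalg_hom_iff)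
 have sM: "subgroup (M n) G1" for n by (rule pro_sub[OF S(1) M])
 have coset: "y:M n #>[G1] a n <-> y:carrier G1 & f y *[G2] inv[G2] x:J n" for y n
 proof -
  have fa: "f (a n):carrier G2" by (rule f.hom_closed[OF a(1)])
  have "f y *[G2] inv[G2] (f (a n)):J n <-> f y *[G2] inv[G2] x:J n" if y: "y:carrier G1"
   using G2.diff_trans[OF sJ f.hom_closed[OF y] x(1) fa _ a(2)]
    G2.diff_trans[OF sJ f.hom_closed[OF y] fa x(1) _ G2.diff_cancel(1)[OF sJ x(1) fa a(2)]] by blast
  thus ?thesis using G1.mem_coset[OF sM a(1)] a(1) by (auto simp: M_def)
 qed
 obtain y where y: "y:carrier G1" "!!n. y *[G1] inv[G1] (a n):M n"
 proof (rule linear_compactness[OF S(1) M a(1)])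
  show "M (Suc n) #>[G1] a (Suc n) <= M n #>[G1] a n" for n
   using J(2)[of n "Suc n"] by (auto simp: coset)
 qed (rule that)
 have "f y *[G2] inv[G2] x:J n" for n
  using coset[of y n] G1.mem_coset[OF sM a(1)] y by blast
 hence "f y *[G2] inv[G2] x = (one G2)"
  using x(1) f.hom_closed[OF y(1)] J(3) by (intro cplt_separated[OF pro_cplt[OF S(2)]]) (simp, blast)
 hence "f y = x" using x(1) y(1) G2.inv_equality[of "f y" "inv[G2] x"] by (simp add: G2.inv_inv)
 thus "x:f ` carrier G1" using y(1) by blast
qed

subsection \<open>Closed subgroups\<close>

text \<open>A relation, not a chosen structure, since \<open>K\<close> determines \<open>T\<close>
  only up to isomorphism; \<open>embedded_unique\<close> makes two choices interchangeable.\<close>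

definition embedded :: "'a monoid => ('a, 'k) pro_fam => 'a set => ('a, 'k) pro_fam => bool" where
 "embedded G S K T <-> proalg G S & subgroup K G & proalg (G || K) T & proalg_hom (G || K) T G S (%x. x)"

text \<open>A member \<open>J\<close> of \<open>T\<close> must contain some trace
  \<open>K Int L m\<close>. By the descending chain condition the products
  \<open>(K Int L n) <#> J\<close> become constant; a point of the trace at the stable index is then
  congruent modulo \<open>J\<close> to points of every \<open>L n\<close>, and linear compactness
  makes it congruent to 1. The modular law exhibits \<open>J\<close> as the trace of
  \<open>J <#> L m\<close>.\<close>

lemma embedded_mem:
 fixes G (structure)
 assumes E: "embedded G S K T"
 shows "J:mem T <-> (EX L:mem S. J = K Int L)"
proof -
 have S: "proalg G S" and K: "subgroup K G" and T: "proalg (G || K) T" and i: "proalg_hom (G || K) T G S (%x. x)"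
  using E by (auto simp: embedded_def)
 interpret cgroup G using pro_comm[OF S] by (simp add: cgroup_def)
 interpret GK: cgroup "G || K" using pro_comm[OF T] by (simp add: cgroup_def)
 have KL: "K Int L:mem T" "qh (G || K) (K Int L) (str T (K Int L)) G L (str S L) (%x. x)"
  "maps (G || K) (K Int L) G L (%x. x)" if "L:mem S" for L
  using i that proalg_hom_maps[OF T S i that] by (simp_all add: proalg_hom_iff Int_def)
 have KG: "x:carrier G" if "x:K" for x using subgroup.mem_carrier[OF K that] .
 show ?thesis
 proof
  assume J: "J:mem T"
  have sJ: "subgroup J G" "J <= K" using pro_sub[OF T J] subgroup_restr[OF K] by auto
  obtain L :: "nat => 'a set" where L: "!!n. L n:mem S" "!!m n. m <= n ==> L n <= L m" "!!H. H:mem S ==> EX n. L n <= H"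
   using pro_chain[OF S] by metis
  have sKL: "subgroup (K Int L n) G" for n using subgroups_Inter_pair[OF K pro_sub[OF S L(1)]] .
  obtain m where m: "!!n. n >= m ==> (K Int L n) <#> J = (K Int L m) <#> J"
  proof (rule pro_dcc[OF T J, of "%n. (K Int L n) <#> J"])
   show "(K Int L n) <#> J:mem T" for n using pro_mult[OF T KL(1)[OF L(1)] J] by simp
   show "J <= (K Int L n) <#> J" for n by (rule set_mult_upper2[OF sKL subgroup.subset[OF sJ(1)]])
   show "(K Int L (Suc n)) <#> J <= (K Int L n) <#> J" for n using L(2)[of n "Suc n"] by (intro set_mult_mono) auto
  qed (rule that, blast)
  have "x:J" if x: "x:K Int L m" for x
  proof -
   have xG: "x:carrier G" "x:K" using x KG by auto
   have "EX a:K Int L n. x \<otimes> inv a:J" for n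
   proof -
    have "x:(K Int L n) <#> J"
    proof (cases "m <= n")
     case True
     thus ?thesis using m[OF True] set_mult_upper1[OF sJ(1) subgroup.subset[OF sKL], of m] x by auto
    next
     case False
     hence "x:K Int L n" using x L(2)[of n m] by auto
     thus ?thesis using set_mult_upper1[OF sJ(1) subgroup.subset[OF sKL]] by blast
    qed
    thus ?thesis using mem_set_mult_iff[OF sJ(1) subgroup.subset[OF sKL]] by blast
   qed
   then obtain a where a: "!!n. a n:K Int L n" "!!n. x \<otimes> inv (a n):J" by metis
   have aK: "a n:K" "a n:carrier G" "a n:L n" for n using a(1)[of n] KG by auto
   have JL: "J Int (K Int L n):mem T" for n by (rule pro_int[OF T J KL(1)[OF L(1)]])
   have sJL: "subgroup (J Int (K Int L n)) G" for n by (rule subgroups_Inter_pair[OF sJ(1) sKL])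
   have coset: "y:(J Int (K Int L n)) #> a n <-> y:carrier G & y:K Int L n & x \<otimes> inv y:J" for y n
   proof -
    have "y \<otimes> inv (a n):J <-> x \<otimes> inv y:J" if y: "y:carrier G"
    proof
     assume "y \<otimes> inv (a n):J"
     thus "x \<otimes> inv y:J" using diff_trans[OF sJ(1) xG(1) aK(2) y a(2)] diff_cancel(1)[OF sJ(1) y aK(2)] by blast
    next
     assume "x \<otimes> inv y:J"
     thus "y \<otimes> inv (a n):J" using diff_trans[OF sJ(1) y xG(1) aK(2) _ a(2)] diff_cancel(1)[OF sJ(1) xG(1) y] by blast
    qed
    moreover have "y \<otimes> inv (a n):K Int L n <-> y:K Int L n" if y: "y:carrier G"
    proof
     assume "y \<otimes> inv (a n):K Int L n"
     thus "y:K Int L n" using diff_cancel(2)[OF sKL y aK(2)] a(1) by blast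
    next
     assume "y:K Int L n"
     thus "y \<otimes> inv (a n):K Int L n"
      using subgroup.m_closed[OF sKL _ subgroup.m_inv_closed[OF sKL a(1)]] by blast
    qed
    ultimately show ?thesis unfolding mem_coset[OF sJL aK(2)] by blast
   qed
   obtain y where y: "y:carrier (G || K)" "!!n. y *[G || K] inv[G || K] (a n):J Int (K Int L n)"
   proof (rule linear_compactness[OF T JL, of a])
    show "J Int (K Int L (Suc n)) #>[G || K] a (Suc n) <= J Int (K Int L n) #>[G || K] a n" for n
     using L(2)[of n "Suc n"] by (auto simp: coset)
   qed (use aK in auto)
   have yK: "y:K" "y:carrier G" using y(1) KG by auto
   have "y:(J Int (K Int L n)) #> a n" for n
    using y(2)[of n] inv_restr[OF K aK(1)[of n]] mem_coset[OF sJL aK(2)] yK by simp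
   hence yL: "y:L n" "x \<otimes> inv y:J" for n using coset by blast+
   have "y = \<one>" using yL(1) L(3) yK(2) by (intro cplt_separated[OF pro_cplt[OF S]]) blast+
   thus ?thesis using yL(2) xG by simp
  qed
  hence KLJ: "K Int L m <= J" by blast
  have "qcl (G || K) (K Int L m) (str T (K Int L m)) J" using pro_qcl[OF T KL(1)[OF L(1)]] J KLJ by simp
  hence "qcl G (L m) (str S (L m)) ((%x. x) ` J <#> L m)"
   by (rule qcl_image[OF pro_qa[OF T KL(1)[OF L(1)]] pro_qa[OF S L(1)] KL(3)[OF L(1)] KL(2)[OF L(1)]])
  hence JL: "J <#> L m:mem S" using pro_qcl[OF S L(1)] by simp
  have "(L m <#> J) Int K = (L m Int K) <#> J" by (rule modular_law[OF pro_sub[OF S L(1)] sJ(1) K sJ(2)])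
  also have "... = J" using KLJ set_mult_least[OF sJ(1), of "L m Int K" J]
    set_mult_upper2[OF sKL[of m], of J] subgroup.subset[OF sJ(1)] by (auto simp: Int_commute)
  finally have "J = K Int (J <#> L m)"
   using set_mult_comm[of "L m" J] subgroup.subset[OF pro_sub[OF S L(1)]] subgroup.subset[OF sJ(1)] by auto
  thus "EX L:mem S. J = K Int L" using JL by blast
 qed (use KL(1) in blast)
qed

lemma embedded_qh:
 assumes E: "embedded G S K T" and L: "L:mem S"
 shows "K Int L:mem T" "qh (G || K) (K Int L) (str T (K Int L)) G L (str S L) (%x. x)"
  "maps (G || K) (K Int L) G L (%x. x)"
 using E L proalg_hom_maps[of "G || K" T G S "%x. x" L] by (simp_all add: embedded_def proalg_hom_iff Int_def)

text \<open>Members of \<open>T\<close> are traces of members of \<open>S\<close>, so their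
  preimages under \<open>f\<close> are known; the quotient maps lift along the injections of the
  quotients of \<open>K\<close> into those of \<open>G\<close>.\<close>

lemma embedded_factor:
 assumes E: "embedded G S K T" and S1: "proalg G1 S1" and f: "proalg_hom G1 S1 G S f" "f ` carrier G1 <= K"
 shows "proalg_hom G1 S1 (G || K) T f"
 unfolding proalg_hom_iff
proof (intro conjI ballI)
 have S: "proalg G S" and K: "subgroup K G" and T: "proalg (G || K) T" using E by (auto simp: embedded_def)
 show fh: "f:hom G1 (G || K)" using f by (auto simp: proalg_hom_iff hom_def)
 fix J assume J: "J:mem T"
 then obtain L where L: "L:mem S" "J = K Int L" using embedded_mem[OF E] by blast
 have eq: "{x:carrier G1. f x:J} = {x:carrier G1. f x:L}" using f(2) L(2) by auto
 have M: "{x:carrier G1. f x:L}:mem S1" using f(1) L(1) by (simp add: proalg_hom_iff)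
 thus "{x:carrier G1. f x:J}:mem S1" by (simp add: eq)
 note iE = embedded_qh[OF E L(1), folded L(2)]
 show "qh G1 {x:carrier G1. f x:J} (str S1 {x:carrier G1. f x:J}) (G || K) J (str T J) f"
  unfolding eq
 proof (rule qh_lift[OF pro_qa[OF S1 M] pro_qa[OF T J] pro_qa[OF S L(1)] _ iE(3) _ iE(2)])
  show "maps G1 {x:carrier G1. f x:L} (G || K) J f"
   using proalg_hom_maps[OF S1 S f(1) L(1)] fh pro_comm[OF T] pro_sub[OF T J] f(2) L(2) by (auto simp: maps_def)
  show "qh G1 {x:carrier G1. f x:L} (str S1 {x:carrier G1. f x:L}) G L (str S L) f"
   using f(1) L(1) by (simp add: proalg_hom_iff)
 qed (use L(2) in auto)
qed

lemma embedded_unique: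
 assumes "embedded G S K T" "embedded G S K T'"
 shows "proalg_hom (G || K) T (G || K) T' (%x. x)"
 using assms by (intro embedded_factor[OF assms(2)]) (auto simp: embedded_def)

lemma embedded_trans:
 assumes "embedded G S K T" "embedded (G || K) T J R"
 shows "embedded G S J R"
proof -
 interpret cgroup G using assms pro_comm[of G S] by (simp add: embedded_def cgroup_def)
 show ?thesis using assms subgroup_restr[of K J] proalg_hom_comp[of "G || J" R "G || K" T G S "%x. x" "%x. x"]
  by (auto simp: embedded_def)
qed

lemma embedded_restrict:
 assumes "embedded G S K T" "embedded G S J R" "J <= K"
 shows "embedded (G || K) T J R"
proof -
 interpret cgroup G using assms pro_comm[of G S] by (simp add: embedded_def cgroup_def)
 show ?thesis
  using assms embedded_factor[OF assms(1), of "G || J" R "%x. x"] subgroup_restr[of K J]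
  by (auto simp: embedded_def)
qed

lemma proalg_closed_iff: "proalg G S ==> proalg_closed G S K <-> (EX T. embedded G S K T)"
 by (auto simp: proalg_closed_def embedded_def)

text \<open>The quotient of \<open>K\<close> by \<open>K Int L\<close> is pulled back from its
  closed image \<open>K <#> L\<close> in the quotient by \<open>L\<close>. The hypothesis
  \<open>cl\<close> says that \<open>K\<close> is the intersection of these products, so limits
  formed in \<open>G\<close> stay in \<open>K\<close>.\<close>

theorem embedded_exists:
 fixes G (structure)
 assumes S: "proalg G S" and K: "subgroup K G" and KL: "!!L. L:mem S ==> K <#>[G] L:mem S"
  and cl: "!!x. x:carrier G ==> (!!L. L:mem S ==> x:K <#>[G] L) ==> x:K"
 obtains T where "embedded G S K T"
proof -
 interpret cgroup G using pro_comm[OF S] by (simp add: cgroup_def)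
 note GK = restr_comm_group[OF K]
 interpret GK: cgroup "G || K" using GK by (simp add: cgroup_def)
 have sS: "subgroup L G" if "L:mem S" for L by (rule pro_sub[OF S that])
 have sKL: "subgroup (K Int L) G" "subgroup (K Int L) (G || K)" if "L:mem S" for L
  using subgroups_Inter_pair[OF K sS[OF that]] subgroup_restr[OF K] by auto
 have KG: "x:carrier G" if "x:K" for x using subgroup.mem_carrier[OF K that] .
 have mapsKL: "maps (G || K) (K Int L) G L (%x. x)" if "L:mem S" for L
  using GK sKL[OF that] sS[OF that] KG by (auto simp: maps_def hom_def comm_group_axioms)
 have ex: "EX X. qa (G || K) (K Int L) X & (ALL L':mem S. K Int L' = K Int L --> qh (G || K) (K Int L) X G L' (str S L') (%x. x))"
  if L: "L:mem S" for L
 proof -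
  have pull: "EX X. qa (G || K) (K Int M) X & qh (G || K) (K Int M) X G M (str S M) (%x. x)" if M: "M:mem S" for M
  proof (rule qa_pullback[OF pro_qa[OF S M] mapsKL[OF M]])
   show "qcl G M (str S M) ((%x. x) ` carrier (G || K) <#> M)"
    using KL[OF M] pro_qcl[OF S M] set_mult_upper2[OF K subgroup.subset[OF sS[OF M]]] by simp
  qed auto
  obtain X where X: "qa (G || K) (K Int L) X" "qh (G || K) (K Int L) X G L (str S L) (%x. x)"
   using pull[OF L] by blast
  \<comment> \<open>One trace may come from several \<open>L\<close>, and its structure must suit
    all of them; two such are compared through their intersection \<open>M\<close>.\<close>
  have "qh (G || K) (K Int L) X G L' (str S L') (%x. x)" if L': "L':mem S" "K Int L' = K Int L" for L'
  proof -
   define M where "M = L Int L'"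
   have M: "M:mem S" "M <= L" "M <= L'" "K Int M = K Int L" using pro_int[OF S L L'(1)] L'(2) by (auto simp: M_def)
   obtain X' where X': "qa (G || K) (K Int L) X'" "qh (G || K) (K Int L) X' G M (str S M) (%x. x)"
    using pull[OF M(1)] M(4) by auto
   have mM: "maps (G || K) (K Int L) G M (%x. x)" using mapsKL[OF M(1)] M(4) by simp
   have X'L: "qh (G || K) (K Int L) X' G N (str S N) (%x. x)" if "N:mem S" "M <= N" for N
    using qh_comp[OF X'(1) mM pro_maps[OF S M(1) that] X'(2) pro_qh[OF S M(1) that]] .
   have mI: "maps (G || K) (K Int L) (G || K) (K Int L) (%x. x)" using GK sKL(2)[OF L] by (intro maps_id) auto
   have "qh (G || K) (K Int L) X (G || K) (K Int L) X' (%x. x)"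
    by (rule qh_lift[OF X(1) X'(1) pro_qa[OF S L] mI mapsKL[OF L] _ X'L[OF L M(2)] X(2)]) auto
   from qh_comp[OF X(1) mI _ this X'L[OF L'(1) M(3)]] show ?thesis using mapsKL[OF L'(1)] L'(2) by simp
  qed
  with X(1) show ?thesis by blast
 qed
 define T :: "('a, 'k) pro_fam" where "T = \<lparr>mem = {K Int L | L. L:mem S},
   str = (%J. SOME X. qa (G || K) J X & (ALL L:mem S. K Int L = J --> qh (G || K) J X G L (str S L) (%x. x)))\<rparr>"
 have memT: "J:mem T <-> (EX L:mem S. J = K Int L)" for J by (auto simp: T_def)
 have T: "qa (G || K) (K Int L) (str T (K Int L))" "qh (G || K) (K Int L) (str T (K Int L)) G L (str S L) (%x. x)" if L: "L:mem S" for L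
  using T_def family.simps someI_ex[OF ex[OF L]] ex[OF L] L by auto
 have tr: "qh (G || K) J (str T J) (G || K) J' (str T J') (%x. x)" "maps (G || K) J (G || K) J' (%x. x)"
  if J: "J:mem T" "J':mem T" "J <= J'" for J J'
 proof -
  obtain L L' where L: "L:mem S" "J = K Int L" "L':mem S" "J' = K Int L'" using J(1,2) unfolding memT by (elim bexE)
  define M where "M = L Int L'"
  have M: "M:mem S" "M <= L'" "J = K Int M" using pro_int[OF S L(1,3)] L J(3) by (auto simp: M_def)
  show mJ: "maps (G || K) J (G || K) J' (%x. x)" using GK sKL(2) L J(3) by (intro maps_id) auto
  have "qh (G || K) J (str T J) G L' (str S L') (%x. x)"
   unfolding M(3) by (rule qh_comp[OF T(1)[OF M(1)] mapsKL[OF M(1)] pro_maps[OF S M(1) L(3) M(2)] T(2)[OF M(1)] pro_qh[OF S M(1) L(3) M(2)]])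
  thus "qh (G || K) J (str T J) (G || K) J' (str T J') (%x. x)"
   using T(1)[OF L(1)] T[OF L(3)] mapsKL[OF L(3)] mJ L
   by (intro qh_lift[OF _ _ pro_qa[OF S L(3)], of "G || K" J "str T J" "G || K" J' "str T J'" "%x. x" "%x. x"]) auto
 qed
 have "proalg (G || K) T"
  unfolding proalg_iff
 proof (intro conjI ballI allI impI)
  show "mem T ~= {}" using pro_ne[OF S] memT by blast
  have "mem T = (Int) K ` mem S" using memT by blast
  thus "countably_coinitial (mem T)" using countably_coinitial_image[OF pro_count[OF S], of "(Int) K"] by auto
  show "EX H'':mem T. H'' <= H Int H'" if H: "H:mem T" "H':mem T" for H H'
  proof -
   obtain L L' where L: "L:mem S" "H = K Int L" "L':mem S" "H' = K Int L'" using H unfolding memT by (elim bexE)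
   thus ?thesis using pro_int[OF S L(1,3)] by (intro bexI[of _ "K Int (L Int L')"]) (auto simp: memT)
  qed
  show "cplt (G || K) (mem T)" unfolding cplt_def
  proof (intro conjI ballI allI impI)
   fix x assume "x:carrier (G || K)" "ALL H:mem T. x:H"
   thus "x = (one (G || K))" using cplt_separated[OF pro_cplt[OF S], of x] KG memT by auto
  next
   fix c assume c: "ALL H:mem T. c H:carrier (G || K)"
    "ALL H:mem T. ALL H':mem T. H <= H' --> c H *[G || K] inv[G || K] c H':H'"
   have cK: "c (K Int L):K" if "L:mem S" for L using c(1) memT that by auto
   obtain y where y: "y:carrier G" "!!L. L:mem S ==> y \<otimes> inv (c (K Int L)):L"
   proof (rule cplt_limit[OF pro_cplt[OF S], of "%L. c (K Int L)"])
    fix L L' assume L: "L:mem S" "L':mem S" "L <= L'"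
    have "c (K Int L) *[G || K] inv[G || K] c (K Int L'):K Int L'"
     using c(2)[rule_format, of "K Int L" "K Int L'"] L memT by blast
    thus "c (K Int L) \<otimes> inv (c (K Int L')):L'" using inv_restr[OF K cK[OF L(2)]] by simp
   qed (use cK KG in auto)
   have "y:K <#> L" if "L:mem S" for L
    using mem_set_mult_iff[OF sS[OF that] subgroup.subset[OF K]] y cK[OF that] that by blast
   hence yK: "y:K" using cl[OF y(1)] by blast
   have "y *[G || K] inv[G || K] c H:H" if "H:mem T" for H
   proof -
    obtain L where L: "L:mem S" "H = K Int L" using `H:mem T` memT by blast
    have "y \<otimes> inv (c H):K" using yK cK[OF L(1)] L(2) subgroup.m_closed[OF K _ subgroup.m_inv_closed[OF K]] by simp
    thus ?thesis using y(2)[OF L(1)] L(2) inv_restr[OF K cK[OF L(1)]] by simp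
   qed
   thus "EX x:carrier (G || K). ALL H:mem T. x *[G || K] inv[G || K] c H:H"
    using yK by (intro bexI[of _ y]) auto
  qed
  fix J J' assume J: "J:mem T"
  then obtain L where L: "L:mem S" "J = K Int L" using memT by blast
  show "qcl (G || K) J (str T J) J' <-> J':mem T & J <= J'"
  proof
   assume q: "qcl (G || K) J (str T J) J'"
   hence J': "subgroup J' G" "J' <= K" "J <= J'" using qclD[OF q] subgroup_restr[OF K] by auto
   have "qcl G L (str S L) ((%x. x) ` J' <#> L)"
    using q unfolding L(2) by (rule qcl_image[OF T(1)[OF L(1)] pro_qa[OF S L(1)] mapsKL[OF L(1)] T(2)[OF L(1)]])
   hence "J' <#> L:mem S" using pro_qcl[OF S L(1)] by simp
   moreover have "K Int (J' <#> L) = J'"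
   proof -
    have "(L <#> J') Int K = (L Int K) <#> J'" by (rule modular_law[OF sS[OF L(1)] J'(1) K J'(2)])
    also have "... = J'" using J'(3) L(2) set_mult_least[OF J'(1), of "L Int K" J']
     set_mult_upper2[OF sKL(1)[OF L(1)], of J'] subgroup.subset[OF J'(1)] by (auto simp: Int_commute)
    finally show ?thesis
     using set_mult_comm[of L J'] subgroup.subset[OF sS[OF L(1)]] subgroup.subset[OF J'(1)] by auto
   qed
   ultimately show "J':mem T & J <= J'" using J'(3) unfolding memT by blast
  next
   assume J': "J':mem T & J <= J'"
   then obtain L' where L': "L':mem S" "J' = K Int L'" using memT by blast
   have q: "qa (G || K) J (str T J)" "qa (G || K) J' (str T J')" using T(1)[OF L(1)] T(1)[OF L'(1)] L(2) L'(2) by simp_all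
   have "qcl (G || K) J (str T J) {x:carrier (G || K). x:J'}"
    using tr[OF J, of J'] J' by (intro qcl_preimage[OF q _ _ qcl_base[OF q(2)]]) auto
   moreover have "{x:carrier (G || K). x:J'} = J'" using L'(2) by auto
   ultimately show "qcl (G || K) J (str T J) J'" by simp
  qed
 qed (use GK memT sKL(2) T(1) tr in auto)
 moreover have "proalg_hom (G || K) T G S (%x. x)"
  unfolding proalg_hom_iff
 proof (intro conjI ballI)
  show "(%x. x):hom (G || K) G" using KG by (auto simp: hom_def)
  fix L assume L: "L:mem S"
  have "{x:carrier (G || K). x:L} = K Int L" by auto
  thus "{x:carrier (G || K). x:L}:mem T" "qh (G || K) {x:carrier (G || K). x:L} (str T {x:carrier (G || K). x:L}) G L (str S L) (%x. x)"
   using T(2)[OF L] L memT by auto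
 qed
 ultimately have "embedded G S K T" using S K by (simp add: embedded_def)
 thus thesis by (rule that)
qed

lemma proalg_image_closed:
 assumes S: "proalg G1 S1" "proalg G2 S2" and f: "proalg_hom G1 S1 G2 S2 f"
 obtains T where "embedded G2 S2 (f ` carrier G1) T" "proalg_hom G1 S1 (G2 || (f ` carrier G1)) T f"
proof -
 obtain T where T: "embedded G2 S2 (f ` carrier G1) T"
  using embedded_exists[OF S(2) proalg_image(1)[OF assms] proalg_image(2)[OF assms] proalg_image(3)[OF assms]] by blast
 show thesis by (rule that[OF T embedded_factor[OF T S(1) f]]) simp
qed

lemma proalg_member_embedded:
 assumes S: "proalg G S" and K: "K:mem S"
 obtains T where "embedded G S K T"
proof (rule embedded_exists[OF S pro_sub[OF S K] pro_mult[OF S K]])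
 interpret cgroup G using pro_comm[OF S] by (simp add: cgroup_def)
 show "x:K" if "!!L. L:mem S ==> x:K <#>[G] L" for x
  using that[OF K] set_mult_absorb[OF pro_sub[OF S K] pro_sub[OF S K]] by simp
qed auto

lemma proalg_quot_quasialg_iff:
 fixes G (structure)
 assumes S: "proalg G S" and N: "subgroup N G"
 shows "proalg_quot_quasialg G S N <-> (EX K:mem S. K <= N)"
proof -
 interpret cgroup G using pro_comm[OF S] by (simp add: cgroup_def)
 have "{N} = (%x. N #> x) ` K <-> K <= N" if K: "K:mem S" for K
 proof -
  have "x:carrier G" if "x:K" for x using subgroup.mem_carrier[OF pro_sub[OF S K] that] .
  moreover have "\<one>:K" using subgroup.one_closed[OF pro_sub[OF S K]] .
  ultimately have "(%x. N #> x) ` K <= {N} <-> K <= N" "(%x. N #> x) ` K ~= {}" using coset_one_iff[OF N] by auto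
  thus ?thesis by (metis subset_singletonD subset_refl)
 qed
 thus ?thesis unfolding proalg_quot_quasialg_def one_FactGroup by (auto simp: image_iff)
qed

end

section \<open>Q-admissible groups and their two morphism axioms\<close>

section \<open>\<open>\<Q>\<close>-admissible groups\<close>

lemma hom_restr:
 assumes "f:hom G1 G2" "H1 <= carrier G1" "f ` H1 <= H2"
 shows "f:hom (G1 || H1) (G2 || H2)"
proof (rule homI)
 fix x y assume xy: "x:carrier (G1 || H1)" "y:carrier (G1 || H1)"
 thus "f (x *[G1 || H1] y) = f x *[G2 || H2] f y"
  using hom_mult[OF assms(1), of x y] assms(2) by auto
qed (use assms(3) in auto)

lemma hom_image_subset: "f:hom G1 G2 ==> H <= carrier G1 ==> f ` H <= carrier G2"
 by (auto simp: hom_def)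

context pos_char
begin

lemma qh_incl_iff:
 fixes G (structure)
 assumes "qa (G || H) B X"
 shows "quasialg_hom (G || H Mod B) X (G || H' Mod B) Y (%c. c) <-> qh (G || H) B X (G || H') B Y (%x. x)"
 unfolding qh_def
proof (rule quasialg_hom_cong[OF qa_top[OF assms] qa_group[OF assms]])
 fix c assume c: "c:carrier (G || H Mod B)"
 have m: "maps (G || H) B (G || H) B (%x. x)" using qaD[OF assms] by (intro maps_id) auto
 show "c = quot_map (G || H') B (%x. x) c"
  using c maps_coset[OF m] by (auto simp: carrier_FactGroup)
qed

text \<open>The limit conditions relative to each \<open>H\<close> are equivalent to two absolute
  ones. Upward directedness turns the first into a covering of \<open>G\<close> by the members;
  completeness passes between \<open>G\<close> and any single member by \<open>cplt_restrict\<close>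
  and \<open>cplt_extend\<close>.\<close>

lemma qad_iff:
 fixes G (structure)
 shows "qadmissible G S <-> comm_group G & mem S ~= {} & (ALL H:mem S. subgroup H G) &
   countably_cofinal (mem S) & countably_coinitial (mem S) &
   (ALL H:mem S. ALL H':mem S. (EX Hp:mem S. H <#> H' <= Hp) & (EX Hm:mem S. Hm <= H Int H')) &
   \<Union>(mem S) = carrier G & cplt G (mem S) &
   (ALL H:mem S. ALL H':mem S. H <= H' --> qa (G || H') H (str S H' H)) &
   (ALL H:mem S. ALL H':mem S. H <= H' --> (ALL K. qcl (G || H') H (str S H' H) K --> K:mem S)) &
   (ALL Hm:mem S. ALL H:mem S. ALL Hp:mem S. Hm <= H --> H <= Hp -->
    qh (G || H) Hm (str S H Hm) (G || Hp) Hm (str S Hp Hm) (%x. x) &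
    qh (G || Hp) Hm (str S Hp Hm) (G || Hp) H (str S Hp H) (%x. x))"
  (is "_ <-> ?c & ?n & ?s & ?cf & ?ci & ?d & ?u & ?l & ?q & ?k & ?h")
proof (cases "?c & ?n & ?s & ?d")
 case True
 then interpret cgroup G by (simp add: cgroup_def)
 have sub: "subgroup H G" if "H:mem S" for H using True that by blast
 have dn: "EX K'':mem S. K'' <= K Int K'" and up: "EX Hp:mem S. K <#> K' <= Hp" if "K:mem S" "K':mem S" for K K'
  using True that by auto
 obtain H0 where H0: "H0:mem S" using True by blast
 have q: "(ALL H:mem S. ALL H':mem S. H <= H' --> quasialg (G || H' Mod H) (str S H' H)) <-> ?q"
  using restr_comm_group[OF sub] subgroup_restr[OF sub] sub by (intro ball_cong refl imp_cong) (auto simp: qa_def)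
 have k: "(ALL H:mem S. ALL H':mem S. H <= H' --> (ALL C. quasialg_closed (G || H' Mod H) (str S H' H) C --> coset_preimage (G || H') H C:mem S)) <-> ?k"
  using subgroup_restr sub qcl_coset_preimage_iff restr_comm_group _ by metis
 have h: "?q ==> (ALL Hm:mem S. ALL H:mem S. ALL Hp:mem S. Hm <= H --> H <= Hp --> quasialg_hom (G || H Mod Hm) (str S H Hm) (G || Hp Mod Hm) (str S Hp Hm) (%c. c) & quasialg_hom (G || Hp Mod Hm) (str S Hp Hm) (G || Hp Mod H) (str S Hp H) (quot_map G H (%x. x))) <-> ?h"
  by (simp add: qh_incl_iff qh_def)
 have u: "(UN Hp:{Hp:mem S. H <= Hp}. quot_set G Hp H) = carrier (G Mod H) <-> ?u" if H: "H:mem S" for H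
 proof -
  have "(UN Hp:{Hp:mem S. H <= Hp}. quot_set G Hp H) <= carrier (G Mod H)"
   using subgroup.mem_carrier[OF sub] by (auto simp: quot_set_image carrier_FactGroup)
  moreover have "carrier (G Mod H) <= (UN Hp:{Hp:mem S. H <= Hp}. quot_set G Hp H) <->
   (ALL x:carrier G. EX Hp:mem S. H <= Hp & x:Hp)"
  proof -
   have "H #> x:(UN Hp:{Hp:mem S. H <= Hp}. quot_set G Hp H) <-> (EX Hp:mem S. H <= Hp & x:Hp)"
    if "x:carrier G" for x using coset_mem_quot_set[OF sub[OF H] sub _ that] by blast
   thus ?thesis unfolding carrier_FactGroup image_subset_iff by (intro ball_cong refl)
  qed
  moreover have "(EX Hp:mem S. H <= Hp & x:Hp) <-> (EX K:mem S. x:K)" if "x:carrier G" for x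
  proof
   assume "EX K:mem S. x:K"
   then obtain K Hp where "K:mem S" "x:K" "Hp:mem S" "H <#> K <= Hp" using up[OF H] by blast
   thus "EX Hp:mem S. H <= Hp & x:Hp"
    using set_mult_upper1[OF sub subgroup.subset[OF sub[OF H]], of K]
     set_mult_upper2[OF sub[OF H] subgroup.subset[OF sub], of K] by (intro bexI[of _ Hp]) auto
  qed blast
  moreover have "\<Union>(mem S) <= carrier G" using subgroup.subset[OF sub] by blast
  ultimately show ?thesis by (auto simp: set_eq_iff)
 qed
 have l: "is_quot_limit (G || H) {Hm:mem S. Hm <= H} <-> ?l" if H: "H:mem S" for H
 proof -
  have "is_quot_limit (G || H) {Hm:mem S. Hm <= H} <-> cplt (G || H) {Hm:mem S. Hm <= H}"
   using subgroup_restr[OF sub[OF H]] sub by (intro is_quot_limit_iff restr_comm_group) (auto simp: H)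
  thus ?thesis
   using cplt_restrict[OF comm_group_axioms sub dn H] cplt_extend[OF comm_group_axioms sub dn H] by blast
 qed
 have ul: "(ALL H:mem S. (UN Hp:{Hp:mem S. H <= Hp}. quot_set G Hp H) = carrier (G Mod H) & is_quot_limit (G || H) {Hm:mem S. Hm <= H}) <-> ?u & ?l" (is "?lhs <-> _")
  using ball_cong refl u l H0 ball_triv by auto
 show ?thesis unfolding qadmissible_def q k ul using h by argo
next
 case False
 thus ?thesis unfolding qadmissible_def by argo
qed

context
 fixes G :: "'a monoid" (structure) and S :: "('a, 'k) qad_fam"
 assumes S: "qadmissible G S"
begin

lemma qadD:
 shows qad_comm: "comm_group G" and qad_ne: "mem S ~= {}" and qad_sub: "H:mem S ==> subgroup H G"
  and qad_cofinal: "countably_cofinal (mem S)" and qad_coinitial: "countably_coinitial (mem S)"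
  and qad_up: "H:mem S ==> H':mem S ==> EX Hp:mem S. H <#> H' <= Hp"
  and qad_down: "H:mem S ==> H':mem S ==> EX Hm:mem S. Hm <= H Int H'"
  and qad_cover: "\<Union>(mem S) = carrier G" and qad_cplt: "cplt G (mem S)"
  and qad_qa: "H:mem S ==> H':mem S ==> H <= H' ==> qa (G || H') H (str S H' H)"
 by (insert S[unfolded qad_iff], (elim conjE; blast)+)

lemma qad_cgroup: "cgroup G"
 using qad_comm by (simp add: cgroup_def)

interpretation cgroup G by (rule qad_cgroup)

lemma qad_subset: "H:mem S ==> H <= carrier G"
 by (rule subgroup.subset[OF qad_sub])

lemma qad_incl: "H:mem S ==> K:mem S ==> K <= H ==> subgroup K (G || H)"
 using subgroup_restr[OF qad_sub] qad_sub by blast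

lemma qad_maps:
 assumes "H:mem S" "Hm:mem S" "Hm <= H" "H':mem S" "Hm':mem S" "Hm' <= H'" "H <= H'" "Hm <= Hm'"
 shows "maps (G || H) Hm (G || H') Hm' (%x. x)"
 using restr_comm_group[OF qad_sub] qad_incl assms by (auto simp: maps_def hom_def)

lemma qad_qh:
 assumes H: "H:mem S" "Hm:mem S" "Hm <= H" "H':mem S" "Hm':mem S" "Hm' <= H'" "H <= H'" "Hm <= Hm'"
 shows "qh (G || H) Hm (str S H Hm) (G || H') Hm' (str S H' Hm') (%x. x)"
proof -
 have "qh (G || H) Hm (str S H Hm) (G || H') Hm (str S H' Hm) (%x. x)"
  "qh (G || H') Hm (str S H' Hm) (G || H') Hm' (str S H' Hm') (%x. x)"
  using S H unfolding qad_iff by blast+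
 thus ?thesis
  using H by (intro qh_comp[OF qad_qa qad_maps qad_maps, of Hm H H' Hm H' Hm']) auto
qed

text \<open>The converse of axiom (Q-ad-2) comes from closedness of images: a member between
  \<open>H\<close> and \<open>H'\<close> is the image of its own quotient by
  \<open>H\<close>.\<close>

lemma qad_qcl:
 assumes H: "H:mem S" "H':mem S" "H <= H'"
 shows "qcl (G || H') H (str S H' H) K <-> K:mem S & H <= K & K <= H'"
proof
 assume q: "qcl (G || H') H (str S H' H) K"
 have "K:mem S" using S H q unfolding qad_iff by blast
 thus "K:mem S & H <= K & K <= H'" using qclD[OF q] subgroup.subset[of K "G || H'"] by auto
next
 assume K: "K:mem S & H <= K & K <= H'"
 have "qcl (G || H') H (str S H' H) ((%x. x) ` carrier (G || K) <#>[G || H'] H)"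
  using H K by (intro qcl_image[OF qad_qa qad_qa qad_maps qad_qh qcl_carrier[OF qad_qa]]) auto
 thus "qcl (G || H') H (str S H' H) K" using set_mult_absorb[of K H] qad_sub H K by simp
qed

lemma qad_bounds:
 assumes "H:mem S" "K:mem S"
 obtains Hm Hp where "Hm:mem S" "Hp:mem S" "Hm <= H" "Hm <= K" "H <= Hp" "K <= Hp"
proof -
 obtain Hm Hp where H: "Hm:mem S" "Hp:mem S" "Hm <= H Int K" "H <#> K <= Hp"
  using qad_up[OF assms] qad_down[OF assms] by blast
 have "H <= H <#> K" "K <= H <#> K"
  using set_mult_upper1 set_mult_upper2 qad_sub qad_subset assms by auto
 thus thesis using H by (intro that[of Hm Hp]) auto
qed

lemma qad_int:
 assumes "H:mem S" "K:mem S"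
 shows "H Int K:mem S"
proof -
 obtain Hm Hp where H: "Hm:mem S" "Hp:mem S" "Hm <= H" "Hm <= K" "H <= Hp" "K <= Hp"
  using qad_bounds[OF assms] .
 hence "qcl (G || Hp) Hm (str S Hp Hm) (H Int K)"
  using assms by (intro qcl_inter qad_qa) (auto simp: qad_qcl)
 thus ?thesis using qad_qcl[of Hm Hp] H by auto
qed

lemma qad_mult:
 assumes "H:mem S" "K:mem S"
 shows "H <#> K:mem S"
proof -
 obtain Hm Hp where H: "Hm:mem S" "Hp:mem S" "Hm <= H" "Hm <= K" "H <= Hp" "K <= Hp"
  using qad_bounds[OF assms] .
 have "qcl (G || Hp) K (str S Hp K) ((%x. x) ` H <#>[G || Hp] K)"
  using assms H by (intro qcl_image[OF qad_qa[of Hm Hp] qad_qa qad_maps qad_qh]) (auto simp: qad_qcl)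
 thus ?thesis using qad_qcl[of K Hp] assms H by simp
qed

lemma qad_le_mult:
 assumes "H:mem S" "K:mem S"
 shows "H <= H <#> K" "K <= H <#> K"
 using set_mult_upper1 set_mult_upper2 qad_sub qad_subset assms by auto

end

definition qpro :: "('a, 'k) qad_fam => 'a set => ('a, 'k) pro_fam" where
 "qpro S H = \<lparr>mem = {Hm:mem S. Hm <= H}, str = (%Hm. str S H Hm)\<rparr>"

lemma qpro_simps [simp]:
 "mem (qpro S H) = {Hm:mem S. Hm <= H}" "str (qpro S H) K = str S H K"
 by (simp_all add: qpro_def)

lemma qpro_proalg:
 fixes G (structure)
 assumes S: "qadmissible G S" and H: "H:mem S"
 shows "proalg (G || H) (qpro S H)"
 unfolding proalg_iff qpro_simps
proof (intro conjI ballI allI impI)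
 interpret cgroup G by (rule qad_cgroup[OF S])
 show "comm_group (G || H)" by (rule restr_comm_group[OF qad_sub[OF S H]])
 show "{Hm:mem S. Hm <= H} ~= {}" using H by blast
 have "(%K. K Int H) ` mem S = {Hm:mem S. Hm <= H}" using qad_int[OF S _ H] by (auto simp: image_iff Int_absorb2)
 thus "countably_coinitial {Hm:mem S. Hm <= H}"
  using countably_coinitial_image[OF qad_coinitial[OF S], of "%K. K Int H"] by fastforce
 show "cplt (G || H) {Hm:mem S. Hm <= H}"
  by (rule cplt_restrict[OF comm_group_axioms qad_sub[OF S] qad_down[OF S] H qad_cplt[OF S]])
 fix K assume K: "K:{Hm:mem S. Hm <= H}"
 thus "subgroup K (G || H)" using qad_incl[OF S H] by blast
 show "qa (G || H) K (str S H K)" using qad_qa[OF S _ H] K by blast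
 show "qcl (G || H) K (str S H K) L <-> L:{Hm:mem S. Hm <= H} & K <= L" for L
  using qad_qcl[OF S _ H, of K L] K by blast
 fix K' assume K': "K':{Hm:mem S. Hm <= H}"
 thus "EX H'':{Hm:mem S. Hm <= H}. H'' <= K Int K'" using qad_int[OF S, of K K'] K by (intro bexI[of _ "K Int K'"]) auto
 assume "K <= K'"
 thus "qh (G || H) K (str S H K) (G || H) K' (str S H K') (%x. x)" using K K' H by (intro qad_qh[OF S]) auto
qed

lemma qpro_embedded:
 assumes S: "qadmissible G S" and H: "H:mem S" "K:mem S" "K <= H"
 shows "embedded (G || H) (qpro S H) K (qpro S K)"
 unfolding embedded_def restr_simps proalg_hom_iff qpro_simps
proof (intro conjI ballI)
 show "(%x. x):hom (G || K) (G || H)" using H(3) by (auto simp: hom_def)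
 fix L assume L: "L:{Hm:mem S. Hm <= H}"
 have eq: "{x:carrier (G || K). x:L} = K Int L" by auto
 have KL: "K Int L:mem S" using qad_int[OF S H(2)] L by blast
 thus "{x:carrier (G || K). x:L}:{Hm:mem S. Hm <= K}" unfolding eq by blast
 show "qh (G || K) {x:carrier (G || K). x:L} (str S K {x:carrier (G || K). x:L}) (G || H) L (str S H L) (%x. x)"
  unfolding eq using KL L H by (intro qad_qh[OF S]) auto
qed (use qpro_proalg[OF S] H qad_incl[OF S] in auto)

subsection \<open>Morphisms\<close>

lemma hom_qad_1_iff:
 assumes f: "f:hom G1 G2" and S: "qadmissible G1 S1" "qadmissible G2 S2"
 shows "hom_qad_1 G1 S1 G2 S2 f <-> (ALL H1:mem S1. EX H2:mem S2. f ` H1 <= H2 &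
  proalg_hom (G1 || H1) (qpro S1 H1) (G2 || H2) (qpro S2 H2) f)"
proof -
 have "(ALL H2m:mem S2. H2m <= H2 --> (let K = {x:H1. f x:H2m} in K:mem S1 & quasialg_hom (G1 || H1 Mod K) (str S1 H1 K) (G2 || H2 Mod H2m) (str S2 H2 H2m) (quot_map G2 H2m f))) <-> proalg_hom (G1 || H1) (qpro S1 H1) (G2 || H2) (qpro S2 H2) f" if H: "H1:mem S1" "H2:mem S2" "f ` H1 <= H2" for H1 H2
  using hom_restr[OF f qad_subset[OF S(1) H(1)] H(3)] f qad_subset[OF S(1) H(1)] S(1) H(1) H(3)
  by (auto simp: proalg_hom_iff Let_def qh_def)
 thus ?thesis unfolding hom_qad_1_def by (intro ball_cong bex_cong refl conj_cong) auto
qed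

lemma hom_qad_1D:
 assumes S: "qadmissible G1 S1" "qadmissible G2 S2" and f: "f:hom G1 G2"
  and H: "H1:mem S1" "H2:mem S2" "f ` H1 <= H2"
  and h: "proalg_hom (G1 || H1) (qpro S1 H1) (G2 || H2) (qpro S2 H2) f"
  and Q: "Q:mem S2" "H2 <= Q"
 shows "proalg_hom (G1 || H1) (qpro S1 H1) (G2 || Q) (qpro S2 Q) f"
proof -
 show ?thesis
  using qpro_embedded[OF S(2) Q(1) H(2) Q(2)] proalg_hom_comp[OF _ _ _ h] qpro_proalg[OF S(1) H(1)] qpro_proalg[OF S(2) H(2)] qpro_proalg[OF S(2) Q(1)]
  by (auto simp: embedded_def)
qed

lemma hom_restr_maps:
 assumes S: "qadmissible G1 S1" "qadmissible G2 S2" and f: "f:hom G1 G2"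
  and H: "H1:mem S1" "K1:mem S1" "K1 <= H1" "H2:mem S2" "K2:mem S2" "K2 <= H2" "f ` H1 <= H2" "f ` K1 <= K2"
 shows "maps (G1 || H1) K1 (G2 || H2) K2 f"
 using cgroup.restr_comm_group[OF qad_cgroup[OF S(1)] qad_sub[OF S(1)]]
  cgroup.restr_comm_group[OF qad_cgroup[OF S(2)] qad_sub[OF S(2)]]
  qad_incl[OF S(1)] qad_incl[OF S(2)] H hom_restr[OF f qad_subset[OF S(1) H(1)] H(7)] by (simp add: maps_def)

text \<open>\<open>hom_qad_2_at H1 H2\<close> is the condition on the pair in (Hom-\<open>\<Q>\<close>-ad-2).\<close>

definition hom_qad_2_at ::
  "'a monoid => ('a, 'k) qad_fam => 'a monoid => ('a, 'k) qad_fam => ('a => 'a) => 'a set => 'a set => bool" where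
 "hom_qad_2_at G1 S1 G2 S2 f H1 H2 <-> f ` H1 <= H2 &
   (ALL H1p:mem S1. H1 <= H1p --> f ` H1p <#>[G2] H2:mem S2 &
    qh (G1 || H1p) H1 (str S1 H1p H1) (G2 || (f ` H1p <#>[G2] H2)) H2 (str S2 (f ` H1p <#>[G2] H2) H2) f)"

lemma hom_qad_2_iff:
 "hom_qad_2 G1 S1 G2 S2 f <-> (ALL H2:mem S2. EX H1:mem S1. hom_qad_2_at G1 S1 G2 S2 f H1 H2)"
 by (simp add: hom_qad_2_def hom_qad_2_at_def Let_def qh_def)

text \<open>In an arbitrary member \<open>H1'\<close> take for \<open>H1\<close> the preimage of
  \<open>H2\<close>. For each larger \<open>H\<close> the first axiom gives a morphism into some
  \<open>Q\<close> containing \<open>H2\<close>; its image modulo \<open>H2\<close> is closed, hence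
  given by a member \<open>L\<close>, and the morphism lifts to that image.\<close>

lemma hom_qad_1_imp_2:
 assumes S: "qadmissible G1 S1" "qadmissible G2 S2" and f: "f:hom G1 G2" and h1: "hom_qad_1 G1 S1 G2 S2 f"
 shows "hom_qad_2 G1 S1 G2 S2 f"
 unfolding hom_qad_2_iff
proof
 interpret G1: cgroup G1 by (rule qad_cgroup[OF S(1)])
 interpret G2: cgroup G2 by (rule qad_cgroup[OF S(2)])
 interpret f: group_hom G1 G2 f using f by unfold_locales
 note h1 = h1[unfolded hom_qad_1_iff[OF f S], rule_format]
 fix H2 assume H2: "H2:mem S2"
 obtain H1' where H1': "H1':mem S1" using qad_ne[OF S(1)] by blast
 obtain H2' where H2': "H2':mem S2" "f ` H1' <= H2'" "proalg_hom (G1 || H1') (qpro S1 H1') (G2 || H2') (qpro S2 H2') f"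
  using h1[OF H1'] by blast
 define H1 where "H1 = {x:H1'. f x:H2' Int H2}"
 have H1: "H1:mem S1" using qad_int[OF S(2) H2'(1) H2] H2'(3) by (auto simp: proalg_hom_iff H1_def)
 have fH1: "f ` H1 <= H2" by (auto simp: H1_def)
 have "f ` H <#>[G2] H2:mem S2 &
   qh (G1 || H) H1 (str S1 H H1) (G2 || (f ` H <#>[G2] H2)) H2 (str S2 (f ` H <#>[G2] H2) H2) f"
  if H: "H:mem S1" "H1 <= H" for H
 proof -
  obtain Q' where Q': "Q':mem S2" "f ` H <= Q'" "proalg_hom (G1 || H) (qpro S1 H) (G2 || Q') (qpro S2 Q') f"
   using h1[OF H(1)] by blast
  define Q where "Q = Q' <#>[G2] H2"
  have Q: "Q:mem S2" "Q' <= Q" "H2 <= Q"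
   using qad_mult[OF S(2) Q'(1) H2] qad_le_mult[OF S(2) Q'(1) H2] by (auto simp: Q_def)
  have fHQ: "f ` H <= Q" using Q'(2) Q(2) by blast
  define K where "K = {x:H. f x:H2}"
  have "proalg_hom (G1 || H) (qpro S1 H) (G2 || Q) (qpro S2 Q) f"
   by (rule hom_qad_1D[OF S f H(1) Q'(1,2,3) Q(1,2)])
  hence K: "K:mem S1" "qh (G1 || H) K (str S1 H K) (G2 || Q) H2 (str S2 Q H2) f"
   using Q(3) H2 unfolding proalg_hom_iff by (auto simp: K_def)
  have sub: "K <= H" "H1 <= K" "f ` K <= H2" using fH1 H(2) by (auto simp: K_def)
  have mH: "maps (G1 || H) H1 (G2 || Q) H2 f"
   using hom_restr_maps[OF S f H(1) H1 H(2) Q(1) H2 Q(3) fHQ fH1] .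
  have qH: "qh (G1 || H) H1 (str S1 H H1) (G2 || Q) H2 (str S2 Q H2) f"
   using qh_comp[OF qad_qa[OF S(1) H1 H] qad_maps[OF S(1) H(1) H1 H(2) H(1) K(1) sub(1) order_refl sub(2)]
    hom_restr_maps[OF S f H(1) K(1) sub(1) Q(1) H2 Q(3) fHQ sub(3)]
    qad_qh[OF S(1) H(1) H1 H(2) H(1) K(1) sub(1) order_refl sub(2)] K(2)] .
  define L where "L = f ` H <#>[G2] H2"
  have L: "L:mem S2" "H2 <= L" "L <= Q"
   using qad_qcl[OF S(2) H2 Q(1,3)] qcl_image[OF qad_qa[OF S(1) H1 H] qad_qa[OF S(2) H2 Q(1,3)] mH qH qcl_carrier[OF qad_qa[OF S(1) H1 H]]]
   by (auto simp: L_def)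
  have fHL: "f ` H <= L" using qad_subset[OF S(2) Q(1)] fHQ G2.set_mult_upper1[OF qad_sub[OF S(2) H2]] unfolding L_def by blast
  have "qh (G1 || H) H1 (str S1 H H1) (G2 || L) H2 (str S2 L H2) f"
   by (rule qh_lift[OF qad_qa[OF S(1) H1 H] qad_qa[OF S(2) H2 L(1,2)] qad_qa[OF S(2) H2 Q(1,3)]
     hom_restr_maps[OF S f H(1) H1 H(2) L(1) H2 L(2) fHL fH1]
     qad_maps[OF S(2) L(1) H2 L(2) Q(1) H2 Q(3) L(3) order_refl] _
     qad_qh[OF S(2) L(1) H2 L(2) Q(1) H2 Q(3) L(3) order_refl] qH])
  with L(1) show ?thesis by (simp add: L_def)
 qed
 thus "EX H1:mem S1. hom_qad_2_at G1 S1 G2 S2 f H1 H2"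
  unfolding hom_qad_2_at_def using H1 fH1 by (intro bexI[of _ H1] conjI ballI impI) auto
qed

text \<open>Enlarging \<open>H\<close> to \<open>H <#> M\<close> does not change the product of the
  image with \<open>Q\<close>, because \<open>f\<close> maps \<open>M\<close> into \<open>Q\<close>;
  the condition for \<open>M\<close> at the larger group is then restricted to
  \<open>H\<close>.\<close>

lemma hom_qad_2_at_mono:
 assumes S: "qadmissible G1 S1" "qadmissible G2 S2" and f: "f:hom G1 G2"
  and M: "M:mem S1" "Q:mem S2" "hom_qad_2_at G1 S1 G2 S2 f M Q" and N: "N:mem S1" "N <= M"
 shows "hom_qad_2_at G1 S1 G2 S2 f N Q"
 unfolding hom_qad_2_at_def
proof (intro conjI ballI impI)
 interpret G1: cgroup G1 by (rule qad_cgroup[OF S(1)])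
 interpret G2: cgroup G2 by (rule qad_cgroup[OF S(2)])
 interpret f: group_hom G1 G2 f using f by unfold_locales
 have fM: "f ` M <= Q" using M(3) by (simp add: hom_qad_2_at_def)
 thus fN: "f ` N <= Q" using N(2) by blast
 fix H assume H: "H:mem S1" "N <= H"
 define HM where "HM = H <#>[G1] M"
 have HM: "HM:mem S1" "H <= HM" "M <= HM"
  using qad_mult[OF S(1) H(1) M(1)] qad_le_mult[OF S(1) H(1) M(1)] by (auto simp: HM_def)
 define L where "L = f ` HM <#>[G2] Q"
 have L: "L:mem S2" "qh (G1 || HM) M (str S1 HM M) (G2 || L) Q (str S2 L Q) f"
  using M(3) HM by (auto simp: hom_qad_2_at_def L_def)
 have fHM: "f ` HM <= carrier G2" "f ` H <= carrier G2" using hom_image_subset[OF f qad_subset[OF S(1)]] HM(1) H(1) by auto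
 have QL: "Q <= L" "f ` HM <= L"
  using G2.set_mult_upper1[OF qad_sub[OF S(2) M(2)] fHM(1)]
   G2.set_mult_upper2[OF f.subgroup_img_is_subgroup[OF qad_sub[OF S(1) HM(1)]] qad_subset[OF S(2) M(2)]] by (auto simp: L_def)
 have sHQ: "subgroup (f ` H <#>[G2] Q) G2"
  by (rule G2.mult_subgroups[OF f.subgroup_img_is_subgroup[OF qad_sub[OF S(1) H(1)]] qad_sub[OF S(2) M(2)]])
 have HQ: "f ` H <= f ` H <#>[G2] Q" "Q <= f ` H <#>[G2] Q"
  using G2.set_mult_upper1[OF qad_sub[OF S(2) M(2)] fHM(2)]
   G2.set_mult_upper2[OF f.subgroup_img_is_subgroup[OF qad_sub[OF S(1) H(1)]] qad_subset[OF S(2) M(2)]] by auto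
 have "f ` HM <= f ` H <#>[G2] Q"
  using qad_subset[OF S(1) H(1)] S(1) H(1) qad_subset[OF S(1) M(1)] M(1) hom_mult[OF f] f fM
  by (fastforce simp: HM_def set_mult_def)
 hence "L <= f ` H <#>[G2] Q" unfolding L_def by (rule G2.set_mult_least[OF sHQ _ HQ(2)])
 moreover have "f ` H <#>[G2] Q <= L" unfolding L_def using HM(2) by (intro G2.set_mult_mono) auto
 ultimately have eq: "f ` H <#>[G2] Q = L" by blast
 show "f ` H <#>[G2] Q:mem S2" unfolding eq by (rule L(1))
 show "qh (G1 || H) N (str S1 H N) (G2 || (f ` H <#>[G2] Q)) Q (str S2 (f ` H <#>[G2] Q) Q) f" unfolding eq
  by (rule qh_comp[OF qad_qa[OF S(1) N(1) H] qad_maps[OF S(1) H(1) N(1) H(2) HM(1) M(1) HM(3,2) N(2)]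
    hom_restr_maps[OF S f HM(1) M(1) HM(3) L(1) M(2) QL fM]
    qad_qh[OF S(1) H(1) N(1) H(2) HM(1) M(1) HM(3,2) N(2)] L(2)])
qed

text \<open>The target is the product \<open>L\<close> of the image of \<open>H1\<close> with any
  \<open>Q\<close>. For \<open>Lm\<close> below \<open>L\<close> the second axiom gives a morphism
  on the quotient by some small \<open>N\<close>; the preimage \<open>K\<close> of \<open>Lm\<close>
  is closed, hence a member, and the morphism descends to the quotient by \<open>K\<close>.\<close>

lemma hom_qad_2_imp_1:
 assumes S: "qadmissible G1 S1" "qadmissible G2 S2" and f: "f:hom G1 G2" and h2: "hom_qad_2 G1 S1 G2 S2 f"
 shows "hom_qad_1 G1 S1 G2 S2 f"
 unfolding hom_qad_1_iff[OF f S]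
proof
 interpret G1: cgroup G1 by (rule qad_cgroup[OF S(1)])
 interpret G2: cgroup G2 by (rule qad_cgroup[OF S(2)])
 interpret f: group_hom G1 G2 f using f by unfold_locales
 note h2 = h2[unfolded hom_qad_2_iff, rule_format]
 fix H1 assume H1: "H1:mem S1"
 obtain Q where Q: "Q:mem S2" using qad_ne[OF S(2)] by blast
 obtain M where M: "M:mem S1" "hom_qad_2_at G1 S1 G2 S2 f M Q" using h2[OF Q] by (elim bexE)
 have "M Int H1:mem S1" by (rule qad_int[OF S(1) M(1) H1])
 hence "f ` H1 <#>[G2] Q:mem S2" using hom_qad_2_at_mono[OF S f M(1) Q M(2)] H1 by (auto simp: hom_qad_2_at_def)
 define L where "L = f ` H1 <#>[G2] Q"
 have L: "L:mem S2" unfolding L_def by fact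
 have fH1: "f ` H1 <= L" unfolding L_def
  using G2.set_mult_upper1[OF qad_sub[OF S(2) Q]] hom_image_subset[OF f qad_subset[OF S(1) H1]] by blast
 have "{x:H1. f x:Lm}:mem S1 & qh (G1 || H1) {x:H1. f x:Lm} (str S1 H1 {x:H1. f x:Lm}) (G2 || L) Lm (str S2 L Lm) f"
  if Lm: "Lm:mem S2" "Lm <= L" for Lm
 proof -
  obtain N' where N': "N':mem S1" "hom_qad_2_at G1 S1 G2 S2 f N' Lm" using h2[OF Lm(1)] by (elim bexE)
  define N where "N = N' Int H1"
  have N: "N:mem S1" "N <= H1" using qad_int[OF S(1) N'(1) H1] by (auto simp: N_def)
  have fN: "f ` N <= Lm" and R: "f ` H1 <#>[G2] Lm:mem S2" "qh (G1 || H1) N (str S1 H1 N) (G2 || (f ` H1 <#>[G2] Lm)) Lm (str S2 (f ` H1 <#>[G2] Lm) Lm) f"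
   using hom_qad_2_at_mono[OF S f N'(1) Lm(1) N'(2) N(1)] H1 N(2) by (auto simp: N_def hom_qad_2_at_def)
  have fG: "f ` H1 <= carrier G2" using hom_image_subset[OF f qad_subset[OF S(1) H1]] .
  have RL: "f ` H1 <#>[G2] Lm <= L" "Lm <= f ` H1 <#>[G2] Lm" "f ` H1 <= f ` H1 <#>[G2] Lm"
   using G2.set_mult_least[OF qad_sub[OF S(2) L] fH1 Lm(2)] G2.set_mult_upper1[OF qad_sub[OF S(2) Lm(1)] fG]
    G2.set_mult_upper2[OF f.subgroup_img_is_subgroup[OF qad_sub[OF S(1) H1]] qad_subset[OF S(2) Lm(1)]] by auto
  have mN: "maps (G1 || H1) N (G2 || L) Lm f" by (rule hom_restr_maps[OF S f H1 N L Lm fH1 fN])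
  have qN: "qh (G1 || H1) N (str S1 H1 N) (G2 || L) Lm (str S2 L Lm) f"
   by (rule qh_comp[OF qad_qa[OF S(1) N(1) H1 N(2)] hom_restr_maps[OF S f H1 N R(1) Lm(1) RL(2,3) fN]
     qad_maps[OF S(2) R(1) Lm(1) RL(2) L Lm RL(1) order_refl] R(2)
     qad_qh[OF S(2) R(1) Lm(1) RL(2) L Lm RL(1) order_refl]])
  define K where "K = {x:H1. f x:Lm}"
  have K: "K:mem S1" "N <= K" "K <= H1"
   using qad_qcl[OF S(1) N(1) H1 N(2)] qcl_preimage[OF qad_qa[OF S(1) N(1) H1 N(2)] qad_qa[OF S(2) Lm(1) L Lm(2)] mN qN qcl_base[OF qad_qa[OF S(2) Lm(1) L Lm(2)]]]
   by (auto simp: K_def)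
  have fK: "f ` K <= Lm" by (auto simp: K_def)
  have sK: "subgroup K (G1 || H1)" by (rule qad_incl[OF S(1) H1 K(1,3)])
  have "group (G1 || H1)" using G1.restr_comm_group[OF qad_sub[OF S(1) H1]] by (simp add: comm_group_def)
  hence "EX x:carrier (G1 || H1). y *[G1 || H1] inv[G1 || H1] x:K" if "y:carrier (G1 || H1)" for y
   using that subgroup.one_closed[OF sK] group.r_inv[of "G1 || H1" y] by (intro bexI[of _ y]) auto
  hence "qh (G1 || H1) K (str S1 H1 K) (G2 || L) Lm (str S2 L Lm) f"
   by (rule qh_descend[OF qad_qa[OF S(1) N(1) H1 N(2)] qad_qa[OF S(1) K(1) H1 K(3)] qad_qa[OF S(2) Lm(1) L Lm(2)]
     qad_maps[OF S(1) H1 N H1 K(1,3) order_refl K(2)] hom_restr_maps[OF S f H1 K(1,3) L Lm fH1 fK] _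
     qad_qh[OF S(1) H1 N H1 K(1,3) order_refl K(2)] qN])
  with K(1) show ?thesis by (simp add: K_def)
 qed
 moreover have "f:hom (G1 || H1) (G2 || L)" by (rule hom_restr[OF f qad_subset[OF S(1) H1] fH1])
 ultimately have "proalg_hom (G1 || H1) (qpro S1 H1) (G2 || L) (qpro S2 L) f"
  unfolding proalg_hom_iff by auto
 with L fH1 show "EX H2:mem S2. f ` H1 <= H2 & proalg_hom (G1 || H1) (qpro S1 H1) (G2 || H2) (qpro S2 H2) f"
  by (intro bexI[of _ L]) auto
qed

theorem hom_qad_1_iff_2:
 assumes "qadmissible G1 S1" "qadmissible G2 S2" "f:hom G1 G2"
 shows "hom_qad_1 G1 S1 G2 S2 f <-> hom_qad_2 G1 S1 G2 S2 f"
 using hom_qad_1_imp_2[OF assms] hom_qad_2_imp_1[OF assms] by blast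

lemma qad_hom_iff:
 assumes "qadmissible G1 S1" "qadmissible G2 S2"
 shows "qad_hom G1 S1 G2 S2 f <-> f:hom G1 G2 & (ALL H1:mem S1. EX H2:mem S2. f ` H1 <= H2 &
  proalg_hom (G1 || H1) (qpro S1 H1) (G2 || H2) (qpro S2 H2) f)"
 unfolding qad_hom_def using hom_qad_1_iff_2[OF assms, of f] hom_qad_1_iff[OF _ assms, of f] by blast

lemma qad_hom_id:
 assumes S: "qadmissible G S" "qadmissible G S'" and "mem S <= mem S'"
  and h: "!!H. H:mem S ==> proalg_hom (G || H) (qpro S H) (G || H) (qpro S' H) (%x. x)"
 shows "qad_hom G S G S' (%x. x)"
 unfolding qad_hom_iff[OF S] using h assms(3) by (auto simp: hom_def)

lemma qad_hom_comp:
 assumes S: "qadmissible G1 S1" "qadmissible G2 S2" "qadmissible G3 S3"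
  and f: "qad_hom G1 S1 G2 S2 f" and g: "qad_hom G2 S2 G3 S3 g"
 shows "qad_hom G1 S1 G3 S3 (%x. g (f x))"
 unfolding qad_hom_iff[OF S(1,3)]
proof (intro conjI ballI)
 note f' = f[unfolded qad_hom_iff[OF S(1,2)]] and g' = g[unfolded qad_hom_iff[OF S(2,3)]]
 show "(%x. g (f x)):hom G1 G3" using f' g' hom_compose[of f G1 G2 g G3] by (simp add: comp_def)
 fix H1 assume H1: "H1:mem S1"
 obtain H2 where H2: "H2:mem S2" "f ` H1 <= H2" "proalg_hom (G1 || H1) (qpro S1 H1) (G2 || H2) (qpro S2 H2) f"
  using f' H1 by blast
 obtain H3 where H3: "H3:mem S3" "g ` H2 <= H3" "proalg_hom (G2 || H2) (qpro S2 H2) (G3 || H3) (qpro S3 H3) g"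
  using g' H2(1) by blast
 show "EX H3:mem S3. (%x. g (f x)) ` H1 <= H3 & proalg_hom (G1 || H1) (qpro S1 H1) (G3 || H3) (qpro S3 H3) (%x. g (f x))"
  using H2 H3 proalg_hom_comp[OF qpro_proalg[OF S(1) H1] qpro_proalg[OF S(2) H2(1)] qpro_proalg[OF S(3) H3(1)] H2(3) H3(3)]
  by (intro bexI[of _ H3]) auto
qed

lemma qad_hom_cong:
 assumes S: "qadmissible G1 S1" "qadmissible G2 S2" and fg: "!!x. x:carrier G1 ==> f x = g x"
  and f: "qad_hom G1 S1 G2 S2 f"
 shows "qad_hom G1 S1 G2 S2 g"
 unfolding qad_hom_iff[OF S]
proof (intro conjI ballI)
 note f' = f[unfolded qad_hom_iff[OF S]]
 show "g:hom G1 G2" by (rule hom_cong[OF qad_comm[OF S(1)] _ fg]) (use f' in auto)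
 fix H1 assume H1: "H1:mem S1"
 obtain H2 where H2: "H2:mem S2" "f ` H1 <= H2" "proalg_hom (G1 || H1) (qpro S1 H1) (G2 || H2) (qpro S2 H2) f"
  using f' H1 by blast
 have fg': "f x = g x" if "x:H1" for x using qad_subset[OF S(1) H1] that fg by blast
 thus "EX H2:mem S2. g ` H1 <= H2 & proalg_hom (G1 || H1) (qpro S1 H1) (G2 || H2) (qpro S2 H2) g"
  using H2(2) H2 fg' proalg_hom_cong[OF qpro_proalg[OF S(1) H1] qpro_proalg[OF S(2) H2(1)], of f g] by auto
qed

end

section \<open>Comparison of Q-admissible with indproalgebraic groups\<close>

section \<open>Indproalgebraic groups\<close>

context pos_char
begin

lemma embedded_mult:
 fixes G (structure)
 assumes E: "embedded G S K T" and L: "L:mem S"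
 shows "K <#> L:mem S"
proof -
 have "proalg (G || K) T" "proalg G S" "proalg_hom (G || K) T G S (%x. x)" using E by (auto simp: embedded_def)
 from proalg_image(2)[OF this L] show ?thesis by simp
qed

lemma embedded_subset: "embedded G S K T ==> K <= carrier G"
 by (auto simp: embedded_def dest: subgroup.subset)

lemma ip_iff:
 fixes G (structure)
 shows "indproalg G S <-> comm_group G & ind_system G (mem S) & (ALL H:mem S. proalg (G || H) (str S H)) &
   (ALL H:mem S. ALL K. (EX T. embedded (G || H) (str S H) K T) --> K:mem S) &
   (ALL H:mem S. ALL K:mem S. K <= H --> embedded (G || H) (str S H) K (str S K))"
  (is "?l <-> ?r")
proof
 assume ?l
 hence I: "comm_group G" "ind_system G (mem S)" "ALL H:mem S. proalg (G || H) (str S H)"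
   "ALL H:mem S. {H':mem S. H' <= H} = {K. proalg_closed (G || H) (str S H) K}"
   "ALL H:mem S. ALL H':mem S. H' <= H --> proalg_hom (G || H') (str S H') (G || H) (str S H) (%x. x)"
  unfolding indproalg_def ind_structure_def by argo+
 then interpret cgroup G by (simp add: cgroup_def)
 have sub: "subgroup H G" if "H:mem S" for H using I(2) that by (simp add: ind_system_def)
 have "K:mem S" if "H:mem S" "EX T. embedded (G || H) (str S H) K T" for H K
  using that I(4) proalg_closed_iff[OF I(3)[rule_format, OF that(1)]] by blast
 moreover have "embedded (G || H) (str S H) K (str S K)" if "H:mem S" "K:mem S" "K <= H" for H K
  unfolding embedded_def restr_simps using I(3,5) that subgroup_restr[OF sub[OF that(1)]] sub[OF that(2)] by blast
 ultimately show ?r using I(1-3) by blast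
next
 assume r: ?r
 hence I: "comm_group G" "ind_system G (mem S)" "ALL H:mem S. proalg (G || H) (str S H)"
  "!!H K T. H:mem S ==> embedded (G || H) (str S H) K T ==> K:mem S"
  "!!H K. H:mem S ==> K:mem S ==> K <= H ==> embedded (G || H) (str S H) K (str S K)" by blast+
 have A: "{H':mem S. H' <= H} = {K. proalg_closed (G || H) (str S H) K}" if H: "H:mem S" for H
  unfolding proalg_closed_iff[OF I(3)[rule_format, OF H]] using I(4,5) H embedded_subset by fastforce
 have B: "proalg_hom (G || K) (str S K) (G || H) (str S H) (%x. x)" if "H:mem S" "K:mem S" "K <= H" for H K
  using I(5)[OF that] by (simp add: embedded_def)
 show ?l unfolding indproalg_def ind_structure_def by (intro conjI ballI impI I(1,2) I(3)[rule_format] A B)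
qed

lemma ipD:
 fixes G (structure)
 assumes "indproalg G S"
 shows ip_comm: "comm_group G" and ip_ne: "mem S ~= {}" and ip_sub: "H:mem S ==> subgroup H G"
  and ip_cofinal: "countably_cofinal (mem S)" and ip_cover: "\<Union>(mem S) = carrier G"
  and ip_up: "H:mem S ==> K:mem S ==> EX Q:mem S. H <#> K <= Q"
  and ip_proalg: "H:mem S ==> proalg (G || H) (str S H)"
  and ip_closed: "H:mem S ==> embedded (G || H) (str S H) K T ==> K:mem S"
  and ip_embedded: "H:mem S ==> K:mem S ==> K <= H ==> embedded (G || H) (str S H) K (str S K)"
proof -
 have D: "comm_group G" "ind_system G (mem S)" "ALL H:mem S. proalg (G || H) (str S H)"
   "ALL H:mem S. ALL K. (EX T. embedded (G || H) (str S H) K T) --> K:mem S"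
   "ALL H:mem S. ALL K:mem S. K <= H --> embedded (G || H) (str S H) K (str S K)"
  using assms unfolding ip_iff by argo+
 show "comm_group G" by fact
 show "mem S ~= {}" "countably_cofinal (mem S)" "\<Union>(mem S) = carrier G" "H:mem S ==> subgroup H G"
  "H:mem S ==> K:mem S ==> EX Q:mem S. H <#> K <= Q" using D(2) unfolding ind_system_def by blast+
 show "H:mem S ==> proalg (G || H) (str S H)" using D(3) by blast
 show "H:mem S ==> embedded (G || H) (str S H) K T ==> K:mem S" using D(4) by blast
 show "H:mem S ==> K:mem S ==> K <= H ==> embedded (G || H) (str S H) K (str S K)" using D(5) by blast
qed

lemma ip_upper:
 fixes G (structure)
 assumes S: "indproalg G S" and H: "H:mem S" "K:mem S"
 obtains Q where "Q:mem S" "H <= Q" "K <= Q"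
proof -
 interpret cgroup G using ip_comm[OF S] by (simp add: cgroup_def)
 note sub = ip_sub[OF S H(1)] ip_sub[OF S H(2)]
 obtain Q where Q: "Q:mem S" "H <#> K <= Q" using ip_up[OF S H] by (elim bexE)
 thus thesis
  using set_mult_upper1[OF sub(2) subgroup.subset[OF sub(1)]] set_mult_upper2[OF sub(1) subgroup.subset[OF sub(2)]]
  by (intro that[of Q]) auto
qed

lemma indproalg_hom_iff:
 "indproalg_hom G1 S1 G2 S2 f <-> f:hom G1 G2 & (ALL H1:mem S1. f ` H1:mem S2 &
   proalg_hom (G1 || H1) (str S1 H1) (G2 || (f ` H1)) (str S2 (f ` H1)) f)"
 by (simp add: indproalg_hom_def ind_hom_def)

text \<open>The definition of morphisms asks for the images of members themselves. A morphism from a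
  larger member into some member suffices, because images of proalgebraic groups are closed, hence
  members, and morphisms factor through them.\<close>

lemma indproalg_homI:
 assumes S: "indproalg G1 S1" "indproalg G2 S2" and f: "f:hom G1 G2"
  and h: "!!H. H:mem S1 ==> EX H1:mem S1. H <= H1 & (EX H2:mem S2. f ` H1 <= H2 &
   proalg_hom (G1 || H1) (str S1 H1) (G2 || H2) (str S2 H2) f)"
 shows "indproalg_hom G1 S1 G2 S2 f"
 unfolding indproalg_hom_iff
proof (intro conjI ballI)
 fix H assume H: "H:mem S1"
 obtain H1 H2 where H1: "H1:mem S1" "H <= H1" "H2:mem S2" "f ` H1 <= H2"
   "proalg_hom (G1 || H1) (str S1 H1) (G2 || H2) (str S2 H2) f" using h[OF H] by (elim bexE conjE)
 have "proalg_hom (G1 || H) (str S1 H) (G1 || H1) (str S1 H1) (%x. x)"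
  using ip_embedded[OF S(1) H1(1) H H1(2)] by (simp add: embedded_def)
 from proalg_hom_comp[OF ip_proalg[OF S(1) H] ip_proalg[OF S(1) H1(1)] ip_proalg[OF S(2) H1(3)] this H1(5)]
 have fH: "proalg_hom (G1 || H) (str S1 H) (G2 || H2) (str S2 H2) f" .
 obtain T where "embedded (G2 || H2) (str S2 H2) (f ` carrier (G1 || H)) T"
  using proalg_image_closed[OF ip_proalg[OF S(1) H] ip_proalg[OF S(2) H1(3)] fH] .
 thus m: "f ` H:mem S2" using ip_closed[OF S(2) H1(3)] by simp
 have "f ` H <= H2" using H1(2,4) by blast
 note E = ip_embedded[OF S(2) H1(3) m this]
 show "proalg_hom (G1 || H) (str S1 H) (G2 || (f ` H)) (str S2 (f ` H)) f"
  using embedded_factor[OF E ip_proalg[OF S(1) H] fH] by simp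
qed (rule f)

subsection \<open>The indproalgebraic group of a \<open>\<Q>\<close>-admissible group\<close>

text \<open>Attachment of \<open>I\<close> to \<open>S\<close> without naming a choice:
  \<open>indpro\<close>, \<open>can_PI_IP\<close> and every admissible structure over its own
  origins satisfy it, so origins and morphisms need to be studied only once.\<close>

definition ip_of :: "'a monoid => ('a, 'k) qad_fam => ('a, 'k) indpro_fam => bool" where
 "ip_of G S I <-> (ALL K. K:mem I <-> (EX H:mem S. EX T. embedded (G || H) (qpro S H) K T)) &
   (ALL K:mem I. ALL H:mem S. K <= H --> embedded (G || H) (qpro S H) K (str I K))"

lemma ip_ofD:
 assumes "ip_of G S I"
 shows "K:mem I ==> EX H:mem S. K <= H & embedded (G || H) (qpro S H) K (str I K)"
  and "H:mem S ==> embedded (G || H) (qpro S H) K T ==> K:mem I"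
  and "K:mem I ==> H:mem S ==> K <= H ==> embedded (G || H) (qpro S H) K (str I K)"
proof -
 have D: "!!K. K:mem I <-> (EX H:mem S. EX T. embedded (G || H) (qpro S H) K T)"
  "ALL K:mem I. ALL H:mem S. K <= H --> embedded (G || H) (qpro S H) K (str I K)" using assms by (simp_all add: ip_of_def)
 show "H:mem S ==> embedded (G || H) (qpro S H) K T ==> K:mem I" using D(1) by blast
 show E: "K:mem I ==> H:mem S ==> K <= H ==> embedded (G || H) (qpro S H) K (str I K)" for K H using D(2) by blast
 show "EX H:mem S. K <= H & embedded (G || H) (qpro S H) K (str I K)" if K: "K:mem I"
 proof -
  obtain H T where "H:mem S" "embedded (G || H) (qpro S H) K T" using D(1) K by blast
  moreover from this have "K <= H" using embedded_subset[of "G || H" "qpro S H" K T] by simp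
  ultimately show ?thesis using E[OF K] by blast
 qed
qed

text \<open>Both \<open>H\<close> and \<open>H'\<close> embed in \<open>H <#> H'\<close>, so being
  embedded does not depend on the ambient member.\<close>

lemma qpro_embedded_unique:
 fixes G (structure)
 assumes S: "qadmissible G S" and H: "H:mem S" "H':mem S" "K <= H'" and E: "embedded (G || H) (qpro S H) K T"
 shows "embedded (G || H') (qpro S H') K T"
proof -
 define Q where "Q = H <#> H'"
 have Q: "Q:mem S" "H <= Q" "H' <= Q" unfolding Q_def using qad_mult[OF S H(1,2)] qad_le_mult[OF S H(1,2)] by auto
 show ?thesis
  using embedded_trans[OF qpro_embedded[OF S Q(1) H(1) Q(2)], of K T] E embedded_restrict[OF qpro_embedded[OF S Q(1) H(2) Q(3)], of K T] H(3)
  by simp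
qed

lemma indpro_generated_cong:
 assumes "mem S = mem S'" "!!H. H:mem S ==> str S H = str S' H"
 shows "indpro_generated G S = indpro_generated G S'"
proof -
 have "indpro_members G S = indpro_members G S'"
  unfolding indpro_members_def using assms by (intro Collect_cong bex_cong) auto
 moreover have "(EX H:mem S. K <= H & Defs.proalg_hom (G || K) T (G || H) (str S H) (%x. x)) <->
  (EX H:mem S'. K <= H & Defs.proalg_hom (G || K) T (G || H) (str S' H) (%x. x))" for K T
  using assms by (intro bex_cong) auto
 ultimately show ?thesis unfolding indpro_generated_def by simp
qed

text \<open>Allowing a cofinal \<open>B\<close> covers both \<open>indpro\<close>, where
  \<open>B\<close> consists of all members, and \<open>can_PI_IP\<close>, where it consists of the
  members above a chosen origin.\<close>

lemma ip_of_generated: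
 fixes G (structure)
 assumes S: "qadmissible G S" and B: "B <= mem S" "!!H. H:mem S ==> EX K:B. H <= K"
 shows "ip_of G S (indpro_generated G \<lparr>mem = B, str = qpro S\<rparr>)"
proof -
 define I where "I = indpro_generated G \<lparr>mem = B, str = qpro S\<rparr>"
 interpret cgroup G by (rule qad_cgroup[OF S])
 have memI: "K:mem I <-> (EX H:B. EX T. embedded (G || H) (qpro S H) K T)" for K
 proof -
  have "K:mem I <-> (EX H:B. proalg_closed (G || H) (qpro S H) K)"
   by (simp add: I_def indpro_generated_def indpro_members_def)
  also have "... <-> (EX H:B. EX T. embedded (G || H) (qpro S H) K T)"
   using proalg_closed_iff[OF qpro_proalg[OF S]] B(1) by (intro bex_cong refl) blast
  finally show ?thesis .
 qed
 have strI: "embedded (G || H) (qpro S H) K (str I K)" if K: "K:mem I" and H: "H:mem S" "K <= H" for K H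
 proof -
  obtain H0 T0 where H0: "H0:B" "embedded (G || H0) (qpro S H0) K T0" using K unfolding memI by (elim bexE exE)
  have sK: "subgroup K G" using H0 B(1) subgroup_restr[OF qad_sub[OF S]] by (auto simp: embedded_def)
  have "EX T. proalg (G || K) T & (EX H:B. K <= H & proalg_hom (G || K) T (G || H) (qpro S H) (%x. x))"
   using H0 embedded_subset[OF H0(2)] by (intro exI[of _ T0] conjI bexI[of _ H0]) (auto simp: embedded_def)
  hence "proalg (G || K) (str I K) & (EX H:B. K <= H & proalg_hom (G || K) (str I K) (G || H) (qpro S H) (%x. x))"
   unfolding I_def indpro_generated_def family.simps by (rule someI_ex)
  then obtain H1 where H1: "H1:B" "K <= H1" "proalg (G || K) (str I K)" "proalg_hom (G || K) (str I K) (G || H1) (qpro S H1) (%x. x)"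
   by (elim conjE bexE)
  have H1S: "H1:mem S" using H1(1) B(1) by blast
  show ?thesis
   using H1 qpro_proalg[OF S H1S] subgroup_restr[OF qad_sub[OF S H1S], of K] sK qpro_embedded_unique[OF S H1S H]
   by (simp add: embedded_def)
 qed
 have "K:mem I" if H: "H:mem S" and T: "embedded (G || H) (qpro S H) K T" for K H T
 proof -
  obtain H' where H': "H':B" "H <= H'" using B(2)[OF H] by (elim bexE)
  hence "embedded (G || H') (qpro S H') K T"
   using embedded_subset[OF T] B(1) by (intro qpro_embedded_unique[OF S H _ _ T]) auto
  thus ?thesis unfolding memI using H'(1) by blast
 qed
 hence "ip_of G S I" unfolding ip_of_def using memI strI B(1) by blast
 thus ?thesis by (simp add: I_def)
qed

context
 fixes G :: "'a monoid" (structure) and S :: "('a, 'k) qad_fam" and I :: "('a, 'k) indpro_fam"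
 assumes S: "qadmissible G S" and I: "ip_of G S I"
begin

interpretation cgroup G by (rule qad_cgroup[OF S])

lemma ip_of_mem: "mem S <= mem I"
 using qpro_embedded[OF S _ _ order_refl] ip_ofD(2)[OF I] by blast

lemma ip_of_qpro:
 assumes "H:mem S"
 shows "proalg_hom (G || H) (str I H) (G || H) (qpro S H) (%x. x)" "proalg_hom (G || H) (qpro S H) (G || H) (str I H) (%x. x)"
proof -
 have E: "embedded (G || H) (qpro S H) H (str I H)" using ip_ofD(3)[OF I _ assms] ip_of_mem assms by blast
 thus "proalg_hom (G || H) (str I H) (G || H) (qpro S H) (%x. x)" by (simp add: embedded_def)
 show "proalg_hom (G || H) (qpro S H) (G || H) (str I H) (%x. x)"
  using embedded_unique[OF qpro_embedded[OF S assms assms order_refl] E] by simp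
qed

lemma ip_of_str_mem:
 assumes H: "H:mem S"
 shows "mem (str I H) = {Hm:mem S. Hm <= H}"
proof -
 have "embedded (G || H) (qpro S H) H (str I H)" using ip_ofD(3)[OF I _ H] ip_of_mem H by blast
 from embedded_mem[OF this] show ?thesis by (auto simp: Int_absorb1)
qed

lemma ip_of_subgroup:
 assumes "K:mem I"
 shows "subgroup K G"
proof -
 obtain H where "H:mem S" "embedded (G || H) (qpro S H) K (str I K)" using ip_ofD(1)[OF I assms] by blast
 thus ?thesis using subgroup_restr[OF qad_sub[OF S]] by (auto simp: embedded_def)
qed

lemma ip_of_embedded:
 assumes K: "H:mem I" "K:mem I" "K <= H"
 shows "embedded (G || H) (str I H) K (str I K)"
proof -
 obtain Q where Q: "Q:mem S" "H <= Q" "embedded (G || Q) (qpro S Q) H (str I H)" using ip_ofD(1)[OF I K(1)] by blast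
 hence "embedded (G || Q) (qpro S Q) K (str I K)" using ip_ofD(3)[OF I K(2)] K(3) by blast
 from embedded_restrict[OF Q(3) this K(3)] show ?thesis by simp
qed

lemma ip_of_closed:
 assumes K: "H:mem I" "embedded (G || H) (str I H) K T"
 shows "K:mem I"
proof -
 obtain Q where Q: "Q:mem S" "H <= Q" "embedded (G || Q) (qpro S Q) H (str I H)" using ip_ofD(1)[OF I K(1)] by blast
 thus ?thesis using embedded_trans[OF Q(3), of K T] K(2) ip_ofD(2)[OF I Q(1)] by simp
qed

lemma ip_of_indproalg: "indproalg G I"
 unfolding ip_iff
proof (intro conjI ballI allI impI)
 show "comm_group G" by (rule comm_group_axioms)
 show "ind_system G (mem I)" unfolding ind_system_def
 proof (intro conjI ballI)
  show "mem I ~= {}" using qad_ne[OF S] ip_of_mem by blast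
  show "subgroup K G" if "K:mem I" for K using ip_of_subgroup[OF that] .
  have le: "EX H:mem S. K <= H" if "K:mem I" for K using ip_ofD(1)[OF I that] by blast
  obtain C where C: "C <= mem S" "countable C" "ALL H:mem S. EX K:C. H <= K"
   using qad_cofinal[OF S] unfolding countably_cofinal_def by (elim exE conjE)
  have "EX K':C. K <= K'" if K: "K:mem I" for K
  proof -
   obtain H where H: "H:mem S" "K <= H" using le[OF K] by (elim bexE)
   from bspec[OF C(3) H(1)] show ?thesis using H(2) by auto
  qed
  thus "countably_cofinal (mem I)" unfolding countably_cofinal_def using C(1,2) ip_of_mem by (intro exI[of _ C] conjI ballI) auto
  show "\<Union>(mem I) = carrier G" using subgroup.subset[OF ip_of_subgroup] ip_of_subgroup ip_of_mem qad_cover[OF S] S by fastforce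
  fix K K' assume K: "K:mem I" "K':mem I"
  obtain H H' where H: "H:mem S" "K <= H" "H':mem S" "K' <= H'" using le[OF K(1)] le[OF K(2)] by blast
  thus "EX H'':mem I. K <#> K' <= H''" using qad_mult[OF S] ip_of_mem set_mult_mono[OF H(2,4)] by blast
 qed
next
 fix H assume H: "H:mem I"
 show "proalg (G || H) (str I H)" using ip_ofD(1)[OF I H] by (auto simp: embedded_def)
 show "K:mem I" if "EX T. embedded (G || H) (str I H) K T" for K using that ip_of_closed[OF H] by blast
 show "embedded (G || H) (str I H) K (str I K)" if "K:mem I" "K <= H" for K using ip_of_embedded[OF H that] .
qed

text \<open>An origin \<open>K\<close> lies in some \<open>H\<close> of \<open>S\<close> and
  contains a member \<open>J\<close> of the structure of \<open>H\<close>, which is then in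
  \<open>S\<close>. Products of closed subgroups with members are members, so
  \<open>K = K <#> J\<close> is in \<open>S\<close>.\<close>

lemma ip_of_origins: "indpro_origins G I = mem S"
proof
 show "mem S <= indpro_origins G I"
 proof
  fix K assume K: "K:mem S"
  have "proalg_quot_quasialg (G || H) (str I H) K" if H: "H:mem I" "K <= H" for H
  proof -
   obtain Q where Q: "Q:mem S" "H <= Q" "embedded (G || Q) (qpro S Q) H (str I H)" using ip_ofD(1)[OF I H(1)] by blast
   have "K:mem (qpro S Q)" using K Q(2) H(2) by simp
   thus ?thesis
    using embedded_mem[OF Q(3)] subgroup_restr[OF ip_of_subgroup[OF H(1)]] qad_sub[OF S K] H(2) proalg_quot_quasialg_iff[OF ip_proalg[OF ip_of_indproalg H(1)]]
    by auto
  qed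
  thus "K:indpro_origins G I" using K ip_of_mem by (auto simp: indpro_origins_def)
 qed
 show "indpro_origins G I <= mem S"
 proof
  fix K assume K: "K:indpro_origins G I"
  hence KI: "K:mem I" by (simp add: indpro_origins_def)
  obtain H where H: "H:mem S" "K <= H" "embedded (G || H) (qpro S H) K (str I K)" using ip_ofD(1)[OF I KI] by blast
  have HI: "H:mem I" using H(1) ip_of_mem by blast
  have sK: "subgroup K (G || H)" using H(3) by (simp add: embedded_def)
  obtain J where J: "J:mem (str I H)" "J <= K"
   using K HI H(2) proalg_quot_quasialg_iff[OF ip_proalg[OF ip_of_indproalg HI] sK] by (auto simp: indpro_origins_def)
  hence JS: "J:mem S" "J <= H" using ip_of_str_mem[OF H(1)] by auto
  hence "K <#> J:mem S" using embedded_mult[OF H(3), of J] by simp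
  thus "K:mem S" using set_mult_absorb[OF ip_of_subgroup[OF KI] qad_sub[OF S JS(1)] J(2)] by simp
 qed
qed

lemma ip_of_ad: "indproalg_ad G I"
 unfolding indproalg_ad_def
proof (intro conjI exI[of _ "mem S"] ballI impI)
 show "indproalg G I" by (rule ip_of_indproalg)
 show "mem S <= mem I" by (rule ip_of_mem)
 show "ind_system G (mem S)" unfolding ind_system_def
  using qad_ne[OF S] qad_sub[OF S] qad_cofinal[OF S] qad_up[OF S] qad_cover[OF S] by blast
 show "indpro_members G (I\<lparr>mem := mem S\<rparr>) = mem I"
 proof
  show "indpro_members G (I\<lparr>mem := mem S\<rparr>) <= mem I"
  proof
   fix K assume "K:indpro_members G (I\<lparr>mem := mem S\<rparr>)"
   then obtain H where H: "H:mem S" "proalg_closed (G || H) (str I H) K" by (auto simp: indpro_members_def)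
   thus "K:mem I" using proalg_closed_iff[OF ip_proalg[OF ip_of_indproalg]] ip_of_closed ip_of_mem by blast
  qed
  show "mem I <= indpro_members G (I\<lparr>mem := mem S\<rparr>)"
  proof
   fix K assume K: "K:mem I"
   then obtain H where H: "H:mem S" "K <= H" using ip_ofD(1)[OF I K] by blast
   hence HI: "H:mem I" using ip_of_mem by blast
   show "K:indpro_members G (I\<lparr>mem := mem S\<rparr>)"
    using proalg_closed_iff[OF ip_proalg[OF ip_of_indproalg HI]] ip_of_embedded[OF HI K H(2)] H(1)
    by (auto simp: indpro_members_def)
  qed
 qed
 show "proalg_quot_quasialg (G || H2) (str I H2) H1" if "H1:mem S" "H2:mem S" "H1 <= H2" for H1 H2
  using that ip_of_mem ip_of_origins by (auto simp: indpro_origins_def)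
qed

end

lemma ip_of_hom:
 assumes S: "qadmissible G1 S1" "qadmissible G2 S2" and I: "ip_of G1 S1 I1" "ip_of G2 S2 I2"
  and f: "qad_hom G1 S1 G2 S2 f"
 shows "indproalg_hom G1 I1 G2 I2 f"
proof (rule indproalg_homI[OF ip_of_indproalg[OF S(1) I(1)] ip_of_indproalg[OF S(2) I(2)]])
 note f' = f[unfolded qad_hom_iff[OF S]]
 show "f:hom G1 G2" using f' by blast
 fix K assume "K:mem I1"
 then obtain H1 where H1: "H1:mem S1" "K <= H1" using ip_ofD(1)[OF I(1)] by blast
 obtain H2 where H2: "H2:mem S2" "f ` H1 <= H2" "proalg_hom (G1 || H1) (qpro S1 H1) (G2 || H2) (qpro S2 H2) f"
  using f' H1(1) by blast
 have m: "H1:mem I1" "H2:mem I2" using ip_of_mem[OF S(1) I(1)] ip_of_mem[OF S(2) I(2)] H1(1) H2(1) by auto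
 note p = ip_proalg[OF ip_of_indproalg[OF S(1) I(1)] m(1)] ip_proalg[OF ip_of_indproalg[OF S(2) I(2)] m(2)]
  qpro_proalg[OF S(1) H1(1)] qpro_proalg[OF S(2) H2(1)]
 have "proalg_hom (G1 || H1) (str I1 H1) (G2 || H2) (qpro S2 H2) f"
  by (rule proalg_hom_comp[OF p(1,3,4) ip_of_qpro(1)[OF S(1) I(1) H1(1)] H2(3)])
 from proalg_hom_comp[OF p(1,4,2) this ip_of_qpro(2)[OF S(2) I(2) H2(1)]]
 show "EX H1:mem I1. K <= H1 & (EX H2:mem I2. f ` H1 <= H2 &
   proalg_hom (G1 || H1) (str I1 H1) (G2 || H2) (str I2 H2) f)"
  using m H1(2) H2(2) by blast
qed

subsection \<open>The \<open>\<Q>\<close>-admissible group of an indproalgebraic group\<close>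

lemma ad_IP_simps [simp]:
 "mem (ad_IP_structure G S) = indpro_origins G S" "str (ad_IP_structure G S) H' H = str (str S H') H"
 by (simp_all add: ad_IP_structure_def)

context
 fixes G :: "'a monoid" (structure) and S :: "('a, 'k) indpro_fam"
 assumes S: "indproalg_ad G S"
begin

lemma ipad_ip: "indproalg G S"
 using S by (simp add: indproalg_ad_def)

interpretation cgroup G using ip_comm[OF ipad_ip] by (simp add: cgroup_def)

lemma origin_iff:
 "H0:indpro_origins G S <-> H0:mem S & (ALL H:mem S. H0 <= H --> (EX K:mem (str S H). K <= H0))"
proof -
 have "proalg_quot_quasialg (G || H) (str S H) H0 <-> (EX K:mem (str S H). K <= H0)"
  if "H0:mem S" "H:mem S" "H0 <= H" for H
  using that subgroup_restr ip_sub[OF ipad_ip] by (intro proalg_quot_quasialg_iff[OF ip_proalg[OF ipad_ip]]) auto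
 thus ?thesis unfolding indpro_origins_def by blast
qed

lemma origin_mem: "H:indpro_origins G S ==> H:mem S"
 by (simp add: indpro_origins_def)

lemma origin_up: "H0:indpro_origins G S ==> H:mem S ==> H0 <= H ==> H:indpro_origins G S"
 unfolding origin_iff by (meson order_trans)

text \<open>Members of a set of definition \<open>M\<close> as in \<open>indproalg_ad\<close> are
  origins, and every member lies in one of them: a group \<open>H\<close> above \<open>H0\<close>
  sits in some \<open>H2\<close> of \<open>M\<close>, and the member of the structure of
  \<open>H2\<close> inside \<open>H0\<close> leaves a trace on \<open>H\<close>.\<close>

lemma origin_cofinal:
 assumes "H:mem S"
 obtains H0 where "H0:indpro_origins G S" "H <= H0"
proof -
 obtain M where M: "M <= mem S" "ind_system G M" "indpro_members G (S\<lparr>mem := M\<rparr>) = mem S"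
   "ALL H1:M. ALL H2:M. H1 <= H2 --> proalg_quot_quasialg (G || H2) (str S H2) H1"
  using S unfolding indproalg_ad_def by (elim conjE exE)
 have cof: "EX H':M. H <= H'" if "H:mem S" for H
 proof -
  have "H:indpro_members G (S\<lparr>mem := M\<rparr>)" using M(3) that by blast
  then obtain H' where "H':M" "proalg_closed (G || H') (str S H') H" by (auto simp: indpro_members_def)
  thus ?thesis using subgroup.subset[of H "G || H'"] by (auto simp: proalg_closed_def)
 qed
 have "H0:indpro_origins G S" if H0: "H0:M" for H0
  unfolding origin_iff
 proof (intro conjI ballI impI)
  show m0: "H0:mem S" using H0 M(1) by blast
  fix H assume H: "H:mem S" "H0 <= H"
  obtain H2 where H2: "H2:M" "H <= H2" using cof[OF H(1)] by (elim bexE)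
  have m2: "H2:mem S" using H2 M(1) by blast
  have "proalg_quot_quasialg (G || H2) (str S H2) H0" using M(4) H0 H2 H(2) by blast
  then obtain K where K: "K:mem (str S H2)" "K <= H0"
   using proalg_quot_quasialg_iff[OF ip_proalg[OF ipad_ip m2]] subgroup_restr[OF ip_sub[OF ipad_ip m2], of H0]
    ip_sub[OF ipad_ip m0] H2(2) H(2) by blast
  have "H Int K:mem (str S H)" using embedded_mem[OF ip_embedded[OF ipad_ip m2 H(1) H2(2)]] K(1) by blast
  thus "EX K:mem (str S H). K <= H0" using K(2) by blast
 qed
 moreover obtain H' where "H':M" "H <= H'" using cof[OF assms] by (elim bexE)
 ultimately show thesis using that by blast
qed

text \<open>An origin below \<open>H1\<close> contains a member and equals its product with it,
  hence is a member. Conversely a member \<open>K\<close> is the trace of some \<open>L\<close> from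
  a common upper bound \<open>Q\<close> of \<open>H\<close> and \<open>H1\<close>; the trace on
  \<open>H\<close> of \<open>J Int L\<close>, with \<open>J <= H1\<close>, is the member below
  \<open>K\<close> that makes \<open>K\<close> an origin.\<close>

lemma origin_str_mem:
 assumes H1: "H1:indpro_origins G S"
 shows "mem (str S H1) = {K:indpro_origins G S. K <= H1}"
proof
 note m1 = origin_mem[OF H1] and P1 = ip_proalg[OF ipad_ip origin_mem[OF H1]]
 show "{K:indpro_origins G S. K <= H1} <= mem (str S H1)"
 proof clarify
  fix K assume K: "K:indpro_origins G S" "K <= H1"
  obtain J where J: "J:mem (str S H1)" "J <= K" using K m1 unfolding origin_iff by blast
  show "K:mem (str S H1)"
   using embedded_mult[OF ip_embedded[OF ipad_ip m1 origin_mem[OF K(1)] K(2)] J(1)] pro_sub[OF P1 J(1)] subgroup_restr[OF ip_sub[OF ipad_ip m1]] set_mult_absorb[OF ip_sub[OF ipad_ip origin_mem[OF K(1)]] _ J(2)]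
   by simp
 qed
 show "mem (str S H1) <= {K:indpro_origins G S. K <= H1}"
 proof
  fix K assume K: "K:mem (str S H1)"
  obtain T where "embedded (G || H1) (str S H1) K T" using proalg_member_embedded[OF P1 K] .
  hence KS: "K:mem S" by (rule ip_closed[OF ipad_ip m1])
  have "EX J:mem (str S H). J <= K" if H: "H:mem S" "K <= H" for H
  proof -
   obtain Q where Q: "Q:mem S" "H <= Q" "H1 <= Q" using ip_upper[OF ipad_ip H(1) m1] .
   obtain J where J: "J:mem (str S Q)" "J <= H1" using H1 Q(1,3) unfolding origin_iff by blast
   obtain L where L: "L:mem (str S Q)" "K = H1 Int L" using embedded_mem[OF ip_embedded[OF ipad_ip Q(1) m1 Q(3)]] K by blast
   have "H Int (J Int L):mem (str S H)"
    using embedded_mem[OF ip_embedded[OF ipad_ip Q(1) H(1) Q(2)]] pro_int[OF ip_proalg[OF ipad_ip Q(1)] J(1) L(1)] by blast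
   thus ?thesis using J(2) L(2) by (intro bexI[of _ "H Int (J Int L)"]) auto
  qed
  hence "K:indpro_origins G S" using KS unfolding origin_iff by blast
  thus "K:{K:indpro_origins G S. K <= H1}" using pro_sub[OF P1 K] subgroup_restr[OF ip_sub[OF ipad_ip m1]] by blast
 qed
qed

lemma origin_qpro: "H:indpro_origins G S ==> qpro (ad_IP_structure G S) H = str S H"
 by (simp add: qpro_def origin_str_mem[symmetric])

lemma ad_IP_qadmissible: "qadmissible G (ad_IP_structure G S)"
 unfolding qad_iff ad_IP_simps
proof (intro conjI ballI allI impI)
 let ?O = "indpro_origins G S"
 note sub = ip_sub[OF ipad_ip origin_mem]
 show "comm_group G" by (rule comm_group_axioms)
 obtain H0 where "H0:mem S" using ip_ne[OF ipad_ip] by blast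
 then obtain H1 where H1: "H1:?O" using origin_cofinal by blast
 thus "?O ~= {}" by blast
 note P1 = ip_proalg[OF ipad_ip origin_mem[OF H1]]
 have up: "EX Q:?O. H <= Q & K <= Q" if "H:?O" "K:?O" for H K
  using ip_upper[OF ipad_ip origin_mem[OF that(1)] origin_mem[OF that(2)]] origin_up[OF that(1)] by metis
 have int: "H Int K:?O" if HK: "H:?O" "K:?O" for H K
  using up[OF HK] HK origin_str_mem pro_int ip_proalg ipad_ip origin_mem by force
 show "countably_cofinal ?O"
 proof -
  obtain C where C: "C <= mem S" "countable C" "ALL H:mem S. EX K:C. H <= K"
   using ip_cofinal[OF ipad_ip] unfolding countably_cofinal_def by (elim exE conjE)
  have "ALL H:mem S. EX K. K:?O & H <= K" using origin_cofinal by blast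
  from bchoice[OF this] obtain u where u: "!!H. H:mem S ==> u H:?O & H <= u H" by blast
  have "EX K:u ` C. H <= K" if H: "H:?O" for H
  proof -
   obtain K where "K:C" "H <= K" using C(3) origin_mem[OF H] by blast
   thus ?thesis using u[of K] C(1) by blast
  qed
  thus ?thesis unfolding countably_cofinal_def using u C(1,2) by (intro exI[of _ "u ` C"]) auto
 qed
 \<comment> \<open>Every origin \<open>H\<close> contains \<open>H Int H1\<close>, which lies in the
   countably coinitial structure of the fixed origin \<open>H1\<close>.\<close>
 show "countably_coinitial ?O"
 proof -
  obtain C where C: "C <= mem (str S H1)" "countable C" "ALL H:mem (str S H1). EX K:C. K <= H"
   using pro_count[OF P1] unfolding countably_coinitial_def by (elim exE conjE)
  have "EX K:C. K <= H" if "H:?O" for H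
  proof -
   have "H Int H1:mem (str S H1)" using int[OF that H1] origin_str_mem[OF H1] by blast
   from bspec[OF C(3) this] show ?thesis by (elim bexE) (auto intro: bexI)
  qed
  thus ?thesis unfolding countably_coinitial_def using C(1,2) origin_str_mem[OF H1] by (intro exI[of _ C] conjI ballI) auto
 qed
 show "\<Union>?O = carrier G"
 proof
  show "\<Union>?O <= carrier G" using subgroup.subset[OF sub] by blast
  show "carrier G <= \<Union>?O" using ip_cover[OF ipad_ip] ipad_ip origin_cofinal by blast
 qed
 show "cplt G ?O"
 proof (rule cplt_extend[OF comm_group_axioms sub _ H1])
  show "EX K'':?O. K'' <= K Int K'" if "K:?O" "K':?O" for K K' using int[OF that] by blast
  show "cplt (G || H1) {K:?O. K <= H1}" using pro_cplt[OF P1] origin_str_mem[OF H1] by simp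
 qed
 fix H assume H: "H:?O"
 show "subgroup H G" by (rule sub[OF H])
 show "EX Hp:?O. H <#> H' <= Hp" if H': "H':?O" for H' using up[OF H H'] H H' set_mult_least sub by metis
 show "EX Hm:?O. Hm <= H Int H'" if "H':?O" for H' using int[OF H that] by blast
 fix H' assume H': "H':?O" "H <= H'"
 note P' = ip_proalg[OF ipad_ip origin_mem[OF H'(1)]]
 have HH': "H:mem (str S H')" using H H' origin_str_mem by blast
 show "qa (G || H') H (str (str S H') H)" by (rule pro_qa[OF P' HH'])
 show "K:?O" if "qcl (G || H') H (str (str S H') H) K" for K
  using that pro_qcl[OF P' HH'] origin_str_mem[OF H'(1)] by blast
 fix Hp assume Hp: "Hp:?O" "H' <= Hp"
 note Pp = ip_proalg[OF ipad_ip origin_mem[OF Hp(1)]]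
 have HHp: "H:mem (str S Hp)" "H':mem (str S Hp)" using H H' Hp origin_str_mem by auto
 show "qh (G || Hp) H (str (str S Hp) H) (G || Hp) H' (str (str S Hp) H') (%x. x)"
  by (rule pro_qh[OF Pp HHp H'(2)])
 have "H' Int H = H" using H'(2) by blast
 thus "qh (G || H') H (str (str S H') H) (G || Hp) H (str (str S Hp) H) (%x. x)"
  using embedded_qh(2)[OF ip_embedded[OF ipad_ip origin_mem[OF Hp(1)] origin_mem[OF H'(1)] Hp(2)] HHp(1)] by simp
qed

lemma ad_IP_ip_of: "ip_of G (ad_IP_structure G S) S"
 unfolding ip_of_def ad_IP_simps
proof (intro conjI allI ballI impI)
 show "embedded (G || H) (qpro (ad_IP_structure G S) H) K (str S K)"
  if "K:mem S" "H:indpro_origins G S" "K <= H" for K H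
  unfolding origin_qpro[OF that(2)] by (rule ip_embedded[OF ipad_ip origin_mem[OF that(2)] that(1,3)])
 thus "K:mem S <-> (EX H:indpro_origins G S. EX T. embedded (G || H) (qpro (ad_IP_structure G S) H) K T)" for K
  using origin_qpro ip_closed[OF ipad_ip origin_mem] origin_cofinal by metis
qed

end

lemma ad_IP_hom:
 assumes S: "indproalg_ad G1 S1" "indproalg_ad G2 S2" and f: "indproalg_hom G1 S1 G2 S2 f"
 shows "qad_hom G1 (ad_IP_structure G1 S1) G2 (ad_IP_structure G2 S2) f"
 unfolding qad_hom_iff[OF ad_IP_qadmissible[OF S(1)] ad_IP_qadmissible[OF S(2)]] ad_IP_simps
proof (intro conjI ballI)
 show "f:hom G1 G2" using f by (simp add: indproalg_hom_iff)
 fix H1 assume H1: "H1:indpro_origins G1 S1"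
 note m1 = origin_mem[OF S(1) H1]
 have fH: "f ` H1:mem S2" "proalg_hom (G1 || H1) (str S1 H1) (G2 || (f ` H1)) (str S2 (f ` H1)) f"
  using f m1 by (auto simp: indproalg_hom_iff)
 obtain H2 where H2: "H2:indpro_origins G2 S2" "f ` H1 <= H2" using origin_cofinal[OF S(2) fH(1)] .
 note m2 = origin_mem[OF S(2) H2(1)]
 have "proalg_hom (G2 || (f ` H1)) (str S2 (f ` H1)) (G2 || H2) (str S2 H2) (%x. x)"
  using ip_embedded[OF ipad_ip[OF S(2)] m2 fH(1) H2(2)] by (simp add: embedded_def)
 from proalg_hom_comp[OF ip_proalg[OF ipad_ip[OF S(1)] m1] ip_proalg[OF ipad_ip[OF S(2)] fH(1)] ip_proalg[OF ipad_ip[OF S(2)] m2] fH(2) this]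
 show "EX H2:indpro_origins G2 S2. f ` H1 <= H2 & proalg_hom (G1 || H1) (qpro (ad_IP_structure G1 S1) H1)
   (G2 || H2) (qpro (ad_IP_structure G2 S2) H2) f"
  using H2 origin_qpro[OF S(1) H1] origin_qpro[OF S(2) H2(1)] by (intro bexI[of _ H2]) auto
qed

lemma indpro_structure_ip_of:
 assumes "qadmissible G S"
 shows "ip_of G S (indpro_structure G S)"
proof -
 show ?thesis using ip_of_generated[OF assms, of "mem S"] by (auto simp: indpro_structure_def qpro_def[abs_def])
qed

text \<open>Inverse up to the irrelevant values of \<open>str\<close>: the two structures have the same members.\<close>

lemma ip_of_ad_IP:
 assumes S: "qadmissible G S" and I: "ip_of G S I"
 shows "qad_hom G S G (ad_IP_structure G I) (%x. x)" "qad_hom G (ad_IP_structure G I) G S (%x. x)"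
proof -
 note ad = ip_of_ad[OF S I]
 have eq: "indpro_origins G I = mem S" by (rule ip_of_origins[OF S I])
 show "qad_hom G S G (ad_IP_structure G I) (%x. x)"
  by (rule qad_hom_id[OF S ad_IP_qadmissible[OF ad]])
   (use ip_of_qpro(2)[OF S I] origin_qpro[OF ad] in \<open>auto simp: eq\<close>)
 show "qad_hom G (ad_IP_structure G I) G S (%x. x)"
  by (rule qad_hom_id[OF ad_IP_qadmissible[OF ad] S])
   (use ip_of_qpro(1)[OF S I] origin_qpro[OF ad] in \<open>auto simp: eq\<close>)
qed

end

section \<open>Comparison of Q-admissible with proindalgebraic groups\<close>

section \<open>Indalgebraic quotients\<close>

lemma (in cgroup) set_mult_subset_iff:
 assumes "subgroup H G" "subgroup K G" "subgroup L G"
 shows "H <#> K <= L <-> H <= L & K <= L"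
 using set_mult_least[OF assms(3)] set_mult_upper1[OF assms(2) subgroup.subset[OF assms(1)]]
  set_mult_upper2[OF assms(1) subgroup.subset[OF assms(2)]] by blast

lemma (in cgroup) quot_set_eq_iff:
 assumes "subgroup H G" "subgroup K G" "subgroup L G" "H <= K" "H <= L"
 shows "quot_set G K H = quot_set G L H <-> K = L"
 using quot_set_mono_iff[OF assms] quot_set_mono_iff[OF assms(1,3,2,5,4)] by blast

lemma maps_restr:
 fixes G1 :: "'a monoid" and G2 :: "'b monoid"
 assumes f: "maps G1 H1 G2 H2 f" and K: "subgroup K G1" "H1 <= K" and L: "subgroup L G2" "H2 <= L" "f ` K <= L"
 shows "maps (G1 || K) H1 (G2 || L) H2 f"
proof -
 interpret mapping G1 H1 G2 H2 f by (rule mapping[OF f])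
 have "f:hom (G1 || K) (G2 || L)" using f subgroup.subset[OF K(1)] L(3) by (intro hom_restr) (auto simp: maps_def)
 thus ?thesis
  using f K L G1.restr_comm_group[OF K(1)] G2.restr_comm_group[OF L(1)] G1.subgroup_restr[OF K(1)] G2.subgroup_restr[OF L(1)]
  by (simp add: maps_def)
qed

text \<open>A member \<open>L\<close> of an indalgebraic structure on \<open>G/H\<close> is given by the subgroup \<open>\<Union>L\<close> of \<open>G\<close>.\<close>

definition imem :: "'a monoid => 'a set => ('a set, 'k) ind_fam => 'a set set" where
 "imem G H T = {K. subgroup K G & H <= K & quot_set G K H:mem T}"

definition istr :: "'a monoid => 'a set => ('a set, 'k) ind_fam => 'a set => ('a set, 'k) kspace" where
 "istr G H T K = str T (quot_set G K H)"

text \<open>The axioms of an indalgebraic structure on the quotient of \<open>G\<close> by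
  \<open>H\<close>, transcribed to subgroups of \<open>G\<close> containing \<open>H\<close>;
  \<open>indalg_imp_iq\<close> and \<open>iq_imp_indalg\<close> form the dictionary.\<close>

definition iq :: "'a monoid => 'a set => 'a set set => ('a set => ('a set, 'k::field) kspace) => bool" where
 "iq G H M X <-> comm_group G & subgroup H G & M ~= {} & (ALL K:M. subgroup K G & H <= K) &
   countably_cofinal M & (ALL K:M. ALL K':M. EX Q:M. K <= Q & K' <= Q) & \<Union>M = carrier G &
   (ALL K:M. qa (G || K) H (X K)) & (ALL K:M. ALL J. qcl (G || K) H (X K) J <-> J:M & J <= K) &
   (ALL K:M. ALL J:M. J <= K --> qh (G || J) H (X J) (G || K) H (X K) (%x. x))"

lemma iqD:
 assumes "iq G H M X"
 shows iq_comm: "comm_group G" and iq_base: "subgroup H G" and iq_ne: "M ~= {}"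
  and iq_sub: "K:M ==> subgroup K G" and iq_le: "K:M ==> H <= K"
  and iq_cofinal: "countably_cofinal M" and iq_up: "K:M ==> K':M ==> EX Q:M. K <= Q & K' <= Q"
  and iq_cover: "\<Union>M = carrier G" and iq_qa: "K:M ==> qa (G || K) H (X K)"
  and iq_qcl: "K:M ==> qcl (G || K) H (X K) J <-> J:M & J <= K"
  and iq_qh: "K:M ==> J:M ==> J <= K ==> qh (G || J) H (X J) (G || K) H (X K) (%x. x)"
proof -
 have D: "comm_group G" "subgroup H G" "M ~= {}" "ALL K:M. subgroup K G & H <= K" "countably_cofinal M"
  "ALL K:M. ALL K':M. EX Q:M. K <= Q & K' <= Q" "\<Union>M = carrier G" "ALL K:M. qa (G || K) H (X K)"
  "ALL K:M. ALL J. qcl (G || K) H (X K) J <-> J:M & J <= K"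
  "ALL K:M. ALL J:M. J <= K --> qh (G || J) H (X J) (G || K) H (X K) (%x. x)"
  using assms unfolding iq_def by argo+
 show "comm_group G" "subgroup H G" "M ~= {}" "countably_cofinal M" "\<Union>M = carrier G" by fact+
 show "K:M ==> subgroup K G" "K:M ==> H <= K" using D(4) by blast+
 show "K:M ==> K':M ==> EX Q:M. K <= Q & K' <= Q" using D(6) by blast
 show "K:M ==> qa (G || K) H (X K)" using D(8) by blast
 show "K:M ==> qcl (G || K) H (X K) J <-> J:M & J <= K" using D(9) by blast
 show "K:M ==> J:M ==> J <= K ==> qh (G || J) H (X J) (G || K) H (X K) (%x. x)" using D(10) by blast
qed

context pos_char
begin

lemma indalg_imp_iq:
 fixes G (structure)
 assumes G: "comm_group G" and H: "subgroup H G" and T: "indalg (G Mod H) T"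
 shows "iq G H (imem G H T) (istr G H T)" "mem T = (%K. quot_set G K H) ` imem G H T"
proof -
 interpret cgroup G using G by (simp add: cgroup_def)
 interpret Q: cgroup "G Mod H" using abelian_FactGroup[OF H] by (simp add: cgroup_def)
 let ?q = "%K. quot_set G K H" and ?M = "imem G H T"
 have T': "ind_system (G Mod H) (mem T)" "ALL L:mem T. quasialg ((G Mod H) || L) (str T L)"
  "ALL L:mem T. {L':mem T. L' <= L} = {C. quasialg_closed ((G Mod H) || L) (str T L) C}"
  "ALL L:mem T. ALL L':mem T. L' <= L --> quasialg_hom ((G Mod H) || L') (str T L') ((G Mod H) || L) (str T L) (%x. x)"
  using T unfolding indalg_def ind_structure_def by argo+
 have sub: "subgroup L (G Mod H)" if "L:mem T" for L using T'(1) that by (simp add: ind_system_def)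
 show memT: "mem T = ?q ` ?M"
 proof
  show "?q ` ?M <= mem T" by (auto simp: imem_def)
  show "mem T <= ?q ` ?M"
  proof
   fix L assume "L:mem T"
   from coset_preimage_subgroup[OF H sub[OF this]] this show "L:?q ` ?M"
    by (intro image_eqI[of _ _ "coset_preimage G H L"]) (auto simp: imem_def)
  qed
 qed
 have M: "subgroup K G" "H <= K" "?q K:mem T" if "K:?M" for K using that by (auto simp: imem_def)
 have M_eq: "?M = \<Union> ` mem T" unfolding memT image_image using Union_quot_set[OF H M(1,2)] by (auto simp: image_iff)
 have qa: "qa (G || K) H (istr G H T K)" if K: "K:?M" for K
  using T'(2)[rule_format, OF M(3)[OF K]] restr_comm_group[OF M(1)[OF K]] subgroup_restr[OF M(1)[OF K]] M(2)[OF K] H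
  by (simp add: qa_def istr_def Mod_restr)
 show "iq G H ?M (istr G H T)" unfolding iq_def
 proof (intro conjI ballI allI impI)
  show "?M ~= {}" using T'(1) memT by (auto simp: ind_system_def)
  show "countably_cofinal ?M" unfolding M_eq
   using T'(1) by (intro countably_cofinal_image) (auto simp: ind_system_def)
  show "\<Union>?M = carrier G"
  proof
   show "\<Union>?M <= carrier G" using subgroup.subset[OF M(1)] by blast
   show "carrier G <= \<Union>?M"
   proof
    fix x assume x: "x:carrier G"
    hence "H #> x:\<Union>(mem T)" using T'(1) by (auto simp: ind_system_def carrier_FactGroup)
    then obtain K where K: "K:?M" "H #> x:?q K" using memT by auto
    thus "x:\<Union>?M" using coset_mem_quot_set[OF H M(1,2)[OF K(1)] x] by blast
   qed
  qed
  fix K assume K: "K:?M"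
  show "subgroup K G" "H <= K" "qa (G || K) H (istr G H T K)" using M(1,2)[OF K] qa[OF K] by auto
  show "EX Q:?M. K <= Q & K' <= Q" if K': "K':?M" for K'
  proof -
   obtain L where L: "L:mem T" "?q K <#>[G Mod H] ?q K' <= L"
    using T'(1) M(3)[OF K] M(3)[OF K'] unfolding ind_system_def by blast
   obtain Q where Q: "Q:?M" "L = ?q Q" using L(1) memT by blast
   have "?q K <= ?q Q" "?q K' <= ?q Q"
    using Q.set_mult_subset_iff[OF sub[OF M(3)[OF K]] sub[OF M(3)[OF K']] sub[OF L(1)]] L(2) Q(2) by auto
   thus ?thesis using quot_set_mono_iff[OF H M(1)[OF K] M(1)[OF Q(1)] M(2)[OF K] M(2)[OF Q(1)]]
     quot_set_mono_iff[OF H M(1)[OF K'] M(1)[OF Q(1)] M(2)[OF K'] M(2)[OF Q(1)]] Q(1) by blast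
  qed
  have cl: "{L':mem T. L' <= ?q K} = {C. quasialg_closed (G || K Mod H) (istr G H T K) C}"
   using T'(3)[rule_format, OF M(3)[OF K]] by (simp add: Mod_restr istr_def)
  show "qcl (G || K) H (istr G H T K) J <-> J:?M & J <= K" for J
  proof
   assume q: "qcl (G || K) H (istr G H T K) J"
   hence J: "subgroup J G" "J <= K" "H <= J" using qclD[OF q] subgroup_restr[OF M(1)[OF K]] by auto
   have "?q J:mem T" using q cl by (auto simp: qcl_def)
   thus "J:?M & J <= K" using J by (auto simp: imem_def)
  next
   assume J: "J:?M & J <= K"
   hence "?q J <= ?q K" by (auto simp: quot_set_image)
   hence "quasialg_closed (G || K Mod H) (istr G H T K) (?q J)" using cl M(3) J by blast
   thus "qcl (G || K) H (istr G H T K) J" using J M subgroup_restr[OF M(1)[OF K]] by (simp add: qcl_def)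
  qed
  fix J assume J: "J:?M" "J <= K"
  hence "?q J <= ?q K" by (auto simp: quot_set_image)
  hence "quasialg_hom (G || J Mod H) (istr G H T J) (G || K Mod H) (istr G H T K) (%x. x)"
   using T'(4)[rule_format, OF M(3)[OF K] M(3)[OF J(1)]] by (simp add: Mod_restr istr_def)
  thus "qh (G || J) H (istr G H T J) (G || K) H (istr G H T K) (%x. x)"
   using qh_incl_iff[OF qa[OF J(1)]] by blast
 qed (rule G H)+
qed

lemma iq_imp_indalg:
 fixes G (structure)
 assumes M: "iq G H M X" and T: "mem T = (%K. quot_set G K H) ` M" "!!K. K:M ==> str T (quot_set G K H) = X K"
 shows "indalg (G Mod H) T" "imem G H T = M" "K:M ==> istr G H T K = X K"
proof -
 note H = iq_base[OF M] and sub = iq_sub[OF M] and le = iq_le[OF M]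
 interpret cgroup G using iq_comm[OF M] by (simp add: cgroup_def)
 interpret Q: cgroup "G Mod H" using abelian_FactGroup[OF H] by (simp add: cgroup_def)
 let ?q = "%K. quot_set G K H"
 show "imem G H T = M" using sub le T(1) H by (auto simp: imem_def quot_set_eq_iff)
 show "istr G H T K = X K" if "K:M" for K using T(2)[OF that] by (simp add: istr_def)
 have subq: "subgroup (?q K) (G Mod H)" if "K:M" for K by (rule quot_set_subgroup[OF H sub[OF that]])
 show "indalg (G Mod H) T"
  unfolding indalg_def ind_structure_def ind_system_def T(1) ball_simps
 proof (intro conjI ballI impI)
  show "comm_group (G Mod H)" by (rule Q.comm_group_axioms)
  show "?q ` M ~= {}" using iq_ne[OF M] by blast
  show "countably_cofinal (?q ` M)"
   by (rule countably_cofinal_image[OF iq_cofinal[OF M]]) (auto simp: quot_set_image)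
  show "\<Union>(?q ` M) = carrier (G Mod H)"
  proof
   show "\<Union>(?q ` M) <= carrier (G Mod H)" using subgroup.subset[OF subq] by blast
   show "carrier (G Mod H) <= \<Union>(?q ` M)"
    using iq_cover[OF M] by (fastforce simp: carrier_FactGroup quot_set_image)
  qed
  fix K assume K: "K:M"
  show "subgroup (?q K) (G Mod H)" by (rule subq[OF K])
  show "quasialg ((G Mod H) || (?q K)) (str T (?q K))"
   using iq_qa[OF M K] by (simp add: T(2)[OF K] Mod_restr qa_def)
  show "{L':?q ` M. L' <= ?q K} = {C. quasialg_closed ((G Mod H) || (?q K)) (str T (?q K)) C}"
   unfolding Mod_restr T(2)[OF K]
  proof (intro equalityI subsetI)
   fix C assume "C:{L':?q ` M. L' <= ?q K}"
   then obtain J where J: "J:M" "C = ?q J" "?q J <= ?q K" by blast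
   thus "C:{C. quasialg_closed (G || K Mod H) (X K) C}"
    using quot_set_mono_iff[OF H sub[OF J(1)] sub[OF K] le[OF J(1)] le[OF K]] iq_qcl[OF M K, of J] J by (simp add: qcl_def)
  next
   fix C assume "C:{C. quasialg_closed (G || K Mod H) (X K) C}"
   hence "qcl (G || K) H (X K) (coset_preimage (G || K) H C)"
    using qcl_coset_preimage_iff[OF restr_comm_group[OF sub[OF K]], of H] subgroup_restr[OF sub[OF K], of H] H le[OF K] by blast
   hence J: "coset_preimage (G || K) H C:M" "coset_preimage (G || K) H C <= K" using iq_qcl[OF M K] by auto
   interpret K: cgroup "G || K" using restr_comm_group[OF sub[OF K]] by (simp add: cgroup_def)
   have "quot_set (G || K) (coset_preimage (G || K) H C) H = C"
    using K.coset_preimage_subgroup(3)[of H C] subgroup_restr[OF sub[OF K], of H] H le[OF K]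
     `C:{C. quasialg_closed (G || K Mod H) (X K) C}` by (simp add: quasialg_closed_def)
   hence C: "C = ?q (coset_preimage (G || K) H C)" by simp
   have "?q (coset_preimage (G || K) H C) <= ?q K" unfolding quot_set_image by (rule image_mono[OF J(2)])
   thus "C:{L':?q ` M. L' <= ?q K}" using C C J(1) by blast
  qed
  fix J assume J: "J:M"
  show "EX H'':?q ` M. ?q K <#>[G Mod H] ?q J <= H''"
  proof -
   obtain Q where Q: "Q:M" "K <= Q" "J <= Q" using iq_up[OF M K J] by blast
   hence "?q K <#>[G Mod H] ?q J <= ?q Q"
    unfolding Q.set_mult_subset_iff[OF subq[OF K] subq[OF J] subq[OF Q(1)]] by (auto simp: quot_set_image)
   with Q(1) show ?thesis by blast
  qed
  assume "?q J <= ?q K"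
  thus "quasialg_hom ((G Mod H) || (?q J)) (str T (?q J)) ((G Mod H) || (?q K)) (str T (?q K)) (%x. x)"
   using quot_set_mono_iff[OF H sub[OF J] sub[OF K] le[OF J] le[OF K]] qh_incl_iff[OF iq_qa[OF M J]] iq_qh[OF M K J] unfolding Mod_restr T(2)[OF K] T(2)[OF J]
   by blast
 qed
qed

lemma indalg_hom_quot_iff:
 fixes G1 G2 :: "'a monoid"
 assumes f: "maps G1 H1 G2 H2 f" and T1: "indalg (G1 Mod H1) T1"
 shows "indalg_hom (G1 Mod H1) T1 (G2 Mod H2) T2 (quot_map G2 H2 f) <->
  (ALL K:imem G1 H1 T1. f ` K <#>[G2] H2:imem G2 H2 T2 &
   qh (G1 || K) H1 (istr G1 H1 T1 K) (G2 || (f ` K <#>[G2] H2)) H2 (istr G2 H2 T2 (f ` K <#>[G2] H2)) f)"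
proof -
 have G: "comm_group G1" "subgroup H1 G1" using f by (auto simp: maps_def)
 note i = indalg_imp_iq[OF G T1]
 have "(quot_map G2 H2 f ` quot_set G1 K H1:mem T2 &
   quasialg_hom ((G1 Mod H1) || quot_set G1 K H1) (str T1 (quot_set G1 K H1))
    ((G2 Mod H2) || (quot_map G2 H2 f ` quot_set G1 K H1)) (str T2 (quot_map G2 H2 f ` quot_set G1 K H1)) (quot_map G2 H2 f)) <->
  (f ` K <#>[G2] H2:imem G2 H2 T2 &
   qh (G1 || K) H1 (istr G1 H1 T1 K) (G2 || (f ` K <#>[G2] H2)) H2 (istr G2 H2 T2 (f ` K <#>[G2] H2)) f)"
  if "K:imem G1 H1 T1" for K
 proof -
  have K: "subgroup K G1" using iq_sub[OF i(1) that] .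
  show ?thesis unfolding quot_map_image[OF f K] Mod_restr qh_def istr_def
   using image_mult_subgroup[OF f K] by (simp add: imem_def)
 qed
 thus ?thesis unfolding indalg_hom_def ind_hom_def i(2) ball_simps using maps_hom[OF f] by simp
qed

lemma strict_epi_quot_iff:
 fixes G (structure)
 assumes G: "comm_group G" and H: "subgroup H G" "subgroup H' G" "H <= H'"
  and T: "indalg (G Mod H) T" and T': "indalg (G Mod H') T'"
 shows "strict_epi (G Mod H) T (G Mod H') T' (quot_map G H' (%x. x)) <->
  imem G H' T' = {K <#> H' | K. K:imem G H T} &
  (ALL K:imem G H T. qh (G || K) H (istr G H T K) (G || (K <#> H')) H' (istr G H' T' (K <#> H')) (%x. x))"
proof -
 interpret cgroup G using G by (simp add: cgroup_def)
 note m = maps_id[OF G H] and i = indalg_imp_iq[OF G H(1) T] and i' = indalg_imp_iq[OF G H(2) T']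
 have "quot_map G H' (%x. x) ` carrier (G Mod H) = carrier (G Mod H')"
  using quot_map_image[OF m subgroup_self] set_mult_absorb[OF subgroup_self H(2) subgroup.subset[OF H(2)]]
  by (simp add: carrier_Mod)
 moreover have "mem T' = {quot_map G H' (%x. x) ` L | L. L:mem T} <-> imem G H' T' = {K <#> H' | K. K:imem G H T}"
 proof -
  have a: "{quot_map G H' (%x. x) ` L | L. L:mem T} = (%N. quot_set G N H') ` {K <#> H' | K. K:imem G H T}"
   unfolding Setcompr_eq_image i(2) image_image using quot_map_image[OF m iq_sub[OF i(1)]] by (intro image_cong) auto
  have b: "inj_on (%N. quot_set G N H') {N. subgroup N G & H' <= N}"
   using quot_set_eq_iff[OF H(2)] by (auto intro!: inj_onI)
  have c: "imem G H' T' <= {N. subgroup N G & H' <= N}" by (auto simp: imem_def)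
  have d: "{K <#> H' | K. K:imem G H T} <= {N. subgroup N G & H' <= N}"
   using image_mult_subgroup[OF m iq_sub[OF i(1)]] by auto
  show ?thesis unfolding i'(2) a by (rule inj_on_image_eq_iff[OF b c d])
 qed
 ultimately show ?thesis unfolding strict_epi_def indalg_hom_quot_iff[OF m T] by auto
qed

lemma strict_subgroup_quot_iff:
 fixes G (structure)
 assumes G: "comm_group G" and H: "subgroup H G" and T: "indalg (G Mod H) T" and N: "subgroup N G" "H <= N"
 shows "strict_subgroup (G Mod H) T (quot_set G N H) <-> (ALL K:imem G H T. N Int K:imem G H T)"
proof -
 interpret cgroup G using G by (simp add: cgroup_def)
 note i = indalg_imp_iq[OF G H T]
 have "quasialg_closed ((G Mod H) || quot_set G K H) (str T (quot_set G K H)) (quot_set G N H Int quot_set G K H) <-> N Int K:imem G H T"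
  if K: "K:imem G H T" for K
 proof -
  have K': "subgroup K G" "H <= K" using iq_sub[OF i(1) K] iq_le[OF i(1) K] by auto
  have "quasialg_closed ((G Mod H) || quot_set G K H) (str T (quot_set G K H)) (quot_set G N H Int quot_set G K H) <->
    qcl (G || K) H (istr G H T K) (N Int K)"
   unfolding quot_set_inter[OF H N(1) K'(1) N(2) K'(2)] Mod_restr qcl_def istr_def
   using subgroup_restr[OF K'(1), of "N Int K"] subgroups_Inter_pair[OF N(1) K'(1)] N(2) K'(2) by simp
  thus ?thesis using iq_qcl[OF i(1) K, of "N Int K"] by auto
 qed
 thus ?thesis unfolding strict_subgroup_def using quot_set_subgroup[OF H N(1)] i(2) by simp
qed

lemma strict_subgroup_quasialg_quot_iff:
 fixes G (structure)
 assumes G: "comm_group G" and H: "subgroup H G" and T: "indalg (G Mod H) T" and N: "subgroup N G" "H <= N"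
  and st: "ALL K:imem G H T. N Int K:imem G H T"
 shows "strict_subgroup_quasialg T (quot_set G N H) <-> N:imem G H T"
proof -
 interpret cgroup G using G by (simp add: cgroup_def)
 note i = indalg_imp_iq[OF G H T]
 have "quot_set G N H = quot_set G N H Int quot_set G K H <-> N <= K" if "K:imem G H T" for K
  using quot_set_mono_iff[OF H N(1) iq_sub[OF i(1) that] N(2) iq_le[OF i(1) that]] by blast
 hence "strict_subgroup_quasialg T (quot_set G N H) <-> (EX K:imem G H T. N <= K)"
  unfolding strict_subgroup_quasialg_def i(2) by auto
 also have "... <-> N:imem G H T" using st by (metis inf.absorb1 order_refl)
 finally show ?thesis .
qed

end

section \<open>Proindalgebraic groups\<close>

abbreviation pim :: "'a monoid => ('a, 'k) proind_fam => 'a set => 'a set set" where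
 "pim G S H == imem G H (str S H)"

abbreviation pist :: "'a monoid => ('a, 'k) proind_fam => 'a set => 'a set => ('a set, 'k) kspace" where
 "pist G S H == istr G H (str S H)"

context pos_char
begin

lemma pi_iff:
 fixes G (structure)
 shows "proindalg G S <-> comm_group G & pro_system G (mem S) & (ALL H:mem S. indalg (G Mod H) (str S H)) &
   (ALL H:mem S. ALL N. subgroup N G & H <= N & (ALL K:pim G S H. N Int K:pim G S H) <-> N:mem S & H <= N) &
   (ALL H:mem S. ALL H':mem S. H <= H' --> pim G S H' = {K <#> H' | K. K:pim G S H} &
    (ALL K:pim G S H. qh (G || K) H (pist G S H K) (G || (K <#> H')) H' (pist G S H' (K <#> H')) (%x. x)))"
proof (cases "comm_group G & pro_system G (mem S) & (ALL H:mem S. indalg (G Mod H) (str S H))")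
 case True
 then interpret cgroup G by (simp add: cgroup_def)
 have sub: "subgroup H G" if "H:mem S" for H using True that by (simp add: pro_system_def)
 have ind: "indalg (G Mod H) (str S H)" if "H:mem S" for H using True that by blast
 have 1: "{H':mem S. H <= H'} = {coset_preimage G H C | C. strict_subgroup (G Mod H) (str S H) C} <->
  (ALL N. subgroup N G & H <= N & (ALL K:pim G S H. N Int K:pim G S H) <-> N:mem S & H <= N)" if H: "H:mem S" for H
 proof -
  have "(EX C. N = coset_preimage G H C & strict_subgroup (G Mod H) (str S H) C) <-> subgroup N G & H <= N & (ALL K:pim G S H. N Int K:pim G S H)" for N
   using strict_subgroup_def coset_preimage_subgroup sub[OF H] H comm_group_axioms ind[OF H] strict_subgroup_quot_iff coset_preimage_quot_set _
   by metis
  hence "N:{coset_preimage G H C | C. strict_subgroup (G Mod H) (str S H) C} <->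
    subgroup N G & H <= N & (ALL K:pim G S H. N Int K:pim G S H)" for N by simp
  thus ?thesis unfolding set_eq_iff by (simp only: mem_Collect_eq) blast
 qed
 have 2: "strict_epi (G Mod H) (str S H) (G Mod H') (str S H') (quot_map G H' (%x. x)) <->
   pim G S H' = {K <#> H' | K. K:pim G S H} &
    (ALL K:pim G S H. qh (G || K) H (pist G S H K) (G || (K <#> H')) H' (pist G S H' (K <#> H')) (%x. x))"
  if "H:mem S" "H':mem S" "H <= H'" for H H'
  by (rule strict_epi_quot_iff[OF comm_group_axioms sub[OF that(1)] sub[OF that(2)] that(3) ind[OF that(1)] ind[OF that(2)]])
 have "(ALL H:mem S. {H':mem S. H <= H'} = {coset_preimage G H C | C. strict_subgroup (G Mod H) (str S H) C}) <->
   (ALL H:mem S. ALL N. subgroup N G & H <= N & (ALL K:pim G S H. N Int K:pim G S H) <-> N:mem S & H <= N)"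
  by (rule ball_cong[OF refl 1])
 moreover have "(ALL H:mem S. ALL H':mem S. H <= H' --> strict_epi (G Mod H) (str S H) (G Mod H') (str S H') (quot_map G H' (%x. x))) <->
   (ALL H:mem S. ALL H':mem S. H <= H' --> pim G S H' = {K <#> H' | K. K:pim G S H} &
    (ALL K:pim G S H. qh (G || K) H (pist G S H K) (G || (K <#> H')) H' (pist G S H' (K <#> H')) (%x. x)))"
  by (intro ball_cong refl imp_cong 2)
 ultimately show ?thesis unfolding proindalg_def pro_structure_def by argo
next
 case False
 thus ?thesis unfolding proindalg_def pro_structure_def by argo
qed

lemma piD:
 fixes G (structure)
 assumes "proindalg G S"
 shows pi_comm: "comm_group G" and pi_ne: "mem S ~= {}" and pi_sub: "H:mem S ==> subgroup H G"
  and pi_count: "countably_coinitial (mem S)" and pi_dir: "H:mem S ==> K:mem S ==> EX Q:mem S. Q <= H Int K"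
  and pi_cplt: "cplt G (mem S)" and pi_indalg: "H:mem S ==> indalg (G Mod H) (str S H)"
  and pi_strict: "H:mem S ==> N:mem S & H <= N <-> subgroup N G & H <= N & (ALL K:pim G S H. N Int K:pim G S H)"
  and pi_pim: "H:mem S ==> H':mem S ==> H <= H' ==> pim G S H' = {K <#> H' | K. K:pim G S H}"
  and pi_qh: "H:mem S ==> H':mem S ==> H <= H' ==> K:pim G S H ==>
   qh (G || K) H (pist G S H K) (G || (K <#> H')) H' (pist G S H' (K <#> H')) (%x. x)"
proof -
 have D: "comm_group G" "pro_system G (mem S)" "ALL H:mem S. indalg (G Mod H) (str S H)"
   "ALL H:mem S. ALL N. subgroup N G & H <= N & (ALL K:pim G S H. N Int K:pim G S H) <-> N:mem S & H <= N"
   "ALL H:mem S. ALL H':mem S. H <= H' --> pim G S H' = {K <#> H' | K. K:pim G S H} &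
    (ALL K:pim G S H. qh (G || K) H (pist G S H K) (G || (K <#> H')) H' (pist G S H' (K <#> H')) (%x. x))"
  using assms unfolding pi_iff by argo+
 show "comm_group G" by fact
 show "mem S ~= {}" "countably_coinitial (mem S)" using D(2) unfolding pro_system_def by blast+
 show sub: "subgroup H G" if "H:mem S" for H using D(2) that unfolding pro_system_def by blast
 show "EX Q:mem S. Q <= H Int K" if "H:mem S" "K:mem S" using D(2) that unfolding pro_system_def by blast
 show "cplt G (mem S)" using D(2) is_quot_limit_iff[OF D(1) sub] unfolding pro_system_def by blast
 show "H:mem S ==> indalg (G Mod H) (str S H)" using D(3) by blast
 show "N:mem S & H <= N <-> subgroup N G & H <= N & (ALL K:pim G S H. N Int K:pim G S H)" if "H:mem S"
  using D(4)[rule_format, OF that, of N] by (rule sym)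
 show "pim G S H' = {K <#> H' | K. K:pim G S H}" if "H:mem S" "H':mem S" "H <= H'"
  by (rule conjunct1[OF D(5)[rule_format, OF that]])
 show "qh (G || K) H (pist G S H K) (G || (K <#> H')) H' (pist G S H' (K <#> H')) (%x. x)"
  if "H:mem S" "H':mem S" "H <= H'" "K:pim G S H"
  by (rule conjunct2[OF D(5)[rule_format, OF that(1-3)], rule_format, OF that(4)])
qed

lemma pi_iq:
 "proindalg G S ==> H:mem S ==> iq G H (pim G S H) (pist G S H)"
 by (rule indalg_imp_iq(1)[OF pi_comm pi_sub pi_indalg])

subsection \<open>Morphisms\<close>

lemma preimage_maps:
 fixes S1 S2 :: "('a, 'k) proind_fam"
 assumes "proindalg G1 S1" "proindalg G2 S2" "f:hom G1 G2" "H:mem S2" "{x:carrier G1. f x:H}:mem S1"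
 shows "maps G1 {x:carrier G1. f x:H} G2 H f"
 using assms pi_comm pi_sub by (auto simp: maps_def)

lemma proindalg_hom_iff:
 assumes S: "proindalg G1 S1" "proindalg G2 S2"
 shows "proindalg_hom G1 S1 G2 S2 f <-> f:hom G1 G2 & (ALL H:mem S2. {x:carrier G1. f x:H}:mem S1 &
  (ALL N:pim G1 S1 {x:carrier G1. f x:H}. f ` N <#>[G2] H:pim G2 S2 H &
   qh (G1 || N) {x:carrier G1. f x:H} (pist G1 S1 {x:carrier G1. f x:H} N)
    (G2 || (f ` N <#>[G2] H)) H (pist G2 S2 H (f ` N <#>[G2] H)) f))"
 unfolding proindalg_hom_def pro_hom_def Let_def
proof (intro conj_cong refl ball_cong)
 fix H assume "f:hom G1 G2" "H:mem S2" "{x:carrier G1. f x:H}:mem S1"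
 note indalg_hom_quot_iff[OF preimage_maps[OF S this] pi_indalg[OF S(1) this(3)], of "str S2 H"]
 thus "indalg_hom (G1 Mod {x:carrier G1. f x:H}) (str S1 {x:carrier G1. f x:H}) (G2 Mod H) (str S2 H) (quot_map G2 H f) <->
  (ALL N:pim G1 S1 {x:carrier G1. f x:H}. f ` N <#>[G2] H:pim G2 S2 H &
   qh (G1 || N) {x:carrier G1. f x:H} (pist G1 S1 {x:carrier G1. f x:H} N)
    (G2 || (f ` N <#>[G2] H)) H (pist G2 S2 H (f ` N <#>[G2] H)) f)" .
qed

lemma pim_maps:
 fixes S1 S2 :: "('a, 'k) proind_fam"
 assumes S: "proindalg G1 S1" "proindalg G2 S2" and f: "f:hom G1 G2" and H: "H:mem S2" "{x:carrier G1. f x:H}:mem S1"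
  and N: "N:pim G1 S1 {x:carrier G1. f x:H}"
 shows "maps (G1 || N) {x:carrier G1. f x:H} (G2 || (f ` N <#>[G2] H)) H f"
proof -
 note m = preimage_maps[OF S f H] and i = pi_iq[OF S(1) H(2)]
 show ?thesis by (rule maps_restr[OF m iq_sub[OF i N] iq_le[OF i N] image_mult_subgroup[OF m iq_sub[OF i N]]])
qed

subsection \<open>Quotients of a \<open>\<Q>\<close>-admissible group\<close>

text \<open>The induced map of quotients is a group isomorphism, so the structure is pulled back
  along its inverse, whose image is everything and therefore closed.\<close>

theorem qa_transport:
 fixes G2 :: "'b monoid"
 assumes qa: "qa G1 B1 X1" and f: "maps G1 B1 G2 B2 f" and inj: "!!x. x:carrier G1 ==> f x:B2 ==> x:B1"
  and surj: "!!y. y:carrier G2 ==> EX x:carrier G1. y *[G2] inv[G2] (f x):B2"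
 obtains X2 :: "('b set, 'k) kspace" where "qa G2 B2 X2" "qh G1 B1 X1 G2 B2 X2 f"
proof -
 interpret mapping G1 B1 G2 B2 f by (rule mapping[OF f])
 let ?A = "G1 Mod B1" and ?C = "G2 Mod B2" and ?p = "quot_map G2 B2 f"
 have iso: "?p:iso ?A ?C"
  using quot_hom quot_map_inj[OF inj] quot_map_onto[OF surj] by (simp add: iso_def bij_betw_def)
 let ?j = "inv_into (carrier ?A) ?p"
 have grp: "group ?A" "comm_group ?C" using qa_group[OF qa] G2.abelian_FactGroup[OF base(2)] by auto
 have j: "?j:iso ?C ?A" by (rule group.iso_set_sym[OF grp(1) iso])
 obtain X2 where X2: "quasialg ?C X2" "quasialg_hom ?C X2 ?A X1 ?j"
 proof (rule quasialg_pullback[OF qaD(3)[OF qa] grp(2)])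
  show "?j:hom ?C ?A" "inj_on ?j (carrier ?C)" using j by (auto simp: iso_def bij_betw_def)
  show "closedin (ktop X1) (?j ` carrier ?C)"
   using j quasialg_closed_carrier[OF qaD(3)[OF qa]] by (auto simp: iso_def bij_betw_def quasialg_closed_def)
 qed
 have "?j (?p c) = c" if "c:carrier ?A" for c using iso that by (auto simp: iso_def bij_betw_def)
 hence "quasialg_hom ?A X1 ?A X1 (%c. ?j (?p c))"
  using quasialg_hom_cong[OF qa_top[OF qa] grp(1), of "%c. ?j (?p c)" "%c. c"]
   quasialg_hom_id[OF quasialg_sheaf[OF qaD(3)[OF qa]] grp(1)] by simp
 hence "quasialg_hom ?A X1 ?C X2 ?p"
  using j by (intro quasialg_hom_lift[OF qaD(3)[OF qa] X2(1) qaD(3)[OF qa] X2(2) _ quot_hom]) (auto simp: iso_def bij_betw_def)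
 thus thesis using that X2(1) base(2) G2.comm_group_axioms by (simp add: qa_def qh_def)
qed

lemma (in cgroup) restr_surj:
 assumes "subgroup A G" "subgroup C G" "subgroup D G" "A <= C" "C <= A <#> D" "y:carrier (G || C)"
 shows "EX x:carrier (G || A). y *[G || C] inv[G || C] x:D"
proof -
 obtain a where "a:A" "y \<otimes> inv a:D" using assms(5,6) mem_set_mult_iff[OF assms(3) subgroup.subset[OF assms(1)]] by auto
 thus ?thesis using inv_restr[OF assms(2), of a] assms(4) by (intro bexI[of _ a]) auto
qed

text \<open>By the second isomorphism theorem, \<open>C <= A <#> D\<close> makes the quotient of
  \<open>A\<close> by \<open>B\<close> map onto the quotient of \<open>C\<close> by
  \<open>D\<close>, and morphisms descend along surjections.\<close>

lemma qh_descend_incl: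
 fixes G (structure)
 assumes qa: "qa (G || A) B X1" "qa (G || C) D X2" "qa G3 B3 X3" and G: "comm_group G"
  and sub: "subgroup A G" "subgroup C G" "A <= C" "C <= A <#> D" "B <= D"
  and f: "maps (G || C) D G3 B3 f"
  and q: "qh (G || A) B X1 (G || C) D X2 (%x. x)" "qh (G || A) B X1 G3 B3 X3 f"
 shows "qh (G || C) D X2 G3 B3 X3 f"
proof (rule qh_descend[OF qa _ f _ q])
 interpret cgroup G using G by (simp add: cgroup_def)
 have B: "subgroup B G" "B <= A" "subgroup D G" "D <= C"
  using qaD(2)[OF qa(1)] qaD(2)[OF qa(2)] subgroup_restr[OF sub(1)] subgroup_restr[OF sub(2)] by auto
 show "maps (G || A) B (G || C) D (%x. x)"
  using maps_restr[OF maps_id[OF G B(1,3) sub(5)] sub(1) B(2) sub(2) B(4)] sub(3) by simp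
 show "EX x:carrier (G || A). y *[G || C] inv[G || C] x:D" if "y:carrier (G || C)" for y
  by (rule restr_surj[OF sub(1,2) B(3) sub(3,4) that])
qed

definition pmem :: "'a monoid => ('a, 'k) qad_fam => 'a set set" where
 "pmem G S = {J. subgroup J G & (ALL K:mem S. K Int J:mem S)}"

text \<open>\<open>presents G S J T\<close>: \<open>T\<close> is the structure on \<open>G/J\<close> with members \<open>(K + J)/J \<cong> K/(K \<inter> J)\<close>.\<close>

definition presents :: "'a monoid => ('a, 'k) qad_fam => 'a set => ('a set, 'k) ind_fam => bool" where
 "presents G S J T <-> indalg (G Mod J) T & imem G J T = {K <#>[G] J | K. K:mem S} &
   (ALL K:mem S. qh (G || K) (K Int J) (str S K (K Int J)) (G || (K <#>[G] J)) J (istr G J T (K <#>[G] J)) (%x. x))"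

definition pi_of :: "'a monoid => ('a, 'k) qad_fam => ('a, 'k) proind_fam => bool" where
 "pi_of G S P <-> mem P = pmem G S & (ALL J:mem P. presents G S J (str P J))"

text \<open>The subgroup \<open>Hp\<close> is recovered from its quotient set as the union of the
  cosets, whence \<open>\<Union>L\<close>.\<close>

definition qind :: "'a monoid => ('a, 'k) qad_fam => 'a set => ('a set, 'k) ind_fam" where
 "qind G S H = \<lparr>mem = {quot_set G Hp H | Hp. Hp:mem S & H <= Hp}, str = (%L. str S (\<Union>L) H)\<rparr>"

lemma presentsD:
 assumes "presents G S J T"
 shows "indalg (G Mod J) T" "imem G J T = {K <#>[G] J | K. K:mem S}"
  "K:mem S ==> qh (G || K) (K Int J) (str S K (K Int J)) (G || (K <#>[G] J)) J (istr G J T (K <#>[G] J)) (%x. x)"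
 using assms by (simp_all add: presents_def)

context
 fixes G :: "'a monoid" (structure) and S :: "('a, 'k) qad_fam"
 assumes S: "qadmissible G S"
begin

interpretation cgroup G by (rule qad_cgroup[OF S])

lemma qad_qh_pre:
 assumes H: "K:mem S" "H:mem S" "H <= K" "K':mem S" "H':mem S" "H' <= K'" "K <= K'" "H <= H'"
  and f: "maps (G || K') H' G3 B3 f" "qh (G || K') H' (str S K' H') G3 B3 X3 f"
 shows "qh (G || K) H (str S K H) G3 B3 X3 f"
 by (rule qh_comp[OF qad_qa[OF S H(2,1,3)] qad_maps[OF S H] f(1) qad_qh[OF S H] f(2)])

lemma qad_qh_descend:
 assumes H: "K:mem S" "H:mem S" "H <= K" "K':mem S" "H':mem S" "H' <= K'" "K <= K'" "H <= H'"
  and le: "K' <= K <#> H'" and f: "qa G3 B3 X3" "maps (G || K') H' G3 B3 f" "qh (G || K) H (str S K H) G3 B3 X3 f"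
 shows "qh (G || K') H' (str S K' H') G3 B3 X3 f"
 by (rule qh_descend_incl[OF qad_qa[OF S H(2,1,3)] qad_qa[OF S H(5,4,6)] f(1) comm_group_axioms qad_sub[OF S H(1)]
  qad_sub[OF S H(4)] H(7) le H(8) f(2) qad_qh[OF S H] f(3)])

lemma qind_indalg:
 assumes H: "H:mem S"
 shows "indalg (G Mod H) (qind G S H)" "imem G H (qind G S H) = {K:mem S. H <= K}"
  "K:mem S ==> H <= K ==> istr G H (qind G S H) K = str S K H"
proof -
 let ?M = "{K:mem S. H <= K}"
 have iq: "iq G H ?M (%K. str S K H)"
  unfolding iq_def
 proof (intro conjI ballI allI impI)
  show "?M ~= {}" using H by blast
  have le: "H <= K <#> H" "K <= K <#> H" "K <#> H:mem S" if "K:mem S" for K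
   using qad_le_mult[OF S that H] qad_mult[OF S that H] by auto
  have absorb: "K <#> H = K" if "K:?M" for K using that set_mult_absorb[OF qad_sub[OF S] qad_sub[OF S H]] by blast
  have eq: "(%K. K <#> H) ` mem S = ?M" using absorb image_eqI[of _ _ K] _ le by fastforce
  show "countably_cofinal ?M"
   unfolding eq[symmetric] by (rule countably_cofinal_image[OF qad_cofinal[OF S]]) (rule set_mult_mono, auto)
  show "\<Union>?M = carrier G"
  proof
   show "\<Union>?M <= carrier G" using qad_subset[OF S] by blast
   show "carrier G <= \<Union>?M"
   proof
    fix x assume "x:carrier G"
    then obtain K where "K:mem S" "x:K" using qad_cover[OF S] by blast
    thus "x:\<Union>?M" using le[of K] by blast
   qed
  qed
  fix K assume K: "K:?M"
  show "subgroup K G" "H <= K" "qa (G || K) H (str S K H)" using K qad_sub[OF S] qad_qa[OF S H] by auto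
  show "EX Q:?M. K <= Q & K' <= Q" if "K':?M" for K'
   using qad_mult[OF S, of K K'] qad_le_mult[OF S, of K K'] K that by (intro bexI[of _ "K <#> K'"]) auto
  show "qcl (G || K) H (str S K H) J <-> J:?M & J <= K" for J using qad_qcl[OF S H, of K J] K by blast
  show "qh (G || J) H (str S J H) (G || K) H (str S K H) (%x. x)" if "J:?M" "J <= K" for J
   using that K H by (intro qad_qh[OF S]) auto
 qed (rule comm_group_axioms qad_sub[OF S H])+
 have T: "mem (qind G S H) = (%K. quot_set G K H) ` ?M" "str (qind G S H) (quot_set G K H) = str S K H" if "K:?M" for K
  using that Union_quot_set[OF qad_sub[OF S H] qad_sub[OF S], of K] by (auto simp: qind_def)
 have memT: "mem (qind G S H) = (%K. quot_set G K H) ` ?M" by (auto simp: qind_def)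
 show "indalg (G Mod H) (qind G S H)" "imem G H (qind G S H) = ?M"
  by (rule iq_imp_indalg[OF iq memT T(2)]; assumption)+
 show "istr G H (qind G S H) K = str S K H" if "K:mem S" "H <= K"
  by (rule iq_imp_indalg(3)[OF iq memT T(2)]) (use that in auto)
qed

lemma pmem_base: "mem S <= pmem G S"
 using qad_sub[OF S] qad_int[OF S] by (auto simp: pmem_def)

lemma pmem_below:
 assumes "J:pmem G S"
 obtains H where "H:mem S" "H <= J"
 using qad_ne[OF S] assms that by (auto simp: pmem_def)

context
 fixes J assumes J: "J:pmem G S"
begin

lemma pmem_sub: "subgroup J G" and pmem_int: "K:mem S ==> K Int J:mem S"
 using J by (auto simp: pmem_def)

lemma mult_sub: "K:mem S ==> subgroup (K <#> J) G"
 by (rule mult_subgroups[OF qad_sub[OF S] pmem_sub])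

lemma mult_le: "K:mem S ==> K <= K <#> J" "K:mem S ==> J <= K <#> J"
 using set_mult_upper1[OF pmem_sub qad_subset[OF S]] set_mult_upper2[OF qad_sub[OF S] subgroup.subset[OF pmem_sub]] by auto

lemma mult_maps:
 assumes "K:mem S" "H:mem S" "H <= K Int J"
 shows "maps (G || K) H (G || (K <#> J)) J (%x. x)"
 using maps_restr[OF maps_id[OF comm_group_axioms qad_sub[OF S assms(2)] pmem_sub] qad_sub[OF S assms(1)] _ mult_sub[OF assms(1)] mult_le(2)[OF assms(1)]]
  mult_le(1)[OF assms(1)] assms by auto

lemma mult_qad_mult:
 assumes "K:mem S" "K':mem S"
 shows "(K <#> K') <#> J = (K <#> J) <#> (K' <#> J)"
proof (rule equalityI)
 show "(K <#> K') <#> J <= (K <#> J) <#> (K' <#> J)"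
 proof (rule set_mult_least[OF mult_subgroups[OF mult_sub[OF assms(1)] mult_sub[OF assms(2)]]])
  show "K <#> K' <= (K <#> J) <#> (K' <#> J)" by (rule set_mult_mono[OF mult_le(1)[OF assms(1)] mult_le(1)[OF assms(2)]])
  show "J <= (K <#> J) <#> (K' <#> J)"
   using mult_le(2)[OF assms(1)] set_mult_upper1[OF mult_sub[OF assms(2)] subgroup.subset[OF mult_sub[OF assms(1)]]] by (rule order_trans)
 qed
 show "(K <#> J) <#> (K' <#> J) <= (K <#> K') <#> J"
  using set_mult_mono[OF qad_le_mult(1)[OF S assms] order_refl[of J]] set_mult_mono[OF qad_le_mult(2)[OF S assms] order_refl[of J]]
  by (rule set_mult_least[OF mult_sub[OF qad_mult[OF S assms]]])
qed

text \<open>\<open>(K' + J) \<inter> K \<in> S\<close>: by the modular law its intersection with \<open>K + K'\<close> is \<open>K' + (J \<inter> (K + K'))\<close>.\<close>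

lemma mult_int:
 assumes K: "K:mem S" "K':mem S"
 shows "K Int (K' <#> J):mem S"
proof -
 define Q where "Q = K <#> K'"
 have Q: "Q:mem S" "K <= Q" "K' <= Q" using qad_mult[OF S K] qad_le_mult[OF S K] by (auto simp: Q_def)
 have "(J <#> K') Int Q:mem S"
  using pmem_int[OF Q(1)] qad_mult[OF S _ K(2)] modular_law[OF pmem_sub qad_sub[OF S K(2)] qad_sub[OF S Q(1)] Q(3)]
  by (simp add: Int_commute)
 moreover have "K Int ((J <#> K') Int Q) = K Int (J <#> K')" using Q(2) by blast
 ultimately have "K Int (J <#> K'):mem S" using qad_int[OF S K(1), of "(J <#> K') Int Q"] by simp
 thus ?thesis using set_mult_comm[OF subgroup.subset[OF pmem_sub] qad_subset[OF S K(2)]] by simp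
qed

text \<open>The structure is transported from the quotient of \<open>K\<close> by
  \<open>K Int J\<close>. Different \<open>K\<close> may have the same product with
  \<open>J\<close>; they are compared through \<open>Q = K <#> K'\<close>, where the modular law
  gives \<open>Q <= K <#> (Q Int J)\<close>, so that the morphism on \<open>K\<close> descends to
  \<open>Q\<close> and restricts to \<open>K'\<close>.\<close>

lemma mult_structure:
 assumes K: "K:mem S"
 shows "EX X. qa (G || (K <#> J)) J X & (ALL K':mem S. K' <#> J = K <#> J -->
  qh (G || K') (K' Int J) (str S K' (K' Int J)) (G || (K <#> J)) J X (%x. x))"
proof -
 have KJ: "K Int J:mem S" using pmem_int[OF K] .
 obtain X where X: "qa (G || (K <#> J)) J X" "qh (G || K) (K Int J) (str S K (K Int J)) (G || (K <#> J)) J X (%x. x)"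
 proof (rule qa_transport[OF qad_qa[OF S KJ K] mult_maps[OF K KJ]])
  show "EX x:carrier (G || K). y *[G || (K <#> J)] inv[G || (K <#> J)] x:J" if "y:carrier (G || (K <#> J))" for y
   by (rule restr_surj[OF qad_sub[OF S K] mult_sub[OF K] pmem_sub mult_le(1)[OF K] order_refl that])
 qed auto
 have "qh (G || K') (K' Int J) (str S K' (K' Int J)) (G || (K <#> J)) J X (%x. x)" if K': "K':mem S" "K' <#> J = K <#> J" for K'
 proof -
  define Q where "Q = K <#> K'"
  have Q: "Q:mem S" "K <= Q" "K' <= Q" using qad_mult[OF S K K'(1)] qad_le_mult[OF S K K'(1)] by (auto simp: Q_def)
  have QJ: "Q Int J:mem S" "K' Int J:mem S" using pmem_int Q(1) K'(1) by auto
  have QKJ: "Q <#> J = K <#> J"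
   unfolding Q_def mult_qad_mult[OF K K'(1)] K'(2) by (rule set_mult_absorb[OF mult_sub[OF K] mult_sub[OF K] order_refl])
  have "Q <= K <#> (Q Int J)"
  proof -
   have "(J <#> K) Int Q = (J Int Q) <#> K" by (rule modular_law[OF pmem_sub qad_sub[OF S K] qad_sub[OF S Q(1)] Q(2)])
   moreover have "Q <= J <#> K" using mult_le(1)[OF Q(1)] QKJ set_mult_comm[OF subgroup.subset[OF pmem_sub] qad_subset[OF S K]] by simp
   ultimately show ?thesis
    using set_mult_comm[OF qad_subset[OF S QJ(1)] qad_subset[OF S K]] by (auto simp: Int_commute)
  qed
  moreover have mQ: "maps (G || Q) (Q Int J) (G || (K <#> J)) J (%x. x)" using mult_maps[OF Q(1) QJ(1)] QKJ by simp
  ultimately have "qh (G || Q) (Q Int J) (str S Q (Q Int J)) (G || (K <#> J)) J X (%x. x)"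
   using Q(2) by (intro qad_qh_descend[OF K KJ _ Q(1) QJ(1) _ Q(2) _ _ X(1) _ X(2)]) auto
  thus ?thesis using Q(3) by (intro qad_qh_pre[OF K'(1) QJ(2) _ Q(1) QJ(1) _ Q(3) _ mQ]) auto
 qed
 thus ?thesis using X(1) by blast
qed

theorem presents_exists:
 obtains T where "presents G S J T"
proof -
 define X where "X = (%N. SOME X. qa (G || N) J X & (ALL K:mem S. K <#> J = N -->
  qh (G || K) (K Int J) (str S K (K Int J)) (G || N) J X (%x. x)))"
 have X: "qa (G || (K <#> J)) J (X (K <#> J))" "qh (G || K) (K Int J) (str S K (K Int J)) (G || (K <#> J)) J (X (K <#> J)) (%x. x)" if K: "K:mem S" for K
  using X_def someI_ex[OF mult_structure[OF K]] mult_structure[OF K] K by auto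
 define M where "M = (%K. K <#> J) ` mem S"
 have iq: "iq G J M X"
  unfolding iq_def
 proof (intro conjI ballI allI impI)
  show "comm_group G" by (rule comm_group_axioms)
  show "subgroup J G" by (rule pmem_sub)
  show "M ~= {}" using qad_ne[OF S] by (simp add: M_def)
  show "countably_cofinal M" unfolding M_def by (rule countably_cofinal_image[OF qad_cofinal[OF S]]) (rule set_mult_mono, auto)
  show "\<Union>M = carrier G" using subgroup.subset[OF mult_sub] mult_sub qad_cover[OF S] S mult_le(1) by (fastforce simp: M_def)
  fix N assume "N:M"
  then obtain K where K: "K:mem S" "N = K <#> J" by (auto simp: M_def)
  show "subgroup N G" "J <= N" "qa (G || N) J (X N)" using mult_sub mult_le X(1) K by auto
  show "EX Q:M. N <= Q & N' <= Q" if "N':M" for N'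
  proof -
   obtain K' where K': "K':mem S" "N' = K' <#> J" using `N':M` by (auto simp: M_def)
   show ?thesis using qad_mult[OF S K(1) K'(1)] unfolding K(2) K'(2) M_def
    using set_mult_mono[OF qad_le_mult(1)[OF S K(1) K'(1)] order_refl[of J]] set_mult_mono[OF qad_le_mult(2)[OF S K(1) K'(1)] order_refl[of J]]
    by (intro bexI[of _ "(K <#> K') <#> J"]) auto
  qed
  have KJ: "K Int J:mem S" using pmem_int[OF K(1)] .
  note mK = mult_maps[OF K(1) KJ order_refl]
  show "qcl (G || N) J (X N) R <-> R:M & R <= N" for R
  proof
   assume q: "qcl (G || N) J (X N) R"
   hence R: "subgroup R G" "R <= N" "J <= R" using qclD[OF q] subgroup_restr[OF mult_sub[OF K(1)]] K(2) by auto
   have "qcl (G || K) (K Int J) (str S K (K Int J)) {x:carrier (G || K). x:R}"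
    using q X[OF K(1)] mK unfolding K(2) by (intro qcl_preimage[OF qad_qa[OF S KJ K(1)]]) auto
   moreover have "{x:carrier (G || K). x:R} = K Int R" by auto
   ultimately have "K Int R:mem S" using qad_qcl[OF S KJ K(1)] by auto
   moreover have "R = (K Int R) <#> J" using modular_law[OF qad_sub[OF S K(1)] pmem_sub R(1,3)] R(2) K(2) by blast
   ultimately show "R:M & R <= N" using R(2) by (auto simp: M_def)
  next
   assume R: "R:M & R <= N"
   then obtain K' where K': "K':mem S" "R = K' <#> J" by (auto simp: M_def)
   have "qcl (G || K) (K Int J) (str S K (K Int J)) (K Int R)"
    using mult_int[OF K(1) K'(1)] K'(2) qad_qcl[OF S KJ K(1)] mult_le(2)[OF K'(1)] K'(2) by auto
   from qcl_image[OF qad_qa[OF S KJ K(1)] X(1)[OF K(1)] mK X(2)[OF K(1)] this]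
   have "qcl (G || N) J (X N) ((K Int R) <#> J)" by (simp add: K(2))
   moreover have "R = (K Int R) <#> J"
    using modular_law[OF qad_sub[OF S K(1)] pmem_sub mult_sub[OF K'(1)] mult_le(2)[OF K'(1)]] R K(2) K'(2) by blast
   ultimately show "qcl (G || N) J (X N) R" by simp
  qed
  fix R assume R: "R:M" "R <= N"
  then obtain K0 where K0: "K0:mem S" "R = K0 <#> J" by (auto simp: M_def)
  \<comment> \<open>Only \<open>K0 <#> J\<close> is known to lie in \<open>K <#> J\<close>;
    enlarging \<open>K\<close> to contain \<open>K0\<close> changes nothing modulo
    \<open>J\<close>.\<close>
  define Q where "Q = K <#> K0"
  have Q: "Q:mem S" "K0 <= Q" using qad_mult[OF S K(1) K0(1)] qad_le_mult[OF S K(1) K0(1)] by (auto simp: Q_def)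
  have QN: "Q <#> J = N"
   using mult_qad_mult[OF K(1) K0(1)] set_mult_absorb[OF mult_sub[OF K(1)] mult_sub[OF K0(1)]] R(2) K(2) K0(2) by (simp add: Q_def)
  have QJ: "Q Int J:mem S" "K0 Int J:mem S" using pmem_int Q(1) K0(1) by auto
  have mQ: "maps (G || Q) (Q Int J) (G || N) J (%x. x)" using mult_maps[OF Q(1) QJ(1)] QN by simp
  have "qh (G || K0) (K0 Int J) (str S K0 (K0 Int J)) (G || N) J (X N) (%x. x)"
   using Q(2) X(2)[OF Q(1)] QN by (intro qad_qh_pre[OF K0(1) QJ(2) _ Q(1) QJ(1) _ Q(2) _ mQ]) auto
  moreover have "maps (G || R) J (G || N) J (%x. x)"
   using maps_restr[OF maps_id[OF comm_group_axioms pmem_sub pmem_sub order_refl] mult_sub[OF K0(1)] mult_le(2)[OF K0(1)] mult_sub[OF K(1)] mult_le(2)[OF K(1)]]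
    R(2) K(2) K0(2) by auto
  ultimately show "qh (G || R) J (X R) (G || N) J (X N) (%x. x)"
   using qh_descend_incl[OF qad_qa[OF S QJ(2) K0(1)] X(1)[OF K0(1)] X(1)[OF K(1)] comm_group_axioms qad_sub[OF S K0(1)]
    mult_sub[OF K0(1)] mult_le(1)[OF K0(1)] order_refl _ _ X(2)[OF K0(1)]] K(2) K0(2) by auto
 qed
 define T where "T = \<lparr>mem = (%N. quot_set G N J) ` M, str = (%L. X (\<Union>L))\<rparr>"
 have T: "mem T = (%N. quot_set G N J) ` M" "str T (quot_set G N J) = X N" if "N:M" for N
  using that Union_quot_set[OF pmem_sub iq_sub[OF iq] iq_le[OF iq]] by (simp_all add: T_def)
 have memT: "mem T = (%N. quot_set G N J) ` M" by (simp add: T_def)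
 have "presents G S J T" unfolding presents_def
 proof (intro conjI ballI)
  show "indalg (G Mod J) T" by (rule iq_imp_indalg(1)[OF iq memT T(2)])
  show "imem G J T = {K <#> J | K. K:mem S}" using iq_imp_indalg(2)[OF iq memT T(2)] by (auto simp: M_def)
  fix K assume K: "K:mem S"
  hence "istr G J T (K <#> J) = X (K <#> J)" by (intro iq_imp_indalg(3)[OF iq memT T(2)]) (auto simp: M_def)
  thus "qh (G || K) (K Int J) (str S K (K Int J)) (G || (K <#> J)) J (istr G J T (K <#> J)) (%x. x)"
   using X(2)[OF K] by simp
 qed
 thus thesis by (rule that)
qed

lemma presents_iq:
 assumes T: "presents G S J T"
 shows "iq G J {K <#> J | K. K:mem S} (istr G J T)"
 using indalg_imp_iq(1)[OF comm_group_axioms pmem_sub presentsD(1)[OF T]] unfolding presentsD(2)[OF T] .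

lemma presents_qa: "presents G S J T ==> K:mem S ==> qa (G || (K <#> J)) J (istr G J T (K <#> J))"
 by (rule iq_qa[OF presents_iq]) auto

lemma presents_qh:
 assumes T: "presents G S J T" and K: "K:mem S" and H: "H:mem S" "H <= K Int J"
 shows "qh (G || K) H (str S K H) (G || (K <#> J)) J (istr G J T (K <#> J)) (%x. x)"
 using H by (intro qad_qh_pre[OF K H(1) _ K pmem_int[OF K] _ order_refl _ mult_maps[OF K pmem_int[OF K] order_refl] presentsD(3)[OF T K]]) auto

text \<open>A morphism out of \<open>(K + J)/J\<close> can be checked on \<open>K\<close>.\<close>

lemma presents_descend:
 assumes T: "presents G S J T" and K: "K:mem S" and H: "H:mem S" "H <= K Int J"
  and q: "qa G3 B3 X3" "maps (G || (K <#> J)) J G3 B3 f" "qh (G || K) H (str S K H) G3 B3 X3 f"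
 shows "qh (G || (K <#> J)) J (istr G J T (K <#> J)) G3 B3 X3 f"
proof (rule qh_descend_incl[OF qad_qa[OF S H(1) K] presents_qa[OF T K] q(1) comm_group_axioms qad_sub[OF S K]
   mult_sub[OF K] mult_le(1)[OF K] order_refl _ q(2) presents_qh[OF T K H] q(3)])
qed (use H in auto)

lemma mult_id_maps: "K:mem S ==> maps (G || (K <#> J)) J (G || (K <#> J)) J (%x. x)"
 using maps_restr[OF maps_id[OF comm_group_axioms pmem_sub pmem_sub order_refl] mult_sub mult_le(2) mult_sub mult_le(2)] by auto

text \<open>The strict epimorphism from the quotient by \<open>H\<close> tests only members above
  \<open>H\<close>. Replacing \<open>K\<close> by \<open>K <#> H\<close> leaves
  \<open>K <#> J\<close> unchanged, as \<open>H <= J\<close>, so all members are reached; this links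
  \<open>presents\<close> to the structures chosen in \<open>proind_generated\<close>.\<close>

lemma presents_iff_strict_epi:
 assumes H: "H:mem S" "H <= J" and T: "indalg (G Mod J) T"
 shows "presents G S J T <-> strict_epi (G Mod H) (qind G S H) (G Mod J) T (quot_map G J (%x. x))"
proof -
 have epi: "strict_epi (G Mod H) (qind G S H) (G Mod J) T (quot_map G J (%x. x)) <->
   imem G J T = {K <#> J | K. K:mem S & H <= K} &
   (ALL K:mem S. H <= K --> qh (G || K) H (str S K H) (G || (K <#> J)) J (istr G J T (K <#> J)) (%x. x))"
  unfolding strict_epi_quot_iff[OF comm_group_axioms qad_sub[OF S H(1)] pmem_sub H(2) qind_indalg(1)[OF H(1)] T]
  using qind_indalg(2,3)[OF H(1)] by auto
 have KH: "(K <#> H) <#> J = K <#> J" "K <#> H:mem S" "H <= K <#> H" "K <= K <#> H" if K: "K:mem S" for K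
 proof -
  show "(K <#> H) <#> J = K <#> J"
   using set_mult_absorb[OF pmem_sub qad_sub[OF S H(1)] H(2)] set_mult_comm[OF qad_subset[OF S H(1)] subgroup.subset[OF pmem_sub]] mult_qad_mult[OF K H(1)] set_mult_absorb[OF mult_sub[OF K] pmem_sub mult_le(2)[OF K]]
   by simp
 qed (use qad_mult[OF S K H(1)] qad_le_mult[OF S K H(1)] in auto)
 have eq: "{K <#> J | K. K:mem S & H <= K} = {K <#> J | K. K:mem S}" using KH by blast
 show ?thesis unfolding epi eq
 proof
  assume P: "presents G S J T"
  thus "imem G J T = {K <#> J | K. K:mem S} &
   (ALL K:mem S. H <= K --> qh (G || K) H (str S K H) (G || (K <#> J)) J (istr G J T (K <#> J)) (%x. x))"
   using presents_qh[OF P _ H(1)] H(2) presentsD(2)[OF P] by auto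
 next
  assume A: "imem G J T = {K <#> J | K. K:mem S} &
   (ALL K:mem S. H <= K --> qh (G || K) H (str S K H) (G || (K <#> J)) J (istr G J T (K <#> J)) (%x. x))"
  have iq: "iq G J {K <#> J | K. K:mem S} (istr G J T)"
   using indalg_imp_iq(1)[OF comm_group_axioms pmem_sub T] A by simp
  have "qh (G || K) (K Int J) (str S K (K Int J)) (G || (K <#> J)) J (istr G J T (K <#> J)) (%x. x)" if K: "K:mem S" for K
  proof -
   define Q where "Q = K <#> H"
   have Q: "Q <#> J = K <#> J" "Q:mem S" "H <= Q" "K <= Q" using KH[OF K] by (auto simp: Q_def)
   have QJ: "Q Int J:mem S" "K Int J:mem S" using pmem_int Q(2) K by auto
   have qaQ: "qa (G || (Q <#> J)) J (istr G J T (Q <#> J))" by (rule iq_qa[OF iq]) (use Q(2) in blast)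
   have mQ: "maps (G || Q) (Q Int J) (G || (Q <#> J)) J (%x. x)" by (rule mult_maps[OF Q(2) QJ(1) order_refl])
   have le: "Q <= Q <#> (Q Int J)" by (rule set_mult_upper1[OF qad_sub[OF S QJ(1)] qad_subset[OF S Q(2)]])
   have "qh (G || Q) H (str S Q H) (G || (Q <#> J)) J (istr G J T (Q <#> J)) (%x. x)" using A Q(2,3) by blast
   hence "qh (G || Q) (Q Int J) (str S Q (Q Int J)) (G || (Q <#> J)) J (istr G J T (Q <#> J)) (%x. x)"
    using H(2) Q(3) by (intro qad_qh_descend[OF Q(2) H(1) Q(3) Q(2) QJ(1) _ order_refl _ le qaQ mQ]) auto
   hence "qh (G || K) (K Int J) (str S K (K Int J)) (G || (Q <#> J)) J (istr G J T (Q <#> J)) (%x. x)"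
    using Q(4) by (intro qad_qh_pre[OF K QJ(2) _ Q(2) QJ(1) _ Q(4) _ mQ]) auto
   thus ?thesis unfolding Q(1) .
  qed
  thus "presents G S J T" unfolding presents_def using T A by blast
 qed
qed

end

end

end

subsection \<open>The proindalgebraic group of a \<open>\<Q>\<close>-admissible group\<close>

lemma proind_generated_cong:
 assumes "mem S = mem S'" "!!H. H:mem S ==> str S H = str S' H"
 shows "proind_generated G S = proind_generated G S'"
proof -
 have "proind_members G S = proind_members G S'"
  unfolding proind_members_def using assms by (intro Collect_cong conj_cong bex_cong) auto
 moreover have "(EX H':mem S. H' <= H & strict_epi (G Mod H') (str S H') (G Mod H) T (quot_map G H (%x. x))) <->
  (EX H':mem S'. H' <= H & strict_epi (G Mod H') (str S' H') (G Mod H) T (quot_map G H (%x. x)))" for H T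
  using assms by (intro bex_cong) auto
 ultimately show ?thesis unfolding proind_generated_def by simp
qed

context pos_char
begin

lemma qpro_hom_idI:
 assumes S: "mem S = mem S'"
  and h: "!!L. L:mem S ==> L <= H ==> qh (G || H) L (str S H L) (G || H) L (str S' H L) (%x. x)"
 shows "proalg_hom (G || H) (qpro S H) (G || H) (qpro S' H) (%x. x)"
 unfolding proalg_hom_iff
proof (intro conjI ballI)
 fix L assume L: "L:mem (qpro S' H)"
 hence "{x:carrier (G || H). x:L} = L" by auto
 thus "{x:carrier (G || H). x:L}:mem (qpro S H)"
  "qh (G || H) {x:carrier (G || H). x:L} (str (qpro S H) {x:carrier (G || H). x:L}) (G || H) L (str (qpro S' H) L) (%x. x)"
  using L S h by simp_all
qed (simp add: hom_def)

lemma pi_origin_iff: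
 assumes S: "proindalg G S"
 shows "H0:proind_origins G S <-> H0:mem S & (ALL H:mem S. H <= H0 --> H0:pim G S H)"
proof -
 have "strict_subgroup_quasialg (str S H) (quot_set G H0 H) <-> H0:pim G S H" if H: "H0:mem S" "H:mem S" "H <= H0" for H
  using pi_strict[OF S H(2), of H0] H
  by (intro strict_subgroup_quasialg_quot_iff[OF pi_comm[OF S] pi_sub[OF S H(2)] pi_indalg[OF S H(2)] pi_sub[OF S H(1)] H(3)]) blast
 thus ?thesis unfolding proind_origins_def by blast
qed

context
 fixes G :: "'a monoid" (structure) and S :: "('a, 'k) qad_fam"
 assumes S: "qadmissible G S"
begin

interpretation cgroup G by (rule qad_cgroup[OF S])

text \<open>Strictness over \<open>H\<close> in \<open>B\<close> concerns traces on members above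
  \<open>H\<close>; since \<open>K Int J\<close> is the intersection of \<open>K\<close> with
  \<open>J Int (K <#> H)\<close>, all members are reached. A coinitial \<open>B\<close> covers both
  \<open>proind\<close> and \<open>can_IP_PI\<close>.\<close>

lemma pi_of_generated:
 assumes B: "B <= mem S" "!!H. H:mem S ==> EX K:B. K <= H"
 shows "pi_of G S (proind_generated G \<lparr>mem = B, str = qind G S\<rparr>)"
proof -
 let ?P = "proind_generated G \<lparr>mem = B, str = qind G S\<rparr>"
 have st: "strict_subgroup (G Mod H) (qind G S H) (quot_set G J H) <-> (ALL K:mem S. H <= K --> J Int K:mem S)"
  if "H:mem S" "subgroup J G" "H <= J" for H J
  using strict_subgroup_quot_iff[OF comm_group_axioms qad_sub[OF S that(1)] qind_indalg(1)[OF S that(1)] that(2,3)]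
   qind_indalg(2)[OF S that(1)] that(3) by auto
 have mem: "J:mem ?P <-> subgroup J G & (EX H:B. H <= J & strict_subgroup (G Mod H) (qind G S H) (quot_set G J H))" for J
  by (simp add: proind_generated_def proind_members_def)
 have "mem ?P = pmem G S"
 proof (intro equalityI subsetI)
  fix J assume "J:mem ?P"
  then obtain H where H: "subgroup J G" "H:B" "H <= J" "strict_subgroup (G Mod H) (qind G S H) (quot_set G J H)"
   unfolding mem by (elim conjE bexE)
  hence HS: "H:mem S" using B(1) by blast
  have "K Int J:mem S" if K: "K:mem S" for K
  proof -
   have "K <#> H:mem S" "K <= K <#> H" "H <= K <#> H" using qad_mult[OF S K HS] qad_le_mult[OF S K HS] by auto
   moreover from this have "J Int (K <#> H):mem S" using H(4) st[OF HS H(1,3)] by blast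
   ultimately have "K Int (J Int (K <#> H)):mem S" "K Int (J Int (K <#> H)) = K Int J" using qad_int[OF S K] by auto
   thus ?thesis by simp
  qed
  thus "J:pmem G S" using H(1) by (simp add: pmem_def)
 next
  fix J assume J: "J:pmem G S"
  obtain H' where "H':mem S" "H' <= J" using pmem_below[OF S J] .
  then obtain H where H: "H:B" "H <= J" using B(2) by blast
  have "J Int K:mem S" if "K:mem S" for K using pmem_int[OF S J that] by (simp add: Int_commute)
  thus "J:mem ?P" unfolding mem using H B(1) st[OF _ pmem_sub[OF S J] H(2)] pmem_sub[OF S J] by blast
 qed
 moreover have "presents G S J (str ?P J)" if J: "J:pmem G S" for J
 proof -
  obtain T where T: "presents G S J T" using presents_exists[OF S J] .
  obtain H' where "H':mem S" "H' <= J" using pmem_below[OF S J] .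
  then obtain H where H: "H:B" "H <= J" using B(2) by blast
  have "indalg (G Mod J) T & (EX H:B. H <= J & strict_epi (G Mod H) (qind G S H) (G Mod J) T (quot_map G J (%x. x)))"
   using presents_iff_strict_epi[OF S J _ H(2) presentsD(1)[OF T]] T H presentsD(1)[OF T] B(1) by blast
  hence "indalg (G Mod J) (str ?P J) &
    (EX H:B. H <= J & strict_epi (G Mod H) (qind G S H) (G Mod J) (str ?P J) (quot_map G J (%x. x)))"
   unfolding proind_generated_def family.simps by (rule someI)
  then obtain H where H: "indalg (G Mod J) (str ?P J)" "H:B" "H <= J"
    "strict_epi (G Mod H) (qind G S H) (G Mod J) (str ?P J) (quot_map G J (%x. x))" by (elim conjE bexE)
  thus ?thesis using presents_iff_strict_epi[OF S J _ H(3,1)] B(1) by blast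
 qed
 ultimately show ?thesis by (simp add: pi_of_def)
qed

lemma mult_absorb2:
 assumes J: "J:pmem G S" "J':pmem G S" "J <= J'" and K: "K:mem S"
 shows "(K <#> J) <#> J' = K <#> J'"
proof (rule equalityI)
 show "K <#> J <#> J' <= K <#> J'"
  using set_mult_mono[OF order_refl J(3)] mult_le(2)[OF S J(2) K] by (rule set_mult_least[OF mult_sub[OF S J(2) K]])
 show "K <#> J' <= K <#> J <#> J'" by (rule set_mult_mono[OF mult_le(1)[OF S J(1) K] order_refl])
qed

context
 fixes P :: "('a, 'k) proind_fam"
 assumes P: "pi_of G S P"
begin

lemma pi_of_mem: "mem P = pmem G S" and pi_of_presents: "J:pmem G S ==> presents G S J (str P J)"
 using P by (auto simp: pi_of_def)

lemma pi_of_pim: "J:pmem G S ==> pim G P J = {K <#> J | K. K:mem S}"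
 by (rule presentsD(2)[OF pi_of_presents])

lemma pi_of_pim_base:
 assumes H: "H:mem S"
 shows "pim G P H = {K:mem S. H <= K}"
proof -
 have eq: "pim G P H = {K <#> H | K. K:mem S}" by (rule pi_of_pim) (use pmem_base[OF S] H in blast)
 show ?thesis unfolding eq
 proof (intro equalityI subsetI)
  fix K assume "K:{K:mem S. H <= K}"
  moreover from this have "K = K <#> H" using set_mult_absorb[OF qad_sub[OF S] qad_sub[OF S H], of K] by simp
  ultimately show "K:{K <#> H | K. K:mem S}" by blast
 next
  fix K assume "K:{K <#> H | K. K:mem S}"
  thus "K:{K:mem S. H <= K}" using qad_mult[OF S _ H] qad_le_mult[OF S _ H] by blast
 qed
qed

lemma pi_of_proindalg: "proindalg G P"
 unfolding pi_iff pi_of_mem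
proof (intro conjI ballI allI impI)
 show "comm_group G" by (rule comm_group_axioms)
 have sub: "subgroup J G" if "J:pmem G S" for J by (rule pmem_sub[OF S that])
 have below: "EX H:mem S. H <= J" if "J:pmem G S" for J by (rule pmem_below[OF S that]) blast
 have dir: "EX Q:pmem G S. Q <= J Int J'" if JJ: "J:pmem G S" "J':pmem G S" for J J'
 proof -
  obtain H H' where H: "H:mem S" "H <= J" "H':mem S" "H' <= J'" using below[OF JJ(1)] below[OF JJ(2)] by (elim bexE)
  thus ?thesis using qad_int[OF S H(1,3)] pmem_base[OF S] by (intro bexI[of _ "H Int H'"]) auto
 qed
 show "pro_system G (pmem G S)" unfolding pro_system_def
 proof (intro conjI ballI)
  show "pmem G S ~= {}" using qad_ne[OF S] pmem_base[OF S] by blast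
  obtain C where C: "C <= mem S" "countable C" "ALL H:mem S. EX K:C. K <= H"
   using qad_coinitial[OF S] unfolding countably_coinitial_def by (elim exE conjE)
  have "EX K:C. K <= J" if J: "J:pmem G S" for J
  proof -
   obtain H where H: "H:mem S" "H <= J" using below[OF J] by (elim bexE)
   from bspec[OF C(3) H(1)] show ?thesis using H(2) by auto
  qed
  thus "countably_coinitial (pmem G S)" unfolding countably_coinitial_def
   using C(1,2) pmem_base[OF S] by (intro exI[of _ C] conjI ballI) auto
  have "cplt G (pmem G S)"
  proof (rule cplt_coinitial[OF comm_group_axioms qad_sub[OF S] sub dir _ below qad_cplt[OF S]])
   show "EX K:pmem G S. K <= H" if "H:mem S" for H using that pmem_base[OF S] by blast
  qed
  thus "is_quot_limit G (pmem G S)" using is_quot_limit_iff[OF comm_group_axioms sub] by blast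
 qed (rule sub dir; assumption)+
 fix J assume J: "J:pmem G S"
 show "indalg (G Mod J) (str P J)" by (rule presentsD(1)[OF pi_of_presents[OF J]])
 show "subgroup N G & J <= N & (ALL K:pim G P J. N Int K:pim G P J) <-> N:pmem G S & J <= N" for N
 proof
  assume N: "subgroup N G & J <= N & (ALL K:pim G P J. N Int K:pim G P J)"
  have "K Int N:mem S" if K: "K:mem S" for K
  proof -
   \<comment> \<open>Strictness controls the trace of \<open>N\<close> on \<open>K <#> J\<close>;
     intersecting with \<open>K\<close> gives \<open>K Int N\<close>, which is in \<open>S\<close>
     by \<open>mult_int\<close>.\<close>
   have "K <#> J:pim G P J" using K pi_of_pim[OF J] by blast
   then obtain K' where K': "K':mem S" "N Int (K <#> J) = K' <#> J" using N pi_of_pim[OF J] by blast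
   have "K Int (K' <#> J):mem S" by (rule mult_int[OF S J K K'(1)])
   moreover have "K Int (K' <#> J) = K Int N" using mult_le(1)[OF S J K] unfolding K'(2)[symmetric] by blast
   ultimately show ?thesis by simp
  qed
  thus "N:pmem G S & J <= N" using N by (simp add: pmem_def)
 next
  assume N: "N:pmem G S & J <= N"
  have "N Int R:pim G P J" if R: "R:pim G P J" for R
  proof -
   obtain K where K: "K:mem S" "R = K <#> J" using R pi_of_pim[OF J] by blast
   have "(K <#> J) Int N = (K Int N) <#> J" using N by (intro modular_law[OF qad_sub[OF S K(1)] sub[OF J] sub]) auto
   moreover have "K Int N:mem S" using pmem_int[OF S _ K(1)] N by blast
   ultimately show ?thesis using K(2) pi_of_pim[OF J] by (auto simp: Int_commute)
  qed
  thus "subgroup N G & J <= N & (ALL K:pim G P J. N Int K:pim G P J)" using N sub by blast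
 qed
 fix J' assume J': "J':pmem G S" "J <= J'"
 note absorb = mult_absorb2[OF J J']
 show "pim G P J' = {R <#> J' | R. R:pim G P J}"
  unfolding pi_of_pim[OF J] pi_of_pim[OF J'(1)] using absorb by blast
 fix R assume "R:pim G P J"
 then obtain K where K: "K:mem S" "R = K <#> J" using pi_of_pim[OF J] by blast
 have H: "K Int J:mem S" "K Int J <= K Int J'" using pmem_int[OF S J K(1)] J'(2) by auto
 show "qh (G || R) J (pist G P J R) (G || (R <#> J')) J' (pist G P J' (R <#> J')) (%x. x)"
  unfolding K(2) absorb[OF K(1)]
 proof (rule presents_descend[OF S J pi_of_presents[OF J] K(1) H(1) order_refl presents_qa[OF S J'(1) pi_of_presents[OF J'(1)] K(1)]
    _ presents_qh[OF S J'(1) pi_of_presents[OF J'(1)] K(1) H]])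
  show "maps (G || (K <#> J)) J (G || (K <#> J')) J' (%x. x)"
   using maps_restr[OF maps_id[OF comm_group_axioms sub[OF J] sub[OF J'(1)] J'(2)] mult_sub[OF S J K(1)] mult_le(2)[OF S J K(1)]
    mult_sub[OF S J'(1) K(1)] mult_le(2)[OF S J'(1) K(1)]] set_mult_mono[OF order_refl J'(2), of K] by simp
 qed
qed

text \<open>An origin contains some \<open>H\<close> of \<open>S\<close> and belongs to the
  structure over \<open>H\<close>, whose members are precisely the members of \<open>S\<close> above
  \<open>H\<close>.\<close>

lemma pi_of_origins: "proind_origins G P = mem S"
proof (intro equalityI subsetI)
 fix H0 assume H0: "H0:proind_origins G P"
 hence m: "H0:pmem G S" unfolding pi_origin_iff[OF pi_of_proindalg] pi_of_mem by blast
 obtain H where H: "H:mem S" "H <= H0" using pmem_below[OF S m] .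
 hence "H0:pim G P H" using H0 pmem_base[OF S] unfolding pi_origin_iff[OF pi_of_proindalg] pi_of_mem by blast
 thus "H0:mem S" using pi_of_pim_base[OF H(1)] by blast
next
 fix H0 assume H0: "H0:mem S"
 have "H0:pim G P J" if J: "J:pmem G S" "J <= H0" for J
 proof -
  show ?thesis using set_mult_absorb[OF qad_sub[OF S H0] pmem_sub[OF S J(1)] J(2)] pi_of_pim[OF J(1)] H0 by blast
 qed
 thus "H0:proind_origins G P" unfolding pi_origin_iff[OF pi_of_proindalg] pi_of_mem using H0 pmem_base[OF S] by blast
qed

lemma pi_of_ad: "proindalg_ad G P"
 unfolding proindalg_ad_def
proof (intro conjI exI[of _ "mem S"] ballI impI)
 show "proindalg G P" by (rule pi_of_proindalg)
 show m: "mem S <= mem P" using pmem_base[OF S] pi_of_mem by simp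
 show "pro_system G (mem S)"
  using is_quot_limit_iff[OF comm_group_axioms qad_sub[OF S]] qad_cplt[OF S] qad_ne[OF S] qad_sub[OF S] qad_coinitial[OF S] qad_down[OF S] unfolding pro_system_def
  by blast
 have "strict_subgroup (G Mod H) (str P H) (quot_set G N H) <-> N:pmem G S" if "H:mem S" "subgroup N G" "H <= N" for H N
  using that m strict_subgroup_quot_iff[OF comm_group_axioms qad_sub[OF S that(1)] pi_indalg[OF pi_of_proindalg] that(2,3)]
   pi_strict[OF pi_of_proindalg, of H N] pi_of_mem by blast
 hence *: "N:proind_members G (P\<lparr>mem := mem S\<rparr>) <-> subgroup N G & (EX H:mem S. H <= N & N:pmem G S)" for N
  unfolding proind_members_def by auto
 show "proind_members G (P\<lparr>mem := mem S\<rparr>) = mem P"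
 proof -
  have "EX H:mem S. H <= N" if "N:pmem G S" for N by (rule pmem_below[OF S that]) blast
  hence "N:proind_members G (P\<lparr>mem := mem S\<rparr>) <-> N:pmem G S" for N
   unfolding * using pmem_sub[OF S, of N] by auto
  thus ?thesis unfolding pi_of_mem by blast
 qed
 show "strict_subgroup_quasialg (str P H1) (quot_set G H2 H1)" if "H1:mem S" "H2:mem S" "H1 <= H2" for H1 H2
  using that m pi_of_origins by (auto simp: proind_origins_def)
qed

end

end

text \<open>Both morphism axioms are used. The first shows that the preimage of \<open>J2\<close>
  meets each \<open>K\<close> in a member; the second provides morphisms of quotients by members
  \<open>H1\<close> and \<open>H2\<close>, from which those modulo \<open>J1\<close> and
  \<open>J2\<close> are obtained by descent.\<close>

lemma pi_of_hom:
 assumes S: "qadmissible G1 S1" "qadmissible G2 S2" and P: "pi_of G1 S1 P1" "pi_of G2 S2 P2"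
  and f: "qad_hom G1 S1 G2 S2 f"
 shows "proindalg_hom G1 P1 G2 P2 f"
 unfolding proindalg_hom_iff[OF pi_of_proindalg[OF S(1) P(1)] pi_of_proindalg[OF S(2) P(2)]]
  pi_of_mem[OF S(1) P(1)] pi_of_mem[OF S(2) P(2)]
proof (intro conjI ballI)
 interpret G1: cgroup G1 by (rule qad_cgroup[OF S(1)])
 interpret G2: cgroup G2 by (rule qad_cgroup[OF S(2)])
 show fh: "f:hom G1 G2" using f by (simp add: qad_hom_def)
 interpret f: group_hom G1 G2 f using fh by unfold_locales
 fix J2 assume J2: "J2:pmem G2 S2"
 interpret J2: subgroup J2 G2 by (rule pmem_sub[OF S(2) J2])
 define J1 where "J1 = {x:carrier G1. f x:J2}"
 have sJ1: "subgroup J1 G1" unfolding J1_def by unfold_locales auto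
 have "K Int J1:mem S1" if K: "K:mem S1" for K
 proof -
  obtain H2 where H2: "H2:mem S2" "f ` K <= H2" "proalg_hom (G1 || K) (qpro S1 K) (G2 || H2) (qpro S2 H2) f"
   using f K unfolding qad_hom_iff[OF S] by blast
  have "{x:carrier (G1 || K). f x:H2 Int J2}:mem S1"
   using pmem_int[OF S(2) J2 H2(1)] H2(3) by (auto simp: proalg_hom_iff)
  moreover have "{x:carrier (G1 || K). f x:H2 Int J2} = K Int J1" using H2(2) qad_subset[OF S(1) K] by (auto simp: J1_def)
  ultimately show ?thesis by simp
 qed
 hence J1: "J1:pmem G1 S1" using sJ1 by (simp add: pmem_def)
 thus "{x:carrier G1. f x:J2}:pmem G1 S1" by (simp add: J1_def)
 have m: "maps G1 J1 G2 J2 f"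
  using fh sJ1 J2.subgroup_axioms G1.comm_group_axioms G2.comm_group_axioms by (auto simp: maps_def J1_def)
 fix N assume "N:pim G1 P1 {x:carrier G1. f x:J2}"
 then obtain K0 where K0: "K0:mem S1" "N = K0 <#>[G1] J1" using pi_of_pim[OF S(1) P(1) J1] by (auto simp: J1_def)
 obtain H2 where H2: "H2:mem S2" "H2 <= J2" using pmem_below[OF S(2) J2] .
 obtain H1 where H1: "H1:mem S1" "hom_qad_2_at G1 S1 G2 S2 f H1 H2"
  using f H2(1) unfolding qad_hom_def hom_qad_2_iff by blast
 \<comment> \<open>\<open>K0\<close> is enlarged by \<open>H1\<close> so that the second axiom
   applies; \<open>N\<close> is unchanged because \<open>H1 <= J1\<close>.\<close>
 define K where "K = K0 <#>[G1] H1"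
 have K: "K:mem S1" "H1 <= K" "K0 <= K" using qad_mult[OF S(1) K0(1) H1(1)] qad_le_mult[OF S(1) K0(1) H1(1)] by (auto simp: K_def)
 define L where "L = f ` K <#>[G2] H2"
 have L: "f ` H1 <= H2" "L:mem S2" "qh (G1 || K) H1 (str S1 K H1) (G2 || L) H2 (str S2 L H2) f"
  using H1(2) K by (auto simp: hom_qad_2_at_def L_def)
 have HJ1: "H1 <= J1" using L(1) H2(2) qad_subset[OF S(1) H1(1)] by (auto simp: J1_def)
 have N: "N = K <#>[G1] J1"
  using mult_absorb2[OF S(1) _ J1 HJ1 K0(1)] pmem_base[OF S(1)] H1(1) K0(2) by (auto simp: K_def)
 have sfK: "subgroup (f ` K) G2" by (rule f.subgroup_img_is_subgroup[OF qad_sub[OF S(1) K(1)]])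
 have H2L: "H2 <= L" "f ` K <= L" unfolding L_def
  using G2.set_mult_upper2[OF sfK qad_subset[OF S(2) H2(1)]] G2.set_mult_upper1[OF qad_sub[OF S(2) H2(1)] subgroup.subset[OF sfK]] by auto
 have eq: "f ` N <#>[G2] J2 = L <#>[G2] J2"
  using image_mult_absorb[OF m qad_sub[OF S(1) K(1)]]
   image_mult_absorb[OF maps_id[OF G2.comm_group_axioms qad_sub[OF S(2) H2(1)] J2.subgroup_axioms H2(2)] sfK] by (simp add: N L_def)
 show "f ` N <#>[G2] J2:pim G2 P2 J2" unfolding eq pi_of_pim[OF S(2) P(2) J2] using L(2) by blast
 note T1 = pi_of_presents[OF S(1) P(1) J1] and T2 = pi_of_presents[OF S(2) P(2) J2]
 have HJ: "H1 <= K Int J1" "H2 <= L Int J2" using K(2) HJ1 H2L H2(2) by auto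
 have "qh (G1 || K) H1 (str S1 K H1) (G2 || (L <#>[G2] J2)) J2 (pist G2 P2 J2 (L <#>[G2] J2)) f"
  by (rule qh_comp[OF qad_qa[OF S(1) H1(1) K(1,2)] hom_restr_maps[OF S fh K(1) H1(1) K(2) L(2) H2(1) H2L L(1)]
    mult_maps[OF S(2) J2 L(2) H2(1) HJ(2)] L(3) presents_qh[OF S(2) J2 T2 L(2) H2(1) HJ(2)]])
 moreover have "maps (G1 || (K <#>[G1] J1)) J1 (G2 || (L <#>[G2] J2)) J2 f"
  using image_mult_subgroup(3)[OF m mult_sub[OF S(1) J1 K(1)]] eq N
  by (intro maps_restr[OF m mult_sub[OF S(1) J1 K(1)] mult_le(2)[OF S(1) J1 K(1)] mult_sub[OF S(2) J2 L(2)] mult_le(2)[OF S(2) J2 L(2)]]) simp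
 ultimately have "qh (G1 || (K <#>[G1] J1)) J1 (pist G1 P1 J1 (K <#>[G1] J1)) (G2 || (L <#>[G2] J2)) J2 (pist G2 P2 J2 (L <#>[G2] J2)) f"
  using presents_descend[OF S(1) J1 T1 K(1) H1(1) HJ(1) presents_qa[OF S(2) J2 T2 L(2)]] by blast
 thus "qh (G1 || N) {x:carrier G1. f x:J2} (pist G1 P1 {x:carrier G1. f x:J2} N)
    (G2 || (f ` N <#>[G2] J2)) J2 (pist G2 P2 J2 (f ` N <#>[G2] J2)) f"
  unfolding eq by (simp add: J1_def N)
qed

subsection \<open>The \<open>\<Q>\<close>-admissible group of a proindalgebraic group\<close>

lemma ad_PI_simps [simp]:
 "mem (ad_PI_structure G S) = proind_origins G S" "str (ad_PI_structure G S) H' H = pist G S H H'"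
 by (simp_all add: ad_PI_structure_def istr_def)

context
 fixes G :: "'a monoid" (structure) and S :: "('a, 'k) proind_fam"
 assumes S: "proindalg_ad G S"
begin

lemma piad_pi: "proindalg G S"
 using S by (simp add: proindalg_ad_def)

interpretation cgroup G using pi_comm[OF piad_pi] by (simp add: cgroup_def)

lemma pi_origin_mem: "H:proind_origins G S ==> H:mem S"
 by (simp add: proind_origins_def)

lemma pim_absorb: "H:mem S ==> K:mem S ==> H <= K ==> K <#> H = K"
 by (rule set_mult_absorb[OF pi_sub[OF piad_pi] pi_sub[OF piad_pi]])

lemma pi_origin_down:
 assumes H0: "H0:proind_origins G S" and K: "K:mem S" "K <= H0"
 shows "K:proind_origins G S"
proof -
 have "K:pim G S H" if H: "H:mem S" "H <= K" for H
  using H0 H K(2) pi_origin_iff[OF piad_pi] piad_pi pi_strict[OF piad_pi H(1), of K] H(1) K K(1) H(2) inf.absorb1 by fastforce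
 thus ?thesis unfolding pi_origin_iff[OF piad_pi] using K(1) by blast
qed

text \<open>A member \<open>H0\<close> of the set of definition belongs to the structure over some
  \<open>H'\<close> below \<open>H\<close>; pushing it forward to the quotient by \<open>H\<close>
  changes nothing because \<open>H <= H0\<close>. So it is an origin.\<close>

lemma pi_origin_below:
 assumes "H:mem S"
 obtains H0 where "H0:proind_origins G S" "H0 <= H"
proof -
 obtain M where M: "M <= mem S" "proind_members G (S\<lparr>mem := M\<rparr>) = mem S"
   "ALL H1:M. ALL H2:M. H1 <= H2 --> strict_subgroup_quasialg (str S H1) (quot_set G H2 H1)"
  using S unfolding proindalg_ad_def by (elim conjE exE)
 have coin: "EX H':M. H' <= H" if "H:mem S" for H using M(2) that by (auto simp: proind_members_def)
 have "H0:proind_origins G S" if H0: "H0:M" for H0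
  unfolding pi_origin_iff[OF piad_pi]
 proof (intro conjI ballI impI)
  show m0: "H0:mem S" using H0 M(1) by blast
  fix H assume H: "H:mem S" "H <= H0"
  obtain H' where H': "H':M" "H' <= H" using coin[OF H(1)] by (elim bexE)
  have m': "H':mem S" "H' <= H0" using H' H(2) M(1) by auto
  have "H0:pim G S H'"
   using M(3) H0 H'(1) m'(2) strict_subgroup_quasialg_quot_iff[OF comm_group_axioms pi_sub[OF piad_pi m'(1)] pi_indalg[OF piad_pi m'(1)] pi_sub[OF piad_pi m0] m'(2)] pi_strict[OF piad_pi m'(1), of H0] m0 m'(2)
   by blast
  thus "H0:pim G S H" using pi_pim[OF piad_pi m'(1) H(1) H'(2)] pim_absorb[OF H(1) m0 H(2)] by blast
 qed
 moreover obtain H' where "H':M" "H' <= H" using coin[OF assms] by (elim bexE)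
 ultimately show thesis using that by blast
qed

text \<open>A member \<open>K\<close> over the origin \<open>H\<close> has to be found over each
  \<open>N\<close> below it. Over some \<open>N'\<close> below both \<open>N\<close> and
  \<open>H\<close>, the origin \<open>H\<close> is itself a member. Inside a large \<open>Q\<close>
  the group \<open>K\<close> is closed modulo \<open>H\<close>, so its preimage modulo
  \<open>N'\<close> is closed, which makes \<open>K\<close> a member over \<open>N'\<close>; pushing
  forward to \<open>N\<close> keeps it.\<close>

lemma pi_origin_pim:
 assumes H: "H:proind_origins G S"
 shows "pim G S H = {K:proind_origins G S. H <= K}"
proof (intro equalityI subsetI)
 note m = pi_origin_mem[OF H] and i = pi_iq[OF piad_pi pi_origin_mem[OF H]]
 show "K:pim G S H" if "K:{K:proind_origins G S. H <= K}" for K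
  using that m unfolding pi_origin_iff[OF piad_pi] by blast
 fix K assume K: "K:pim G S H"
 note sK = iq_sub[OF i K] and HK = iq_le[OF i K]
 have int: "K Int L:pim G S H" if L: "L:pim G S H" for L using iq_up[OF i K L] i K L qcl_inter iq_qa iq_qcl by meson
 hence mK: "K:mem S" using pi_strict[OF piad_pi m, of K] sK HK by blast
 have "K:pim G S N" if N: "N:mem S" "N <= K" for N
 proof -
  obtain N' where N': "N':mem S" "N' <= N Int H" using pi_dir[OF piad_pi N(1) m] by (elim bexE)
  note i' = pi_iq[OF piad_pi N'(1)]
  have N'H: "N' <= H" "N' <= N" using N'(2) by auto
  have HN': "H:pim G S N'" using H N'(1) N'H unfolding pi_origin_iff[OF piad_pi] by blast
  obtain J where J: "J:pim G S N'" "K = J <#> H" using K pi_pim[OF piad_pi N'(1) m N'H(1)] by blast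
  obtain Q where Q: "Q:pim G S N'" "J <= Q" "H <= Q" using iq_up[OF i' J(1) HN'] by blast
  have sQ: "subgroup Q G" by (rule iq_sub[OF i' Q(1)])
  have QH: "Q <#> H = Q" by (rule set_mult_absorb[OF sQ pi_sub[OF piad_pi m] Q(3)])
  have QM: "Q:pim G S H" using pi_pim[OF piad_pi N'(1) m N'H(1)] Q(1) QH by blast
  have KQ: "K <= Q" unfolding J(2) by (rule set_mult_least[OF sQ Q(2,3)])
  have "qcl (G || Q) H (pist G S H Q) K" using iq_qcl[OF i QM] K KQ by blast
  moreover have "maps (G || Q) N' (G || Q) H (%x. x)"
   using maps_restr[OF maps_id[OF comm_group_axioms pi_sub[OF piad_pi N'(1)] pi_sub[OF piad_pi m] N'H(1)] sQ iq_le[OF i' Q(1)] sQ Q(3)] by simp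
  moreover have "qh (G || Q) N' (pist G S N' Q) (G || Q) H (pist G S H Q) (%x. x)"
   using pi_qh[OF piad_pi N'(1) m N'H(1) Q(1)] QH by simp
  ultimately have "qcl (G || Q) N' (pist G S N' Q) {x:carrier (G || Q). x:K}"
   by (intro qcl_preimage[OF iq_qa[OF i' Q(1)] iq_qa[OF i QM]])
  moreover have "{x:carrier (G || Q). x:K} = K" using KQ by auto
  ultimately have "K:pim G S N'" using iq_qcl[OF i' Q(1)] by simp
  thus ?thesis using pi_pim[OF piad_pi N'(1) N(1) N'H(2)] pim_absorb[OF N(1) mK N(2)] by blast
 qed
 thus "K:{K:proind_origins G S. H <= K}" using mK HK unfolding pi_origin_iff[OF piad_pi] by blast
qed

lemma ad_PI_qadmissible: "qadmissible G (ad_PI_structure G S)"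
 unfolding qad_iff ad_PI_simps
proof (intro conjI ballI allI impI)
 let ?O = "proind_origins G S"
 note sub = pi_sub[OF piad_pi pi_origin_mem]
 show "comm_group G" by (rule comm_group_axioms)
 obtain H1 where H1: "H1:?O" using pi_ne[OF piad_pi] pi_origin_below by blast
 thus "?O ~= {}" by blast
 note i1 = pi_iq[OF piad_pi pi_origin_mem[OF H1]]
 have low: "EX Q:?O. Q <= H Int K" if HK: "H:?O" "K:?O" for H K
 proof -
  obtain Q where Q: "Q:mem S" "Q <= H Int K" using pi_dir[OF piad_pi pi_origin_mem[OF HK(1)] pi_origin_mem[OF HK(2)]] by (elim bexE)
  thus ?thesis using pi_origin_down[OF HK(1) Q(1)] by (intro bexI[of _ Q]) auto
 qed
 have up: "EX Q:?O. H <= Q & K <= Q" if HK: "H:?O" "K:?O" for H K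
 proof -
  obtain N where N: "N:?O" "N <= H Int K" using low[OF HK] by (elim bexE)
  have "H:pim G S N" "K:pim G S N" using pi_origin_pim[OF N(1)] HK N(2) by auto
  from iq_up[OF pi_iq[OF piad_pi pi_origin_mem[OF N(1)]] this] show ?thesis using pi_origin_pim[OF N(1)] by blast
 qed
 show "countably_coinitial ?O"
 proof -
  obtain C where C: "C <= mem S" "countable C" "ALL H:mem S. EX K:C. K <= H"
   using pi_count[OF piad_pi] unfolding countably_coinitial_def by (elim exE conjE)
  have "ALL H:mem S. EX K. K:?O & K <= H" using pi_origin_below by blast
  from bchoice[OF this] obtain u where u: "!!H. H:mem S ==> u H:?O & u H <= H" by blast
  have "EX K:u ` C. K <= H" if H: "H:?O" for H
  proof -
   obtain K where "K:C" "K <= H" using C(3) pi_origin_mem[OF H] by blast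
   thus ?thesis using u[of K] C(1) by blast
  qed
  thus ?thesis unfolding countably_coinitial_def using u C(1,2) by (intro exI[of _ "u ` C"]) auto
 qed
 show "countably_cofinal ?O"
 proof -
  obtain C where C: "C <= pim G S H1" "countable C" "ALL H:pim G S H1. EX K:C. H <= K"
   using iq_cofinal[OF i1] unfolding countably_cofinal_def by (elim exE conjE)
  have "EX K:C. H <= K" if H: "H:?O" for H
  proof -
   obtain Q where Q: "Q:?O" "H <= Q" "H1 <= Q" using up[OF H H1] by blast
   hence "Q:pim G S H1" using pi_origin_pim[OF H1] by blast
   from bspec[OF C(3) this] obtain K where "K:C" "Q <= K" by (elim bexE)
   thus ?thesis using Q(2) by (intro bexI[of _ K]) auto
  qed
  thus ?thesis unfolding countably_cofinal_def using C(1,2) pi_origin_pim[OF H1] by (intro exI[of _ C] conjI ballI) auto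
 qed
 show "\<Union>?O = carrier G"
 proof
  show "\<Union>?O <= carrier G" using subgroup.subset[OF sub] by blast
  show "carrier G <= \<Union>?O" using iq_cover[OF i1] pi_origin_pim[OF H1] by blast
 qed
 show "cplt G ?O"
 proof (rule cplt_coinitial[OF comm_group_axioms pi_sub[OF piad_pi] sub low _ _ pi_cplt[OF piad_pi]])
  show "EX K:?O. K <= H" if H: "H:mem S" for H by (rule pi_origin_below[OF H]) blast
  show "EX H:mem S. H <= K" if "K:?O" for K using pi_origin_mem[OF that] by blast
 qed
 fix H assume H: "H:?O"
 note iH = pi_iq[OF piad_pi pi_origin_mem[OF H]]
 show "subgroup H G" by (rule sub[OF H])
 show "EX Hp:?O. H <#> H' <= Hp" if H': "H':?O" for H'
 proof -
  obtain Q where Q: "Q:?O" "H <= Q" "H' <= Q" using up[OF H H'] by blast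
  thus ?thesis using set_mult_least[OF sub[OF Q(1)] Q(2,3)] by blast
 qed
 show "EX Hm:?O. Hm <= H Int H'" if "H':?O" for H' by (rule low[OF H that])
 fix H' assume H': "H':?O" "H <= H'"
 have HH': "H':pim G S H" using H' pi_origin_pim[OF H] by blast
 show "qa (G || H') H (pist G S H H')" by (rule iq_qa[OF iH HH'])
 show "K:?O" if "qcl (G || H') H (pist G S H H') K" for K
  using that iq_qcl[OF iH HH'] pi_origin_pim[OF H] by blast
 fix Hp assume Hp: "Hp:?O" "H' <= Hp"
 have HHp: "Hp:pim G S H" using Hp H' pi_origin_pim[OF H] by blast
 show "qh (G || H') H (pist G S H H') (G || Hp) H (pist G S H Hp) (%x. x)" by (rule iq_qh[OF iH HHp HH' Hp(2)])
 show "qh (G || Hp) H (pist G S H Hp) (G || Hp) H' (pist G S H' Hp) (%x. x)"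
  using pi_qh[OF piad_pi pi_origin_mem[OF H] pi_origin_mem[OF H'(1)] H'(2) HHp]
   pim_absorb[OF pi_origin_mem[OF H'(1)] pi_origin_mem[OF Hp(1)] Hp(2)] by simp
qed

text \<open>Over an origin \<open>H\<close> below \<open>J\<close> the given structure agrees with
  \<open>qind\<close> of the group of origins, so (PI-3) is exactly the condition in
  \<open>presents_iff_strict_epi\<close>.\<close>

lemma ad_PI_pi_of: "pi_of G (ad_PI_structure G S) S"
 unfolding pi_of_def
proof (intro conjI ballI)
 let ?O = "proind_origins G S"
 note A = ad_PI_qadmissible
 show eq: "mem S = pmem G (ad_PI_structure G S)"
 proof (intro equalityI subsetI)
  fix J assume J: "J:mem S"
  have "K Int J:?O" if K: "K:?O" for K
  proof -
   obtain H' where H': "H':mem S" "H' <= K Int J" using pi_dir[OF piad_pi pi_origin_mem[OF K] J] by (elim bexE)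
   hence H: "H':?O" "H' <= K" "H' <= J" using pi_origin_down[OF K H'(1)] by auto
   hence "K:pim G S H'" using pi_origin_pim[OF H(1)] K by blast
   thus ?thesis using pi_strict[OF piad_pi H'(1), of J] J H(3) pi_origin_pim[OF H(1)] by (auto simp: Int_commute)
  qed
  thus "J:pmem G (ad_PI_structure G S)" using pi_sub[OF piad_pi J] by (simp add: pmem_def)
 next
  fix J assume J: "J:pmem G (ad_PI_structure G S)"
  obtain H where H: "H:?O" "H <= J" using pmem_below[OF A J] by auto
  have "J Int K:pim G S H" if "K:pim G S H" for K
   using that pmem_int[OF A J, of K] pi_origin_pim[OF H(1)] H(2) by (auto simp: Int_commute)
  thus "J:mem S" using pi_strict[OF piad_pi pi_origin_mem[OF H(1)], of J] pmem_sub[OF A J] H(2) by blast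
 qed
 fix J assume J: "J:mem S"
 hence J': "J:pmem G (ad_PI_structure G S)" using eq by simp
 obtain H where H: "H:?O" "H <= J" using pi_origin_below[OF J] .
 have HA: "H:mem (ad_PI_structure G S)" using H(1) by simp
 note q = qind_indalg[OF A HA] and m = pi_origin_mem[OF H(1)]
 have im: "imem G H (qind G (ad_PI_structure G S) H) = pim G S H" using q(2) pi_origin_pim[OF H(1)] by simp
 have is': "istr G H (qind G (ad_PI_structure G S) H) K = pist G S H K" if "K:pim G S H" for K
  using q(3)[of K] that pi_origin_pim[OF H(1)] by simp
 have "strict_epi (G Mod H) (qind G (ad_PI_structure G S) H) (G Mod J) (str S J) (quot_map G J (%x. x))"
  unfolding strict_epi_quot_iff[OF comm_group_axioms pi_sub[OF piad_pi m] pi_sub[OF piad_pi J] H(2) q(1) pi_indalg[OF piad_pi J]] im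
  using pi_pim[OF piad_pi m J H(2)] pi_qh[OF piad_pi m J H(2)] is' by auto
 thus "presents G (ad_PI_structure G S) J (str S J)"
  using presents_iff_strict_epi[OF A J' HA H(2) pi_indalg[OF piad_pi J]] by blast
qed

end

text \<open>Morphisms of proindalgebraic groups yield the second axiom directly; the first then
  comes from the equivalence of the two.\<close>

lemma ad_PI_hom:
 assumes S: "proindalg_ad G1 S1" "proindalg_ad G2 S2" and f: "proindalg_hom G1 S1 G2 S2 f"
 shows "qad_hom G1 (ad_PI_structure G1 S1) G2 (ad_PI_structure G2 S2) f"
proof -
 note pi = piad_pi[OF S(1)] piad_pi[OF S(2)] and A = ad_PI_qadmissible[OF S(1)] ad_PI_qadmissible[OF S(2)]
 note f' = f[unfolded proindalg_hom_iff[OF pi]]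
 have fh: "f:hom G1 G2" using f' by blast
 have "hom_qad_2 G1 (ad_PI_structure G1 S1) G2 (ad_PI_structure G2 S2) f"
  unfolding hom_qad_2_iff ad_PI_simps
 proof
  fix H2 assume H2: "H2:proind_origins G2 S2"
  note m2 = pi_origin_mem[OF S(2) H2]
  define K where "K = {x:carrier G1. f x:H2}"
  have K: "K:mem S1" using f' m2 by (simp add: K_def)
  note m = preimage_maps[OF pi fh m2, folded K_def, OF K]
  obtain H1 where H1: "H1:proind_origins G1 S1" "H1 <= K" using pi_origin_below[OF S(1) K] .
  note m1 = pi_origin_mem[OF S(1) H1(1)]
  have "f ` H <#>[G2] H2:proind_origins G2 S2 &
    qh (G1 || H) H1 (pist G1 S1 H1 H) (G2 || (f ` H <#>[G2] H2)) H2 (pist G2 S2 H2 (f ` H <#>[G2] H2)) f"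
   if H: "H:proind_origins G1 S1" "H1 <= H" for H
  proof -
   have HM: "H:pim G1 S1 H1" using H pi_origin_pim[OF S(1) H1(1)] by blast
   define N where "N = H <#>[G1] K"
   have N: "N:pim G1 S1 K" "qh (G1 || H) H1 (pist G1 S1 H1 H) (G1 || N) K (pist G1 S1 K N) (%x. x)"
    using pi_pim[OF pi(1) m1 K H1(2)] pi_qh[OF pi(1) m1 K H1(2) HM] HM by (auto simp: N_def)
   note sH = pi_sub[OF pi(1) pi_origin_mem[OF S(1) H(1)]]
   have eq: "f ` N <#>[G2] H2 = f ` H <#>[G2] H2" unfolding N_def by (rule image_mult_absorb[OF m sH])
   have R: "f ` N <#>[G2] H2:pim G2 S2 H2"
    "qh (G1 || N) K (pist G1 S1 K N) (G2 || (f ` N <#>[G2] H2)) H2 (pist G2 S2 H2 (f ` N <#>[G2] H2)) f"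
    using f' m2 N(1) unfolding K_def by auto
   have mi: "maps G1 H1 G1 K (%x. x)" by (rule maps_id[OF pi_comm[OF pi(1)] pi_sub[OF pi(1) m1] pi_sub[OF pi(1) K] H1(2)])
   have "maps (G1 || H) H1 (G1 || N) K (%x. x)"
    using maps_restr[OF mi sH H(2)] image_mult_subgroup[OF mi sH] by (simp add: N_def)
   moreover have "maps (G1 || N) K (G2 || (f ` N <#>[G2] H2)) H2 f"
    using pim_maps[OF pi fh m2, folded K_def, OF K N(1)] .
   ultimately have "qh (G1 || H) H1 (pist G1 S1 H1 H) (G2 || (f ` N <#>[G2] H2)) H2 (pist G2 S2 H2 (f ` N <#>[G2] H2)) f"
    using qh_comp[OF iq_qa[OF pi_iq[OF pi(1) m1] HM] _ _ N(2) R(2)] by blast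
   thus ?thesis using R(1) pi_origin_pim[OF S(2) H2] unfolding eq by blast
  qed
  moreover have "f ` H1 <= H2" using H1(2) by (auto simp: K_def)
  ultimately show "EX H1:proind_origins G1 S1. hom_qad_2_at G1 (ad_PI_structure G1 S1) G2 (ad_PI_structure G2 S2) f H1 H2"
   unfolding hom_qad_2_at_def ad_PI_simps using H1(1) by (intro bexI[of _ H1] conjI ballI impI) auto
 qed
 thus ?thesis unfolding qad_hom_def using fh hom_qad_1_iff_2[OF A fh] by blast
qed

lemma proind_structure_pi_of:
 assumes "qadmissible G S"
 shows "pi_of G S (proind_structure G S)"
proof -
 show ?thesis using pi_of_generated[OF assms, of "mem S"] by (auto simp: proind_structure_def qind_def[abs_def])
qed

lemma pi_of_ad_PI:
 fixes G (structure)
 assumes S: "qadmissible G S" and P: "pi_of G S P"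
 shows "qad_hom G S G (ad_PI_structure G P) (%x. x)" "qad_hom G (ad_PI_structure G P) G S (%x. x)"
proof -
 interpret cgroup G by (rule qad_cgroup[OF S])
 note ad = pi_of_ad[OF S P]
 have eq: "proind_origins G P = mem S" by (rule pi_of_origins[OF S P])
 have h: "qh (G || H) L (str S H L) (G || H) L (pist G P L H) (%x. x)"
  "qh (G || H) L (pist G P L H) (G || H) L (str S H L) (%x. x)" if L: "L:mem S" "H:mem S" "L <= H" for H L
 proof -
  have J: "L:pmem G S" using pmem_base[OF S] L(1) by blast
  note T = pi_of_presents[OF S P J]
  have HL: "H Int L = L" "H <#> L = H" using L(3) set_mult_absorb[OF qad_sub[OF S L(2)] qad_sub[OF S L(1)] L(3)] by auto
  show "qh (G || H) L (str S H L) (G || H) L (pist G P L H) (%x. x)" using presentsD(3)[OF T L(2)] by (simp add: HL)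
  show "qh (G || H) L (pist G P L H) (G || H) L (str S H L) (%x. x)"
   using mult_id_maps[OF S J L(2)] presents_descend[OF S J T L(2) L(1) _ qad_qa[OF S L(1,2,3)] _ qh_id[OF qad_qa[OF S L(1,2,3)]]]
   by (simp add: HL)
 qed
 show "qad_hom G S G (ad_PI_structure G P) (%x. x)"
  by (rule qad_hom_id[OF S ad_PI_qadmissible[OF ad] _ qpro_hom_idI]) (use h(1) in \<open>auto simp: eq\<close>)
 show "qad_hom G (ad_PI_structure G P) G S (%x. x)"
  by (rule qad_hom_id[OF ad_PI_qadmissible[OF ad] S _ qpro_hom_idI]) (use h(2) in \<open>auto simp: eq\<close>)
qed

end

section \<open>Independence of the chosen origin and commutativity of the diagram\<close>

section \<open>The canonical functors\<close>

context pos_char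
begin

text \<open>The chosen origin \<open>H0\<close> only selects the origins below it as generating
  family. By intersecting with \<open>H0\<close> this family is coinitial among all origins, so
  \<open>pi_of\<close> holds whatever the choice.\<close>

lemma can_IP_PI_pi_of:
 fixes G (structure)
 assumes S: "indproalg_ad G S"
 shows "pi_of G (ad_IP_structure G S) (can_IP_PI_structure G S)"
proof -
 let ?A = "ad_IP_structure G S" and ?O = "indpro_origins G S"
 note A = ad_IP_qadmissible[OF S]
 define H0 where "H0 = (SOME H0. H0:?O)"
 have H0: "H0:?O" using qad_ne[OF A] some_in_eq[THEN iffD2] unfolding H0_def by auto
 let ?B = "mem (str S H0)"
 have B: "?B = {K:?O. K <= H0}" by (rule origin_str_mem[OF S H0])
 have "can_IP_PI_structure G S = proind_generated G \<lparr>mem = ?B, str = qind G ?A\<rparr>"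
  unfolding can_IP_PI_structure_def Let_def H0_def[symmetric]
 proof (rule proind_generated_cong)
  fix H assume "H:mem \<lparr>mem = ?B, str = %H. \<lparr>mem = {quot_set G H' H | H'. H':mem S & H <= H'}, str = %L. str (str S (\<Union>L)) H\<rparr>\<rparr>"
  hence "H:?O" using B by simp
  hence "H':mem S & H <= H' <-> H':?O & H <= H'" for H' using origin_up[OF S] origin_mem[OF S] by blast
  thus "str \<lparr>mem = ?B, str = %H. \<lparr>mem = {quot_set G H' H | H'. H':mem S & H <= H'}, str = %L. str (str S (\<Union>L)) H\<rparr>\<rparr> H =
    str \<lparr>mem = ?B, str = qind G ?A\<rparr> H" by (simp add: qind_def)
 qed simp
 moreover have "EX K:?B. K <= H" if H: "H:mem ?A" for H
  using qad_int[OF A H, of H0] H0 B by (intro bexI[of _ "H Int H0"]) auto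
 ultimately show ?thesis using pi_of_generated[OF A, of ?B] B by auto
qed

text \<open>Here the origins above \<open>H0\<close> generate; multiplication by \<open>H0\<close>
  shows that they are cofinal, so the choice is harmless again.\<close>

lemma can_PI_IP_ip_of:
 fixes G (structure)
 assumes S: "proindalg_ad G S"
 shows "ip_of G (ad_PI_structure G S) (can_PI_IP_structure G S)"
proof -
 let ?A = "ad_PI_structure G S" and ?O = "proind_origins G S"
 note A = ad_PI_qadmissible[OF S] and pi = piad_pi[OF S]
 interpret cgroup G by (rule qad_cgroup[OF A])
 define H0 where "H0 = (SOME H0. H0:?O)"
 have H0: "H0:?O" using qad_ne[OF A] some_in_eq[THEN iffD2] unfolding H0_def by auto
 let ?B = "{H:mem S. H0 <= H & quot_set G H H0:mem (str S H0)}"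
 have B: "?B = {K:?O. H0 <= K}" using pi_sub[OF pi] pi_origin_pim[OF S H0] pi_origin_mem[OF S] by (auto simp: imem_def)
 have "can_PI_IP_structure G S = indpro_generated G \<lparr>mem = ?B, str = qpro ?A\<rparr>"
  unfolding can_PI_IP_structure_def Let_def H0_def[symmetric]
 proof (rule indpro_generated_cong)
  fix H assume "H:mem \<lparr>mem = ?B, str = %H. \<lparr>mem = {H':mem S. H' <= H}, str = %H'. str (str S H') (quot_set G H H')\<rparr>\<rparr>"
  hence "{H':mem S. H' <= H} = {H':?O. H' <= H}" using B pi_origin_down[OF S] pi_origin_mem[OF S] by auto
  thus "str \<lparr>mem = ?B, str = %H. \<lparr>mem = {H':mem S. H' <= H}, str = %H'. str (str S H') (quot_set G H H')\<rparr>\<rparr> H =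
    str \<lparr>mem = ?B, str = qpro ?A\<rparr> H" by (simp add: qpro_def istr_def)
 qed simp
 moreover have "EX K:?B. H <= K" if H: "H:mem ?A" for H
  using qad_mult[OF A H, of H0] qad_le_mult[OF A H, of H0] H0 unfolding B by (intro bexI[of _ "H <#> H0"]) auto
 moreover have "?B <= mem ?A" unfolding B by auto
 ultimately show ?thesis using ip_of_generated[OF A, of ?B] by simp
qed

end

context pos_char
begin

lemma qad_hom_refl:
 assumes "qadmissible G S"
 shows "qad_hom G S G S (%x. x)"
 by (rule qad_hom_id[OF assms assms order_refl proalg_hom_id[OF qpro_proalg[OF assms]]])

lemma concrete_QAd: "concrete qadmissible qad_hom"
proof
 fix G1 G2 G3 :: "'a monoid" and S1 S2 S3 :: "('a, 'k) qad_fam" and f g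
 show "qad_hom G1 S1 G2 S2 f ==> f:hom G1 G2" by (simp add: qad_hom_def)
 show "qadmissible G1 S1 ==> qad_hom G1 S1 G1 S1 (%x. x)" by (rule qad_hom_refl)
 show "qadmissible G1 S1 ==> qadmissible G2 S2 ==> qadmissible G3 S3 ==> qad_hom G1 S1 G2 S2 f ==>
   qad_hom G2 S2 G3 S3 g ==> qad_hom G1 S1 G3 S3 (%x. g (f x))"
  by (rule qad_hom_comp)
 show "qad_hom G1 S1 G2 S2 g" if "qadmissible G1 S1" "qadmissible G2 S2" "!!x. x:carrier G1 ==> f x = g x" "qad_hom G1 S1 G2 S2 f"
  by (rule qad_hom_cong[OF that])
qed

lemma concrete_IPad: "concrete indproalg_ad indproalg_hom"
 unfolding indproalg_hom_def
 by (rule concrete_mono[OF ind_hom_concrete[OF concrete_proalg] ipad_ip[unfolded indproalg_def]])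

lemma concrete_PIad: "concrete proindalg_ad proindalg_hom"
 unfolding proindalg_hom_def indalg_hom_def
 by (rule concrete_mono[OF pro_hom_concrete[OF ind_hom_concrete[OF concrete_quasialg]] piad_pi[unfolded proindalg_def indalg_def]])

end

text \<open>Every indproalgebraic or proindalgebraic structure in the diagram is attached to a
  Q-admissible group by \<open>ip_of\<close> or \<open>pi_of\<close>, and \<open>ip_of_hom\<close>
  and \<open>pi_of_hom\<close> carry morphisms of Q-admissible groups to attached structures. So the
  identity is an isomorphism between the ends of two parallel paths as soon as it is one between the
  Q-admissible groups behind them.\<close>

theorem mainTheorem3:
  assumes char_pos: "CHAR('k::alg_closed_field) > 0"
  shows
    "mutually_inverse_equivalences (QAd :: ('a, 'k) qad_cat) IPad indpro ad_IP \<and>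
     mutually_inverse_equivalences (QAd :: ('a, 'k) qad_cat) PIad proind ad_PI \<and>
     (\<comment> \<open>any two parallel paths in the diagram agree\<close>
      functors_agree (QAd :: ('a, 'k) qad_cat) QAd (ad_IP \<circ>\<^sub>F indpro) id_funct \<and>
      functors_agree (QAd :: ('a, 'k) qad_cat) QAd (ad_PI \<circ>\<^sub>F proind) id_funct \<and>
      functors_agree (IPad :: ('a, 'k) indpro_cat) IPad (indpro \<circ>\<^sub>F ad_IP) id_funct \<and>
      functors_agree (PIad :: ('a, 'k) proind_cat) PIad (proind \<circ>\<^sub>F ad_PI) id_funct \<and>
      functors_agree (IPad :: ('a, 'k) indpro_cat) IPad (can_PI_IP \<circ>\<^sub>F can_IP_PI) id_funct \<and>
      functors_agree (PIad :: ('a, 'k) proind_cat) PIad (can_IP_PI \<circ>\<^sub>F can_PI_IP) id_funct \<and>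
      functors_agree (QAd :: ('a, 'k) qad_cat) PIad (can_IP_PI \<circ>\<^sub>F indpro) proind \<and>
      functors_agree (QAd :: ('a, 'k) qad_cat) IPad (can_PI_IP \<circ>\<^sub>F proind) indpro \<and>
      functors_agree (IPad :: ('a, 'k) indpro_cat) QAd (ad_PI \<circ>\<^sub>F can_IP_PI) ad_IP \<and>
      functors_agree (PIad :: ('a, 'k) proind_cat) QAd (ad_IP \<circ>\<^sub>F can_PI_IP) ad_PI \<and>
      functors_agree (IPad :: ('a, 'k) indpro_cat) PIad (proind \<circ>\<^sub>F ad_IP) can_IP_PI \<and>
      functors_agree (PIad :: ('a, 'k) proind_cat) IPad (indpro \<circ>\<^sub>F ad_PI) can_PI_IP) \<and>
     (\<forall>G1 G2 (S1 :: ('a, 'k) qad_fam) S2 f.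
        qadmissible G1 S1 \<longrightarrow> qadmissible G2 S2 \<longrightarrow> f \<in> hom G1 G2 \<longrightarrow>
        (hom_qad_1 G1 S1 G2 S2 f \<longleftrightarrow> hom_qad_2 G1 S1 G2 S2 f))"
proof -
 interpret pos_char "TYPE('k)" by (rule pos_char.intro[OF char_pos])
 note agree = concrete2.functors_agree_concrete[OF concrete2.intro]
  and funct = concrete2.is_functor_concrete[OF concrete2.intro]
 note ca = concrete_QAd concrete_IPad concrete_PIad
 note i = indpro_structure_ip_of and p = proind_structure_pi_of and refl = qad_hom_refl
  and IA = ad_IP_qadmissible and iA = ad_IP_ip_of and PA = ad_PI_qadmissible and pA = ad_PI_pi_of
  and c = can_IP_PI_pi_of and d = can_PI_IP_ip_of
 note ic = ip_of_ad[OF _ i] and pc = pi_of_ad[OF _ p] and cc = pi_of_ad[OF IA c] and dc = ip_of_ad[OF PA d]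
 note maps = ic pc IA PA cc dc ip_of_hom[OF _ _ i i] pi_of_hom[OF _ _ p p] ad_IP_hom ad_PI_hom
  pi_of_hom[OF IA IA c c ad_IP_hom] ip_of_hom[OF PA PA d d ad_PI_hom]
 \<comment> \<open>Identities between a Q-admissible group and the group of origins of an attached
   structure, each in both directions.\<close>
 note toQ = ip_of_ad_IP[OF _ i] pi_of_ad_PI[OF _ p] pi_of_ad_PI[OF IA c] ip_of_ad_IP[OF PA d]
 \<comment> \<open>Each further line compares the ends of one pair of parallel paths in both
   directions. Where the two ends are attached to different Q-admissible groups, a member of
   \<open>toQ\<close> relates these; otherwise \<open>refl\<close> does.\<close>
 note ids = toQ
  ip_of_hom[OF IA IA i[OF IA] iA refl[OF IA]] ip_of_hom[OF IA IA iA i[OF IA] refl[OF IA]]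
  ip_of_hom[OF PA[OF cc] IA d[OF cc] iA toQ(6)] ip_of_hom[OF IA PA[OF cc] iA d[OF cc] toQ(5)]
  ip_of_hom[OF PA[OF pc] _ d[OF pc] i toQ(4)] ip_of_hom[OF _ PA[OF pc] i d[OF pc] toQ(3)]
  ip_of_hom[OF PA PA i[OF PA] d refl[OF PA]] ip_of_hom[OF PA PA d i[OF PA] refl[OF PA]]
  pi_of_hom[OF PA PA p[OF PA] pA refl[OF PA]] pi_of_hom[OF PA PA pA p[OF PA] refl[OF PA]]
  pi_of_hom[OF IA[OF dc] PA c[OF dc] pA toQ(8)] pi_of_hom[OF PA IA[OF dc] pA c[OF dc] toQ(7)]
  pi_of_hom[OF IA[OF ic] _ c[OF ic] p toQ(2)] pi_of_hom[OF _ IA[OF ic] p c[OF ic] toQ(1)]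
  pi_of_hom[OF IA IA p[OF IA] c refl[OF IA]] pi_of_hom[OF IA IA c p[OF IA] refl[OF IA]]
 have F: "is_functor (QAd :: ('a, 'k) qad_cat) IPad indpro" "is_functor (IPad :: ('a, 'k) indpro_cat) QAd ad_IP"
  "is_functor (QAd :: ('a, 'k) qad_cat) PIad proind" "is_functor (PIad :: ('a, 'k) proind_cat) QAd ad_PI"
  unfolding QAd_def IPad_def PIad_def by (rule funct[OF ca(1,2)] funct[OF ca(2,1)] funct[OF ca(1,3)] funct[OF ca(3,1)]; (assumption | rule maps)+)+
 have Q: "functors_agree (QAd :: ('a, 'k) qad_cat) QAd (ad_IP \<circ>\<^sub>F indpro) id_funct"
  "functors_agree (QAd :: ('a, 'k) qad_cat) QAd (ad_PI \<circ>\<^sub>F proind) id_funct"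
  unfolding concrete_funct_comp concrete_funct_id QAd_def by (rule agree[OF ca(1,1)]; (assumption | rule ids maps)+)+
 have I: "functors_agree (IPad :: ('a, 'k) indpro_cat) IPad (indpro \<circ>\<^sub>F ad_IP) id_funct"
  "functors_agree (IPad :: ('a, 'k) indpro_cat) IPad (can_PI_IP \<circ>\<^sub>F can_IP_PI) id_funct"
  unfolding concrete_funct_comp concrete_funct_id IPad_def by (rule agree[OF ca(2,2)]; (assumption | rule ids maps)+)+
 have P: "functors_agree (PIad :: ('a, 'k) proind_cat) PIad (proind \<circ>\<^sub>F ad_PI) id_funct"
  "functors_agree (PIad :: ('a, 'k) proind_cat) PIad (can_IP_PI \<circ>\<^sub>F can_PI_IP) id_funct"
  unfolding concrete_funct_comp concrete_funct_id PIad_def by (rule agree[OF ca(3,3)]; (assumption | rule ids maps)+)+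
 have M: "functors_agree (QAd :: ('a, 'k) qad_cat) PIad (can_IP_PI \<circ>\<^sub>F indpro) proind"
  "functors_agree (QAd :: ('a, 'k) qad_cat) IPad (can_PI_IP \<circ>\<^sub>F proind) indpro"
  "functors_agree (IPad :: ('a, 'k) indpro_cat) QAd (ad_PI \<circ>\<^sub>F can_IP_PI) ad_IP"
  "functors_agree (PIad :: ('a, 'k) proind_cat) QAd (ad_IP \<circ>\<^sub>F can_PI_IP) ad_PI"
  "functors_agree (IPad :: ('a, 'k) indpro_cat) PIad (proind \<circ>\<^sub>F ad_IP) can_IP_PI"
  "functors_agree (PIad :: ('a, 'k) proind_cat) IPad (indpro \<circ>\<^sub>F ad_PI) can_PI_IP"
  unfolding concrete_funct_comp QAd_def IPad_def PIad_def
  by (rule agree[OF ca(1,3)] agree[OF ca(1,2)] agree[OF ca(2,1)] agree[OF ca(3,1)] agree[OF ca(2,3)] agree[OF ca(3,2)]; (assumption | rule ids maps)+)+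
 show ?thesis
  by (intro conjI allI impI agree_imp_equivalences F Q I P M hom_qad_1_iff_2)
qed

end
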